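(* Let $\mathbb{K}$ be a field of characteristic zero and let $$X:=(z=x=0)\cup(z=y=0)\cup(z+xw=x+y=0)\subset\mathbb{A}^4_{w,x,y,z}.$$ Then $X$ is snc at every point except the origin. Let $\sigma:X'\to X$ be the blowing-up of the origin and let $D'$ be its exceptional divisor. In the "$w$-chart", with coordinates $(w,x/w,y/w,z/w)$, the strict transform $X'$ of $X$ is given by the same equations as $X$, $D'=(w=0)$, and $(X',D')$ is snc except at the origin of this chart. Consequently, the analogue of resolving all but stable-snc singularities fails for snc: there is no finite sequence of blowings-up $X=X_0\leftarrow X_1\leftarrow\cdots\leftarrow X_t$ with smooth centres $C_j\subset X_j$, each $C_j$ consisting only of non-snc points of $(X_j,\widetilde D_j)$, such that $(X_t,\widetilde D_t)$ is snc at every point (where $\widetilde D_0=0$).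
   Context: A variety $X$ is snc at $a$ if there is a smooth local embedding variety $Z$ of $X$ at $a$ with a regular system of coordinates in which each irreducible component of $X$ at $a$ is a coordinate subspace. A pair $(X,D)$, $D$ a $\mathbb{Q}$-Weil divisor on $X$, is snc at $a$ if there are such $Z$ and coordinates, some of which, $y_1,\ldots,y_q$, are not used in defining any component of $X$ at $a$, with $D=\sum_{j=1}^q\alpha_j\,(y_j=0)|_X$ locally at $a$, $\alpha_j\in\mathbb{Q}$. Transforms: $\widetilde D_{j+1}$ is the birational (strict) transform of $\widetilde D_j$ plus the exceptional divisor $\sigma_{j+1}^{-1}(C_j)$ of the blowing-up $\sigma_{j+1}:X_{j+1}\to X_j$ with centre $C_j$. *)

theory Defs
  imports
    "HOL-Analysis.Abstract_Topology"
    "HOL-Library.Poly_Mapping"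
    "HOL-Library.Extended_Nat"
    "HOL-Algebra.QuotRing"
    "HOL-Algebra.Ideal_Product"
begin

section \<open>Commutative algebra\<close>

text \<open>In a local ring the maximal ideal is the set of non-units.\<close>

definition local_ring :: "'a ring \<Rightarrow> bool" where
  "local_ring R \<longleftrightarrow> cring R \<and> (\<exists>!m. maximalideal m R)"

definition max_ideal :: "'a ring \<Rightarrow> 'a set" where
  "max_ideal R = carrier R - Units R"

definition prime_spectrum :: "'a ring \<Rightarrow> 'a set set" where
  "prime_spectrum R = {P. primeideal P R}"

definition minimal_primes :: "'a ring \<Rightarrow> 'a set set" where
  "minimal_primes R = {P. primeideal P R \<and> (\<forall>Q. primeideal Q R \<and> Q \<subseteq> P \<longrightarrow> Q = P)}"

definition krull_dim :: "'a ring \<Rightarrow> enat" where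
  "krull_dim R = Sup {enat n | n. \<exists>P. (\<forall>i\<le>n. primeideal (P i) R) \<and> (\<forall>i<n. P i \<subset> P (Suc i))}"

text \<open>The length of \<open>R / I\<close> as an \<open>R\<close>-module. Only used when this length is finite.\<close>

definition colength :: "'a ring \<Rightarrow> 'a set \<Rightarrow> nat" where
  "colength R I = (GREATEST n. \<exists>J. J 0 = I \<and> J n = carrier R \<and>
      (\<forall>i\<le>n. ideal (J i) R) \<and> (\<forall>i<n. J i \<subset> J (Suc i)))"

primrec ideal_pow :: "'a ring \<Rightarrow> 'a set \<Rightarrow> nat \<Rightarrow> 'a set" where
  "ideal_pow R I 0 = carrier R"
| "ideal_pow R I (Suc n) = ideal_prod R (ideal_pow R I n) I"

text \<open>The ring of fractions of \<open>R\<close> with denominators in \<open>S\<close>: \<open>fraction R S a s\<close> is the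
  equivalence class of \<open>a / s\<close>.\<close>

definition fraction :: "'a ring \<Rightarrow> 'a set \<Rightarrow> 'a \<Rightarrow> 'a \<Rightarrow> ('a \<times> 'a) set" where
  "fraction R S a s = {(b, t). b \<in> carrier R \<and> t \<in> S \<and>
      (\<exists>u\<in>S. u \<otimes>\<^bsub>R\<^esub> (a \<otimes>\<^bsub>R\<^esub> t) = u \<otimes>\<^bsub>R\<^esub> (b \<otimes>\<^bsub>R\<^esub> s))}"

definition localization :: "'a ring \<Rightarrow> 'a set \<Rightarrow> ('a \<times> 'a) set ring" where
  "localization R S = \<lparr>
     carrier = {fraction R S a s | a s. a \<in> carrier R \<and> s \<in> S},
     monoid.mult = (\<lambda>x y. \<Union>(a, s)\<in>x. \<Union>(b, t)\<in>y. fraction R S (a \<otimes>\<^bsub>R\<^esub> b) (s \<otimes>\<^bsub>R\<^esub> t)),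
     one = fraction R S \<one>\<^bsub>R\<^esub> \<one>\<^bsub>R\<^esub>,
     ring.zero = fraction R S \<zero>\<^bsub>R\<^esub> \<one>\<^bsub>R\<^esub>,
     add = (\<lambda>x y. \<Union>(a, s)\<in>x. \<Union>(b, t)\<in>y.
              fraction R S (a \<otimes>\<^bsub>R\<^esub> t \<oplus>\<^bsub>R\<^esub> b \<otimes>\<^bsub>R\<^esub> s) (s \<otimes>\<^bsub>R\<^esub> t)) \<rparr>"


section \<open>Polynomials over the base field\<close>

definition base_field :: "'k::field_char_0 ring" where
  "base_field = \<lparr> carrier = UNIV, monoid.mult = (*), one = 1, ring.zero = 0, add = (+) \<rparr>"

text \<open>Polynomials in the variables \<open>T\<^sub>0, T\<^sub>1, \<dots>\<close> are finitely supported maps from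
  exponents to coefficients; \<open>poly_ring n\<close> is the subring \<open>K[T\<^sub>0, \<dots>, T\<^sub>n\<^sub>-\<^sub>1]\<close>.\<close>

type_synonym 'k mpol = "(nat \<Rightarrow>\<^sub>0 nat) \<Rightarrow>\<^sub>0 'k"

definition mvar :: "nat \<Rightarrow> 'k::field_char_0 mpol" where
  "mvar i = Poly_Mapping.single (Poly_Mapping.single i 1) 1"

definition mconst :: "'k::field_char_0 \<Rightarrow> 'k mpol" where
  "mconst c = Poly_Mapping.single 0 c"

definition poly_ring :: "nat \<Rightarrow> 'k::field_char_0 mpol ring" where
  "poly_ring n = \<lparr> carrier = {p. \<forall>m\<in>Poly_Mapping.keys p. Poly_Mapping.keys m \<subseteq> {..<n}},
                   monoid.mult = (*), one = 1, ring.zero = 0, add = (+) \<rparr>"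

definition mderiv :: "nat \<Rightarrow> 'k::field_char_0 mpol \<Rightarrow> 'k mpol" where
  "mderiv j p = (\<Sum>m\<in>Poly_Mapping.keys p.
     Poly_Mapping.single (m - Poly_Mapping.single j 1)
       (of_nat (Poly_Mapping.lookup m j) * Poly_Mapping.lookup p m))"


section \<open>Schemes over the base field\<close>

text \<open>A space with a sheaf of \<open>K\<close>-algebras, where a section over \<open>U\<close> is given by its family
  of germs: \<open>sec X U\<close> consists of functions sending a point \<open>p\<close> of \<open>U\<close> to an element of the
  stalk at \<open>p\<close>, and restriction of sections is restriction of functions.\<close>

record ('p, 's, 'k) kspace =
  sp :: "'p topology"
  stalk :: "'p \<Rightarrow> 's ring"
  scalar :: "'p \<Rightarrow> 'k \<Rightarrow> 's"
  sec :: "'p set \<Rightarrow> ('p \<Rightarrow> 's) set"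

abbreviation pts :: "('p, 's, 'k) kspace \<Rightarrow> 'p set" where
  "pts X \<equiv> topspace (sp X)"

definition sec_ring :: "('p, 's, 'k) kspace \<Rightarrow> 'p set \<Rightarrow> ('p \<Rightarrow> 's) ring" where
  "sec_ring X U = \<lparr>
     carrier = sec X U,
     monoid.mult = (\<lambda>f g. \<lambda>p\<in>U. f p \<otimes>\<^bsub>stalk X p\<^esub> g p),
     one = (\<lambda>p\<in>U. \<one>\<^bsub>stalk X p\<^esub>),
     ring.zero = (\<lambda>p\<in>U. \<zero>\<^bsub>stalk X p\<^esub>),
     add = (\<lambda>f g. \<lambda>p\<in>U. f p \<oplus>\<^bsub>stalk X p\<^esub> g p) \<rparr>"

text \<open>The last two conditions below say that \<open>stalk X p\<close> is the direct limit of the \<open>sec X U\<close>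
  over the neighbourhoods \<open>U\<close> of \<open>p\<close>.\<close>

definition locally_ringed_kspace :: "('p, 's, 'k::field_char_0) kspace \<Rightarrow> bool" where
  "locally_ringed_kspace X \<longleftrightarrow>
     (\<forall>p\<in>pts X. local_ring (stalk X p) \<and> scalar X p \<in> ring_hom base_field (stalk X p)) \<and>
     (\<forall>U. openin (sp X) U \<longrightarrow>
        cring (sec_ring X U) \<and>
        (\<forall>c. (\<lambda>p\<in>U. scalar X p c) \<in> sec X U) \<and>
        (\<forall>V. openin (sp X) V \<and> V \<subseteq> U \<longrightarrow> (\<forall>s\<in>sec X U. restrict s V \<in> sec X V)) \<and>
        (\<forall>s. s \<in> sec X U \<longleftrightarrow>
           s \<in> (\<Pi>\<^sub>E p\<in>U. carrier (stalk X p)) \<and>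
           (\<forall>p\<in>U. \<exists>V. openin (sp X) V \<and> p \<in> V \<and> V \<subseteq> U \<and> restrict s V \<in> sec X V))) \<and>
     (\<forall>p\<in>pts X. \<forall>a\<in>carrier (stalk X p). \<exists>U s. openin (sp X) U \<and> p \<in> U \<and> s \<in> sec X U \<and> s p = a) \<and>
     (\<forall>U p. \<forall>s\<in>sec X U. \<forall>t\<in>sec X U. openin (sp X) U \<and> p \<in> U \<and> s p = t p \<longrightarrow>
        (\<exists>V. openin (sp X) V \<and> p \<in> V \<and> V \<subseteq> U \<and> restrict s V = restrict t V))"

text \<open>\<open>U\<close> is affine if the canonical morphism from \<open>U\<close> to the spectrum of \<open>sec X U\<close> is an
  isomorphism: it is bijective on points, the sets where a section is invertible form a basis
  of the topology, and \<open>stalk X p\<close> is the localization of \<open>sec X U\<close> at the prime of \<open>p\<close>.\<close>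

definition prime_of :: "('p, 's, 'k) kspace \<Rightarrow> 'p set \<Rightarrow> 'p \<Rightarrow> ('p \<Rightarrow> 's) set" where
  "prime_of X U p = {s \<in> sec X U. s p \<in> max_ideal (stalk X p)}"

definition affine_open :: "('p, 's, 'k) kspace \<Rightarrow> 'p set \<Rightarrow> bool" where
  "affine_open X U \<longleftrightarrow> openin (sp X) U \<and>
     bij_betw (prime_of X U) U (prime_spectrum (sec_ring X U)) \<and>
     (\<forall>s\<in>sec X U. openin (sp X) {p \<in> U. s p \<in> Units (stalk X p)}) \<and>
     (\<forall>V p. openin (sp X) V \<and> p \<in> U \<inter> V \<longrightarrow>
        (\<exists>s\<in>sec X U. p \<in> {q \<in> U. s q \<in> Units (stalk X q)} \<and>
                      {q \<in> U. s q \<in> Units (stalk X q)} \<subseteq> V)) \<and>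
     (\<forall>p\<in>U. \<forall>a\<in>carrier (stalk X p). \<exists>s\<in>sec X U. \<exists>t\<in>sec X U.
        t p \<in> Units (stalk X p) \<and> a \<otimes>\<^bsub>stalk X p\<^esub> t p = s p) \<and>
     (\<forall>p\<in>U. \<forall>s\<in>sec X U. s p = \<zero>\<^bsub>stalk X p\<^esub> \<longrightarrow>
        (\<exists>t\<in>sec X U. t p \<in> Units (stalk X p) \<and> t \<otimes>\<^bsub>sec_ring X U\<^esub> s = \<zero>\<^bsub>sec_ring X U\<^esub>))"

definition kscheme :: "('p, 's, 'k::field_char_0) kspace \<Rightarrow> bool" where
  "kscheme X \<longleftrightarrow> locally_ringed_kspace X \<and> (\<forall>p\<in>pts X. \<exists>U. affine_open X U \<and> p \<in> U)"

text \<open>The affine open set \<open>U\<close> is identified, through the functions \<open>\<phi> T\<^sub>i\<close>, with the closed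
  subscheme of affine \<open>n\<close>-space with ideal \<open>I\<close>.\<close>

definition affine_coords ::
  "nat \<Rightarrow> 'k mpol set \<Rightarrow> ('p, 's, 'k::field_char_0) kspace \<Rightarrow> 'p set \<Rightarrow> ('k mpol \<Rightarrow> 'p \<Rightarrow> 's) \<Rightarrow> bool" where
  "affine_coords n I X U \<phi> \<longleftrightarrow> affine_open X U \<and>
     \<phi> \<in> ring_hom (poly_ring n) (sec_ring X U) \<and>
     \<phi> ` carrier (poly_ring n) = sec X U \<and>
     a_kernel (poly_ring n) (sec_ring X U) \<phi> = I \<and>
     (\<forall>c. \<phi> (mconst c) = (\<lambda>p\<in>U. scalar X p c))"

definition origin ::
  "nat \<Rightarrow> ('p, 's, 'k::field_char_0) kspace \<Rightarrow> 'p set \<Rightarrow> ('k mpol \<Rightarrow> 'p \<Rightarrow> 's) \<Rightarrow> 'p" where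
  "origin n X U \<phi> = (THE p. p \<in> U \<and> (\<forall>i<n. \<phi> (mvar i) p \<in> max_ideal (stalk X p)))"

record ('q, 'p, 'r, 's) kmap =
  on_pts :: "'q \<Rightarrow> 'p"
  on_stalks :: "'q \<Rightarrow> 's \<Rightarrow> 'r"

definition pullback ::
  "('q, 'r, 'k) kspace \<Rightarrow> ('q, 'p, 'r, 's) kmap \<Rightarrow> 'p set \<Rightarrow> ('p \<Rightarrow> 's) \<Rightarrow> 'q \<Rightarrow> 'r" where
  "pullback X' \<sigma> U s = (\<lambda>q\<in>{q \<in> pts X'. on_pts \<sigma> q \<in> U}. on_stalks \<sigma> q (s (on_pts \<sigma> q)))"

definition kmorphism ::
  "('q, 'r, 'k) kspace \<Rightarrow> ('p, 's, 'k) kspace \<Rightarrow> ('q, 'p, 'r, 's) kmap \<Rightarrow> bool" where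
  "kmorphism X' X \<sigma> \<longleftrightarrow>
     continuous_map (sp X') (sp X) (on_pts \<sigma>) \<and>
     (\<forall>q\<in>pts X'. on_stalks \<sigma> q \<in> ring_hom (stalk X (on_pts \<sigma> q)) (stalk X' q) \<and>
        on_stalks \<sigma> q ` max_ideal (stalk X (on_pts \<sigma> q)) \<subseteq> max_ideal (stalk X' q) \<and>
        (\<forall>c. on_stalks \<sigma> q (scalar X (on_pts \<sigma> q) c) = scalar X' q c)) \<and>
     (\<forall>U. openin (sp X) U \<longrightarrow>
        pullback X' \<sigma> U ` sec X U \<subseteq> sec X' {q \<in> pts X'. on_pts \<sigma> q \<in> U})"


section \<open>Smooth germs\<close>

text \<open>Let \<open>Z\<close> be the closed subscheme \<open>f\<^sub>1 = \<dots> = f\<^sub>c = 0\<close> of affine \<open>n\<close>-space, where \<open>fs\<close> is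
  the list of the \<open>f\<^sub>i\<close>, and \<open>z\<close> a point of \<open>Z\<close>, i.e. a prime of its coordinate ring.
  \<open>Z\<close> is smooth at \<open>z\<close> by the Jacobian criterion: the rows of the Jacobian matrix are linearly
  independent over the residue field of \<open>z\<close> (stated over the domain whose fraction field it
  is). Every variety that is smooth over \<open>K\<close> is locally of this form.\<close>

definition coord_ring :: "nat \<Rightarrow> 'k::field_char_0 mpol list \<Rightarrow> 'k mpol set ring" where
  "coord_ring n fs = poly_ring n Quot (genideal (poly_ring n) (set fs))"

definition coord_class :: "nat \<Rightarrow> 'k::field_char_0 mpol list \<Rightarrow> 'k mpol \<Rightarrow> 'k mpol set" where
  "coord_class n fs p = genideal (poly_ring n) (set fs) +>\<^bsub>poly_ring n\<^esub> p"

definition smooth_point :: "nat \<Rightarrow> 'k::field_char_0 mpol list \<Rightarrow> 'k mpol set set \<Rightarrow> bool" where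
  "smooth_point n fs z \<longleftrightarrow> set fs \<subseteq> carrier (poly_ring n) \<and> primeideal z (coord_ring n fs) \<and>
     (\<forall>c. (\<forall>i<length fs. c i \<in> carrier (poly_ring n)) \<and>
          (\<forall>j<n. coord_class n fs (\<Sum>i<length fs. c i * mderiv j (fs ! i)) \<in> z) \<longrightarrow>
          (\<forall>i<length fs. coord_class n fs (c i) \<in> z))"

type_synonym 'k germ = "('k mpol set \<times> 'k mpol set) set"

definition germ_ring ::
  "nat \<Rightarrow> 'k::field_char_0 mpol list \<Rightarrow> 'k mpol set set \<Rightarrow> 'k germ ring" where
  "germ_ring n fs z = localization (coord_ring n fs) (carrier (coord_ring n fs) - z)"

definition germ_const ::
  "nat \<Rightarrow> 'k::field_char_0 mpol list \<Rightarrow> 'k mpol set set \<Rightarrow> 'k \<Rightarrow> 'k germ" where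
  "germ_const n fs z c = fraction (coord_ring n fs) (carrier (coord_ring n fs) - z)
     (coord_class n fs (mconst c)) \<one>\<^bsub>coord_ring n fs\<^esub>"

text \<open>A regular system of coordinates (parameters) of a smooth germ: elements of the maximal
  ideal \<open>m\<close> whose classes form a basis of the vector space \<open>m/m\<^sup>2\<close>.\<close>

definition regular_coords :: "'a ring \<Rightarrow> nat \<Rightarrow> (nat \<Rightarrow> 'a) \<Rightarrow> bool" where
  "regular_coords R r y \<longleftrightarrow>
     (\<forall>i<r. y i \<in> max_ideal R) \<and>
     (\<forall>u\<in>max_ideal R. \<exists>c\<in>{..<r} \<rightarrow> carrier R.
        u \<ominus>\<^bsub>R\<^esub> (\<Oplus>\<^bsub>R\<^esub>i\<in>{..<r}. c i \<otimes>\<^bsub>R\<^esub> y i) \<in> ideal_prod R (max_ideal R) (max_ideal R)) \<and>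
     (\<forall>c\<in>{..<r} \<rightarrow> carrier R.
        (\<Oplus>\<^bsub>R\<^esub>i\<in>{..<r}. c i \<otimes>\<^bsub>R\<^esub> y i) \<in> ideal_prod R (max_ideal R) (max_ideal R) \<longrightarrow>
        (\<forall>i<r. c i \<in> max_ideal R))"


section \<open>Simple normal crossings\<close>

text \<open>Prime divisors are represented by their generic points, and a \<open>\<rat>\<close>-Weil divisor by the
  function giving the coefficient of each prime divisor. \<open>div_of X s\<close> is the divisor of zeros
  of a function \<open>s\<close> that is not a zero-divisor.\<close>

definition prime_divisor :: "('p, 's, 'k) kspace \<Rightarrow> 'p \<Rightarrow> bool" where
  "prime_divisor X \<xi> \<longleftrightarrow> \<xi> \<in> pts X \<and> krull_dim (stalk X \<xi>) = 1"

definition div_of :: "('p, 's, 'k) kspace \<Rightarrow> ('p \<Rightarrow> 's) \<Rightarrow> 'p \<Rightarrow> rat" where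
  "div_of X s \<xi> = (if prime_divisor X \<xi>
     then of_nat (colength (stalk X \<xi>) (genideal (stalk X \<xi>) {s \<xi>})) else 0)"

text \<open>The germ of \<open>X\<close> at \<open>a\<close> is embedded in the smooth germ of \<open>Z\<close> at \<open>z\<close>; a closed
  embedding of germs is the same as a surjection of local \<open>K\<close>-algebras \<open>\<theta>\<close>.\<close>

definition smooth_embedding ::
  "('p, 's, 'k::field_char_0) kspace \<Rightarrow> 'p \<Rightarrow> nat \<Rightarrow> 'k mpol list \<Rightarrow> 'k mpol set set \<Rightarrow>
   ('k germ \<Rightarrow> 's) \<Rightarrow> bool" where
  "smooth_embedding X a n fs z \<theta> \<longleftrightarrow> smooth_point n fs z \<and>
     \<theta> \<in> ring_hom (germ_ring n fs z) (stalk X a) \<and>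
     \<theta> ` carrier (germ_ring n fs z) = carrier (stalk X a) \<and>
     (\<forall>c. \<theta> (germ_const n fs z c) = scalar X a c)"

text \<open>The irreducible components of \<open>X\<close> at \<open>a\<close> are the minimal primes of the local ring, and
  the component \<open>P\<close> is the coordinate subspace \<open>y\<^sub>i = 0\<close>, \<open>i \<in> S P\<close>.\<close>

definition snc_coords ::
  "('p, 's, 'k::field_char_0) kspace \<Rightarrow> 'p \<Rightarrow> nat \<Rightarrow> 'k mpol list \<Rightarrow> 'k mpol set set \<Rightarrow>
   ('k germ \<Rightarrow> 's) \<Rightarrow> nat \<Rightarrow> (nat \<Rightarrow> 'k germ) \<Rightarrow> ('s set \<Rightarrow> nat set) \<Rightarrow> bool" where
  "snc_coords X a n fs z \<theta> r y S \<longleftrightarrow>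
     smooth_embedding X a n fs z \<theta> \<and> regular_coords (germ_ring n fs z) r y \<and>
     (\<forall>P\<in>minimal_primes (stalk X a). S P \<subseteq> {..<r} \<and>
        {u \<in> carrier (germ_ring n fs z). \<theta> u \<in> P} = genideal (germ_ring n fs z) (y ` S P))"

definition snc_at :: "('p, 's, 'k::field_char_0) kspace \<Rightarrow> 'p \<Rightarrow> bool" where
  "snc_at X a \<longleftrightarrow> (\<exists>n fs z \<theta> r y S. snc_coords X a n fs z \<theta> r y S)"

text \<open>Here \<open>s j\<close> is the restriction to \<open>X\<close>, near \<open>a\<close>, of the coordinate \<open>y j\<close>.\<close>

definition snc_pair_at ::
  "('p, 's, 'k::field_char_0) kspace \<Rightarrow> ('p \<Rightarrow> rat) \<Rightarrow> 'p \<Rightarrow> bool" where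
  "snc_pair_at X D a \<longleftrightarrow> (\<exists>n fs z \<theta> r y S. snc_coords X a n fs z \<theta> r y S \<and>
     (\<exists>Q \<alpha> U s. Q \<subseteq> {..<r} \<and> (\<forall>P\<in>minimal_primes (stalk X a). Q \<inter> S P = {}) \<and>
        openin (sp X) U \<and> a \<in> U \<and> (\<forall>j\<in>Q. s j \<in> sec X U \<and> s j a = \<theta> (y j)) \<and>
        (\<forall>\<xi>\<in>U. prime_divisor X \<xi> \<longrightarrow> D \<xi> = (\<Sum>j\<in>Q. \<alpha> j * div_of X (s j) \<xi>))))"


section \<open>Blowing-up\<close>

text \<open>A closed set \<open>C\<close> carries its reduced structure, with ideal sheaf \<open>ideal_sections X C\<close>.\<close>

definition ideal_sections :: "('p, 's, 'k) kspace \<Rightarrow> 'p set \<Rightarrow> 'p set \<Rightarrow> ('p \<Rightarrow> 's) set" where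
  "ideal_sections X C U = {s \<in> sec X U. \<forall>p\<in>U \<inter> C. s p \<in> max_ideal (stalk X p)}"

definition ideal_stalk :: "('p, 's, 'k) kspace \<Rightarrow> 'p set \<Rightarrow> 'p \<Rightarrow> 's set" where
  "ideal_stalk X C p = {s p | s U. openin (sp X) U \<and> p \<in> U \<and> s \<in> ideal_sections X C U}"

definition smooth_closed :: "('p, 's, 'k::field_char_0) kspace \<Rightarrow> 'p set \<Rightarrow> bool" where
  "smooth_closed X C \<longleftrightarrow> closedin (sp X) C \<and>
     (\<forall>p\<in>C. \<exists>n fs z \<theta>. smooth_point n fs z \<and>
        \<theta> \<in> ring_iso (germ_ring n fs z) (stalk X p Quot ideal_stalk X C p) \<and>
        (\<forall>c. \<theta> (germ_const n fs z c) = ideal_stalk X C p +>\<^bsub>stalk X p\<^esub> scalar X p c))"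

definition inverse_ideal ::
  "('p, 's, 'k) kspace \<Rightarrow> 'p set \<Rightarrow> ('q, 'r, 'k) kspace \<Rightarrow> ('q, 'p, 'r, 's) kmap \<Rightarrow> 'q \<Rightarrow> 'r set" where
  "inverse_ideal X C X' \<sigma> q =
     genideal (stalk X' q) (on_stalks \<sigma> q ` ideal_stalk X C (on_pts \<sigma> q))"

definition blowup_chart ::
  "('p, 's, 'k) kspace \<Rightarrow> 'p set \<Rightarrow> ('q, 'r, 'k) kspace \<Rightarrow> ('q, 'p, 'r, 's) kmap \<Rightarrow>
   'p set \<Rightarrow> ('p \<Rightarrow> 's) \<Rightarrow> 'q set" where
  "blowup_chart X C X' \<sigma> U f = {q \<in> pts X'. on_pts \<sigma> q \<in> U \<and>
     inverse_ideal X C X' \<sigma> q = genideal (stalk X' q) {on_stalks \<sigma> q (f (on_pts \<sigma> q))}}"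

text \<open>\<open>\<sigma>\<close> is the blowing-up of \<open>X\<close> with centre \<open>C\<close>: over an affine open \<open>U\<close> with
  \<open>A = sec X U\<close> and \<open>I\<close> the ideal of \<open>C\<close> in \<open>A\<close>, it is \<open>Proj\<close> of the Rees algebra
  \<open>\<Oplus>\<^sub>n I\<^sup>n\<close>. The latter is described by its standard charts \<open>D\<^sub>+(f)\<close>, \<open>f \<in> I\<close>; these are
  the loci where \<open>f\<close> generates the inverse image of \<open>I\<close>, and they are affine with ring the
  degree \<open>0\<close> part of the Rees algebra localized at \<open>f\<close>, i.e. the ring of the fractions
  \<open>b / f\<^sup>n\<close> with \<open>b \<in> I\<^sup>n\<close>.\<close>

definition blowing_up ::
  "('p, 's, 'k::field_char_0) kspace \<Rightarrow> 'p set \<Rightarrow> ('q, 'r, 'k) kspace \<Rightarrow>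
   ('q, 'p, 'r, 's) kmap \<Rightarrow> bool" where
  "blowing_up X C X' \<sigma> \<longleftrightarrow> kscheme X' \<and> kmorphism X' X \<sigma> \<and>
     (\<forall>U. affine_open X U \<longrightarrow>
       (let A = sec_ring X U; I = ideal_sections X C U in
        {q \<in> pts X'. on_pts \<sigma> q \<in> U} = (\<Union>f\<in>I. blowup_chart X C X' \<sigma> U f) \<and>
        (\<forall>f\<in>I.
          let V = blowup_chart X C X' \<sigma> U f; B = sec_ring X' V;
              h = (\<lambda>s. restrict (pullback X' \<sigma> U s) V) in
          affine_open X' V \<and>
          (\<forall>n. \<forall>b\<in>ideal_pow A I n. \<exists>g\<in>carrier B. (h f [^]\<^bsub>B\<^esub> n) \<otimes>\<^bsub>B\<^esub> g = h b) \<and>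
          (\<forall>g\<in>carrier B. \<exists>n. \<exists>b\<in>ideal_pow A I n. (h f [^]\<^bsub>B\<^esub> n) \<otimes>\<^bsub>B\<^esub> g = h b) \<and>
          (\<forall>g\<in>carrier B. h f \<otimes>\<^bsub>B\<^esub> g = \<zero>\<^bsub>B\<^esub> \<longrightarrow> g = \<zero>\<^bsub>B\<^esub>) \<and>
          (\<forall>b\<in>carrier A. h b = \<zero>\<^bsub>B\<^esub> \<longrightarrow> (\<exists>n. (f [^]\<^bsub>A\<^esub> (n::nat)) \<otimes>\<^bsub>A\<^esub> b = \<zero>\<^bsub>A\<^esub>)))))"

text \<open>The Weil divisor of the Cartier divisor \<open>\<sigma>\<inverse>(C)\<close>.\<close>

definition exceptional_divisor ::
  "('p, 's, 'k) kspace \<Rightarrow> 'p set \<Rightarrow> ('q, 'r, 'k) kspace \<Rightarrow> ('q, 'p, 'r, 's) kmap \<Rightarrow> 'q \<Rightarrow> rat" where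
  "exceptional_divisor X C X' \<sigma> \<xi> = (if prime_divisor X' \<xi> \<and> on_pts \<sigma> \<xi> \<in> C
     then of_nat (colength (stalk X' \<xi>) (inverse_ideal X C X' \<sigma> \<xi>)) else 0)"

text \<open>\<open>\<sigma>\<close> is an isomorphism outside \<open>C\<close>, so the prime divisors of \<open>X'\<close> not contained in
  \<open>\<sigma>\<inverse>(C)\<close> are the strict transforms of the prime divisors of \<open>X\<close> not contained in \<open>C\<close>.\<close>

definition strict_transform ::
  "'p set \<Rightarrow> ('q, 'r, 'k) kspace \<Rightarrow> ('q, 'p, 'r, 's) kmap \<Rightarrow> ('p \<Rightarrow> rat) \<Rightarrow> 'q \<Rightarrow> rat" where
  "strict_transform C X' \<sigma> D \<xi> =
     (if prime_divisor X' \<xi> \<and> on_pts \<sigma> \<xi> \<notin> C then D (on_pts \<sigma> \<xi>) else 0)"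

definition transform_divisor ::
  "('p, 's, 'k) kspace \<Rightarrow> 'p set \<Rightarrow> ('q, 'r, 'k) kspace \<Rightarrow> ('q, 'p, 'r, 's) kmap \<Rightarrow>
   ('p \<Rightarrow> rat) \<Rightarrow> 'q \<Rightarrow> rat" where
  "transform_divisor X C X' \<sigma> D \<xi> =
     strict_transform C X' \<sigma> D \<xi> + exceptional_divisor X C X' \<sigma> \<xi>"

text \<open>The sequence \<open>X\<^sub>0 \<leftarrow> X\<^sub>1 \<leftarrow> \<dots> \<leftarrow> X\<^sub>t\<close> of blowings-up \<open>\<sigma>\<^sub>j\<^sub>+\<^sub>1 : X\<^sub>j\<^sub>+\<^sub>1 \<rightarrow> X\<^sub>j\<close> with
  centres \<open>C\<^sub>j\<close>; \<open>\<sigma> j\<close> below stands for \<open>\<sigma>\<^sub>j\<^sub>+\<^sub>1\<close>.\<close>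

definition snc_avoiding_sequence ::
  "('p, 's, 'k::field_char_0) kspace \<Rightarrow> nat \<Rightarrow> (nat \<Rightarrow> ('p, 's, 'k) kspace) \<Rightarrow> (nat \<Rightarrow> 'p set) \<Rightarrow>
   (nat \<Rightarrow> ('p, 'p, 's, 's) kmap) \<Rightarrow> (nat \<Rightarrow> 'p \<Rightarrow> rat) \<Rightarrow> bool" where
  "snc_avoiding_sequence X t Xs C \<sigma> D \<longleftrightarrow> Xs 0 = X \<and> D 0 = (\<lambda>_. 0) \<and>
     (\<forall>j<t. smooth_closed (Xs j) (C j) \<and>
        (\<forall>p\<in>C j. \<not> snc_pair_at (Xs j) (D j) p) \<and>
        blowing_up (Xs j) (C j) (Xs (Suc j)) (\<sigma> j) \<and>
        D (Suc j) = transform_divisor (Xs j) (C j) (Xs (Suc j)) (\<sigma> j) (D j))"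


section \<open>The example\<close>

text \<open>Coordinates of affine 4-space are numbered so that \<open>w, x, y, z\<close> are
  \<open>T\<^sub>0, T\<^sub>1, T\<^sub>2, T\<^sub>3\<close>. The ideal is that of the (reduced) union of the three planes.\<close>

definition three_planes :: "'k::field_char_0 mpol set" where
  "three_planes =
     genideal (poly_ring 4) {mvar 3, mvar 1} \<inter>
     genideal (poly_ring 4) {mvar 3, mvar 2} \<inter>
     genideal (poly_ring 4) {mvar 3 + mvar 1 * mvar 0, mvar 1 + mvar 2}"

end

(*
At the origin the three planes are not simple normal crossings: with the ideals P0 = (x,z),
P1 = (y,z), P2 = (x+y, z+xw), the element x lies in (P0 + P2) \<inter> (P1 + P2), whereas the tangent
vector d/dx - d/dy kills P0 \<inter> P1 + P2 + m^2; for coordinate subspaces of a smooth germ these two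
ideals have the same linear parts.  Away from the origin, explicit functions with a nonsingular
Jacobian matrix make the planes passing through the point, together with the exceptional divisor,
coordinate subspaces.

Blowing up the origin and substituting (w, xw, yw, zw) in the equations reproduces the same three
planes in the chart of w, with exceptional divisor w = 0.  The only possible centre meeting this
chart is therefore again its origin, so every member of an admissible sequence of blowings-up
contains an open copy of the three planes on which the divisor is a multiple of w = 0, and hence a
point that is not snc.
*)
theory Submission
  imports Defs "HOL-Computational_Algebra.Polynomial"
begin

section \<open>Polynomials\<close>

text \<open>Components are handled through parametrizations: the ideal of a plane is the kernel of a
  substitution, so primeness is automatic and membership is one equation. Stalks and germ rings are
  both presented as rings of fractions of polynomials (\<open>local_presentation\<close>), which
  turns most questions about them into questions about a prime of \<open>poly_ring n\<close>. Points
  are arbitrary primes, not only closed points, and coordinates must be a whole basis of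
  \<open>m/m^2\<close>. Derivations yield only the independence of the explicit functions;
  completing them to a basis requires \<open>m\<close> to be finitely generated, which is the reason
  for Hilbert's basis theorem. At the origin the obstacle is that the ambient smooth germ is
  unknown. Only the surjection onto the stalk and linear algebra modulo \<open>m^2\<close> are
  available, so the ideal of functions killed by the tangent vector is formed in the stalk and then
  pulled back. A centre may also miss the distinguished chart. Then the chart must reappear
  unchanged together with its divisor, which calls for the invariance of Krull dimension and
  colength under isomorphisms of stalks.\<close>

abbreviation pcarr :: "nat \<Rightarrow> 'k::field_char_0 mpol set" where
  "pcarr n \<equiv> carrier (poly_ring n)"

lemma poly_ring_simps [simp]:
  "monoid.mult (poly_ring n) = (*)" "one (poly_ring n) = 1"
  "ring.zero (poly_ring n) = 0" "add (poly_ring n) = (+)"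
  by (simp_all add: poly_ring_def)

lemma pcarr_iff: "p \<in> pcarr n \<longleftrightarrow> (\<forall>m\<in>Poly_Mapping.keys p. Poly_Mapping.keys m \<subseteq> {..<n})"
  by (simp add: poly_ring_def)

lemma pcarr_add [intro, simp]: "p \<in> pcarr n \<Longrightarrow> q \<in> pcarr n \<Longrightarrow> p + q \<in> pcarr n"
  using Poly_Mapping.keys_add[of p q] unfolding pcarr_iff by blast

lemma pcarr_mult [intro, simp]: "p \<in> pcarr n \<Longrightarrow> q \<in> pcarr n \<Longrightarrow> p * q \<in> pcarr n"
  unfolding pcarr_iff
proof
  fix m assume pq: "\<forall>m\<in>Poly_Mapping.keys p. Poly_Mapping.keys m \<subseteq> {..<n}"
    "\<forall>m\<in>Poly_Mapping.keys q. Poly_Mapping.keys m \<subseteq> {..<n}" and m: "m \<in> Poly_Mapping.keys (p * q)"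
  obtain a b where "m = a + b" "a \<in> Poly_Mapping.keys p" "b \<in> Poly_Mapping.keys q"
    using m Poly_Mapping.keys_mult[of p q] by blast
  then show "Poly_Mapping.keys m \<subseteq> {..<n}"
    using pq Poly_Mapping.keys_add[of a b] by blast
qed

lemma pcarr_uminus [intro, simp]: "p \<in> pcarr n \<Longrightarrow> - p \<in> pcarr n"
  by (simp add: pcarr_iff in_keys_iff)

lemma pcarr_diff [intro, simp]: "p \<in> pcarr n \<Longrightarrow> q \<in> pcarr n \<Longrightarrow> p - q \<in> pcarr n"
  using pcarr_add[of p n "- q"] by simp

lemma pcarr_0 [intro, simp]: "0 \<in> pcarr n" and pcarr_1 [intro, simp]: "1 \<in> pcarr n"
  by (simp_all add: pcarr_iff)

lemma pcarr_power [intro, simp]: "p \<in> pcarr n \<Longrightarrow> p ^ d \<in> pcarr n"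
  by (induction d) auto

lemma pcarr_sum [intro]: "(\<And>i. i \<in> A \<Longrightarrow> f i \<in> pcarr n) \<Longrightarrow> sum f A \<in> pcarr n"
  by (induction A rule: infinite_finite_induct) auto

lemma pcarr_mvar [intro, simp]: "i < n \<Longrightarrow> mvar i \<in> pcarr n"
  by (simp add: pcarr_iff mvar_def)

lemma pcarr_mconst [intro, simp]: "mconst c \<in> pcarr n"
  by (simp add: pcarr_iff mconst_def)

lemma mconst_simps [simp]: "mconst 0 = 0" "mconst 1 = 1"
  "mconst (a + b) = mconst a + mconst b" "mconst (a * b) = mconst a * mconst b"
  by (simp_all add: mconst_def single_add mult_single)

lemma mconst_eq_0_iff [simp]: "mconst c = 0 \<longleftrightarrow> c = 0"
  unfolding mconst_def by (metis lookup_single_eq lookup_zero single_zero)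

lemma domain_poly_ring: "domain (poly_ring n :: 'k::field_char_0 mpol ring)"
proof (rule domain.intro)
  show "cring (poly_ring n :: 'k mpol ring)"
  proof (rule cringI)
    show "abelian_group (poly_ring n :: 'k mpol ring)"
    proof (rule abelian_groupI)
      fix x :: "'k mpol" assume "x \<in> pcarr n"
      then show "\<exists>y\<in>pcarr n. y \<oplus>\<^bsub>poly_ring n\<^esub> x = \<zero>\<^bsub>poly_ring n\<^esub>"
        by (intro bexI[of _ "- x"]) auto
    qed (auto simp: algebra_simps)
    show "Group.comm_monoid (poly_ring n :: 'k mpol ring)"
      by (rule comm_monoidI) (auto simp: algebra_simps)
  qed (auto simp: algebra_simps)
qed (unfold_locales, auto)

lemma cring_poly_ring: "cring (poly_ring n)"
  using domain_poly_ring domain.axioms(1) by blast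

lemma ring_poly_ring: "ring (poly_ring n)"
  using cring_poly_ring cring.axioms(1) by blast

lemma a_inv_poly_ring [simp]: "p \<in> pcarr n \<Longrightarrow> \<ominus>\<^bsub>poly_ring n\<^esub> p = - p"
  using abelian_group.minus_equality[of "poly_ring n" "- p" p] ring.is_abelian_group[OF ring_poly_ring]
  by auto

lemma a_minus_poly_ring [simp]: "q \<in> pcarr n \<Longrightarrow> p \<ominus>\<^bsub>poly_ring n\<^esub> q = p - q"
  by (simp add: a_minus_def)

lemma mvar_power: "mvar i ^ d = Poly_Mapping.single (Poly_Mapping.single i d) 1"
  by (induction d) (simp_all add: mvar_def mult_single single_add[symmetric])

text \<open>The term split off has a new key, so nothing cancels. The rule serves on two levels: for
  polynomials as maps from exponents to coefficients, and for one exponent as a map from variables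
  to degrees.\<close>

lemma mpol_add_single_induct [case_names zero add]:
  assumes "Q (0 :: 'a \<Rightarrow>\<^sub>0 'b::comm_monoid_add)"
    and "\<And>m c f. m \<notin> Poly_Mapping.keys f \<Longrightarrow> c \<noteq> 0 \<Longrightarrow> Q f \<Longrightarrow> Q (Poly_Mapping.single m c + f)"
  shows "Q f"
proof (induction f rule: update_induct)
  case (update f a b)
  have "Poly_Mapping.update a b f = Poly_Mapping.single a b + f"
    using update(1) by (intro poly_mapping_eqI) (auto simp: lookup_update lookup_add lookup_single in_keys_iff)
  then show ?case using assms(2)[OF update] by simp
qed (rule assms)

lemma keys_single_add:
  assumes "m \<notin> Poly_Mapping.keys f" "(c :: 'b::comm_monoid_add) \<noteq> 0"
  shows "Poly_Mapping.keys (Poly_Mapping.single m c + f) = insert m (Poly_Mapping.keys f)"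
proof (rule Set.set_eqI)
  fix x show "x \<in> Poly_Mapping.keys (Poly_Mapping.single m c + f) \<longleftrightarrow> x \<in> insert m (Poly_Mapping.keys f)"
    using assms by (cases "x = m") (auto simp: in_keys_iff lookup_add lookup_single)
qed

lemma monom_induct:
  assumes "Poly_Mapping.keys (m :: nat \<Rightarrow>\<^sub>0 nat) \<subseteq> {..<n}" "Q (1 :: 'k::field_char_0 mpol)"
    and "\<And>i f. i < n \<Longrightarrow> f \<in> pcarr n \<Longrightarrow> Q f \<Longrightarrow> Q (mvar i * f)"
  shows "Q (Poly_Mapping.single m 1)"
  using assms(1)
proof (induction m rule: mpol_add_single_induct)
  case zero then show ?case using assms(2) by simp
next
  case (add i d m)
  have k: "Poly_Mapping.keys m \<subseteq> {..<n}" "i < n"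
    using add.prems unfolding keys_single_add[OF add(1,2)] by auto
  have "Q (mvar i ^ d * Poly_Mapping.single m 1)" for d
  proof (induction d)
    case (Suc d)
    have "mvar i ^ d * Poly_Mapping.single m (1::'k) \<in> pcarr n"
      using k by (intro pcarr_mult pcarr_power pcarr_mvar) (auto simp: pcarr_iff)
    from assms(3)[OF k(2) this Suc] show ?case by (simp add: mult.assoc)
  qed (use add k in auto)
  then show ?case by (simp add: mvar_power mult_single)
qed

text \<open>Constants and variables generate the ring, so claims compatible with sums and products,
  above all those about homomorphisms and derivations, need not look at monomials.\<close>

lemma mpol_induct [consumes 1, case_names const var add mult]:
  assumes "f \<in> pcarr n" and c: "\<And>c. Q (mconst c)" and v: "\<And>i. i < n \<Longrightarrow> Q (mvar i)"
    and a: "\<And>f g. f \<in> pcarr n \<Longrightarrow> g \<in> pcarr n \<Longrightarrow> Q f \<Longrightarrow> Q g \<Longrightarrow> Q (f + g)"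
    and m: "\<And>f g. f \<in> pcarr n \<Longrightarrow> g \<in> pcarr n \<Longrightarrow> Q f \<Longrightarrow> Q g \<Longrightarrow> Q (f * g)"
  shows "Q (f :: 'k::field_char_0 mpol)"
  using assms(1)
proof (induction f rule: mpol_add_single_induct)
  case zero then show ?case using c[of 0] by simp
next
  case (add k d f)
  have "k \<in> Poly_Mapping.keys (Poly_Mapping.single k d + f)"
    using add(1,2) by (auto simp: in_keys_iff lookup_add)
  then have k: "Poly_Mapping.keys k \<subseteq> {..<n}" using add.prems unfolding pcarr_iff by blast
  have f: "f \<in> pcarr n"
    unfolding pcarr_iff
  proof
    fix l assume l: "l \<in> Poly_Mapping.keys f"
    then have "l \<noteq> k" using add(1) by auto
    then have "l \<in> Poly_Mapping.keys (Poly_Mapping.single k d + f)"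
      using l by (auto simp: in_keys_iff lookup_add lookup_single_not_eq)
    then show "Poly_Mapping.keys l \<subseteq> {..<n}" using add.prems unfolding pcarr_iff by blast
  qed
  have s: "Poly_Mapping.single k d = mconst d * Poly_Mapping.single k 1"
    by (simp add: mconst_def mult_single)
  have s1: "Poly_Mapping.single k (1::'k) \<in> pcarr n" using k by (auto simp: pcarr_iff)
  have "Q (Poly_Mapping.single k 1)"
    by (rule monom_induct[OF k]) (use c[of 1] v m in auto)
  then have "Q (Poly_Mapping.single k d)" unfolding s using c m s1 by auto
  then show ?case using a f s1 s add.IH[OF f] by auto
qed

subsection \<open>Substitution homomorphisms\<close>

definition mono_sub :: "(nat \<Rightarrow> 'a::comm_ring_1) \<Rightarrow> (nat \<Rightarrow>\<^sub>0 nat) \<Rightarrow> 'a" where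
  "mono_sub s m = (\<Prod>i\<in>Poly_Mapping.keys m. s i ^ Poly_Mapping.lookup m i)"

text \<open>Evaluation at \<open>s\<close>. Polynomials in any number of variables share one type,
  so a substitution is an endomorphism of that type; the variables that occur are tracked separately
  by \<open>sub_pcarr\<close>.\<close>

definition sub :: "(nat \<Rightarrow> 'k::field_char_0 mpol) \<Rightarrow> 'k mpol \<Rightarrow> 'k mpol" where
  "sub s p = (\<Sum>m\<in>Poly_Mapping.keys p. mconst (Poly_Mapping.lookup p m) * mono_sub s m)"

lemma mono_sub_superset:
  assumes "finite A" "Poly_Mapping.keys m \<subseteq> A"
  shows "mono_sub s m = (\<Prod>i\<in>A. s i ^ Poly_Mapping.lookup m i)"
  unfolding mono_sub_def using assms
  by (intro prod.mono_neutral_left) (auto simp: in_keys_iff)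

lemma mono_sub_add: "mono_sub s (m + m') = mono_sub s m * mono_sub s m'"
proof -
  let ?A = "Poly_Mapping.keys m \<union> Poly_Mapping.keys m'"
  have "mono_sub s (m + m') = (\<Prod>i\<in>?A. s i ^ Poly_Mapping.lookup (m + m') i)"
    by (rule mono_sub_superset) (auto simp: Poly_Mapping.keys_add)
  also have "\<dots> = (\<Prod>i\<in>?A. s i ^ Poly_Mapping.lookup m i) * (\<Prod>i\<in>?A. s i ^ Poly_Mapping.lookup m' i)"
    by (simp add: lookup_add power_add prod.distrib)
  finally show ?thesis by (simp add: mono_sub_superset[of ?A, symmetric])
qed

lemma sub_single: "sub s (Poly_Mapping.single m c) = mconst c * mono_sub s m"
  by (cases "c = 0") (simp_all add: sub_def)

lemma sub_add [simp]: "sub s (p + q) = sub s p + sub s q"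
  unfolding sub_def
  by (rule setsum_keys_plus_distrib) (auto simp: algebra_simps)

lemma sub_0 [simp]: "sub s 0 = 0" by (simp add: sub_def)

lemma sub_mult [simp]: "sub s (p * q) = sub s p * sub s q"
proof (induction p rule: mpol_add_single_induct)
  case (add m c p)
  have "sub s (Poly_Mapping.single m c * q) = sub s (Poly_Mapping.single m c) * sub s q"
    by (induction q rule: mpol_add_single_induct)
      (auto simp: algebra_simps mult_single sub_single mono_sub_add)
  with add show ?case by (simp add: distrib_right)
qed simp

lemma sub_mconst [simp]: "sub s (mconst c) = mconst c"
  by (simp add: mconst_def sub_single mono_sub_def)

lemma sub_1 [simp]: "sub s 1 = 1"
  using sub_mconst[of s 1] by simp

lemma sub_mvar [simp]: "sub s (mvar i) = s i"
  by (simp add: mvar_def sub_single mono_sub_def)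

lemma sub_uminus [simp]: "sub s (- p) = - sub s p"
  using sub_add[of s p "- p"] by (simp add: eq_neg_iff_add_eq_0 add.commute)

lemma sub_diff [simp]: "sub s (p - q) = sub s p - sub s q"
  using sub_add[of s p "- q"] by simp

lemma sub_power [simp]: "sub s (p ^ d) = sub s p ^ d"
  by (induction d) simp_all

lemma sub_pcarr:
  assumes "p \<in> pcarr n" "\<And>i. i < n \<Longrightarrow> s i \<in> pcarr n'" shows "sub s p \<in> pcarr n'"
  using assms by (induction p rule: mpol_induct) auto

lemma sub_sub:
  assumes "p \<in> pcarr n" "\<And>i. i < n \<Longrightarrow> sub s (t i) = u i"
  shows "sub s (sub t p) = sub u p"
  using assms by (induction p rule: mpol_induct) auto

text \<open>A first-order Taylor formula, proved by the product rule for differences. If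
  \<open>s\<close> parametrizes a plane, it writes each element of the kernel of
  \<open>sub s\<close> as a combination of the equations \<open>mvar i - s i\<close>; for
  \<open>s = 0\<close> it splits a polynomial into its constant term and multiples of the
  variables.\<close>

lemma sub_diff_combination:
  assumes "p \<in> pcarr n" "\<And>i. i < n \<Longrightarrow> s i \<in> pcarr n"
  shows "\<exists>a. (\<forall>i<n. a i \<in> pcarr n) \<and> p - sub s p = (\<Sum>i<n. a i * (mvar i - s i))"
  using assms(1)
proof (induction p rule: mpol_induct)
  case (const c)
  show ?case by (rule exI[of _ "\<lambda>_. 0"]) auto
next
  case (var i)
  show ?case
    by (rule exI[of _ "\<lambda>j. if j = i then 1 else 0"]) (use var in \<open>auto simp: if_distrib[of "\<lambda>x. x * _"] cong: if_cong\<close>)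
next
  case (add f g)
  then obtain a b where "\<forall>i<n. a i \<in> pcarr n" "f - sub s f = (\<Sum>i<n. a i * (mvar i - s i))"
    "\<forall>i<n. b i \<in> pcarr n" "g - sub s g = (\<Sum>i<n. b i * (mvar i - s i))" by auto
  then show ?case
    by (intro exI[of _ "\<lambda>i. a i + b i"]) (auto simp: distrib_right sum.distrib add_diff_add)
next
  case (mult f g)
  then obtain a b where ab: "\<forall>i<n. a i \<in> pcarr n" "f - sub s f = (\<Sum>i<n. a i * (mvar i - s i))"
    "\<forall>i<n. b i \<in> pcarr n" "g - sub s g = (\<Sum>i<n. b i * (mvar i - s i))" by auto
  have "f * g - sub s (f * g) = (f - sub s f) * g + sub s f * (g - sub s g)"
    by (simp add: algebra_simps)
  also have "\<dots> = (\<Sum>i<n. (a i * g + sub s f * b i) * (mvar i - s i))"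
    unfolding ab(2,4)
    by (simp add: sum_distrib_left sum_distrib_right sum.distrib distrib_right mult.assoc mult.left_commute mult.commute[of g])
  finally show ?case
    using ab mult(1,2) sub_pcarr[OF mult(1) assms(2)]
    by (intro exI[of _ "\<lambda>i. a i * g + sub s f * b i"]) auto
qed

text \<open>The chart substitution \<open>T\<^sub>i \<mapsto> T\<^sub>i T\<^sub>k\<close> for \<open>i \<noteq> k\<close>, which describes the blowing-up of the origin
  in the chart of \<open>T\<^sub>k\<close>.\<close>

definition chart_sub :: "nat \<Rightarrow> 'k::field_char_0 mpol \<Rightarrow> 'k mpol" where
  "chart_sub k = sub (\<lambda>i. if i = k then mvar k else mvar i * mvar k)"

lemma chart_sub_pcarr: "p \<in> pcarr n \<Longrightarrow> k < n \<Longrightarrow> chart_sub k p \<in> pcarr n"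
  unfolding chart_sub_def by (erule sub_pcarr) auto

text \<open>Monomials go to monomials, and the map \<open>\<iota>\<close> on exponents is injective:
  exponents of variables other than \<open>T_k\<close> stay the same and determine by how much the
  exponent of \<open>T_k\<close> grows. So no cancellation can occur.\<close>

lemma chart_sub_inj:
  assumes "chart_sub k p = 0" shows "p = (0 :: 'k::field_char_0 mpol)"
proof -
  \<comment> \<open>Every factor \<open>T_i\<close> with \<open>i \<noteq> k\<close> brings along
    one factor \<open>T_k\<close>, so the exponent of \<open>T_k\<close> increases by the total
    degree in the other variables.\<close>
  define \<iota> where "\<iota> m = m + Poly_Mapping.single k (\<Sum>i\<in>Poly_Mapping.keys m - {k}. Poly_Mapping.lookup m i)"
    for m :: "nat \<Rightarrow>\<^sub>0 nat"
  have mono: "mono_sub (\<lambda>i. if i = k then mvar k else mvar i * mvar k) m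
      = (Poly_Mapping.single (\<iota> m) 1 :: 'k mpol)" for m
  proof (induction m rule: mpol_add_single_induct)
    case zero then show ?case by (simp add: mono_sub_def \<iota>_def)
  next
    case (add i d m)
    have iota: "\<iota> (Poly_Mapping.single i d + m) = \<iota> m + Poly_Mapping.single i d +
        Poly_Mapping.single k (if i = k then 0 else d)"
    proof -
      have ks: "Poly_Mapping.keys (Poly_Mapping.single i d + m) = insert i (Poly_Mapping.keys m)"
        by (rule keys_single_add[OF add(1,2)])
      have "(\<Sum>j\<in>Poly_Mapping.keys m - {k}. Poly_Mapping.lookup (Poly_Mapping.single i d + m) j)
          = (\<Sum>j\<in>Poly_Mapping.keys m - {k}. Poly_Mapping.lookup m j)"
        using add(1) by (intro sum.cong) (auto simp: lookup_add lookup_single when_def)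
      moreover have "Poly_Mapping.lookup m i = 0" using add(1) by (simp add: in_keys_iff)
      ultimately show ?thesis using add(1) unfolding \<iota>_def ks
        by (cases "i = k")
          (simp_all add: insert_Diff_if lookup_add[of _ _ i] single_add ac_simps)
    qed
    show ?case unfolding mono_sub_add add(3) iota
      by (auto simp: mono_sub_def mvar_power mult_single power_mult_distrib algebra_simps)
  qed
  have inj: "\<iota> m = \<iota> m' \<Longrightarrow> m = m'" for m m'
  proof -
    assume eq: "\<iota> m = \<iota> m'"
    have l: "Poly_Mapping.lookup m i = Poly_Mapping.lookup m' i" if "i \<noteq> k" for i
      using arg_cong[OF eq, of "\<lambda>x. Poly_Mapping.lookup x i"] that
      by (auto simp: \<iota>_def lookup_add lookup_single_not_eq)
    then have "Poly_Mapping.keys m - {k} = Poly_Mapping.keys m' - {k}" by (auto simp: in_keys_iff)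
    then have "(\<Sum>i\<in>Poly_Mapping.keys m - {k}. Poly_Mapping.lookup m i) =
      (\<Sum>i\<in>Poly_Mapping.keys m' - {k}. Poly_Mapping.lookup m' i)"
      by (intro sum.cong) (auto simp: l)
    then show ?thesis using eq by (simp add: \<iota>_def)
  qed
  have "Poly_Mapping.lookup (chart_sub k p) (\<iota> m) = Poly_Mapping.lookup p m" for m
  proof -
    have "Poly_Mapping.lookup (chart_sub k p) (\<iota> m) =
      (\<Sum>m'\<in>Poly_Mapping.keys p. Poly_Mapping.lookup p m' when \<iota> m' = \<iota> m)"
      unfolding chart_sub_def sub_def mono
      by (simp add: mconst_def mult_single lookup_sum lookup_single)
    also have "\<dots> = (\<Sum>m'\<in>Poly_Mapping.keys p. if m' = m then Poly_Mapping.lookup p m' else 0)"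
      by (intro sum.cong) (auto simp: when_def dest: inj)
    also have "\<dots> = Poly_Mapping.lookup p m" by (auto simp: in_keys_iff)
    finally show ?thesis .
  qed
  then show ?thesis using assms by (intro poly_mapping_eqI) simp
qed

subsection \<open>Derivations\<close>

lemma mderiv_add: "mderiv j (p + q) = mderiv j p + mderiv j q"
  unfolding mderiv_def
  by (rule setsum_keys_plus_distrib) (auto simp: single_add[symmetric] algebra_simps)

lemma mderiv_single: "mderiv j (Poly_Mapping.single m c) =
    Poly_Mapping.single (m - Poly_Mapping.single j 1) (of_nat (Poly_Mapping.lookup m j) * c)"
  by (cases "c = 0") (simp_all add: mderiv_def)

lemma mderiv_0 [simp]: "mderiv j 0 = 0" by (simp add: mderiv_def)

lemma mderiv_mult: "mderiv j (p * q) = mderiv j p * q + p * mderiv j q"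
proof (induction p rule: mpol_add_single_induct)
  case (add m c p)
  have "mderiv j (Poly_Mapping.single m c * q) =
    mderiv j (Poly_Mapping.single m c) * q + Poly_Mapping.single m c * mderiv j q"
  proof (induction q rule: mpol_add_single_induct)
    case (add m' c' q)
    \<comment> \<open>Subtraction of exponents is truncated, so the shift is valid only if
      \<open>T_j\<close> occurs in \<open>m\<close>. Otherwise the factor \<open>lookup m j\<close>
      of the coefficient is 0 and both terms vanish.\<close>
    have shift: "m - Poly_Mapping.single j 1 + m' = m + m' - Poly_Mapping.single j 1"
      if "Poly_Mapping.lookup m j \<noteq> 0" for m m' :: "nat \<Rightarrow>\<^sub>0 nat"
      using that by (intro poly_mapping_eqI) (auto simp: lookup_add lookup_minus lookup_single when_def)
    have *: "Poly_Mapping.single (m - Poly_Mapping.single j 1 + m') (of_nat (Poly_Mapping.lookup m j) * x)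
        = Poly_Mapping.single (m + m' - Poly_Mapping.single j 1) (of_nat (Poly_Mapping.lookup m j) * x)"
      for m m' :: "nat \<Rightarrow>\<^sub>0 nat" and x :: 'a
      using shift[of m m'] by (cases "Poly_Mapping.lookup m j = 0") auto
    have "mderiv j (Poly_Mapping.single m c * Poly_Mapping.single m' c') =
       mderiv j (Poly_Mapping.single m c) * Poly_Mapping.single m' c' +
       Poly_Mapping.single m c * mderiv j (Poly_Mapping.single m' c')"
      using *[of m m' "c * c'"] *[of m' m "c * c'"]
      by (simp add: mult_single mderiv_single lookup_add single_add[symmetric] algebra_simps)
    then show ?case using add by (simp add: mderiv_add algebra_simps)
  qed simp
  with add show ?case by (simp add: mderiv_add algebra_simps)
qed simp

lemma mderiv_mvar: "mderiv j (mvar i) = (if i = j then 1 else 0)"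
  by (auto simp: mvar_def mderiv_single lookup_single)

lemma mderiv_mconst [simp]: "mderiv j (mconst c) = 0"
  by (simp add: mconst_def mderiv_single)

lemma mderiv_pcarr [intro, simp]: "p \<in> pcarr n \<Longrightarrow> mderiv j p \<in> pcarr n"
  by (induction p rule: mpol_induct) (auto simp: mderiv_add mderiv_mult mderiv_mvar)

text \<open>Polynomial vector fields instead of partial derivatives: combinations such as
  \<open>mderiv 0 p - mvar 1 * mderiv 3 p\<close> are what makes the Jacobian matrices below
  diagonal.\<close>

definition derivation :: "nat \<Rightarrow> ('k::field_char_0 mpol \<Rightarrow> 'k mpol) \<Rightarrow> bool" where
  "derivation n D \<longleftrightarrow> (\<forall>p\<in>pcarr n. \<forall>q\<in>pcarr n.
     D (p + q) = D p + D q \<and> D (p * q) = D p * q + p * D q) \<and> D ` pcarr n \<subseteq> pcarr n"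

lemma derivation_mderiv: "derivation n (mderiv j)"
  by (auto simp: derivation_def mderiv_add mderiv_mult)

lemma derivation_add: "derivation n D \<Longrightarrow> derivation n E \<Longrightarrow> derivation n (\<lambda>p. D p + E p)"
  by (auto simp: derivation_def algebra_simps image_subset_iff)

lemma derivation_smult: "derivation n D \<Longrightarrow> a \<in> pcarr n \<Longrightarrow> derivation n (\<lambda>p. a * D p)"
  by (auto simp: derivation_def algebra_simps image_subset_iff)

lemma derivation_diff: "derivation n D \<Longrightarrow> derivation n E \<Longrightarrow> derivation n (\<lambda>p. D p - E p)"
  by (auto simp: derivation_def algebra_simps image_subset_iff)

lemma mderiv_uminus: "mderiv j (- p) = - mderiv j p"
  using mderiv_add[of j p "- p"] by (simp add: eq_neg_iff_add_eq_0 add.commute)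

lemma mderiv_diff: "mderiv j (p - q) = mderiv j p - mderiv j q"
  using mderiv_add[of j p "- q"] by (simp add: mderiv_uminus)

lemma mderiv_1 [simp]: "mderiv j 1 = 0"
  using mderiv_mconst[of j 1] by simp

lemmas mderiv_simps = mderiv_add mderiv_diff mderiv_uminus mderiv_mult mderiv_mvar

subsection \<open>Hilbert's basis theorem\<close>

text \<open>Rings are encoded as subsets of a type because the rings \<open>pcarr n\<close> for all
  \<open>n\<close> live in one type. Hilbert's theorem then becomes an induction over
  \<open>n\<close> that adjoins \<open>mvar n\<close> to such a subset.\<close>

definition subring_set :: "'a::comm_ring_1 set \<Rightarrow> bool" where
  "subring_set A \<longleftrightarrow> 0 \<in> A \<and> 1 \<in> A \<and> (\<forall>a\<in>A. \<forall>b\<in>A. a + b \<in> A \<and> a * b \<in> A \<and> - a \<in> A)"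

definition ideal_set :: "'a::comm_ring_1 set \<Rightarrow> 'a set \<Rightarrow> bool" where
  "ideal_set A I \<longleftrightarrow> I \<subseteq> A \<and> 0 \<in> I \<and> (\<forall>a\<in>I. \<forall>b\<in>I. a + b \<in> I) \<and> (\<forall>a\<in>A. \<forall>b\<in>I. a * b \<in> I)"

definition combs :: "'a::comm_ring_1 set \<Rightarrow> nat \<Rightarrow> (nat \<Rightarrow> 'a) \<Rightarrow> 'a set" where
  "combs A n g = {\<Sum>i<n. c i * g i | c. \<forall>i<n. c i \<in> A}"

definition noetherian_set :: "'a::comm_ring_1 set \<Rightarrow> bool" where
  "noetherian_set A \<longleftrightarrow> (\<forall>I. ideal_set A I \<longrightarrow> (\<exists>n g. (\<forall>i<n. g i \<in> I) \<and> I \<subseteq> combs A n g))"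

lemma ideal_set_sum: "ideal_set A I \<Longrightarrow> (\<And>i. i \<in> S \<Longrightarrow> f i \<in> I) \<Longrightarrow> sum f S \<in> I"
  by (induction S rule: infinite_finite_induct) (auto simp: ideal_set_def)

lemma subring_set_sum: "subring_set A \<Longrightarrow> (\<And>i. i \<in> S \<Longrightarrow> f i \<in> A) \<Longrightarrow> sum f S \<in> A"
  by (induction S rule: infinite_finite_induct) (auto simp: subring_set_def)

lemma combs_ideal:
  assumes "subring_set A" "\<forall>i<n. g i \<in> A" shows "ideal_set A (combs A n g)"
  unfolding ideal_set_def
proof (intro conjI ballI)
  show "combs A n g \<subseteq> A"
    using assms subring_set_sum[OF assms(1), of "{..<n}"] by (auto simp: combs_def subring_set_def)
  show "0 \<in> combs A n g"
    using assms by (auto simp: combs_def subring_set_def intro!: exI[of _ "\<lambda>_. 0"])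
  fix a b assume "a \<in> combs A n g" "b \<in> combs A n g"
  then obtain c d where "a = (\<Sum>i<n. c i * g i)" "b = (\<Sum>i<n. d i * g i)" "\<forall>i<n. c i \<in> A" "\<forall>i<n. d i \<in> A"
    by (auto simp: combs_def)
  then show "a + b \<in> combs A n g" using assms(1)
    by (auto simp: combs_def subring_set_def sum.distrib distrib_right intro!: exI[of _ "\<lambda>i. c i + d i"])
next
  fix a b assume "a \<in> A" "b \<in> combs A n g"
  then obtain d where "b = (\<Sum>i<n. d i * g i)" "\<forall>i<n. d i \<in> A" by (auto simp: combs_def)
  then show "a * b \<in> combs A n g" using assms(1) \<open>a \<in> A\<close>
    by (auto simp: combs_def subring_set_def sum_distrib_left mult.assoc intro!: exI[of _ "\<lambda>i. a * d i"])
qed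

lemma combs_mono:
  assumes "subring_set A" "m \<le> n" shows "combs A m g \<subseteq> combs A n g"
proof
  fix a assume "a \<in> combs A m g"
  then obtain c where c: "a = (\<Sum>i<m. c i * g i)" "\<forall>i<m. c i \<in> A" by (auto simp: combs_def)
  have "a = (\<Sum>i<n. (if i < m then c i else 0) * g i)"
    unfolding c(1) using assms(2) by (intro sum.mono_neutral_cong_left) auto
  then show "a \<in> combs A n g" using assms(1) c(2)
    by (auto simp: combs_def subring_set_def intro!: exI[of _ "\<lambda>i. if i < m then c i else 0"])
qed

lemma combs_gen: assumes "subring_set A" "i < n" shows "g i \<in> combs A n g"
  unfolding combs_def
proof (intro CollectI exI conjI)
  show "g i = (\<Sum>j<n. (if j = i then 1 else 0) * g j)"
    using assms(2) by (simp add: if_distrib[of "\<lambda>x. x * _"] cong: if_cong)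
qed (use assms(1) in \<open>auto simp: subring_set_def\<close>)

text \<open>The elements of \<open>A[X]\<close> are the polynomials with coefficients in \<open>A\<close>. A sequence of elements
  of least degree outside the ideal of their predecessors cannot go on, because the leading
  coefficients generate a finitely generated ideal of \<open>A\<close>.\<close>

lemma hilbert_basis_poly:
  assumes A: "subring_set A" "noetherian_set A"
  shows "noetherian_set {p :: 'a::comm_ring_1 poly. \<forall>i. coeff p i \<in> A}" (is "noetherian_set ?B")
  unfolding noetherian_set_def
proof (intro allI impI, rule ccontr)
  fix I assume I: "ideal_set ?B I"
    and neg: "\<not> (\<exists>n g. (\<forall>i<n. g i \<in> I) \<and> I \<subseteq> combs ?B n g)"
  have B: "subring_set ?B"
    using A(1) by (auto simp: subring_set_def coeff_mult intro!: subring_set_sum)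
  let ?Q = "\<lambda>k f p. p \<in> I - combs ?B k f \<and> (\<forall>q \<in> I - combs ?B k f. degree p \<le> degree q)"
  have "\<exists>f. \<forall>k::nat. f k \<in> I \<and> ?Q k f (f k)"
  proof -
    \<comment> \<open>Membership of the predecessors in \<open>I\<close> is a premise of each
      choice, since only then does \<open>neg\<close> provide an element of \<open>I\<close> outside
      their ideal. The premise is discharged afterwards by induction.\<close>
    have "\<exists>f. \<forall>k::nat. (\<forall>i<k. f i \<in> I) \<longrightarrow> f k \<in> I \<and> ?Q k f (f k)"
    proof (rule dependent_wf_choice[of "{(x, y). x < y}" "\<lambda>f k p. (\<forall>i<k. f i \<in> I) \<longrightarrow> p \<in> I \<and> ?Q k f p"])
      show "wf {(x, y). x < (y::nat)}" by (rule wf)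
      fix f g :: "nat \<Rightarrow> 'a poly" and x r
      assume fg: "\<And>z. (z, x) \<in> {(x, y). x < y} \<Longrightarrow> f z = g z"
      then have "combs ?B x f = combs ?B x g" by (auto simp: combs_def)
      then show "((\<forall>i<x. f i \<in> I) \<longrightarrow> r \<in> I \<and> ?Q x f r) \<longleftrightarrow> ((\<forall>i<x. g i \<in> I) \<longrightarrow> r \<in> I \<and> ?Q x g r)"
        using fg by auto
    next
      fix k f
      show "\<exists>p. (\<forall>i<k. f i \<in> I) \<longrightarrow> p \<in> I \<and> ?Q k f p"
      proof (cases "\<forall>i<k. f i \<in> I")
        case True
        then obtain q where "q \<in> I - combs ?B k f" using neg by blast
        then obtain p where "p \<in> I - combs ?B k f" "\<forall>q \<in> I - combs ?B k f. degree p \<le> degree q"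
          using ex_has_least_nat[of "\<lambda>p. p \<in> I - combs ?B k f" q degree] by blast
        then show ?thesis by blast
      qed auto
    qed
    then obtain f where f: "\<And>k::nat. (\<forall>i<k. f i \<in> I) \<longrightarrow> f k \<in> I \<and> ?Q k f (f k)" by blast
    have "f k \<in> I" for k by (induction k rule: less_induct) (use f in blast)
    then show ?thesis using f by blast
  qed
  then obtain f where fI: "\<And>k. f k \<in> I" and fQ: "\<And>k. ?Q k f (f k)" by blast
  have fB: "f k \<in> ?B" for k using fI I by (auto simp: ideal_set_def)
  define l where "l k = lead_coeff (f k)" for k
  have l: "l k \<in> A" for k using fB[of k] by (simp add: l_def)
  have "ideal_set A (\<Union>n. combs A n l)"
    unfolding ideal_set_def
  proof (intro conjI ballI)
    fix a b assume "a \<in> (\<Union>n. combs A n l)" "b \<in> (\<Union>n. combs A n l)"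
    then obtain n m where "a \<in> combs A n l" "b \<in> combs A m l" by auto
    then have "a \<in> combs A (max n m) l" "b \<in> combs A (max n m) l"
      using combs_mono[OF A(1)] by (meson max.cobounded1 max.cobounded2 subsetD)+
    then have "a + b \<in> combs A (max n m) l"
      using combs_ideal[OF A(1)] l by (auto simp: ideal_set_def)
    then show "a + b \<in> (\<Union>n. combs A n l)" by blast
  next
    have id: "ideal_set A (combs A n l)" for n by (rule combs_ideal[OF A(1)]) (use l in blast)
    show "(\<Union>n. combs A n l) \<subseteq> A" using id unfolding ideal_set_def by blast
    show "0 \<in> (\<Union>n. combs A n l)" using id[of 0] unfolding ideal_set_def by blast
    fix a b assume "a \<in> A" "b \<in> (\<Union>n. combs A n l)"
    then show "a * b \<in> (\<Union>n. combs A n l)" using id unfolding ideal_set_def by blast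
  qed
  then obtain n g where g: "\<forall>i<n. g i \<in> (\<Union>n. combs A n l)" "(\<Union>n. combs A n l) \<subseteq> combs A n g"
    using A(2) unfolding noetherian_set_def by blast
  have "\<exists>N. \<forall>i<n'. g i \<in> combs A N l" if "n' \<le> n" for n'
    using that
  proof (induction n')
    case (Suc n')
    then obtain N where N: "\<forall>i<n'. g i \<in> combs A N l" by auto
    have "g n' \<in> (\<Union>n. combs A n l)" using g(1) Suc(2) by simp
    then obtain M where "g n' \<in> combs A M l" by blast
    then have "\<forall>i<Suc n'. g i \<in> combs A (max N M) l"
      using N combs_mono[OF A(1), of N "max N M" l] combs_mono[OF A(1), of M "max N M" l]
      by (auto simp: less_Suc_eq)
    then show ?case by blast
  qed auto
  then obtain N where N: "\<forall>i<n. g i \<in> combs A N l" by blast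
  have "combs A n g \<subseteq> combs A N l"
  proof
    fix a assume "a \<in> combs A n g"
    then obtain c where "a = (\<Sum>i<n. c i * g i)" "\<forall>i<n. c i \<in> A" by (auto simp: combs_def)
    then show "a \<in> combs A N l" unfolding \<open>a = _\<close>
      using N l combs_ideal[OF A(1), of N l]
      by (intro ideal_set_sum[of A]) (auto simp: ideal_set_def)
  qed
  moreover have "l N \<in> combs A (Suc N) l" using combs_gen[OF A(1)] by blast
  ultimately have "l N \<in> combs A N l" using g(2) by blast
  then obtain c where c: "l N = (\<Sum>i<N. c i * l i)" "\<forall>i<N. c i \<in> A" by (auto simp: combs_def)
  have deg: "degree (f i) \<le> degree (f N)" if "i \<le> N" for i
    using fQ[of i] fQ[of N] fI[of N] combs_mono[OF B that, of f] by blast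
  \<comment> \<open>The predecessors are shifted to the degree of \<open>f N\<close> and combined in
    the way \<open>l N\<close> is combined from their leading coefficients. Hence
    \<open>f N - r\<close> loses its leading term without entering the ideal of the
    predecessors.\<close>
  define r where "r = (\<Sum>i<N. monom (c i) (degree (f N) - degree (f i)) * f i)"
  have "r \<in> combs ?B N f"
    unfolding r_def combs_def using c(2) A(1)
    by (auto simp: subring_set_def intro!: exI[of _ "\<lambda>i. monom (c i) (degree (f N) - degree (f i))"])
  then have rI: "r \<in> I" and "f N - r \<notin> combs ?B N f"
  proof -
    have id: "ideal_set ?B (combs ?B N f)" by (rule combs_ideal[OF B]) (use fB in blast)
    show "f N - r \<notin> combs ?B N f" if "r \<in> combs ?B N f"
    proof
      assume "f N - r \<in> combs ?B N f"
      with that id have "(f N - r) + r \<in> combs ?B N f" unfolding ideal_set_def by blast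
      then show False using fQ[of N] by simp
    qed
    show "r \<in> I" unfolding r_def
      by (rule ideal_set_sum[OF I]) (use I fI c(2) A(1) in \<open>auto simp: ideal_set_def subring_set_def\<close>)
  qed
  moreover have "f N - r \<in> I"
  proof -
    have "(- 1) * r \<in> I" using I rI B unfolding ideal_set_def subring_set_def by blast
    then have "f N + (- 1) * r \<in> I" using I fI[of N] unfolding ideal_set_def by blast
    then show ?thesis by simp
  qed
  ultimately have le: "degree (f N) \<le> degree (f N - r)" and ne: "f N - r \<noteq> 0"
    using fQ[of N] combs_ideal[OF B, of N f] fB by (auto simp: ideal_set_def)
  have "degree r \<le> degree (f N)"
    unfolding r_def
  proof (rule degree_sum_le)
    fix i assume "i \<in> {..<N}"
    then have "degree (monom (c i) (degree (f N) - degree (f i)) * f i) \<le> degree (f N) - degree (f i) + degree (f i)"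
      by (intro degree_mult_le[THEN order_trans] add_mono degree_monom_le) auto
    then show "degree (monom (c i) (degree (f N) - degree (f i)) * f i) \<le> degree (f N)"
      using deg[of i] \<open>i \<in> {..<N}\<close> by simp
  qed auto
  then have "degree (f N - r) \<le> degree (f N)" by (rule degree_diff_le[OF order_refl])
  moreover have "coeff (f N - r) (degree (f N)) = 0"
  proof -
    have "coeff (monom (c i) (degree (f N) - degree (f i)) * f i) (degree (f N)) = c i * l i" if "i < N" for i
      using deg[of i] that by (simp add: coeff_monom_mult l_def)
    then show ?thesis by (simp add: r_def coeff_sum c(1)[unfolded l_def[of N]])
  qed
  \<comment> \<open>By minimality the degree of \<open>f N - r\<close> has not dropped, so the
    coefficient just seen to vanish is the leading coefficient of a nonzero polynomial.\<close>
  ultimately show False using le ne by (metis le_antisym leading_coeff_0_iff)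
qed

text \<open>Ideals are pulled back along the evaluation of \<open>A[X]\<close> at \<open>t\<close>.
  Stated for the image of an arbitrary evaluation, it applies to \<open>t = mvar n\<close> without
  identifying \<open>pcarr (Suc n)\<close> with a ring of univariate polynomials.\<close>

lemma hilbert_basis_adjoin:
  assumes A: "subring_set A" "noetherian_set A"
  shows "noetherian_set {poly p t | p. \<forall>i. coeff p i \<in> A}" (is "noetherian_set ?C")
  unfolding noetherian_set_def
proof (intro allI impI)
  let ?B = "{p. \<forall>i. coeff p i \<in> A}"
  have B: "subring_set ?B"
    using A(1) by (auto simp: subring_set_def coeff_mult intro!: subring_set_sum)
  fix I assume I: "ideal_set ?C I"
  have "ideal_set ?B {p \<in> ?B. poly p t \<in> I}"
    unfolding ideal_set_def
  proof (intro conjI ballI)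
    show "0 \<in> {p \<in> ?B. poly p t \<in> I}" using B I unfolding ideal_set_def subring_set_def by simp
    fix p q assume "p \<in> {p \<in> ?B. poly p t \<in> I}" "q \<in> {p \<in> ?B. poly p t \<in> I}"
    then show "p + q \<in> {p \<in> ?B. poly p t \<in> I}"
      using B I unfolding ideal_set_def subring_set_def by simp
  next
    fix p q assume p: "p \<in> ?B" and q: "q \<in> {p \<in> ?B. poly p t \<in> I}"
    have "p * q \<in> ?B" using B p q unfolding subring_set_def by blast
    moreover have "poly p t * poly q t \<in> I" using I p q unfolding ideal_set_def by blast
    ultimately show "p * q \<in> {p \<in> ?B. poly p t \<in> I}" by simp
  qed blast
  then obtain n g where g: "\<forall>i<n. g i \<in> ?B \<and> poly (g i) t \<in> I" "{p \<in> ?B. poly p t \<in> I} \<subseteq> combs ?B n g"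
    using hilbert_basis_poly[OF A] unfolding noetherian_set_def by blast
  have "I \<subseteq> combs ?C n (\<lambda>i. poly (g i) t)"
  proof
    fix a assume a: "a \<in> I"
    then obtain p where p: "p \<in> ?B" "a = poly p t" using I by (auto simp: ideal_set_def)
    then have "p \<in> combs ?B n g" using g(2) a by blast
    then obtain c where "p = (\<Sum>i<n. c i * g i)" "\<forall>i<n. c i \<in> ?B" by (auto simp: combs_def)
    then show "a \<in> combs ?C n (\<lambda>i. poly (g i) t)"
      using p by (auto simp: combs_def poly_sum intro!: exI[of _ "\<lambda>i. poly (c i) t"])
  qed
  then show "\<exists>n g. (\<forall>i<n. g i \<in> I) \<and> I \<subseteq> combs ?C n g"
    using g(1) by (intro exI[of _ n] exI[of _ "\<lambda>i. poly (g i) t"]) simp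
qed

lemma subring_set_pcarr: "subring_set (pcarr n)"
  by (auto simp: subring_set_def)

text \<open>Its purpose is \<open>max_ideal_generators\<close>: finitely many generators of the
  maximal ideal are what allows independent elements to be completed to regular coordinates.\<close>

lemma noetherian_pcarr: "noetherian_set (pcarr n :: 'k::field_char_0 mpol set)"
proof (induction n)
  case 0
  have const: "\<exists>c. p = mconst c" if "p \<in> pcarr 0" for p :: "'k mpol"
    using that
  proof (induction p rule: mpol_induct)
    case (add f g)
    then obtain a b where "f = mconst a" "g = mconst b" by auto
    then show ?case by (intro exI[of _ "a + b"]) simp
  next
    case (mult f g)
    then obtain a b where "f = mconst a" "g = mconst b" by auto
    then show ?case by (intro exI[of _ "a * b"]) simp
  qed auto
  show ?case unfolding noetherian_set_def
  proof (intro allI impI)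
    fix I :: "'k mpol set" assume I: "ideal_set (pcarr 0) I"
    show "\<exists>n g. (\<forall>i<n. g i \<in> I) \<and> I \<subseteq> combs (pcarr 0) n g"
    proof (cases "I \<subseteq> {0}")
      case True
      then show ?thesis by (intro exI[of _ 0]) (auto simp: combs_def)
    next
      case False
      then obtain a where "a \<in> I" "a \<noteq> 0" by blast
      moreover have "a \<in> pcarr 0" using I \<open>a \<in> I\<close> unfolding ideal_set_def by blast
      ultimately obtain c where c: "a = mconst c" "c \<noteq> 0" using const[of a] by auto
      have "mconst (inverse c) * a \<in> I" using I \<open>a \<in> I\<close> by (auto simp: ideal_set_def)
      moreover have "mconst (inverse c) * a = 1" using c by (metis left_inverse mconst_simps(2,4))
      ultimately have "1 \<in> I" by simp
      then show ?thesis
      proof (intro exI[of _ 1] exI[of _ "\<lambda>_. 1"] conjI subsetI)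
        fix x assume "x \<in> I"
        then have "x \<in> pcarr 0" using I unfolding ideal_set_def by blast
        then show "x \<in> combs (pcarr 0) 1 (\<lambda>_. 1)" unfolding combs_def
          by (intro CollectI exI[of _ "\<lambda>_. x"]) simp
      qed auto
    qed
  qed
next
  case (Suc n)
  have "pcarr (Suc n) = {poly p (mvar n) | p. \<forall>i. coeff p i \<in> (pcarr n :: 'k mpol set)}"
  proof (intro equalityI subsetI)
    fix f :: "'k mpol" assume "f \<in> pcarr (Suc n)"
    then show "f \<in> {poly p (mvar n) | p. \<forall>i. coeff p i \<in> (pcarr n :: 'k mpol set)}"
    proof (induction f rule: mpol_induct)
      case (const c)
      then show ?case by (auto simp: coeff_pCons split: nat.split intro!: exI[of _ "[:mconst c:]"])
    next
      case (var i)
      then show ?case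
      proof (cases "i = n")
        case True
        then show ?thesis by (auto simp: coeff_pCons split: nat.split intro!: exI[of _ "[:0, 1:]"])
      next
        case False
        then show ?thesis using var
          by (auto simp: coeff_pCons less_Suc_eq split: nat.split intro!: exI[of _ "[:mvar i:]"])
      qed
    next
      case (add f g)
      then obtain p q where "f = poly p (mvar n)" "g = poly q (mvar n)"
        "\<forall>i. coeff p i \<in> pcarr n" "\<forall>i. coeff q i \<in> pcarr n" by auto
      then show ?case by (auto intro!: exI[of _ "p + q"])
    next
      case (mult f g)
      then obtain p q where "f = poly p (mvar n)" "g = poly q (mvar n)"
        "\<forall>i. coeff p i \<in> pcarr n" "\<forall>i. coeff q i \<in> pcarr n" by auto
      then show ?case by (auto simp: coeff_mult intro!: exI[of _ "p * q"] pcarr_sum)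
    qed
  next
    have mono: "p \<in> pcarr (Suc n)" if "p \<in> pcarr n" for p :: "'k mpol"
      using that by (fastforce simp: pcarr_iff)
    fix f :: "'k mpol" assume "f \<in> {poly p (mvar n) | p. \<forall>i. coeff p i \<in> pcarr n}"
    then show "f \<in> pcarr (Suc n)"
      by (auto simp: poly_altdef intro!: pcarr_sum pcarr_mult pcarr_power pcarr_mvar intro: mono)
  qed
  then show ?case using hilbert_basis_adjoin[OF subring_set_pcarr Suc] by simp
qed

section \<open>Localization\<close>

lemma (in cring) idealI_closed:
  assumes I: "I \<subseteq> carrier R" "\<zero> \<in> I" "\<And>a b. a \<in> I \<Longrightarrow> b \<in> I \<Longrightarrow> a \<oplus> b \<in> I"
    "\<And>a x. a \<in> I \<Longrightarrow> x \<in> carrier R \<Longrightarrow> x \<otimes> a \<in> I"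
  shows "ideal I R"
proof (rule idealI)
  show "ring R" by (rule ring_axioms)
  show "subgroup I (add_monoid R)"
  proof (rule subgroup.intro)
    fix a assume a: "a \<in> I"
    then have "\<ominus> \<one> \<otimes> a \<in> I" by (rule I(4)) simp
    moreover have "\<ominus> \<one> \<otimes> a = \<ominus> a" using a I(1) by (simp add: l_minus subset_iff)
    ultimately show "inv\<^bsub>add_monoid R\<^esub> a \<in> I" by (simp add: a_inv_def)
  qed (simp_all add: I)
  fix a x assume a: "a \<in> I" "x \<in> carrier R"
  then show "x \<otimes> a \<in> I" by (rule I(4))
  then show "a \<otimes> x \<in> I" using a I(1) by (simp add: m_comm subset_iff)
qed

lemma (in cring) mult_fracs:
  assumes "a \<in> carrier R" "b \<in> carrier R" "u \<in> carrier R" "v \<in> carrier R"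
  shows "(a \<otimes> b) \<otimes> (u \<otimes> v) = (a \<otimes> u) \<otimes> (b \<otimes> v)"
  using assms by (simp add: m_ac)

lemma (in cring) add_fracs:
  assumes "a \<in> carrier R" "b \<in> carrier R" "u \<in> carrier R" "v \<in> carrier R"
  shows "(a \<oplus> b) \<otimes> (u \<otimes> v) = (a \<otimes> u) \<otimes> v \<oplus> (b \<otimes> v) \<otimes> u"
  using assms by (simp add: l_distr[of a b "u \<otimes> v"]) (simp add: m_ac)

lemma (in ideal) add_mem: "a \<in> I \<Longrightarrow> b \<in> I \<Longrightarrow> a \<oplus> b \<in> I"
  using additive_subgroup.a_closed[OF additive_subgroup_axioms] by blast

lemma (in ideal) minus_mem: "a \<in> I \<Longrightarrow> b \<in> I \<Longrightarrow> a \<ominus> b \<in> I"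
  unfolding a_minus_def using additive_subgroup.a_inv_closed[OF additive_subgroup_axioms] add_mem by blast

lemma (in cring) primeideal_vimage:
  assumes "cring S" "h \<in> ring_hom R S" "primeideal Q S"
  shows "primeideal {a \<in> carrier R. h a \<in> Q} R"
proof -
  interpret Q: primeideal Q S by fact
  interpret h: ring_hom_cring R S h
    using assms is_cring by (simp add: ring_hom_cring_def ring_hom_cring_axioms_def)
  show ?thesis
  proof (rule primeidealI[OF idealI_closed is_cring])
    show "carrier R \<noteq> {a \<in> carrier R. h a \<in> Q}"
    proof
      assume "carrier R = {a \<in> carrier R. h a \<in> Q}"
      then have "\<one> \<in> {a \<in> carrier R. h a \<in> Q}" using one_closed by simp
      then show False using Q.I_notcarr Q.one_imp_carrier by simp
    qed
    fix a b assume "a \<in> carrier R" "b \<in> carrier R" "a \<otimes> b \<in> {a \<in> carrier R. h a \<in> Q}"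
    then show "a \<in> {a \<in> carrier R. h a \<in> Q} \<or> b \<in> {a \<in> carrier R. h a \<in> Q}"
      using Q.I_prime[of "h a" "h b"] by auto
  qed (auto simp: Q.add_mem Q.I_l_closed)
qed

text \<open>An element of the last factor outside the prime multiplies the intersection of the other
  factors into the full intersection, hence into the prime. This finds the components through a
  point.\<close>

lemma (in primeideal) prime_contains_factor:
  assumes "\<And>i. i < (k::nat) \<Longrightarrow> ideal (P i) R" "{a \<in> carrier R. \<forall>i<k. a \<in> P i} \<subseteq> I"
  shows "\<exists>i<k. P i \<subseteq> I"
  using assms
proof (induction k)
  case 0
  then show ?case using I_notcarr a_subset by auto
next
  case (Suc k)
  show ?case
  proof (cases "P k \<subseteq> I")
    case False
    then obtain b where b: "b \<in> P k" "b \<notin> I" by blast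
    have bc: "b \<in> carrier R" using b Suc.prems(1)[of k] by (simp add: ideal.Icarr)
    have "{a \<in> carrier R. \<forall>i<k. a \<in> P i} \<subseteq> I"
    proof
      fix a assume a: "a \<in> {a \<in> carrier R. \<forall>i<k. a \<in> P i}"
      have "a \<otimes> b \<in> P i" if "i < Suc k" for i
      proof (cases "i = k")
        case True
        then show ?thesis using ideal.I_l_closed[OF Suc.prems(1)[of k] b(1)] a by simp
      next
        case False
        then show ?thesis using that ideal.I_r_closed[OF Suc.prems(1)[of i] _ bc] a by auto
      qed
      then have "a \<otimes> b \<in> I" using Suc.prems(2) a bc by auto
      then show "a \<in> I" using I_prime[OF _ bc] a b by blast
    qed
    with Suc obtain i where "i < k" "P i \<subseteq> I" by auto
    then show ?thesis by (auto intro: exI[of _ i])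
  qed auto
qed

section \<open>Rings of fractions\<close>

locale mult_subset = cring R for R :: "'a ring" (structure) +
  fixes S :: "'a set"
  assumes S_sub: "S \<subseteq> carrier R" and S_one: "\<one> \<in> S"
    and S_mult: "s \<in> S \<Longrightarrow> t \<in> S \<Longrightarrow> s \<otimes> t \<in> S"
begin

lemma S_carr: "s \<in> S \<Longrightarrow> s \<in> carrier R" using S_sub by blast

lemma mem_fraction: "(b, t) \<in> fraction R S a s \<longleftrightarrow>
    b \<in> carrier R \<and> t \<in> S \<and> (\<exists>u\<in>S. u \<otimes> (a \<otimes> t) = u \<otimes> (b \<otimes> s))"
  by (simp add: fraction_def)

lemma fraction_trans:
  assumes "a \<in> carrier R" "b \<in> carrier R" "c \<in> carrier R" "s \<in> S" "t \<in> S" "q \<in> S"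
    and "\<exists>u\<in>S. u \<otimes> (a \<otimes> t) = u \<otimes> (b \<otimes> s)" "\<exists>u\<in>S. u \<otimes> (b \<otimes> q) = u \<otimes> (c \<otimes> t)"
  shows "\<exists>u\<in>S. u \<otimes> (a \<otimes> q) = u \<otimes> (c \<otimes> s)"
proof -
  obtain u v where uv: "u \<in> S" "v \<in> S" "u \<otimes> (a \<otimes> t) = u \<otimes> (b \<otimes> s)" "v \<otimes> (b \<otimes> q) = v \<otimes> (c \<otimes> t)"
    using assms by blast
  note c = assms(1-3) assms(4-6)[THEN S_carr] uv(1,2)[THEN S_carr]
  \<comment> \<open>The middle denominator \<open>t\<close> becomes part of the witness. This chains
    the two relations without cancelling \<open>t\<close>, which may be a zero-divisor.\<close>
  have "(u \<otimes> v \<otimes> t) \<otimes> (a \<otimes> q) = (v \<otimes> q) \<otimes> (u \<otimes> (a \<otimes> t))" using c by (simp add: m_ac)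
  also have "\<dots> = (u \<otimes> s) \<otimes> (v \<otimes> (b \<otimes> q))" unfolding uv(3) using c by (simp add: m_ac)
  also have "\<dots> = (u \<otimes> v \<otimes> t) \<otimes> (c \<otimes> s)" unfolding uv(4) using c by (simp add: m_ac)
  finally show ?thesis using uv assms S_mult by blast
qed

lemma fraction_eq_iff:
  assumes "a \<in> carrier R" "b \<in> carrier R" "s \<in> S" "t \<in> S"
  shows "fraction R S a s = fraction R S b t \<longleftrightarrow> (\<exists>u\<in>S. u \<otimes> (a \<otimes> t) = u \<otimes> (b \<otimes> s))"
proof
  assume "fraction R S a s = fraction R S b t"
  moreover have "(b, t) \<in> fraction R S b t" using assms S_one by (auto simp: mem_fraction)
  ultimately have "(b, t) \<in> fraction R S a s" by simp
  then show "\<exists>u\<in>S. u \<otimes> (a \<otimes> t) = u \<otimes> (b \<otimes> s)" by (auto simp: mem_fraction)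
next
  assume ex: "\<exists>u\<in>S. u \<otimes> (a \<otimes> t) = u \<otimes> (b \<otimes> s)"
  then have ex': "\<exists>u\<in>S. u \<otimes> (b \<otimes> s) = u \<otimes> (a \<otimes> t)" by metis
  have sym: "\<exists>u\<in>S. u \<otimes> (c \<otimes> q) = u \<otimes> (d \<otimes> r) \<Longrightarrow> \<exists>u\<in>S. u \<otimes> (d \<otimes> r) = u \<otimes> (c \<otimes> q)" for c d q r
    by metis
  show "fraction R S a s = fraction R S b t"
    using fraction_trans[of b a _ t s, OF assms(2,1) _ assms(4,3) _ ex']
      fraction_trans[of a b _ s t, OF assms(1,2) _ assms(3,4) _ ex]
    by (auto simp: mem_fraction)
qed

lemma fraction_eqI:
  assumes "a \<in> carrier R" "b \<in> carrier R" "s \<in> S" "t \<in> S" "a \<otimes> t = b \<otimes> s"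
  shows "fraction R S a s = fraction R S b t"
  unfolding fraction_eq_iff[OF assms(1-4)] using assms(5) S_one by (intro bexI[of _ \<one>]) simp_all

lemma fraction_self: "a \<in> carrier R \<Longrightarrow> s \<in> S \<Longrightarrow> (a, s) \<in> fraction R S a s"
  using S_one by (auto simp: mem_fraction)

lemma localization_carrier:
  "x \<in> carrier (localization R S) \<longleftrightarrow> (\<exists>a\<in>carrier R. \<exists>s\<in>S. x = fraction R S a s)"
  by (auto simp: localization_def)

lemma fraction_carrier: "a \<in> carrier R \<Longrightarrow> s \<in> S \<Longrightarrow> fraction R S a s \<in> carrier (localization R S)"
  by (auto simp: localization_carrier)

text \<open>The operations of \<open>localization\<close> are unions over all representatives of two
  classes. Once the result is independent of the representatives, such a union is a union of equal
  sets, that is, a single class.\<close>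

lemma UN2_const:
  assumes "\<And>a s b t. (a, s) \<in> A \<Longrightarrow> (b, t) \<in> B \<Longrightarrow> f a s b t = c" "(p, q) \<in> A" "(p', q') \<in> B"
  shows "(\<Union>(a, s)\<in>A. \<Union>(b, t)\<in>B. f a s b t) = c"
proof -
  have "(\<Union>(b, t)\<in>B. f a s b t) = c" if "(a, s) \<in> A" for a s
  proof -
    have "(\<Union>(b, t)\<in>B. f a s b t) = (\<Union>x\<in>B. c)"
      by (rule SUP_cong) (use assms(1) that in auto)
    also have "\<dots> = c" using assms(3) by auto
    finally show ?thesis .
  qed
  then have "(\<Union>(a, s)\<in>A. \<Union>(b, t)\<in>B. f a s b t) = (\<Union>x\<in>A. c)"
    by (intro SUP_cong refl) (simp add: case_prod_beta)
  also have "\<dots> = c" using assms(2) by auto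
  finally show ?thesis .
qed

lemma localization_mult:
  assumes "a \<in> carrier R" "b \<in> carrier R" "s \<in> S" "t \<in> S"
  shows "fraction R S a s \<otimes>\<^bsub>localization R S\<^esub> fraction R S b t = fraction R S (a \<otimes> b) (s \<otimes> t)"
proof -
  have "fraction R S (a' \<otimes> b') (s' \<otimes> t') = fraction R S (a \<otimes> b) (s \<otimes> t)"
    if m: "(a', s') \<in> fraction R S a s" "(b', t') \<in> fraction R S b t" for a' s' b' t'
  proof -
    obtain u v where uv: "u \<in> S" "v \<in> S" "u \<otimes> (a \<otimes> s') = u \<otimes> (a' \<otimes> s)" "v \<otimes> (b \<otimes> t') = v \<otimes> (b' \<otimes> t)"
      using m by (auto simp: mem_fraction)
    have m': "a' \<in> carrier R" "b' \<in> carrier R" "s' \<in> S" "t' \<in> S" using m by (auto simp: mem_fraction)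
    note c = assms(1,2) assms(3,4)[THEN S_carr] m'(1,2) m'(3,4)[THEN S_carr] uv(1,2)[THEN S_carr]
    have "(u \<otimes> v) \<otimes> ((a' \<otimes> b') \<otimes> (s \<otimes> t)) = (u \<otimes> (a' \<otimes> s)) \<otimes> (v \<otimes> (b' \<otimes> t))"
      using c by (simp add: m_ac)
    also have "\<dots> = (u \<otimes> v) \<otimes> ((a \<otimes> b) \<otimes> (s' \<otimes> t'))"
      unfolding uv(3,4)[symmetric] using c by (simp add: m_ac)
    finally have "\<exists>w\<in>S. w \<otimes> ((a' \<otimes> b') \<otimes> (s \<otimes> t)) = w \<otimes> ((a \<otimes> b) \<otimes> (s' \<otimes> t'))"
      using S_mult[OF uv(1,2)] by (intro bexI)
    then show ?thesis
      using c S_mult[OF assms(3,4)] S_mult[OF m'(3,4)] by (subst fraction_eq_iff) simp_all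
  qed
  from UN2_const[OF this fraction_self[OF assms(1,3)] fraction_self[OF assms(2,4)]]
  show ?thesis by (simp add: localization_def)
qed

lemma localization_add:
  assumes "a \<in> carrier R" "b \<in> carrier R" "s \<in> S" "t \<in> S"
  shows "fraction R S a s \<oplus>\<^bsub>localization R S\<^esub> fraction R S b t = fraction R S (a \<otimes> t \<oplus> b \<otimes> s) (s \<otimes> t)"
proof -
  have "fraction R S (a' \<otimes> t' \<oplus> b' \<otimes> s') (s' \<otimes> t') = fraction R S (a \<otimes> t \<oplus> b \<otimes> s) (s \<otimes> t)"
    if m: "(a', s') \<in> fraction R S a s" "(b', t') \<in> fraction R S b t" for a' s' b' t'
  proof -
    obtain u v where uv: "u \<in> S" "v \<in> S" "u \<otimes> (a \<otimes> s') = u \<otimes> (a' \<otimes> s)" "v \<otimes> (b \<otimes> t') = v \<otimes> (b' \<otimes> t)"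
      using m by (auto simp: mem_fraction)
    have m': "a' \<in> carrier R" "b' \<in> carrier R" "s' \<in> S" "t' \<in> S" using m by (auto simp: mem_fraction)
    note c = assms(1,2) assms(3,4)[THEN S_carr] m'(1,2) m'(3,4)[THEN S_carr] uv(1,2)[THEN S_carr]
    have "(u \<otimes> v) \<otimes> ((a' \<otimes> t' \<oplus> b' \<otimes> s') \<otimes> (s \<otimes> t)) =
        (v \<otimes> t \<otimes> t') \<otimes> (u \<otimes> (a' \<otimes> s)) \<oplus> (u \<otimes> s \<otimes> s') \<otimes> (v \<otimes> (b' \<otimes> t))"
      using c by (simp add: m_ac l_distr r_distr)
    also have "\<dots> = (u \<otimes> v) \<otimes> ((a \<otimes> t \<oplus> b \<otimes> s) \<otimes> (s' \<otimes> t'))"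
      unfolding uv(3,4)[symmetric] using c by (simp add: m_ac l_distr r_distr)
    finally have "\<exists>w\<in>S. w \<otimes> ((a' \<otimes> t' \<oplus> b' \<otimes> s') \<otimes> (s \<otimes> t)) = w \<otimes> ((a \<otimes> t \<oplus> b \<otimes> s) \<otimes> (s' \<otimes> t'))"
      using S_mult[OF uv(1,2)] by (intro bexI)
    then show ?thesis
      using c S_mult[OF assms(3,4)] S_mult[OF m'(3,4)] by (subst fraction_eq_iff) simp_all
  qed
  from UN2_const[OF this fraction_self[OF assms(1,3)] fraction_self[OF assms(2,4)]]
  show ?thesis by (simp add: localization_def)
qed

lemma localization_zero: "\<zero>\<^bsub>localization R S\<^esub> = fraction R S \<zero> \<one>"
  and localization_one: "\<one>\<^bsub>localization R S\<^esub> = fraction R S \<one> \<one>"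
  by (simp_all add: localization_def)

lemma localization_obtain:
  assumes "x \<in> carrier (localization R S)"
  obtains a s where "x = fraction R S a s" "a \<in> carrier R" "s \<in> S" "s \<in> carrier R"
  using assms S_carr unfolding localization_carrier by blast

lemma cring_localization: "cring (localization R S)"
proof (rule cringI)
  note [simp] = localization_mult localization_add localization_zero localization_one S_mult S_one
    fraction_carrier
  show "abelian_group (localization R S)"
  proof (rule abelian_groupI)
    fix x y assume "x \<in> carrier (localization R S)" "y \<in> carrier (localization R S)"
    then obtain a s b t where x: "x = fraction R S a s" "a \<in> carrier R" "s \<in> S" "s \<in> carrier R"
      "y = fraction R S b t" "b \<in> carrier R" "t \<in> S" "t \<in> carrier R" by (elim localization_obtain)
    then show "x \<oplus>\<^bsub>localization R S\<^esub> y \<in> carrier (localization R S)" by simp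
    show "x \<oplus>\<^bsub>localization R S\<^esub> y = y \<oplus>\<^bsub>localization R S\<^esub> x"
      using x by (simp add: m_ac a_ac)
    fix z assume "z \<in> carrier (localization R S)"
    then obtain c q where z: "z = fraction R S c q" "c \<in> carrier R" "q \<in> S" "q \<in> carrier R"
      by (elim localization_obtain)
    show "x \<oplus>\<^bsub>localization R S\<^esub> y \<oplus>\<^bsub>localization R S\<^esub> z =
       x \<oplus>\<^bsub>localization R S\<^esub> (y \<oplus>\<^bsub>localization R S\<^esub> z)"
      using x z by (simp add: m_ac a_ac l_distr r_distr)
  next
    show "\<zero>\<^bsub>localization R S\<^esub> \<in> carrier (localization R S)" by simp
    fix x assume "x \<in> carrier (localization R S)"
    then obtain a s where x: "x = fraction R S a s" "a \<in> carrier R" "s \<in> S" "s \<in> carrier R"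
      by (elim localization_obtain)
    show "\<zero>\<^bsub>localization R S\<^esub> \<oplus>\<^bsub>localization R S\<^esub> x = x" using x by simp
    have "fraction R S (\<ominus> a) s \<oplus>\<^bsub>localization R S\<^esub> x = \<zero>\<^bsub>localization R S\<^esub>"
      using x by (simp, intro fraction_eqI) (simp_all add: l_minus l_neg)
    then show "\<exists>y\<in>carrier (localization R S). y \<oplus>\<^bsub>localization R S\<^esub> x = \<zero>\<^bsub>localization R S\<^esub>"
      using x by (intro bexI[of _ "fraction R S (\<ominus> a) s"]) simp_all
  qed
  show "Group.comm_monoid (localization R S)"
  proof (rule comm_monoidI)
    fix x y assume "x \<in> carrier (localization R S)" "y \<in> carrier (localization R S)"
    then obtain a s b t where x: "x = fraction R S a s" "a \<in> carrier R" "s \<in> S" "s \<in> carrier R"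
      "y = fraction R S b t" "b \<in> carrier R" "t \<in> S" "t \<in> carrier R" by (elim localization_obtain)
    then show "x \<otimes>\<^bsub>localization R S\<^esub> y \<in> carrier (localization R S)" by simp
    show "x \<otimes>\<^bsub>localization R S\<^esub> y = y \<otimes>\<^bsub>localization R S\<^esub> x"
      using x by (simp add: m_ac)
    fix z assume "z \<in> carrier (localization R S)"
    then obtain c q where z: "z = fraction R S c q" "c \<in> carrier R" "q \<in> S" "q \<in> carrier R"
      by (elim localization_obtain)
    show "x \<otimes>\<^bsub>localization R S\<^esub> y \<otimes>\<^bsub>localization R S\<^esub> z =
       x \<otimes>\<^bsub>localization R S\<^esub> (y \<otimes>\<^bsub>localization R S\<^esub> z)"
      using x z by (simp add: m_ac)
  next
    show "\<one>\<^bsub>localization R S\<^esub> \<in> carrier (localization R S)" by simp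
    fix x assume "x \<in> carrier (localization R S)"
    then obtain a s where "x = fraction R S a s" "a \<in> carrier R" "s \<in> S" "s \<in> carrier R"
      by (elim localization_obtain)
    then show "\<one>\<^bsub>localization R S\<^esub> \<otimes>\<^bsub>localization R S\<^esub> x = x" by simp
  qed
  fix x y z assume "x \<in> carrier (localization R S)" "y \<in> carrier (localization R S)"
    "z \<in> carrier (localization R S)"
  then obtain a s b t c q where x: "x = fraction R S a s" "a \<in> carrier R" "s \<in> S" "s \<in> carrier R"
    "y = fraction R S b t" "b \<in> carrier R" "t \<in> S" "t \<in> carrier R"
    "z = fraction R S c q" "c \<in> carrier R" "q \<in> S" "q \<in> carrier R"
    by (elim localization_obtain)
  show "(x \<oplus>\<^bsub>localization R S\<^esub> y) \<otimes>\<^bsub>localization R S\<^esub> z =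
     x \<otimes>\<^bsub>localization R S\<^esub> z \<oplus>\<^bsub>localization R S\<^esub> y \<otimes>\<^bsub>localization R S\<^esub> z"
    using x by (simp, intro fraction_eqI) (simp_all add: m_ac l_distr r_distr)
qed

lemma localization_hom: "(\<lambda>a. fraction R S a \<one>) \<in> ring_hom R (localization R S)"
  by (rule ring_hom_memI)
    (simp_all add: localization_mult localization_add localization_one S_one fraction_carrier)

end

text \<open>\<open>S\<close> is the local ring of \<open>R/J\<close> at the prime formed by the elements which \<open>h\<close> does not map
  to units.\<close>

locale local_presentation = ring_hom_cring R S h
  for R :: "'a ring" (structure) and S :: "'b ring" (structure) and h +
  fixes J :: "'a set"
  assumes frac: "a \<in> carrier S \<Longrightarrow> \<exists>f\<in>carrier R. \<exists>g\<in>carrier R. h g \<in> Units S \<and> a \<otimes>\<^bsub>S\<^esub> h g = h f"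
    and ker: "f \<in> carrier R \<Longrightarrow> h f = \<zero>\<^bsub>S\<^esub> \<longleftrightarrow> (\<exists>g\<in>carrier R. h g \<in> Units S \<and> g \<otimes> f \<in> J)"
    and ideal_J: "ideal J R"
    and prime: "primeideal {f \<in> carrier R. h f \<notin> Units S} R"
begin

definition pp :: "'a set" where "pp = {f \<in> carrier R. h f \<notin> Units S}"

text \<open>The extension of \<open>I\<close> along \<open>h\<close>. As \<open>S\<close> consists
  of fractions, every element of the extension is one fraction with numerator in \<open>I\<close>,
  so no sums appear.\<close>

definition ext :: "'a set \<Rightarrow> 'b set" where
  "ext I = {a \<in> carrier S. \<exists>f\<in>I. \<exists>g\<in>carrier R. h g \<in> Units S \<and> a \<otimes>\<^bsub>S\<^esub> h g = h f}"

text \<open>Together with \<open>J \<subseteq> I\<close> this is the condition under which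
  \<open>I\<close> is recovered from its extension, see \<open>ext_contract\<close>. Primes inside
  \<open>pp\<close> satisfy it, and so do the ideals cut out by a tangent vector.\<close>

definition saturated :: "'a set \<Rightarrow> bool" where
  "saturated I \<longleftrightarrow> (\<forall>f\<in>carrier R. \<forall>g\<in>carrier R. h g \<in> Units S \<longrightarrow> g \<otimes> f \<in> I \<longrightarrow> f \<in> I)"

lemma prime_pp: "primeideal pp R" using prime by (simp add: pp_def)

lemma unit_cancel: "u \<in> Units S \<Longrightarrow> a \<in> carrier S \<Longrightarrow> b \<in> carrier S \<Longrightarrow>
    a \<otimes>\<^bsub>S\<^esub> u = b \<otimes>\<^bsub>S\<^esub> u \<longleftrightarrow> a = b"
  using S.Units_l_cancel[of u a b] S.Units_closed[of u]
  by (simp only: S.m_comm[of _ u])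

lemma ext_mem: "a \<in> carrier S \<Longrightarrow> f \<in> I \<Longrightarrow> g \<in> carrier R \<Longrightarrow> h g \<in> Units S \<Longrightarrow> a \<otimes>\<^bsub>S\<^esub> h g = h f \<Longrightarrow> a \<in> ext I"
  by (auto simp: ext_def)

lemma ext_h: "f \<in> I \<Longrightarrow> f \<in> carrier R \<Longrightarrow> h f \<in> ext I"
  by (rule ext_mem[where f = f and g = \<one>]) auto

lemma ideal_ext:
  assumes "ideal I R" shows "ideal (ext I) S"
proof -
  interpret I: ideal I R by fact
  show ?thesis
  proof (rule S.idealI_closed)
    show "\<zero>\<^bsub>S\<^esub> \<in> ext I" using ext_h[of \<zero> I] by auto
    fix a b assume "a \<in> ext I" "b \<in> ext I"
    then obtain f g f' g' where *: "a \<in> carrier S" "b \<in> carrier S" "f \<in> I" "f' \<in> I"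
      "g \<in> carrier R" "g' \<in> carrier R" "h g \<in> Units S" "h g' \<in> Units S"
      "a \<otimes>\<^bsub>S\<^esub> h g = h f" "b \<otimes>\<^bsub>S\<^esub> h g' = h f'" by (auto simp: ext_def)
    have "(a \<oplus>\<^bsub>S\<^esub> b) \<otimes>\<^bsub>S\<^esub> (h g \<otimes>\<^bsub>S\<^esub> h g') = (a \<otimes>\<^bsub>S\<^esub> h g) \<otimes>\<^bsub>S\<^esub> h g' \<oplus>\<^bsub>S\<^esub> (b \<otimes>\<^bsub>S\<^esub> h g') \<otimes>\<^bsub>S\<^esub> h g"
      using *(1,2,5,6) by (intro S.add_fracs) auto
    also have "\<dots> = h (f \<otimes> g' \<oplus> f' \<otimes> g)" unfolding *(9,10) using *(3-6) by simp
    finally show "a \<oplus>\<^bsub>S\<^esub> b \<in> ext I" using *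
      by (intro ext_mem[where f = "f \<otimes> g' \<oplus> f' \<otimes> g" and g = "g \<otimes> g'"]) (auto simp: I.I_r_closed I.add_mem)
  next
    fix a x assume "a \<in> ext I" "x \<in> carrier S"
    then obtain f g f' g' where *: "a \<in> carrier S" "x \<in> carrier S" "f \<in> I" "f' \<in> carrier R"
      "g \<in> carrier R" "g' \<in> carrier R" "h g \<in> Units S" "h g' \<in> Units S"
      "a \<otimes>\<^bsub>S\<^esub> h g = h f" "x \<otimes>\<^bsub>S\<^esub> h g' = h f'" using frac[of x] by (auto simp: ext_def)
    have "(x \<otimes>\<^bsub>S\<^esub> a) \<otimes>\<^bsub>S\<^esub> (h g' \<otimes>\<^bsub>S\<^esub> h g) = (x \<otimes>\<^bsub>S\<^esub> h g') \<otimes>\<^bsub>S\<^esub> (a \<otimes>\<^bsub>S\<^esub> h g)"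
      using *(1,2,5,6) by (intro S.mult_fracs) auto
    also have "\<dots> = h (f' \<otimes> f)" unfolding *(9,10) using *(3,4) by simp
    finally show "x \<otimes>\<^bsub>S\<^esub> a \<in> ext I" using *
      by (intro ext_mem[where f = "f' \<otimes> f" and g = "g' \<otimes> g"]) (auto simp: I.I_l_closed)
  qed (auto simp: ext_def)
qed

lemma h_eq_imp:
  assumes "f \<in> carrier R" "f' \<in> carrier R" "h f = h f'"
  shows "\<exists>g\<in>carrier R. h g \<in> Units S \<and> g \<otimes> (f \<ominus> f') \<in> J"
proof -
  have "h (f \<ominus> f') = \<zero>\<^bsub>S\<^esub>"
    using assms by (simp add: R.minus_eq S.r_neg)
  then show ?thesis using ker[of "f \<ominus> f'"] assms by auto
qed

lemma ext_contract:
  assumes "ideal I R" "J \<subseteq> I" "saturated I" "f \<in> carrier R"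
  shows "h f \<in> ext I \<longleftrightarrow> f \<in> I"
proof
  interpret I: ideal I R by fact
  assume "h f \<in> ext I"
  then obtain f' g where *: "f' \<in> I" "g \<in> carrier R" "h g \<in> Units S" "h f \<otimes>\<^bsub>S\<^esub> h g = h f'"
    by (auto simp: ext_def)
  then have "h (g \<otimes> f) = h f'" using assms(4) by (simp add: S.m_comm)
  \<comment> \<open>An equation in \<open>S\<close> lifts to \<open>R\<close> only modulo
    \<open>J\<close> and after multiplication by some \<open>k\<close> outside \<open>pp\<close>.
    The inclusion \<open>J \<subseteq> I\<close> absorbs the first defect, saturation the
    second.\<close>
  then obtain k where k: "k \<in> carrier R" "h k \<in> Units S" "k \<otimes> (g \<otimes> f \<ominus> f') \<in> J"
    using h_eq_imp[of "g \<otimes> f" f'] * assms(4) by auto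
  have "k \<otimes> (g \<otimes> f \<ominus> f') \<oplus> k \<otimes> f' \<in> I"
    using assms(2) k *(1) I.add_mem I.I_l_closed by (meson subsetD)
  moreover have "k \<otimes> (g \<otimes> f \<ominus> f') \<oplus> k \<otimes> f' = k \<otimes> (g \<otimes> f)"
    using k(1) *(2) I.Icarr[OF *(1)] assms(4)
    by (simp add: R.minus_eq R.r_distr R.r_minus R.a_assoc R.l_neg)
  ultimately show "f \<in> I" using assms(3,4) k * unfolding saturated_def by (metis R.m_closed)
qed (use assms in \<open>auto intro: ext_h\<close>)

lemma saturated_prime:
  assumes "primeideal I R" "I \<subseteq> pp" shows "saturated I"
proof -
  interpret I: primeideal I R by fact
  show ?thesis using I.I_prime assms(2) unfolding saturated_def pp_def by blast
qed

lemma J_pp: "J \<subseteq> pp"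
proof
  fix f assume f: "f \<in> J"
  then have fc: "f \<in> carrier R" using ideal_J by (simp add: ideal.Icarr)
  have "h f = \<zero>\<^bsub>S\<^esub>" using ker[OF fc] f fc by (metis R.l_one R.one_closed S.Units_one_closed hom_one)
  then have "f \<in> pp" if "\<zero>\<^bsub>S\<^esub> \<notin> Units S" using that fc by (simp add: pp_def)
  moreover have "\<zero>\<^bsub>S\<^esub> \<notin> Units S"
  proof
    assume "\<zero>\<^bsub>S\<^esub> \<in> Units S"
    then have "\<zero> \<notin> pp" by (simp add: pp_def)
    then show False using prime_pp by (metis additive_subgroup.zero_closed ideal.axioms(1) primeideal.axioms(1))
  qed
  ultimately show "f \<in> pp" by blast
qed

lemma max_ideal_ext: "max_ideal S = ext pp"
proof (intro equalityI subsetI)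
  fix a assume a: "a \<in> max_ideal S"
  then obtain f g where fg: "f \<in> carrier R" "g \<in> carrier R" "h g \<in> Units S" "a \<otimes>\<^bsub>S\<^esub> h g = h f"
    using frac[of a] unfolding max_ideal_def by blast
  have "h f \<notin> Units S"
  proof
    assume "h f \<in> Units S"
    then have "h f \<otimes>\<^bsub>S\<^esub> inv\<^bsub>S\<^esub> h g \<in> Units S" using fg by blast
    moreover have "h f \<otimes>\<^bsub>S\<^esub> inv\<^bsub>S\<^esub> h g = a"
      using fg a by (metis DiffD1 S.Units_closed S.Units_inv_closed S.Units_r_inv S.m_assoc S.r_one max_ideal_def)
    ultimately show False using a by (simp add: max_ideal_def)
  qed
  then show "a \<in> ext pp" using fg a by (auto simp: ext_def max_ideal_def pp_def)
next
  fix a assume "a \<in> ext pp"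
  then obtain f g where fg: "f \<in> pp" "g \<in> carrier R" "h g \<in> Units S" "a \<otimes>\<^bsub>S\<^esub> h g = h f" "a \<in> carrier S"
    by (auto simp: ext_def)
  have "a \<notin> Units S"
  proof
    assume "a \<in> Units S"
    then have "a \<otimes>\<^bsub>S\<^esub> h g \<in> Units S" using fg(3) by (rule S.Units_m_closed)
    then show False using fg(1,4) by (simp add: pp_def)
  qed
  then show "a \<in> max_ideal S" using fg by (simp add: max_ideal_def)
qed

lemma ideal_max: "ideal (max_ideal S) S"
  unfolding max_ideal_ext by (rule ideal_ext[OF primeideal.axioms(1)[OF prime_pp]])

lemma h_max: "f \<in> carrier R \<Longrightarrow> h f \<in> max_ideal S \<longleftrightarrow> f \<in> pp"
  by (simp add: max_ideal_def pp_def)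

lemma ext_mono: "I \<subseteq> I' \<Longrightarrow> ext I \<subseteq> ext I'" by (auto simp: ext_def)

lemma frac_mem_ideal:
  assumes "ideal Q S" "a \<in> carrier S" "g \<in> carrier R" "h g \<in> Units S" "a \<otimes>\<^bsub>S\<^esub> h g = h f"
  shows "a \<in> Q \<longleftrightarrow> h f \<in> Q"
proof
  interpret Q: ideal Q S by fact
  assume "h f \<in> Q"
  then have "h f \<otimes>\<^bsub>S\<^esub> inv\<^bsub>S\<^esub> h g \<in> Q" using assms by (intro Q.I_r_closed) auto
  moreover have "h f \<otimes>\<^bsub>S\<^esub> inv\<^bsub>S\<^esub> h g = a"
    using assms by (metis S.Units_closed S.Units_inv_closed S.Units_r_inv S.m_assoc S.r_one)
  ultimately show "a \<in> Q" by simp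
next
  interpret Q: ideal Q S by fact
  assume "a \<in> Q"
  then show "h f \<in> Q" using assms Q.I_r_closed[of a "h g"] by auto
qed

lemma primeideal_ext:
  assumes "primeideal I R" "J \<subseteq> I" "I \<subseteq> pp" shows "primeideal (ext I) S"
proof -
  interpret I: primeideal I R by fact
  have sat: "saturated I" using saturated_prime assms by blast
  note con = ext_contract[OF I.ideal_axioms assms(2) sat]
  have E: "ideal (ext I) S" by (rule ideal_ext) (rule I.ideal_axioms)
  show ?thesis
  proof (rule primeidealI[OF E S.is_cring])
    have "\<one> \<notin> I" using I.I_notcarr I.one_imp_carrier by auto
    then have "\<one>\<^bsub>S\<^esub> \<notin> ext I" using con[of \<one>] by simp
    then show "carrier S \<noteq> ext I" by auto
    fix a b assume ab: "a \<in> carrier S" "b \<in> carrier S" "a \<otimes>\<^bsub>S\<^esub> b \<in> ext I"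
    obtain f g where f: "f \<in> carrier R" "g \<in> carrier R" "h g \<in> Units S" "a \<otimes>\<^bsub>S\<^esub> h g = h f" using frac ab by blast
    obtain f' g' where f': "f' \<in> carrier R" "g' \<in> carrier R" "h g' \<in> Units S" "b \<otimes>\<^bsub>S\<^esub> h g' = h f'" using frac ab by blast
    have "(a \<otimes>\<^bsub>S\<^esub> b) \<otimes>\<^bsub>S\<^esub> h (g \<otimes> g') = (a \<otimes>\<^bsub>S\<^esub> h g) \<otimes>\<^bsub>S\<^esub> (b \<otimes>\<^bsub>S\<^esub> h g')"
      using S.mult_fracs[of a b "h g" "h g'"] ab(1,2) f(2) f'(2) by simp
    then have "(a \<otimes>\<^bsub>S\<^esub> b) \<otimes>\<^bsub>S\<^esub> h (g \<otimes> g') = h (f \<otimes> f')" using f f' by simp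
    then have "h (f \<otimes> f') \<in> ext I"
      using ideal.I_r_closed[OF E ab(3), of "h (g \<otimes> g')"] f f' by simp
    then have "f \<otimes> f' \<in> I" using con[OF R.m_closed[OF f(1) f'(1)]] by blast
    then have "f \<in> I \<or> f' \<in> I" using I.I_prime f f' by blast
    then show "a \<in> ext I \<or> b \<in> ext I" using ab f f' by (auto simp: ext_def)
  qed
qed

lemma contract_prime:
  assumes "primeideal Q S"
  defines "I \<equiv> {f \<in> carrier R. h f \<in> Q}"
  shows "primeideal I R" "J \<subseteq> I" "I \<subseteq> pp" "ext I = Q"
proof -
  interpret Q: primeideal Q S by fact
  show "primeideal I R" unfolding I_def
    by (rule R.primeideal_vimage[OF S.is_cring homh assms(1)])
  show "J \<subseteq> I"
  proof
    fix f assume f: "f \<in> J"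
    then have fc: "f \<in> carrier R" using ideal_J by (simp add: ideal.Icarr)
    have "h f = \<zero>\<^bsub>S\<^esub>" using ker[OF fc] f fc by (metis R.l_one R.one_closed S.Units_one_closed hom_one)
    then show "f \<in> I" using fc by (simp add: I_def)
  qed
  show "I \<subseteq> pp"
  proof
    fix f assume f: "f \<in> I"
    have "h f \<notin> Units S"
    proof
      assume u: "h f \<in> Units S"
      then have "inv\<^bsub>S\<^esub> h f \<otimes>\<^bsub>S\<^esub> h f \<in> Q" using f by (intro Q.I_l_closed) (auto simp: I_def)
      then show False using u Q.one_imp_carrier Q.I_notcarr by simp
    qed
    then show "f \<in> pp" using f by (simp add: I_def pp_def)
  qed
  show "ext I = Q"
  proof (intro equalityI subsetI)
    fix a assume "a \<in> ext I"
    then show "a \<in> Q" using frac_mem_ideal[OF Q.ideal_axioms] by (auto simp: ext_def I_def)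
  next
    fix a assume a: "a \<in> Q"
    then obtain f g where fg: "f \<in> carrier R" "g \<in> carrier R" "h g \<in> Units S" "a \<otimes>\<^bsub>S\<^esub> h g = h f"
      using frac[OF Q.Icarr] by blast
    with a have "f \<in> I" using frac_mem_ideal[OF Q.ideal_axioms Q.Icarr] unfolding I_def by blast
    then show "a \<in> ext I" using fg Q.Icarr[OF a] by (intro ext_mem)
  qed
qed

text \<open>A prime of \<open>S\<close> contracts to a prime over \<open>J\<close>, which contains
  one of the \<open>P i\<close> because their intersection lies in \<open>J\<close>; minimality
  turns the inclusion of extensions into equality. It bounds the components that have to be checked
  for snc.\<close>

lemma minimal_primes_ext:
  assumes P: "\<And>i. i < (k::nat) \<Longrightarrow> primeideal (P i) R" "\<And>i. i < k \<Longrightarrow> J \<subseteq> P i"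
    and J: "{f \<in> carrier R. \<forall>i<k. f \<in> P i} \<subseteq> J" and Q: "Q \<in> minimal_primes S"
  shows "\<exists>i<k. P i \<subseteq> pp \<and> Q = ext (P i)"
proof -
  have Qp: "primeideal Q S" using Q by (simp add: minimal_primes_def)
  define I where "I = {f \<in> carrier R. h f \<in> Q}"
  note c = contract_prime[OF Qp, folded I_def]
  obtain i where i: "i < k" "P i \<subseteq> I"
    using primeideal.prime_contains_factor[OF c(1), of k P, OF primeideal.axioms(1)[OF P(1)] order_trans[OF J c(2)]]
    by blast
  then have "primeideal (ext (P i)) S" "ext (P i) \<subseteq> Q" "P i \<subseteq> pp"
    using primeideal_ext[OF P(1)[OF i(1)] P(2)[OF i(1)]] c ext_mono[of "P i" I] by auto
  then show ?thesis using Q i by (auto simp: minimal_primes_def)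
qed

text \<open>The converse direction, used at the origin: there one has to know that each of the three
  planes really is a component of the germ, and for this the planes must be incomparable.\<close>

lemma ext_minimal_prime:
  assumes P: "\<And>i. i < (k::nat) \<Longrightarrow> primeideal (P i) R" "\<And>i. i < k \<Longrightarrow> J \<subseteq> P i"
    and J: "{f \<in> carrier R. \<forall>i<k. f \<in> P i} \<subseteq> J" and j: "j < k" "P j \<subseteq> pp"
    and inc: "\<And>i. i < k \<Longrightarrow> P i \<subseteq> P j \<Longrightarrow> P i = P j"
  shows "ext (P j) \<in> minimal_primes S"
  unfolding minimal_primes_def
proof (intro CollectI conjI allI impI)
  show "primeideal (ext (P j)) S" 
    by (rule primeideal_ext[OF P(1)[OF j(1)] P(2)[OF j(1)] j(2)])
  fix Q assume Q: "primeideal Q S \<and> Q \<subseteq> ext (P j)"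
  define I where "I = {f \<in> carrier R. h f \<in> Q}"
  note c = contract_prime[OF Q[THEN conjunct1], folded I_def]
  obtain i where i: "i < k" "P i \<subseteq> I"
    using primeideal.prime_contains_factor[OF c(1), of k P, OF primeideal.axioms(1)[OF P(1)] order_trans[OF J c(2)]]
    by blast
  have "I \<subseteq> P j"
    using Q ext_contract[OF primeideal.axioms(1)[OF P(1)[OF j(1)]] P(2)[OF j(1)] saturated_prime[OF P(1)[OF j(1)] j(2)]]
    unfolding I_def by auto
  then have "I = P j" using inc[OF i(1)] i(2) by blast
  then show "Q = ext (P j)" using c(4) by simp
qed

lemma common_denominator:
  assumes "\<And>i. i < (k::nat) \<Longrightarrow> c i \<in> carrier S"
  shows "\<exists>g f. g \<in> carrier R \<and> h g \<in> Units S \<and> (\<forall>i<k. f i \<in> carrier R \<and> c i \<otimes>\<^bsub>S\<^esub> h g = h (f i))"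
  using assms
proof (induction k)
  case 0
  then show ?case by (intro exI[of _ \<one>]) auto
next
  case (Suc k)
  then obtain g f where gf: "g \<in> carrier R" "h g \<in> Units S" "\<forall>i<k. f i \<in> carrier R \<and> c i \<otimes>\<^bsub>S\<^esub> h g = h (f i)" by auto
  obtain f' g' where f': "f' \<in> carrier R" "g' \<in> carrier R" "h g' \<in> Units S" "c k \<otimes>\<^bsub>S\<^esub> h g' = h f'"
    using frac[OF Suc.prems[of k]] by blast
  have "c i \<otimes>\<^bsub>S\<^esub> h (g \<otimes> g') = h (if i = k then f' \<otimes> g else f i \<otimes> g')" if "i < Suc k" for i
  proof (cases "i = k")
    case True
    have "c k \<otimes>\<^bsub>S\<^esub> h (g \<otimes> g') = (c k \<otimes>\<^bsub>S\<^esub> h g') \<otimes>\<^bsub>S\<^esub> h g"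
      using Suc.prems[of k] gf(1) f'(2) by (simp add: S.m_ac)
    then show ?thesis using True gf(1) f'(1,4) by simp
  next
    case False
    then have "c i \<otimes>\<^bsub>S\<^esub> h (g \<otimes> g') = (c i \<otimes>\<^bsub>S\<^esub> h g) \<otimes>\<^bsub>S\<^esub> h g'"
      using that Suc.prems[of i] gf(1) f'(2) by (simp add: S.m_ac)
    then show ?thesis using False that gf(1,3) f'(2) by simp
  qed
  then show ?case using gf f'
    by (intro exI[of _ "g \<otimes> g'"] exI[of _ "\<lambda>i. if i = k then f' \<otimes> g else f i \<otimes> g'"]) auto
qed

end

text \<open>Precomposition with a surjection makes the polynomial ring the common source: the stalk
  of a scheme is presented through its section ring, a germ ring through the coordinate ring of the
  smooth space.\<close>

lemma local_presentation_compose: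
  assumes "local_presentation R S h J" "cring R'" "c \<in> ring_hom R' R" "c ` carrier R' = carrier R"
  shows "local_presentation R' S (\<lambda>f. h (c f)) {f \<in> carrier R'. c f \<in> J}"
proof -
  interpret local_presentation R S h J by fact
  interpret c: ring_hom_cring R' R c
    using assms R.is_cring by (simp add: ring_hom_cring_def ring_hom_cring_axioms_def)
  interpret J: ideal J R by (rule ideal_J)
  have comp: "(\<lambda>f. h (c f)) \<in> ring_hom R' S"
    by (rule ring_hom_memI) auto
  have "ring_hom_cring R' S (\<lambda>f. h (c f))"
    using assms(2) S.is_cring comp by (simp add: ring_hom_cring_def ring_hom_cring_axioms_def)
  moreover have "ideal {f \<in> carrier R'. c f \<in> J} R'"
    by (rule c.R.idealI_closed) (auto simp: J.add_mem J.I_l_closed)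
  moreover have "primeideal {f \<in> carrier R'. h (c f) \<notin> Units S} R'"
    using c.R.primeideal_vimage[OF R.is_cring c.homh prime_pp]
    by (simp add: pp_def) (metis (no_types, lifting) c.hom_closed Collect_cong)
  moreover have "\<exists>f\<in>carrier R'. \<exists>g\<in>carrier R'. h (c g) \<in> Units S \<and> a \<otimes>\<^bsub>S\<^esub> h (c g) = h (c f)"
    if "a \<in> carrier S" for a using frac[OF that] unfolding assms(4)[symmetric] by auto
  moreover have "h (c f) = \<zero>\<^bsub>S\<^esub> \<longleftrightarrow> (\<exists>g\<in>carrier R'. h (c g) \<in> Units S \<and> g \<otimes>\<^bsub>R'\<^esub> f \<in> {f \<in> carrier R'. c f \<in> J})"
    if "f \<in> carrier R'" for f
    using ker[of "c f"] that unfolding assms(4)[symmetric] by auto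
  ultimately show ?thesis
    by (simp add: local_presentation_def local_presentation_axioms_def)
qed

lemma local_presentation_localization:
  assumes "cring R" "primeideal z R"
  defines "L \<equiv> localization R (carrier R - z)"
  shows "local_presentation R L (\<lambda>a. fraction R (carrier R - z) a \<one>\<^bsub>R\<^esub>) {\<zero>\<^bsub>R\<^esub>}"
    and "{a \<in> carrier R. fraction R (carrier R - z) a \<one>\<^bsub>R\<^esub> \<notin> Units L} = z"
proof -
  interpret R: cring R by fact
  interpret z: primeideal z R by fact
  let ?S = "carrier R - z"
  have "\<one>\<^bsub>R\<^esub> \<notin> z" using z.I_notcarr z.one_imp_carrier by auto
  then interpret M: mult_subset R ?S
    by unfold_locales (use z.I_prime in auto)
  interpret L: cring L unfolding L_def by (rule M.cring_localization)
  let ?e = "\<lambda>a. fraction R ?S a \<one>\<^bsub>R\<^esub>"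
  interpret e: ring_hom_cring R L ?e
    unfolding ring_hom_cring_def ring_hom_cring_axioms_def L_def
    using R.is_cring M.cring_localization M.localization_hom by blast
  have unit: "?e s \<in> Units L" if "s \<in> ?S" for s
  proof -
    have "?e s \<otimes>\<^bsub>L\<^esub> fraction R ?S \<one>\<^bsub>R\<^esub> s = fraction R ?S (s \<otimes>\<^bsub>R\<^esub> \<one>\<^bsub>R\<^esub>) (\<one>\<^bsub>R\<^esub> \<otimes>\<^bsub>R\<^esub> s)"
      using that unfolding L_def by (intro M.localization_mult M.S_one) auto
    also have "\<dots> = \<one>\<^bsub>L\<^esub>"
      unfolding L_def M.localization_one using that M.S_one by (intro M.fraction_eqI) auto
    finally have "?e s \<otimes>\<^bsub>L\<^esub> fraction R ?S \<one>\<^bsub>R\<^esub> s = \<one>\<^bsub>L\<^esub>" .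
    moreover have "fraction R ?S \<one>\<^bsub>R\<^esub> s \<in> carrier L" using that unfolding L_def by (auto intro: M.fraction_carrier)
    moreover have "?e s \<in> carrier L" using that e.hom_closed by blast
    ultimately show ?thesis unfolding Units_def using L.m_comm[of "?e s" "fraction R ?S \<one>\<^bsub>R\<^esub> s"]
      by (intro CollectI conjI bexI[of _ "fraction R ?S \<one>\<^bsub>R\<^esub> s"]) simp_all
  qed
  have unit_iff: "?e s \<in> Units L \<longleftrightarrow> s \<in> ?S" if s: "s \<in> carrier R" for s
  proof
    assume "?e s \<in> Units L"
    then obtain y where y: "y \<in> carrier L" "?e s \<otimes>\<^bsub>L\<^esub> y = \<one>\<^bsub>L\<^esub>" by (auto simp: Units_def)
    then obtain b t where bt: "y = fraction R ?S b t" "b \<in> carrier R" "t \<in> ?S"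
      unfolding L_def M.localization_carrier by blast
    have "?e s \<otimes>\<^bsub>L\<^esub> y = fraction R ?S (s \<otimes>\<^bsub>R\<^esub> b) (\<one>\<^bsub>R\<^esub> \<otimes>\<^bsub>R\<^esub> t)"
      unfolding L_def bt(1) using s bt(2,3) by (intro M.localization_mult M.S_one) auto
    then have "fraction R ?S (s \<otimes>\<^bsub>R\<^esub> b) (\<one>\<^bsub>R\<^esub> \<otimes>\<^bsub>R\<^esub> t) = fraction R ?S \<one>\<^bsub>R\<^esub> \<one>\<^bsub>R\<^esub>"
      using y(2) by (simp only: L_def M.localization_one)
    then have "\<exists>u\<in>?S. u \<otimes>\<^bsub>R\<^esub> (s \<otimes>\<^bsub>R\<^esub> b \<otimes>\<^bsub>R\<^esub> \<one>\<^bsub>R\<^esub>) = u \<otimes>\<^bsub>R\<^esub> (\<one>\<^bsub>R\<^esub> \<otimes>\<^bsub>R\<^esub> (\<one>\<^bsub>R\<^esub> \<otimes>\<^bsub>R\<^esub> t))"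
      using s bt(2,3) M.S_one by (subst (asm) M.fraction_eq_iff) auto
    then obtain u where u: "u \<in> ?S" "u \<otimes>\<^bsub>R\<^esub> (s \<otimes>\<^bsub>R\<^esub> b \<otimes>\<^bsub>R\<^esub> \<one>\<^bsub>R\<^esub>) = u \<otimes>\<^bsub>R\<^esub> t"
      using bt(3) by auto
    have "s \<notin> z"
    proof
      assume "s \<in> z"
      then have "u \<otimes>\<^bsub>R\<^esub> (s \<otimes>\<^bsub>R\<^esub> b \<otimes>\<^bsub>R\<^esub> \<one>\<^bsub>R\<^esub>) \<in> z" using u(1) bt(2) by (intro z.I_l_closed z.I_r_closed) auto
      then have "u \<otimes>\<^bsub>R\<^esub> t \<in> z" by (simp only: u(2))
      then show False using u(1) z.I_prime[of u t] bt(3) by blast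
    qed
    then show "s \<in> ?S" using s by blast
  qed (rule unit)
  show "{a \<in> carrier R. ?e a \<notin> Units L} = z"
    using unit_iff z.Icarr by auto
  show "local_presentation R L ?e {\<zero>\<^bsub>R\<^esub>}"
    unfolding local_presentation_def local_presentation_axioms_def
  proof (intro conjI allI impI)
    show "ring_hom_cring R L ?e" by (rule e.ring_hom_cring_axioms)
  next
    fix a assume "a \<in> carrier L"
    then obtain b t where bt: "a = fraction R ?S b t" "b \<in> carrier R" "t \<in> ?S"
      unfolding L_def M.localization_carrier by blast
    have "a \<otimes>\<^bsub>L\<^esub> ?e t = fraction R ?S (b \<otimes>\<^bsub>R\<^esub> t) (t \<otimes>\<^bsub>R\<^esub> \<one>\<^bsub>R\<^esub>)"
      using bt unfolding L_def bt(1) by (intro M.localization_mult M.S_one) auto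
    also have "\<dots> = ?e b" using bt M.S_one by (intro M.fraction_eqI) auto
    finally have "a \<otimes>\<^bsub>L\<^esub> ?e t = ?e b" .
    then show "\<exists>f\<in>carrier R. \<exists>g\<in>carrier R. ?e g \<in> Units L \<and> a \<otimes>\<^bsub>L\<^esub> ?e g = ?e f"
      using bt unit by (intro bexI[of _ b] bexI[of _ t]) auto
  next
    fix f assume f: "f \<in> carrier R"
    have "?e f = \<zero>\<^bsub>L\<^esub> \<longleftrightarrow> (\<exists>u\<in>?S. u \<otimes>\<^bsub>R\<^esub> f = \<zero>\<^bsub>R\<^esub>)"
      unfolding L_def M.localization_zero using f M.S_one
      by (subst M.fraction_eq_iff) auto
    then show "?e f = \<zero>\<^bsub>L\<^esub> \<longleftrightarrow> (\<exists>g\<in>carrier R. ?e g \<in> Units L \<and> g \<otimes>\<^bsub>R\<^esub> f \<in> {\<zero>\<^bsub>R\<^esub>})"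
      using unit_iff by auto
  next
    show "ideal {\<zero>\<^bsub>R\<^esub>} R" by (rule R.zeroideal)
    have "{a \<in> carrier R. ?e a \<notin> Units L} = z" using unit_iff z.Icarr by auto
    then show "primeideal {a \<in> carrier R. ?e a \<notin> Units L} R" using assms(2) by simp
  qed
qed

text \<open>The universal property of fractions. With more relations and the same denominators the
  second ring is a quotient of the first; for \<open>J = {0}\<close> this gives the closed embedding
  of the germ of a scheme in the germ of affine space.\<close>

lemma local_presentation_hom:
  assumes A: "local_presentation R S h J" and B: "local_presentation R S' h' J'"
    and JJ: "J \<subseteq> J'" and U: "\<And>g. g \<in> carrier R \<Longrightarrow> h g \<in> Units S \<longleftrightarrow> h' g \<in> Units S'"
  obtains \<theta> where "\<theta> \<in> ring_hom S S'" "\<And>f. f \<in> carrier R \<Longrightarrow> \<theta> (h f) = h' f"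
    "\<theta> ` carrier S = carrier S'"
proof -
  interpret A: local_presentation R S h J by fact
  interpret B: local_presentation R S' h' J' by fact
  \<comment> \<open>One fraction for \<open>a\<close> is chosen here; \<open>key\<close> shows that
    all others give the same value, because equality of fractions in \<open>S\<close> is a relation
    in \<open>J\<close> up to a denominator, and \<open>J \<subseteq> J'\<close>.\<close>
  define \<theta> where "\<theta> a = (SOME b. b \<in> carrier S' \<and> (\<exists>f\<in>carrier R. \<exists>g\<in>carrier R. h g \<in> Units S \<and>
     a \<otimes>\<^bsub>S\<^esub> h g = h f \<and> b \<otimes>\<^bsub>S'\<^esub> h' g = h' f))" for a
  have ex: "\<exists>b. b \<in> carrier S' \<and> b \<otimes>\<^bsub>S'\<^esub> h' g = h' f" if "f \<in> carrier R" "g \<in> carrier R" "h g \<in> Units S" for f g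
    using that U[of g]
    by (intro exI[of _ "h' f \<otimes>\<^bsub>S'\<^esub> inv\<^bsub>S'\<^esub> h' g"]) (auto simp: B.S.m_assoc)
  have th: "\<theta> a \<in> carrier S' \<and> (\<exists>f\<in>carrier R. \<exists>g\<in>carrier R. h g \<in> Units S \<and>
     a \<otimes>\<^bsub>S\<^esub> h g = h f \<and> \<theta> a \<otimes>\<^bsub>S'\<^esub> h' g = h' f)" if "a \<in> carrier S" for a
    unfolding \<theta>_def by (rule someI_ex) (use A.frac[OF that] ex in blast)
  have key: "\<theta> a \<otimes>\<^bsub>S'\<^esub> h' g = h' f"
    if a: "a \<in> carrier S" and fg: "f \<in> carrier R" "g \<in> carrier R" "h g \<in> Units S" "a \<otimes>\<^bsub>S\<^esub> h g = h f" for a f g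
  proof -
    obtain f1 g1 where 1: "f1 \<in> carrier R" "g1 \<in> carrier R" "h g1 \<in> Units S"
      "a \<otimes>\<^bsub>S\<^esub> h g1 = h f1" "\<theta> a \<otimes>\<^bsub>S'\<^esub> h' g1 = h' f1" "\<theta> a \<in> carrier S'" using th[OF a] by blast
    have "h (f \<otimes>\<^bsub>R\<^esub> g1) = (a \<otimes>\<^bsub>S\<^esub> h g) \<otimes>\<^bsub>S\<^esub> h g1" unfolding fg(4) using fg(1) 1(2) by simp
    also have "\<dots> = (a \<otimes>\<^bsub>S\<^esub> h g1) \<otimes>\<^bsub>S\<^esub> h g" using a fg(2) 1(2) by (simp add: A.S.m_ac)
    also have "\<dots> = h (f1 \<otimes>\<^bsub>R\<^esub> g)" unfolding 1(4) using fg(2) 1(1) by simp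
    finally obtain k where k: "k \<in> carrier R" "h k \<in> Units S" "k \<otimes>\<^bsub>R\<^esub> (f \<otimes>\<^bsub>R\<^esub> g1 \<ominus>\<^bsub>R\<^esub> f1 \<otimes>\<^bsub>R\<^esub> g) \<in> J"
      using A.h_eq_imp[of "f \<otimes>\<^bsub>R\<^esub> g1" "f1 \<otimes>\<^bsub>R\<^esub> g"] fg 1 by auto
    then have "h' (f \<otimes>\<^bsub>R\<^esub> g1 \<ominus>\<^bsub>R\<^esub> f1 \<otimes>\<^bsub>R\<^esub> g) = \<zero>\<^bsub>S'\<^esub>"
      using B.ker[of "f \<otimes>\<^bsub>R\<^esub> g1 \<ominus>\<^bsub>R\<^esub> f1 \<otimes>\<^bsub>R\<^esub> g"] JJ U fg 1 by auto
    then have "h' f \<otimes>\<^bsub>S'\<^esub> h' g1 \<oplus>\<^bsub>S'\<^esub> \<ominus>\<^bsub>S'\<^esub> (h' f1 \<otimes>\<^bsub>S'\<^esub> h' g) = \<zero>\<^bsub>S'\<^esub>"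
      using fg 1 by (simp add: A.R.minus_eq)
    then have "h' f \<otimes>\<^bsub>S'\<^esub> h' g1 = h' f1 \<otimes>\<^bsub>S'\<^esub> h' g"
      using fg(1,2) 1(1,2) B.S.minus_equality[of "h' f \<otimes>\<^bsub>S'\<^esub> h' g1" "\<ominus>\<^bsub>S'\<^esub> (h' f1 \<otimes>\<^bsub>S'\<^esub> h' g)"]
      by simp
    also have "\<dots> = (\<theta> a \<otimes>\<^bsub>S'\<^esub> h' g) \<otimes>\<^bsub>S'\<^esub> h' g1"
      unfolding 1(5)[symmetric] using 1(2,6) fg(2) by (simp add: B.S.m_ac)
    finally show ?thesis
      using B.unit_cancel[of "h' g1" "h' f" "\<theta> a \<otimes>\<^bsub>S'\<^esub> h' g"] 1(2,3,6) fg(1,2) U by simp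
  qed
  have uniq: "b = \<theta> a" if "a \<in> carrier S" "b \<in> carrier S'" "f \<in> carrier R" "g \<in> carrier R" "h g \<in> Units S"
    "a \<otimes>\<^bsub>S\<^esub> h g = h f" "b \<otimes>\<^bsub>S'\<^esub> h' g = h' f" for a b f g
    using key[OF that(1,3-6)] B.unit_cancel[of "h' g" b "\<theta> a"] that th U by auto
  have thh: "\<theta> (h f) = h' f" if "f \<in> carrier R" for f
    by (rule uniq[symmetric, where g = "\<one>\<^bsub>R\<^esub>" and f = f]) (use that in auto)
  show thesis
  proof (rule that[of \<theta>])
    show "\<theta> \<in> ring_hom S S'"
    proof (rule ring_hom_memI)
      fix a b assume ab: "a \<in> carrier S" "b \<in> carrier S"
      obtain f g where f: "f \<in> carrier R" "g \<in> carrier R" "h g \<in> Units S" "a \<otimes>\<^bsub>S\<^esub> h g = h f" using A.frac ab by blast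
      obtain f' g' where f': "f' \<in> carrier R" "g' \<in> carrier R" "h g' \<in> Units S" "b \<otimes>\<^bsub>S\<^esub> h g' = h f'" using A.frac ab by blast
      note k = key[OF ab(1) f] key[OF ab(2) f'] th[OF ab(1), THEN conjunct1] th[OF ab(2), THEN conjunct1]
      have e1: "(a \<otimes>\<^bsub>S\<^esub> b) \<otimes>\<^bsub>S\<^esub> h (g \<otimes>\<^bsub>R\<^esub> g') = (a \<otimes>\<^bsub>S\<^esub> h g) \<otimes>\<^bsub>S\<^esub> (b \<otimes>\<^bsub>S\<^esub> h g')"
        using A.S.mult_fracs[of a b "h g" "h g'"] ab f(2) f'(2) by simp
      have e2: "(\<theta> a \<otimes>\<^bsub>S'\<^esub> \<theta> b) \<otimes>\<^bsub>S'\<^esub> h' (g \<otimes>\<^bsub>R\<^esub> g') = (\<theta> a \<otimes>\<^bsub>S'\<^esub> h' g) \<otimes>\<^bsub>S'\<^esub> (\<theta> b \<otimes>\<^bsub>S'\<^esub> h' g')"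
        using B.S.mult_fracs[of "\<theta> a" "\<theta> b" "h' g" "h' g'"] k(3,4) f(2) f'(2) by simp
      show "\<theta> (a \<otimes>\<^bsub>S\<^esub> b) = \<theta> a \<otimes>\<^bsub>S'\<^esub> \<theta> b"
        by (rule uniq[symmetric, where g = "g \<otimes>\<^bsub>R\<^esub> g'" and f = "f \<otimes>\<^bsub>R\<^esub> f'"])
          (use ab f f' k e1 e2 in auto)
      have e3: "(a \<oplus>\<^bsub>S\<^esub> b) \<otimes>\<^bsub>S\<^esub> h (g \<otimes>\<^bsub>R\<^esub> g') = (a \<otimes>\<^bsub>S\<^esub> h g) \<otimes>\<^bsub>S\<^esub> h g' \<oplus>\<^bsub>S\<^esub> (b \<otimes>\<^bsub>S\<^esub> h g') \<otimes>\<^bsub>S\<^esub> h g"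
        using A.S.add_fracs[of a b "h g" "h g'"] ab f(2) f'(2) by simp
      have e4: "(\<theta> a \<oplus>\<^bsub>S'\<^esub> \<theta> b) \<otimes>\<^bsub>S'\<^esub> h' (g \<otimes>\<^bsub>R\<^esub> g') = (\<theta> a \<otimes>\<^bsub>S'\<^esub> h' g) \<otimes>\<^bsub>S'\<^esub> h' g' \<oplus>\<^bsub>S'\<^esub> (\<theta> b \<otimes>\<^bsub>S'\<^esub> h' g') \<otimes>\<^bsub>S'\<^esub> h' g"
        using B.S.add_fracs[of "\<theta> a" "\<theta> b" "h' g" "h' g'"] k(3,4) f(2) f'(2) by simp
      show "\<theta> (a \<oplus>\<^bsub>S\<^esub> b) = \<theta> a \<oplus>\<^bsub>S'\<^esub> \<theta> b"
        by (rule uniq[symmetric, where g = "g \<otimes>\<^bsub>R\<^esub> g'" and f = "f \<otimes>\<^bsub>R\<^esub> g' \<oplus>\<^bsub>R\<^esub> f' \<otimes>\<^bsub>R\<^esub> g"])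
          (use ab f f' k e3 e4 in auto)
    next
      show "\<theta> \<one>\<^bsub>S\<^esub> = \<one>\<^bsub>S'\<^esub>" using thh[of "\<one>\<^bsub>R\<^esub>"] by simp
    qed (use th in auto)
    show "\<theta> (h f) = h' f" if "f \<in> carrier R" for f using thh that by simp
    show "\<theta> ` carrier S = carrier S'"
    proof (intro equalityI subsetI)
      fix b assume b: "b \<in> carrier S'"
      obtain f g where fg: "f \<in> carrier R" "g \<in> carrier R" "h' g \<in> Units S'" "b \<otimes>\<^bsub>S'\<^esub> h' g = h' f" using B.frac b by blast
      then have u: "h g \<in> Units S" using U by simp
      define a where "a = h f \<otimes>\<^bsub>S\<^esub> inv\<^bsub>S\<^esub> h g"
      have a: "a \<in> carrier S" "a \<otimes>\<^bsub>S\<^esub> h g = h f" using fg u by (auto simp: a_def A.S.m_assoc)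
      have "b = \<theta> a" by (rule uniq[OF a(1) b fg(1,2) u a(2) fg(4)])
      then show "b \<in> \<theta> ` carrier S" using a by blast
    qed (use th in auto)
  qed
qed

section \<open>Affine open sets with coordinates\<close>

lemma sec_ring_simps [simp]:
  "carrier (sec_ring X U) = sec X U"
  "f \<otimes>\<^bsub>sec_ring X U\<^esub> g = (\<lambda>p\<in>U. f p \<otimes>\<^bsub>stalk X p\<^esub> g p)"
  "f \<oplus>\<^bsub>sec_ring X U\<^esub> g = (\<lambda>p\<in>U. f p \<oplus>\<^bsub>stalk X p\<^esub> g p)"
  "\<one>\<^bsub>sec_ring X U\<^esub> = (\<lambda>p\<in>U. \<one>\<^bsub>stalk X p\<^esub>)"
  "\<zero>\<^bsub>sec_ring X U\<^esub> = (\<lambda>p\<in>U. \<zero>\<^bsub>stalk X p\<^esub>)"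
  by (simp_all add: sec_ring_def)

lemma stalk_cring:
  assumes "locally_ringed_kspace X" "p \<in> pts X" shows "cring (stalk X p)"
  using assms(1)[unfolded locally_ringed_kspace_def, THEN conjunct1, rule_format, OF assms(2)]
  by (simp add: local_ring_def)

lemma sec_props:
  assumes "locally_ringed_kspace X" "openin (sp X) U"
  shows sec_cring: "cring (sec_ring X U)"
    and scalar_section: "(\<lambda>p\<in>U. scalar X p c) \<in> sec X U"
    and sec_restrict: "openin (sp X) V \<Longrightarrow> V \<subseteq> U \<Longrightarrow> s \<in> sec X U \<Longrightarrow> restrict s V \<in> sec X V"
    and sec_PiE: "s \<in> sec X U \<Longrightarrow> s \<in> (\<Pi>\<^sub>E p\<in>U. carrier (stalk X p))"
proof -
  note * = assms(1)[unfolded locally_ringed_kspace_def, THEN conjunct2, THEN conjunct1, rule_format, OF assms(2)]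
  show "cring (sec_ring X U)" by (rule *[THEN conjunct1])
  show "(\<lambda>p\<in>U. scalar X p c) \<in> sec X U" by (rule *[THEN conjunct2, THEN conjunct1, rule_format])
  show "openin (sp X) V \<Longrightarrow> V \<subseteq> U \<Longrightarrow> s \<in> sec X U \<Longrightarrow> restrict s V \<in> sec X V"
    using *[THEN conjunct2, THEN conjunct2, THEN conjunct1, THEN spec[of _ V]] by simp
  show "s \<in> sec X U \<Longrightarrow> s \<in> (\<Pi>\<^sub>E p\<in>U. carrier (stalk X p))"
    using *[THEN conjunct2, THEN conjunct2, THEN conjunct2, THEN spec[of _ s]] by simp
qed

lemma sec_value: "locally_ringed_kspace X \<Longrightarrow> openin (sp X) U \<Longrightarrow> s \<in> sec X U \<Longrightarrow> p \<in> U \<Longrightarrow>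
    s p \<in> carrier (stalk X p)"
  using PiE_mem[OF sec_PiE] .

lemma affine_openD:
  assumes "affine_open X U"
  shows "openin (sp X) U" "bij_betw (prime_of X U) U (prime_spectrum (sec_ring X U))"
    and "s \<in> sec X U \<Longrightarrow> openin (sp X) {p \<in> U. s p \<in> Units (stalk X p)}"
    and "p \<in> U \<Longrightarrow> a \<in> carrier (stalk X p) \<Longrightarrow>
      \<exists>s\<in>sec X U. \<exists>t\<in>sec X U. t p \<in> Units (stalk X p) \<and> a \<otimes>\<^bsub>stalk X p\<^esub> t p = s p"
    and "p \<in> U \<Longrightarrow> s \<in> sec X U \<Longrightarrow> s p = \<zero>\<^bsub>stalk X p\<^esub> \<Longrightarrow>
      \<exists>t\<in>sec X U. t p \<in> Units (stalk X p) \<and> t \<otimes>\<^bsub>sec_ring X U\<^esub> s = \<zero>\<^bsub>sec_ring X U\<^esub>"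
proof -
  note * = assms[unfolded affine_open_def]
  show "openin (sp X) U" by (rule *[THEN conjunct1])
  note * = *[THEN conjunct2]
  show "bij_betw (prime_of X U) U (prime_spectrum (sec_ring X U))" by (rule *[THEN conjunct1])
  note * = *[THEN conjunct2]
  show "s \<in> sec X U \<Longrightarrow> openin (sp X) {p \<in> U. s p \<in> Units (stalk X p)}"
    by (rule *[THEN conjunct1, rule_format])
  note * = *[THEN conjunct2, THEN conjunct2]
  show "p \<in> U \<Longrightarrow> a \<in> carrier (stalk X p) \<Longrightarrow>
      \<exists>s\<in>sec X U. \<exists>t\<in>sec X U. t p \<in> Units (stalk X p) \<and> a \<otimes>\<^bsub>stalk X p\<^esub> t p = s p"
    by (rule *[THEN conjunct1, rule_format])
  note * = *[THEN conjunct2]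
  show "p \<in> U \<Longrightarrow> s \<in> sec X U \<Longrightarrow> s p = \<zero>\<^bsub>stalk X p\<^esub> \<Longrightarrow>
      \<exists>t\<in>sec X U. t p \<in> Units (stalk X p) \<and> t \<otimes>\<^bsub>sec_ring X U\<^esub> s = \<zero>\<^bsub>sec_ring X U\<^esub>"
    by (rule *[rule_format])
qed

lemma local_presentation_stalk:
  assumes X: "locally_ringed_kspace X" and U: "affine_open X U" and p: "p \<in> U"
  shows "local_presentation (sec_ring X U) (stalk X p) (\<lambda>s. s p) {\<zero>\<^bsub>sec_ring X U\<^esub>}"
proof -
  have op: "openin (sp X) U" by (rule affine_openD(1)[OF U])
  then have pX: "p \<in> pts X" using p openin_subset by blast
  interpret S: cring "stalk X p" by (rule stalk_cring[OF X pX])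
  interpret R: cring "sec_ring X U" by (rule sec_cring[OF X op])
  note val = sec_value[OF X op _ p]
  have hom: "ring_hom_cring (sec_ring X U) (stalk X p) (\<lambda>s. s p)"
    unfolding ring_hom_cring_def ring_hom_cring_axioms_def
    using R.is_cring S.is_cring val p by (auto intro!: ring_hom_memI)
  have pr: "prime_of X U p = {s \<in> carrier (sec_ring X U). s p \<notin> Units (stalk X p)}"
    using val by (auto simp: prime_of_def max_ideal_def)
  have "prime_of X U p \<in> prime_spectrum (sec_ring X U)"
    using affine_openD(2)[OF U] p unfolding bij_betw_def by blast
  then have prime: "primeideal {s \<in> carrier (sec_ring X U). s p \<notin> Units (stalk X p)} (sec_ring X U)"
    by (simp only: pr prime_spectrum_def mem_Collect_eq)
  have frac: "\<exists>s\<in>sec X U. \<exists>t\<in>sec X U. t p \<in> Units (stalk X p) \<and> a \<otimes>\<^bsub>stalk X p\<^esub> t p = s p"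
    if "a \<in> carrier (stalk X p)" for a
    by (rule affine_openD(4)[OF U p that])
  have ker: "s p = \<zero>\<^bsub>stalk X p\<^esub> \<longleftrightarrow>
      (\<exists>t\<in>sec X U. t p \<in> Units (stalk X p) \<and> t \<otimes>\<^bsub>sec_ring X U\<^esub> s = \<zero>\<^bsub>sec_ring X U\<^esub>)"
    if s: "s \<in> sec X U" for s
  proof
    assume "s p = \<zero>\<^bsub>stalk X p\<^esub>"
    then show "\<exists>t\<in>sec X U. t p \<in> Units (stalk X p) \<and> t \<otimes>\<^bsub>sec_ring X U\<^esub> s = \<zero>\<^bsub>sec_ring X U\<^esub>"
      by (rule affine_openD(5)[OF U p s])
  next
    assume "\<exists>t\<in>sec X U. t p \<in> Units (stalk X p) \<and> t \<otimes>\<^bsub>sec_ring X U\<^esub> s = \<zero>\<^bsub>sec_ring X U\<^esub>"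
    then obtain t where t: "t p \<in> Units (stalk X p)" "t \<otimes>\<^bsub>sec_ring X U\<^esub> s = \<zero>\<^bsub>sec_ring X U\<^esub>" by blast
    have "t p \<otimes>\<^bsub>stalk X p\<^esub> s p = t p \<otimes>\<^bsub>stalk X p\<^esub> \<zero>\<^bsub>stalk X p\<^esub>"
      using p fun_cong[OF t(2)[unfolded sec_ring_simps], of p] S.Units_closed[OF t(1)] by simp
    then show "s p = \<zero>\<^bsub>stalk X p\<^esub>" using S.Units_l_cancel[OF t(1) val[OF s] S.zero_closed] by blast
  qed
  show ?thesis
    unfolding local_presentation_def local_presentation_axioms_def singleton_iff sec_ring_simps(1)
    by (intro conjI allI impI hom frac ker R.zeroideal) (use prime in simp_all)
qed

lemma affine_coords_open: "affine_coords n I X U \<phi> \<Longrightarrow> openin (sp X) U"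
  by (simp add: affine_coords_def affine_open_def)

lemma affine_coords_sec: "affine_coords n I X U \<phi> \<Longrightarrow> f \<in> pcarr n \<Longrightarrow> \<phi> f \<in> sec X U"
  by (auto simp: affine_coords_def)

lemma affine_coords_ker:
  assumes "affine_coords n I X U \<phi>"
  shows "I = {f \<in> pcarr n. \<phi> f = \<zero>\<^bsub>sec_ring X U\<^esub>}"
  using assms by (simp add: affine_coords_def a_kernel_def')

lemma affine_coords_presentation:
  assumes X: "locally_ringed_kspace X" and ac: "affine_coords n I X U \<phi>" and p: "p \<in> U"
  shows "local_presentation (poly_ring n) (stalk X p) (\<lambda>f. \<phi> f p) I"
proof -
  have U: "affine_open X U" using ac by (simp add: affine_coords_def)
  have "local_presentation (poly_ring n) (stalk X p) (\<lambda>f. \<phi> f p)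
     {f \<in> pcarr n. \<phi> f \<in> {\<zero>\<^bsub>sec_ring X U\<^esub>}}"
    by (rule local_presentation_compose[OF local_presentation_stalk[OF X U p] cring_poly_ring])
      (use ac in \<open>auto simp: affine_coords_def\<close>)
  then show ?thesis unfolding affine_coords_ker[OF ac] by simp
qed

lemma affine_coords_cring_hom:
  assumes "locally_ringed_kspace X" "affine_coords n I X U \<phi>"
  shows "ring_hom_cring (poly_ring n) (sec_ring X U) \<phi>"
  using assms sec_cring[OF assms(1) affine_coords_open[OF assms(2)]] cring_poly_ring
  by (simp add: ring_hom_cring_def ring_hom_cring_axioms_def affine_coords_def)

lemma primeideal_image:
  assumes hom: "ring_hom_cring R R' c" and surj: "c ` carrier R = carrier R'"
    and P: "primeideal P R" and ker: "{f \<in> carrier R. c f = \<zero>\<^bsub>R'\<^esub>} \<subseteq> P"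
  shows "primeideal (c ` P) R'" "f \<in> carrier R \<Longrightarrow> c f \<in> c ` P \<longleftrightarrow> f \<in> P"
proof -
  interpret c: ring_hom_cring R R' c by fact
  interpret P: primeideal P R by fact
  have mem: "c f \<in> c ` P \<longleftrightarrow> f \<in> P" if f: "f \<in> carrier R" for f
  proof
    assume "c f \<in> c ` P"
    then obtain g where g: "g \<in> P" "c f = c g" by auto
    have gc: "g \<in> carrier R" by (rule P.Icarr[OF g(1)])
    have "c (f \<ominus>\<^bsub>R\<^esub> g) = \<zero>\<^bsub>R'\<^esub>" using f gc g(2) by (simp add: a_minus_def c.S.r_neg)
    then have "f \<ominus>\<^bsub>R\<^esub> g \<in> P" using ker f gc by blast
    then have "f \<ominus>\<^bsub>R\<^esub> g \<oplus>\<^bsub>R\<^esub> g \<in> P" using g(1) P.add_mem by blast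
    then show "f \<in> P" using f gc by (simp add: a_minus_def c.R.a_assoc c.R.l_neg)
  qed blast
  show "f \<in> carrier R \<Longrightarrow> c f \<in> c ` P \<longleftrightarrow> f \<in> P" by (rule mem)
  show "primeideal (c ` P) R'"
  proof (rule primeidealI[OF c.S.idealI_closed c.S.is_cring])
    show "c ` P \<subseteq> carrier R'" using P.Icarr by auto
    show "\<zero>\<^bsub>R'\<^esub> \<in> c ` P" using mem[of "\<zero>\<^bsub>R\<^esub>"] by simp
    show "a \<oplus>\<^bsub>R'\<^esub> b \<in> c ` P" if ab: "a \<in> c ` P" "b \<in> c ` P" for a b
    proof -
      obtain f g where fg: "f \<in> P" "a = c f" "g \<in> P" "b = c g" using ab by blast
      then have "a \<oplus>\<^bsub>R'\<^esub> b = c (f \<oplus>\<^bsub>R\<^esub> g)" using P.Icarr by simp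
      then show ?thesis using fg P.add_mem by blast
    qed
    show "x \<otimes>\<^bsub>R'\<^esub> a \<in> c ` P" if ax: "a \<in> c ` P" "x \<in> carrier R'" for a x
    proof -
      obtain f g where fg: "f \<in> P" "a = c f" "g \<in> carrier R" "x = c g"
        using ax unfolding surj[symmetric] by blast
      then have "x \<otimes>\<^bsub>R'\<^esub> a = c (g \<otimes>\<^bsub>R\<^esub> f)" using P.Icarr by simp
      then show ?thesis using fg P.I_l_closed by blast
    qed
    show "carrier R' \<noteq> c ` P"
    proof
      assume "carrier R' = c ` P"
      then have "c \<one>\<^bsub>R\<^esub> \<in> c ` P" by auto
      then have "\<one>\<^bsub>R\<^esub> \<in> P" using mem[of "\<one>\<^bsub>R\<^esub>"] by simp
      then show False using P.one_imp_carrier P.I_notcarr by auto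
    qed
    fix a b assume ab: "a \<in> carrier R'" "b \<in> carrier R'" "a \<otimes>\<^bsub>R'\<^esub> b \<in> c ` P"
    then obtain f g where fg: "f \<in> carrier R" "a = c f" "g \<in> carrier R" "b = c g"
      unfolding surj[symmetric] by blast
    then have "c (f \<otimes>\<^bsub>R\<^esub> g) \<in> c ` P" using ab(3) by simp
    then have "f \<otimes>\<^bsub>R\<^esub> g \<in> P" using mem[of "f \<otimes>\<^bsub>R\<^esub> g"] fg by simp
    then show "a \<in> c ` P \<or> b \<in> c ` P" using P.I_prime fg by blast
  qed
qed

text \<open>\<open>affine_open\<close> matches points with primes of the section ring, and along the
  surjection \<open>\<phi>\<close> these are the primes of the polynomial ring above its kernel. The
  existence of the origin rests on this.\<close>

lemma affine_coords_points:
  assumes X: "locally_ringed_kspace X" and ac: "affine_coords n I X U \<phi>"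
    and P: "primeideal P (poly_ring n)" "I \<subseteq> P"
  shows "\<exists>!p. p \<in> U \<and> {f \<in> pcarr n. \<phi> f p \<in> max_ideal (stalk X p)} = P"
proof -
  interpret \<phi>: ring_hom_cring "poly_ring n" "sec_ring X U" \<phi> by (rule affine_coords_cring_hom[OF X ac])
  have surj: "\<phi> ` pcarr n = sec X U" using ac by (simp add: affine_coords_def)
  have ker: "{f \<in> pcarr n. \<phi> f = \<zero>\<^bsub>sec_ring X U\<^esub>} \<subseteq> P" using P(2) affine_coords_ker[OF ac] by simp
  note im = primeideal_image[OF \<phi>.ring_hom_cring_axioms _ P(1) ker, unfolded sec_ring_simps(1), OF surj]
  have bij: "bij_betw (prime_of X U) U (prime_spectrum (sec_ring X U))"
    using ac by (simp add: affine_coords_def affine_open_def)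
  have of_P: "prime_of X U p = \<phi> ` {f \<in> pcarr n. \<phi> f p \<in> max_ideal (stalk X p)}" for p
    unfolding prime_of_def surj[symmetric] by blast
  have "\<phi> ` P \<in> prime_spectrum (sec_ring X U)" using im(1) by (simp add: prime_spectrum_def)
  then obtain p where p: "p \<in> U" "prime_of X U p = \<phi> ` P" using bij unfolding bij_betw_def by (metis imageE)
  have "{f \<in> pcarr n. \<phi> f p \<in> max_ideal (stalk X p)} = P"
  proof (intro equalityI subsetI)
    fix f assume f: "f \<in> {f \<in> pcarr n. \<phi> f p \<in> max_ideal (stalk X p)}"
    then have "\<phi> f \<in> \<phi> ` P" using p(2) of_P by blast
    then show "f \<in> P" using im(2) f by blast
  next
    fix f assume f: "f \<in> P"
    then have fc: "f \<in> pcarr n" using P(1) by (meson ideal.Icarr primeideal.axioms(1))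
    have "\<phi> f \<in> prime_of X U p" using f p(2) by blast
    then show "f \<in> {f \<in> pcarr n. \<phi> f p \<in> max_ideal (stalk X p)}" using fc by (simp add: prime_of_def)
  qed
  then show ?thesis
  proof (intro ex1I[of _ p] conjI p(1))
    fix q assume q: "q \<in> U \<and> {f \<in> pcarr n. \<phi> f q \<in> max_ideal (stalk X q)} = P"
    then have "prime_of X U q = prime_of X U p" using of_P p(2) by simp
    then show "q = p" using bij p(1) q by (meson bij_betw_def inj_onD)
  qed
qed

section \<open>Regular coordinates\<close>

text \<open>\<open>regular_coords\<close> is split into independence and spanning in
  \<open>m/m^2\<close>, so that a system can grow one element at a time while independence is
  kept.\<close>

definition indep_mod_sq :: "'a ring \<Rightarrow> nat \<Rightarrow> (nat \<Rightarrow> 'a) \<Rightarrow> bool" where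
  "indep_mod_sq R r y \<longleftrightarrow> (\<forall>i<r. y i \<in> max_ideal R) \<and>
     (\<forall>c\<in>{..<r} \<rightarrow> carrier R.
        (\<Oplus>\<^bsub>R\<^esub>i\<in>{..<r}. c i \<otimes>\<^bsub>R\<^esub> y i) \<in> ideal_prod R (max_ideal R) (max_ideal R) \<longrightarrow>
        (\<forall>i<r. c i \<in> max_ideal R))"

definition span_mod_sq :: "'a ring \<Rightarrow> nat \<Rightarrow> (nat \<Rightarrow> 'a) \<Rightarrow> 'a set" where
  "span_mod_sq R r y = {u \<in> carrier R. \<exists>c\<in>{..<r} \<rightarrow> carrier R.
        u \<ominus>\<^bsub>R\<^esub> (\<Oplus>\<^bsub>R\<^esub>i\<in>{..<r}. c i \<otimes>\<^bsub>R\<^esub> y i) \<in> ideal_prod R (max_ideal R) (max_ideal R)}"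

context
  fixes R :: "'a ring" (structure)
  assumes cr: "cring R" and M: "ideal (max_ideal R) R"
begin

interpretation cring R by (rule cr)
interpretation M: ideal "max_ideal R" R by (rule M)
interpretation Q: ideal "ideal_prod R (max_ideal R) (max_ideal R)" R
  by (rule ideal_prod_is_ideal[OF M M])

lemma finsum_scale:
  assumes "a \<in> carrier R" "c \<in> {..<(r::nat)} \<rightarrow> carrier R" "\<And>i. i < r \<Longrightarrow> y i \<in> carrier R"
  shows "a \<otimes> (\<Oplus>i\<in>{..<r}. c i \<otimes> y i) = (\<Oplus>i\<in>{..<r}. (a \<otimes> c i) \<otimes> y i)"
proof -
  have cc: "\<And>i. i < r \<Longrightarrow> c i \<in> carrier R" using assms(2) by auto
  have "a \<otimes> (\<Oplus>i\<in>{..<r}. c i \<otimes> y i) = (\<Oplus>i\<in>{..<r}. a \<otimes> (c i \<otimes> y i))"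
    by (rule finsum_rdistr) (use assms cc in auto)
  also have "\<dots> = (\<Oplus>i\<in>{..<r}. (a \<otimes> c i) \<otimes> y i)"
    by (rule add.finprod_cong') (use assms cc in \<open>auto simp: m_assoc\<close>)
  finally show ?thesis .
qed

lemma ideal_span_mod_sq:
  assumes y: "\<And>i. i < r \<Longrightarrow> y i \<in> carrier R"
  shows "ideal (span_mod_sq R r y) R"
proof (rule idealI_closed)
  let ?s = "\<lambda>c. \<Oplus>i\<in>{..<r}. c i \<otimes> y i"
  have sc: "?s c \<in> carrier R" if "c \<in> {..<r} \<rightarrow> carrier R" for c
    using that y by (intro finsum_closed) auto
  have "?s (\<lambda>_. \<zero>) = (\<Oplus>i\<in>{..<r}. \<zero>)" by (rule add.finprod_cong') (use y in auto)
  then have "\<zero> \<ominus> ?s (\<lambda>_. \<zero>) = \<zero>" by (simp add: a_minus_def)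
  then have "\<zero> \<ominus> ?s (\<lambda>_. \<zero>) \<in> ideal_prod R (max_ideal R) (max_ideal R)" using Q.zero_closed by simp
  then show "\<zero> \<in> span_mod_sq R r y"
    unfolding span_mod_sq_def by (intro CollectI conjI bexI[of _ "\<lambda>_. \<zero>"]) auto
  fix a b assume "a \<in> span_mod_sq R r y" "b \<in> span_mod_sq R r y"
  then obtain c d where *: "a \<in> carrier R" "b \<in> carrier R" "c \<in> {..<r} \<rightarrow> carrier R" "d \<in> {..<r} \<rightarrow> carrier R"
    "a \<ominus> ?s c \<in> ideal_prod R (max_ideal R) (max_ideal R)" "b \<ominus> ?s d \<in> ideal_prod R (max_ideal R) (max_ideal R)"
    by (auto simp: span_mod_sq_def)
  have cd: "\<And>i. i < r \<Longrightarrow> c i \<in> carrier R" "\<And>i. i < r \<Longrightarrow> d i \<in> carrier R" using * by auto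
  have "?s (\<lambda>i. c i \<oplus> d i) = (\<Oplus>i\<in>{..<r}. c i \<otimes> y i \<oplus> d i \<otimes> y i)"
    by (rule add.finprod_cong') (use y cd in \<open>auto simp: l_distr\<close>)
  also have "\<dots> = ?s c \<oplus> ?s d" by (rule finsum_addf) (use y cd in auto)
  finally have e: "?s (\<lambda>i. c i \<oplus> d i) = ?s c \<oplus> ?s d" .
  have "(a \<ominus> ?s c) \<oplus> (b \<ominus> ?s d) = (a \<oplus> b) \<ominus> ?s (\<lambda>i. c i \<oplus> d i)"
    unfolding e using *(1,2) sc[OF *(3)] sc[OF *(4)] by (simp add: a_minus_def minus_add a_ac)
  then have "(a \<oplus> b) \<ominus> ?s (\<lambda>i. c i \<oplus> d i) \<in> ideal_prod R (max_ideal R) (max_ideal R)"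
    using Q.add_mem[OF *(5,6)] by simp
  then show "a \<oplus> b \<in> span_mod_sq R r y"
    unfolding span_mod_sq_def using *(1,2) cd
    by (intro CollectI conjI bexI[of _ "\<lambda>i. c i \<oplus> d i"]) auto
next
  let ?s = "\<lambda>c. \<Oplus>i\<in>{..<r}. c i \<otimes> y i"
  fix a x assume "a \<in> span_mod_sq R r y" and x: "x \<in> carrier R"
  then obtain c where *: "a \<in> carrier R" "c \<in> {..<r} \<rightarrow> carrier R"
    "a \<ominus> ?s c \<in> ideal_prod R (max_ideal R) (max_ideal R)" by (auto simp: span_mod_sq_def)
  have sc: "?s c \<in> carrier R" using *(2) y by (intro finsum_closed) auto
  have "x \<otimes> (a \<ominus> ?s c) = x \<otimes> a \<ominus> x \<otimes> ?s c"
    using x *(1) sc by (simp add: a_minus_def r_distr r_minus)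
  then have "x \<otimes> a \<ominus> ?s (\<lambda>i. x \<otimes> c i) \<in> ideal_prod R (max_ideal R) (max_ideal R)"
    using Q.I_l_closed[OF *(3) x] finsum_scale[OF x *(2) y] by simp
  then show "x \<otimes> a \<in> span_mod_sq R r y"
    unfolding span_mod_sq_def using *(1,2) x
    by (intro CollectI conjI bexI[of _ "\<lambda>i. x \<otimes> c i"]) auto
qed (auto simp: span_mod_sq_def)

lemma span_mod_sq_gen:
  assumes y: "\<And>i. i < r \<Longrightarrow> y i \<in> carrier R" and j: "j < r"
  shows "y j \<in> span_mod_sq R r y"
proof -
  have "(\<Oplus>i\<in>{..<r}. (if i = j then \<one> else \<zero>) \<otimes> y i) = (\<Oplus>i\<in>{..<r}. if j = i then y i else \<zero>)"
    by (rule add.finprod_cong') (use y in auto)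
  also have "\<dots> = y j" using j y by (intro add.finprod_singleton) auto
  finally show ?thesis unfolding span_mod_sq_def
    using y[OF j] Q.zero_closed
    by (intro CollectI conjI bexI[of _ "\<lambda>i. if i = j then \<one> else \<zero>"]) (auto simp: a_minus_def r_neg)
qed

lemma finsum_lessThan_Suc:
  assumes "\<And>i. i < Suc r \<Longrightarrow> f i \<in> carrier R"
  shows "(\<Oplus>i\<in>{..<Suc r}. f i) = f r \<oplus> (\<Oplus>i\<in>{..<r}. f i)"
  unfolding lessThan_Suc by (rule finsum_insert) (use assms in auto)

text \<open>In a relation modulo \<open>m^2\<close> the coefficient of \<open>g\<close> cannot be a
  unit, since dividing by it would put \<open>g\<close> into the span. So that term lies in
  \<open>m^2\<close> itself and the old independence applies.\<close>

lemma indep_mod_sq_Suc: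
  assumes ind: "indep_mod_sq R r y" and g: "g \<in> max_ideal R" "g \<notin> span_mod_sq R r y"
  shows "indep_mod_sq R (Suc r) (y(r := g))"
  unfolding indep_mod_sq_def
proof (intro conjI ballI impI)
  let ?Q = "ideal_prod R (max_ideal R) (max_ideal R)"
  have ym: "\<And>i. i < r \<Longrightarrow> y i \<in> max_ideal R" using ind by (simp add: indep_mod_sq_def)
  show "\<forall>i<Suc r. (y(r := g)) i \<in> max_ideal R" using ym g(1) by (auto simp: less_Suc_eq)
  fix c assume c: "c \<in> {..<Suc r} \<rightarrow> carrier R"
    and s: "(\<Oplus>i\<in>{..<Suc r}. c i \<otimes> (y(r := g)) i) \<in> ?Q"
  have cc: "\<And>i. i \<le> r \<Longrightarrow> c i \<in> carrier R" using c by auto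
  have yc: "\<And>i. i < r \<Longrightarrow> y i \<in> carrier R" using ym M.Icarr by blast
  have gc: "g \<in> carrier R" using g(1) M.Icarr by blast
  define t where "t = (\<Oplus>i\<in>{..<r}. c i \<otimes> y i)"
  have tc: "t \<in> carrier R" unfolding t_def using cc yc by (intro finsum_closed) auto
  have "(\<Oplus>i\<in>{..<r}. c i \<otimes> (y(r := g)) i) = t"
    unfolding t_def by (rule add.finprod_cong') (use cc yc in auto)
  moreover have "c i \<otimes> (y(r := g)) i \<in> carrier R" if "i < Suc r" for i
    using that cc yc gc by (auto simp: less_Suc_eq)
  ultimately have q: "c r \<otimes> g \<oplus> t \<in> ?Q"
    using s finsum_lessThan_Suc[of r "\<lambda>i. c i \<otimes> (y(r := g)) i"] by simp
  have "c r \<in> max_ideal R"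
  proof (rule ccontr)
    assume "c r \<notin> max_ideal R"
    then have u: "c r \<in> Units R" using cc by (simp add: max_ideal_def)
    define v where "v = inv (c r)"
    have v: "v \<in> carrier R" "v \<otimes> c r = \<one>" using u by (auto simp: v_def)
    have "v \<otimes> (c r \<otimes> g \<oplus> t) = (v \<otimes> c r) \<otimes> g \<oplus> v \<otimes> t"
      using v(1) cc[of r] gc tc by (simp add: r_distr m_assoc)
    also have "\<dots> = g \<ominus> (\<ominus> v) \<otimes> t" using v gc tc by (simp add: a_minus_def l_minus)
    also have "(\<ominus> v) \<otimes> t = (\<Oplus>i\<in>{..<r}. ((\<ominus> v) \<otimes> c i) \<otimes> y i)"
      unfolding t_def using v(1) cc yc by (intro finsum_scale) auto
    finally have "g \<ominus> (\<Oplus>i\<in>{..<r}. ((\<ominus> v) \<otimes> c i) \<otimes> y i) \<in> ?Q" using Q.I_l_closed[OF q v(1)] by simp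
    then have "g \<in> span_mod_sq R r y" unfolding span_mod_sq_def using gc cc v(1)
      by (intro CollectI conjI bexI[of _ "\<lambda>i. (\<ominus> v) \<otimes> c i"]) auto
    then show False using g(2) by blast
  qed
  moreover from this have "c r \<otimes> g \<in> ?Q" using g(1) by (rule ideal_prod.prod)
  then have "c r \<otimes> g \<oplus> t \<ominus> c r \<otimes> g \<in> ?Q" using q Q.minus_mem by blast
  then have "t \<in> ?Q" using cc[of r] gc tc by (simp add: a_minus_def a_ac r_neg)
  then have "\<forall>i<r. c i \<in> max_ideal R"
    using ind c unfolding indep_mod_sq_def t_def by (auto simp: Pi_def)
  ultimately show "\<forall>i<Suc r. c i \<in> max_ideal R" by (simp add: less_Suc_eq)
qed

text \<open>Completion to a basis as in linear algebra: the generators of \<open>m\<close> are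
  inspected one by one and kept when they are not yet in the span. The span is an ideal, so in the
  end it contains all of \<open>m\<close>.\<close>

lemma extend_regular_coords:
  assumes ind: "indep_mod_sq R m y" and g: "\<And>i. i < (k::nat) \<Longrightarrow> g i \<in> max_ideal R"
    and gen: "max_ideal R \<subseteq> genideal R (g ` {..<k})"
  shows "\<exists>r y'. m \<le> r \<and> (\<forall>i<m. y' i = y i) \<and> regular_coords R r y'"
proof -
  have "\<exists>r y'. m \<le> r \<and> (\<forall>i<m. y' i = y i) \<and> indep_mod_sq R r y' \<and> (\<forall>i<k'. g i \<in> span_mod_sq R r y')"
    if "k' \<le> k" for k'
    using that
  proof (induction k')
    case 0
    then show ?case using ind by auto
  next
    case (Suc k')
    then obtain r y' where r: "m \<le> r" "\<forall>i<m. y' i = y i" "indep_mod_sq R r y'"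
      "\<forall>i<k'. g i \<in> span_mod_sq R r y'" by auto
    show ?case
    proof (cases "g k' \<in> span_mod_sq R r y'")
      case True
      then show ?thesis using r by (intro exI[of _ r] exI[of _ y']) (auto simp: less_Suc_eq)
    next
      case False
      define yy where "yy = y'(r := g k')"
      have ind': "indep_mod_sq R (Suc r) yy" unfolding yy_def using indep_mod_sq_Suc[OF r(3) g False] Suc.prems by simp
      then have yc: "\<And>i. i < Suc r \<Longrightarrow> yy i \<in> carrier R" unfolding indep_mod_sq_def using M.Icarr by blast
      have "span_mod_sq R r y' \<subseteq> span_mod_sq R (Suc r) yy"
      proof
        fix u assume "u \<in> span_mod_sq R r y'"
        then obtain c where c: "u \<in> carrier R" "c \<in> {..<r} \<rightarrow> carrier R"
          "u \<ominus> (\<Oplus>i\<in>{..<r}. c i \<otimes> y' i) \<in> ideal_prod R (max_ideal R) (max_ideal R)"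
          by (auto simp: span_mod_sq_def)
        let ?c = "c(r := \<zero>)"
        have y'c: "y' i \<in> carrier R" if "i < r" for i using yc[of i] that by (simp add: yy_def)
        have gc: "g k' \<in> carrier R" using yc[of r] by (simp add: yy_def)
        have cc: "c i \<in> carrier R" if "i < r" for i using c(2) that by auto
        have "(\<Oplus>i\<in>{..<Suc r}. ?c i \<otimes> yy i) = ?c r \<otimes> yy r \<oplus> (\<Oplus>i\<in>{..<r}. ?c i \<otimes> yy i)"
          by (rule finsum_lessThan_Suc) (use y'c cc gc in \<open>auto simp: less_Suc_eq yy_def\<close>)
        also have "(\<Oplus>i\<in>{..<r}. ?c i \<otimes> yy i) = (\<Oplus>i\<in>{..<r}. c i \<otimes> y' i)"
          by (rule add.finprod_cong') (use y'c c(2) in \<open>auto simp: yy_def\<close>)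
        finally have "(\<Oplus>i\<in>{..<Suc r}. ?c i \<otimes> yy i) = (\<Oplus>i\<in>{..<r}. c i \<otimes> y' i)"
          using yc[of r] finsum_closed[of "\<lambda>i. c i \<otimes> y' i" "{..<r}"] y'c cc by simp
        then show "u \<in> span_mod_sq R (Suc r) yy" unfolding span_mod_sq_def using c
          by (intro CollectI conjI bexI[of _ ?c]) (auto simp: less_Suc_eq)
      qed
      moreover have "g k' \<in> span_mod_sq R (Suc r) yy" using span_mod_sq_gen[of "Suc r" yy r] yc by (simp add: yy_def)
      moreover have "\<forall>i<m. yy i = y i" using r(1,2) by (simp add: yy_def)
      ultimately show ?thesis using r(1,4) ind'
        by (intro exI[of _ "Suc r"] exI[of _ yy]) (auto simp: less_Suc_eq)
    qed
  qed
  then obtain r y' where r: "m \<le> r" "\<forall>i<m. y' i = y i" "indep_mod_sq R r y'"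
      "\<forall>i<k. g i \<in> span_mod_sq R r y'" by blast
  have yc: "\<And>i. i < r \<Longrightarrow> y' i \<in> carrier R" using r(3) unfolding indep_mod_sq_def using M.Icarr by blast
  have "genideal R (g ` {..<k}) \<subseteq> span_mod_sq R r y'"
    by (rule genideal_minimal[OF ideal_span_mod_sq]) (use yc r(4) in auto)
  then have "max_ideal R \<subseteq> span_mod_sq R r y'" using gen by blast
  then have "regular_coords R r y'"
    using r(3) unfolding regular_coords_def indep_mod_sq_def span_mod_sq_def by blast
  then show ?thesis using r by blast
qed

end

section \<open>The Jacobian criterion at a prime of a polynomial ring\<close>

locale poly_presentation = local_presentation "poly_ring n" S h J
  for n and S :: "'b ring" (structure) and h :: "'k::field_char_0 mpol \<Rightarrow> 'b" and J
begin

lemma pp_pcarr: "f \<in> pp \<Longrightarrow> f \<in> pcarr n" by (simp add: pp_def)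

lemma unit_iff: "f \<in> pcarr n \<Longrightarrow> h f \<in> Units S \<longleftrightarrow> f \<notin> pp"
  by (simp add: pp_def)

interpretation pp: primeideal pp "poly_ring n" by (rule prime_pp)

lemma hom_simps:
  "f \<in> pcarr n \<Longrightarrow> g \<in> pcarr n \<Longrightarrow> h (f * g) = h f \<otimes> h g"
  "f \<in> pcarr n \<Longrightarrow> g \<in> pcarr n \<Longrightarrow> h (f + g) = h f \<oplus> h g"
  "h 1 = \<one>" "h 0 = \<zero>"
  using hom_mult[of f g] hom_add[of f g] hom_one hom_zero by simp_all

lemma pp_mem:
  shows pp_add: "f \<in> pp \<Longrightarrow> g \<in> pp \<Longrightarrow> f + g \<in> pp"
    and pp_mult: "f \<in> pp \<Longrightarrow> g \<in> pcarr n \<Longrightarrow> g * f \<in> pp"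
    and pp_mult': "f \<in> pp \<Longrightarrow> g \<in> pcarr n \<Longrightarrow> f * g \<in> pp"
    and pp_0: "0 \<in> pp" and pp_1: "1 \<notin> pp"
    and pp_diff: "f \<in> pp \<Longrightarrow> g \<in> pp \<Longrightarrow> f - g \<in> pp"
    and pp_prime: "f \<in> pcarr n \<Longrightarrow> g \<in> pcarr n \<Longrightarrow> f * g \<in> pp \<Longrightarrow> f \<in> pp \<or> g \<in> pp"
proof -
  show add: "f \<in> pp \<Longrightarrow> g \<in> pp \<Longrightarrow> f + g \<in> pp" for f g using pp.add_mem[of f g] by simp
  show "f \<in> pp \<Longrightarrow> g \<in> pcarr n \<Longrightarrow> g * f \<in> pp" using pp.I_l_closed[of f g] by simp
  show "f \<in> pp \<Longrightarrow> g \<in> pcarr n \<Longrightarrow> f * g \<in> pp" using pp.I_r_closed[of f g] by simp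
  show "0 \<in> pp" using pp.zero_closed by simp
  show "1 \<notin> pp" using pp.I_notcarr pp.one_imp_carrier by auto
  show "f \<in> pp \<Longrightarrow> g \<in> pp \<Longrightarrow> f - g \<in> pp"
    using pp.minus_mem[of f g] pp_pcarr by simp
  show "f \<in> pcarr n \<Longrightarrow> g \<in> pcarr n \<Longrightarrow> f * g \<in> pp \<Longrightarrow> f \<in> pp \<or> g \<in> pp" using pp.I_prime[of f g] by simp
qed

lemma pp_sum: "finite A \<Longrightarrow> (\<And>i. i \<in> A \<Longrightarrow> f i \<in> pp) \<Longrightarrow> sum f A \<in> pp"
  by (induction A rule: finite_induct) (auto intro: pp_add pp_0)

lemma h_combination_mem:
  assumes Q: "ideal Q S" and "finite A" "\<And>i. i \<in> A \<Longrightarrow> h (y i) \<in> Q" "\<And>i. i \<in> A \<Longrightarrow> y i \<in> pcarr n"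
    "\<And>i. i \<in> A \<Longrightarrow> a i \<in> pcarr n"
  shows "h (\<Sum>i\<in>A. a i * y i) \<in> Q"
  using assms(2-)
proof (induction A rule: finite_induct)
  case empty
  then show ?case using additive_subgroup.zero_closed[OF ideal.axioms(1)[OF Q]] by (simp add: hom_simps)
next
  case (insert i A)
  have "h (a i * y i) \<in> Q" using insert ideal.I_l_closed[OF Q, of "h (y i)" "h (a i)"] by (simp add: hom_simps)
  moreover have "(\<Sum>i\<in>A. a i * y i) \<in> pcarr n" by (rule pcarr_sum) (use insert in auto)
  ultimately show ?case using insert ideal.add_mem[OF Q] by (simp add: hom_simps)
qed

lemma max_ideal_generators:
  "\<exists>k g. (\<forall>i<(k::nat). g i \<in> max_ideal S) \<and> max_ideal S \<subseteq> genideal S (g ` {..<k})"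
proof -
  have "ideal_set (pcarr n) pp" unfolding ideal_set_def using pp_pcarr pp_mem by blast
  then obtain k g where g: "\<forall>i<k. g i \<in> pp" "pp \<subseteq> combs (pcarr n) k g"
    using noetherian_pcarr unfolding noetherian_set_def by blast
  have hg: "h (g i) \<in> max_ideal S" if "i < k" for i using g(1) that h_max pp_pcarr by blast
  let ?G = "genideal S ((h \<circ> g) ` {..<k})"
  have sub: "(h \<circ> g) ` {..<k} \<subseteq> carrier S" using g(1) pp_pcarr hom_closed by auto
  have G: "ideal ?G S" by (rule S.genideal_ideal[OF sub])
  have gG: "h (g i) \<in> ?G" if "i < k" for i using S.genideal_self[OF sub] that by auto
  have "max_ideal S \<subseteq> ?G"
  proof
    fix a assume "a \<in> max_ideal S"
    then obtain f q where fq: "a \<in> carrier S" "f \<in> pp" "q \<in> pcarr n" "h q \<in> Units S" "a \<otimes> h q = h f"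
      unfolding max_ideal_ext ext_def by blast
    obtain c where c: "f = (\<Sum>i<k. c i * g i)" "\<forall>i<k. c i \<in> pcarr n" using g(2) fq(2) by (auto simp: combs_def)
    have "h f \<in> ?G" unfolding c(1)
      by (rule h_combination_mem[OF G]) (use gG g(1) c(2) pp_pcarr in auto)
    then show "a \<in> ?G" using frac_mem_ideal[OF G fq(1,3,4,5)] by blast
  qed
  then show ?thesis using hg by (intro exI[of _ k] exI[of _ "h \<circ> g"] conjI) simp_all
qed

text \<open>\<open>M\<close> consists of the functions that vanish at the point and are killed by
  the tangent vector of \<open>D\<close> there. By the Leibniz rule it is an ideal containing all
  products of two elements of \<open>pp\<close>, and it is stable under division by functions
  outside \<open>pp\<close>, so it passes to the local ring.\<close>

lemma derivation_ideal:
  assumes D: "derivation n D"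
  defines "M \<equiv> {f \<in> pp. D f \<in> pp}"
  shows "ideal M (poly_ring n)" "saturated M" "J \<subseteq> M \<Longrightarrow> ideal_prod S (max_ideal S) (max_ideal S) \<subseteq> ext M"
proof -
  have Dc: "f \<in> pcarr n \<Longrightarrow> D f \<in> pcarr n" for f using D by (auto simp: derivation_def)
  have Da: "f \<in> pcarr n \<Longrightarrow> g \<in> pcarr n \<Longrightarrow> D (f + g) = D f + D g" for f g using D by (auto simp: derivation_def)
  have Dm: "f \<in> pcarr n \<Longrightarrow> g \<in> pcarr n \<Longrightarrow> D (f * g) = D f * g + f * D g" for f g
    using D by (auto simp: derivation_def)
  have D0: "D 0 = 0" using Da[of 0 0] by simp
  show id: "ideal M (poly_ring n)"
  proof (rule R.idealI_closed)
    fix a x :: "'k mpol" assume "a \<in> M" "x \<in> pcarr n"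
    then show "x \<otimes>\<^bsub>poly_ring n\<^esub> a \<in> M"
      using Dm[of x a] Dc[of x] pp_pcarr by (auto simp: M_def intro!: pp_add pp_mult)
  next
    fix a b assume "a \<in> M" "b \<in> M"
    then show "a \<oplus>\<^bsub>poly_ring n\<^esub> b \<in> M"
      using Da[of a b] pp_pcarr by (auto simp: M_def intro!: pp_add)
  qed (auto simp: M_def D0 pp_0 pp_pcarr)
  show "saturated M" unfolding saturated_def
  proof (intro ballI impI)
    fix f g assume f: "f \<in> pcarr n" and g: "g \<in> pcarr n" "h g \<in> Units S" and gf: "g \<otimes>\<^bsub>poly_ring n\<^esub> f \<in> M"
    have gp: "g \<notin> pp" using g unit_iff by blast
    have fp: "f \<in> pp" using gf pp_prime[OF g(1) f] gp by (simp add: M_def)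
    have "D g * f + g * D f \<in> pp" using gf Dm[OF g(1) f] by (simp add: M_def)
    then have "(D g * f + g * D f) - D g * f \<in> pp" by (rule pp_diff) (use pp_mult fp Dc g in blast)
    then have "D f \<in> pp" using pp_prime[OF g(1) Dc[OF f]] gp by simp
    then show "f \<in> M" using fp by (simp add: M_def)
  qed
  assume "J \<subseteq> M"
  have E: "ideal (ext M) S" by (rule ideal_ext[OF id])
  show "ideal_prod S (max_ideal S) (max_ideal S) \<subseteq> ext M"
  proof
    fix u assume "u \<in> ideal_prod S (max_ideal S) (max_ideal S)"
    then show "u \<in> ext M"
    proof (induction rule: ideal_prod.induct)
      case (prod a b)
      then obtain f g f' g' where a: "a \<in> carrier S" "f \<in> pp" "g \<in> pcarr n" "h g \<in> Units S" "a \<otimes> h g = h f"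
        and b: "b \<in> carrier S" "f' \<in> pp" "g' \<in> pcarr n" "h g' \<in> Units S" "b \<otimes> h g' = h f'"
        unfolding max_ideal_ext ext_def by blast
      have "f * f' \<in> pp" "D f * f' + f * D f' \<in> pp"
        by (intro pp_add pp_mult[OF b(2)] pp_mult'[OF a(2)] Dc pp_pcarr a(2) b(2))+
      then have "f * f' \<in> M" using Dm[OF pp_pcarr[OF a(2)] pp_pcarr[OF b(2)]] by (simp add: M_def)
      moreover have "(a \<otimes> b) \<otimes> h (g * g') = h (f * f')"
        unfolding hom_simps(1)[OF a(3) b(3)] hom_simps(1)[OF pp_pcarr[OF a(2)] pp_pcarr[OF b(2)]]
          a(5)[symmetric] b(5)[symmetric]
        by (rule S.mult_fracs[OF a(1) b(1) hom_closed[OF a(3)] hom_closed[OF b(3)]])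
      moreover have "h (g * g') \<in> Units S" unfolding hom_simps(1)[OF a(3) b(3)] using a(4) b(4) by blast
      ultimately show ?case using ext_mem[of "a \<otimes> b" "f * f'" M "g * g'"] a(1,3) b(1,3) by simp
    next
      case (sum s t)
      then show ?case using ideal.add_mem[OF E] by blast
    qed
  qed
qed

text \<open>Let a combination of the \<open>y j\<close> lie in \<open>m^2\<close>. Applying
  \<open>D i\<close> at the point leaves only the \<open>i\<close>-th coefficient times
  \<open>D i (y i)\<close>, and the latter does not vanish there. Derivations act on polynomials, so
  a common denominator of the coefficients is removed beforehand.\<close>

lemma jacobian_independent:
  assumes y: "\<And>i. i < m \<Longrightarrow> y i \<in> pp" and D: "\<And>i. i < m \<Longrightarrow> derivation n (D i)"
    and Dy: "\<And>i j. i < m \<Longrightarrow> j < m \<Longrightarrow> i \<noteq> j \<Longrightarrow> D i (y j) \<in> pp" and Dyy: "\<And>i. i < m \<Longrightarrow> D i (y i) \<notin> pp"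
    and DJ: "\<And>i. i < m \<Longrightarrow> J \<subseteq> {f \<in> pp. D i f \<in> pp}"
  shows "indep_mod_sq S m (\<lambda>i. h (y i))"
  unfolding indep_mod_sq_def
proof (intro conjI ballI impI allI)
  show "h (y i) \<in> max_ideal S" if "i < m" for i using h_max y[OF that] pp_pcarr by blast
  fix c i assume c: "c \<in> {..<m} \<rightarrow> carrier S"
    and s: "(\<Oplus>i\<in>{..<m}. c i \<otimes> h (y i)) \<in> ideal_prod S (max_ideal S) (max_ideal S)" and i: "i < m"
  have cc: "\<And>j. j < m \<Longrightarrow> c j \<in> carrier S" using c by auto
  have "\<exists>g f. g \<in> pcarr n \<and> h g \<in> Units S \<and> (\<forall>j<m. f j \<in> pcarr n \<and> c j \<otimes> h g = h (f j))"
    by (rule common_denominator) (rule cc)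
  then obtain g f where gf0: "g \<in> pcarr n" "h g \<in> Units S"
    "\<forall>j<m. f j \<in> pcarr n \<and> c j \<otimes> h g = h (f j)" by (elim exE conjE)
  have gf: "g \<in> pcarr n" "h g \<in> Units S" "\<And>j. j < m \<Longrightarrow> f j \<in> pcarr n"
    "\<And>j. j < m \<Longrightarrow> c j \<otimes> h g = h (f j)" using gf0 by simp_all
  have yc: "\<And>j. j < m \<Longrightarrow> y j \<in> pcarr n" using y pp_pcarr by blast
  have fin: "(\<Oplus>i\<in>{..<m'}. c i \<otimes> h (y i)) \<in> carrier S" if "m' \<le> m" for m'
    using that cc yc by (intro S.finsum_closed) auto
  have "(\<Oplus>i\<in>{..<m'}. c i \<otimes> h (y i)) \<otimes> h g = h (\<Sum>i<m'. f i * y i)" if "m' \<le> m" for m'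
    using that
  proof (induction m')
    case (Suc m')
    have "(\<Oplus>i\<in>{..<Suc m'}. c i \<otimes> h (y i)) = c m' \<otimes> h (y m') \<oplus> (\<Oplus>i\<in>{..<m'}. c i \<otimes> h (y i))"
      unfolding lessThan_Suc by (rule S.finsum_insert) (use cc yc Suc.prems in auto)
    then have "(\<Oplus>i\<in>{..<Suc m'}. c i \<otimes> h (y i)) \<otimes> h g =
        c m' \<otimes> h (y m') \<otimes> h g \<oplus> (\<Oplus>i\<in>{..<m'}. c i \<otimes> h (y i)) \<otimes> h g"
      using cc[of m'] yc[of m'] gf(1) fin[of m'] Suc.prems by (simp add: S.l_distr)
    also have "c m' \<otimes> h (y m') \<otimes> h g = (c m' \<otimes> h g) \<otimes> h (y m')"
      using cc[of m'] yc[of m'] gf(1) Suc.prems by (simp add: S.m_ac)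
    also have "c m' \<otimes> h g = h (f m')" using gf(4) Suc.prems by simp
    also have "(\<Oplus>i\<in>{..<m'}. c i \<otimes> h (y i)) \<otimes> h g = h (\<Sum>i<m'. f i * y i)" using Suc by simp
    also have "h (f m') \<otimes> h (y m') \<oplus> h (\<Sum>i<m'. f i * y i) = h (f m' * y m' + (\<Sum>i<m'. f i * y i))"
    proof -
      have "(\<Sum>i<m'. f i * y i) \<in> pcarr n" by (rule pcarr_sum) (use gf(3) yc Suc.prems in auto)
      then show ?thesis using gf(3)[of m'] yc[of m'] Suc.prems by (simp add: hom_simps)
    qed
    finally show ?case by (simp add: add.commute)
  qed (use gf(1) in \<open>auto simp: hom_simps\<close>)
  then have eq: "(\<Oplus>i\<in>{..<m}. c i \<otimes> h (y i)) \<otimes> h g = h (\<Sum>i<m. f i * y i)" by blast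
  let ?M = "{f \<in> pp. D i f \<in> pp}"
  note dm = derivation_ideal[OF D[OF i]]
  have sumc: "(\<Sum>i<m. f i * y i) \<in> pcarr n" by (rule pcarr_sum) (use gf(3) yc in auto)
  have E: "ideal (ext ?M) S" by (rule ideal_ext[OF dm(1)])
  have "(\<Oplus>i\<in>{..<m}. c i \<otimes> h (y i)) \<in> ext ?M" using s dm(3)[OF DJ[OF i]] by blast
  then have "h (\<Sum>i<m. f i * y i) \<in> ext ?M" using frac_mem_ideal[OF E fin[OF order_refl] gf(1,2) eq] by blast
  then have "(\<Sum>i<m. f i * y i) \<in> ?M" using ext_contract[OF dm(1) DJ[OF i] dm(2) sumc] by blast
  then have Dsum: "D i (\<Sum>j<m. f j * y j) \<in> pp" by blast
  have Dc: "q \<in> pcarr n \<Longrightarrow> D i q \<in> pcarr n" for q using D[OF i] by (auto simp: derivation_def)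
  have Da: "q \<in> pcarr n \<Longrightarrow> q' \<in> pcarr n \<Longrightarrow> D i (q + q') = D i q + D i q'" for q q'
    using D[OF i] by (auto simp: derivation_def)
  have D0: "D i 0 = 0" using Da[of 0 0] by simp
  have "D i (\<Sum>j<m'. f j * y j) = (\<Sum>j<m'. D i (f j * y j))" if "m' \<le> m" for m'
    using that
  proof (induction m')
    case (Suc m')
    have "(\<Sum>i<m'. f i * y i) \<in> pcarr n" by (rule pcarr_sum) (use gf(3) yc Suc.prems in auto)
    then show ?case using Suc gf(3) yc Da by simp
  qed (simp add: D0)
  then have "D i (\<Sum>j<m. f j * y j) = (\<Sum>j<m. D i (f j * y j))" by blast
  also have "\<dots> = D i (f i * y i) + (\<Sum>j\<in>{..<m} - {i}. D i (f j * y j))"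
    using i by (intro sum.remove) auto
  finally have e: "D i (\<Sum>j<m. f j * y j) - (\<Sum>j\<in>{..<m} - {i}. D i (f j * y j)) = D i (f i * y i)" by simp
  have Dm: "D i (f j * y j) = D i (f j) * y j + f j * D i (y j)" if "j < m" for j
    using D[OF i] gf(3)[OF that] yc[OF that] by (auto simp: derivation_def)
  have "(\<Sum>j\<in>{..<m} - {i}. D i (f j * y j)) \<in> pp"
  proof (rule pp_sum)
    fix j assume "j \<in> {..<m} - {i}"
    then have j: "j < m" "i \<noteq> j" by auto
    show "D i (f j * y j) \<in> pp" unfolding Dm[OF j(1)]
      by (intro pp_add pp_mult y[OF j(1)] Dy[OF i j] Dc gf(3)[OF j(1)])
  qed simp
  then have "D i (f i * y i) \<in> pp" unfolding e[symmetric] by (rule pp_diff[OF Dsum])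
  then have "D i (f i * y i) - D i (f i) * y i \<in> pp"
    by (rule pp_diff[OF _ pp_mult[OF y[OF i] Dc[OF gf(3)[OF i]]]])
  then have "f i * D i (y i) \<in> pp" using Dm[OF i] by simp
  then have "f i \<in> pp" using pp_prime[OF gf(3)[OF i] Dc[OF yc[OF i]]] Dyy[OF i] by blast
  then have "c i \<in> ext pp" using ext_mem[OF cc[OF i] _ gf(1,2) gf(4)[OF i]] by blast
  then show "c i \<in> max_ideal S" by (simp only: max_ideal_ext)
qed

text \<open>The generators need to produce \<open>f\<close> only up to a factor \<open>g\<close>
  outside \<open>pp\<close>, as \<open>g\<close> is a unit at the point. At the triple points this
  factor is the coordinate \<open>w\<close>.\<close>

lemma ext_eq_genideal:
  assumes P: "ideal P (poly_ring n)" and T: "finite T" and y: "\<And>j. j \<in> T \<Longrightarrow> y j \<in> P"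
    and gen: "\<And>f. f \<in> P \<Longrightarrow> \<exists>g\<in>pcarr n. g \<notin> pp \<and> (\<exists>a. (\<forall>j\<in>T. a j \<in> pcarr n) \<and> g * f = (\<Sum>j\<in>T. a j * y j))"
  shows "ext P = genideal S ((\<lambda>j. h (y j)) ` T)"
proof -
  have yc: "\<And>j. j \<in> T \<Longrightarrow> y j \<in> pcarr n" using y ideal.Icarr[OF P] by blast
  have sub: "(\<lambda>j. h (y j)) ` T \<subseteq> carrier S" using yc by auto
  have G: "ideal (genideal S ((\<lambda>j. h (y j)) ` T)) S" by (rule S.genideal_ideal[OF sub])
  show ?thesis
  proof (intro equalityI)
    show "genideal S ((\<lambda>j. h (y j)) ` T) \<subseteq> ext P"
      by (rule S.genideal_minimal[OF ideal_ext[OF P]]) (use y yc ext_h in auto)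
    show "ext P \<subseteq> genideal S ((\<lambda>j. h (y j)) ` T)"
    proof
      fix u assume "u \<in> ext P"
      then obtain f q where fq: "u \<in> carrier S" "f \<in> P" "q \<in> pcarr n" "h q \<in> Units S" "u \<otimes> h q = h f"
        unfolding ext_def by blast
      obtain g a where g: "g \<in> pcarr n" "g \<notin> pp" "\<forall>j\<in>T. a j \<in> pcarr n" "g * f = (\<Sum>j\<in>T. a j * y j)"
        using gen[OF fq(2)] by blast
      have fc: "f \<in> pcarr n" using fq(2) ideal.Icarr[OF P] by blast
      have "h (g * f) \<in> genideal S ((\<lambda>j. h (y j)) ` T)" unfolding g(4)
        by (rule h_combination_mem[OF G T]) (use S.genideal_self[OF sub] yc g(3) in auto)
      moreover have "u \<otimes> h (q * g) = h (g * f)"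
      proof -
        have "u \<otimes> h (q * g) = (u \<otimes> h q) \<otimes> h g" using fq(1,3) g(1) by (simp add: hom_simps S.m_assoc)
        then show ?thesis using fq(5) g(1) fc by (simp add: hom_simps S.m_comm)
      qed
      moreover have "q * g \<in> pcarr n" "h (q * g) \<in> Units S"
        using fq(3,4) g(1,2) unit_iff[of g] by (auto simp: hom_simps)
      ultimately show "u \<in> genideal S ((\<lambda>j. h (y j)) ` T)" using frac_mem_ideal[OF G fq(1)] by blast
    qed
  qed
qed

end

section \<open>Embeddings in affine space\<close>

lemma coord_class_hom:
  fixes fs :: "'k::field_char_0 mpol list"
  assumes "set fs \<subseteq> pcarr n"
  shows "ring_hom_cring (poly_ring n) (coord_ring n fs) (coord_class n fs)"
    and "coord_class n fs ` pcarr n = carrier (coord_ring n fs)"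
    and "{f \<in> pcarr n. coord_class n fs f = \<zero>\<^bsub>coord_ring n fs\<^esub>} = genideal (poly_ring n) (set fs)"
proof -
  interpret P: cring "poly_ring n :: 'k mpol ring" by (rule cring_poly_ring)
  interpret I: ideal "genideal (poly_ring n) (set fs)" "poly_ring n" by (rule P.genideal_ideal[OF assms])
  have cc: "coord_class n fs = (+>\<^bsub>poly_ring n\<^esub>) (genideal (poly_ring n) (set fs))"
    by (intro ext) (simp add: coord_class_def)
  show "ring_hom_cring (poly_ring n) (coord_ring n fs) (coord_class n fs)"
    unfolding cc coord_ring_def by (rule I.rcos_ring_hom_cring[OF P.is_cring])
  show "coord_class n fs ` pcarr n = carrier (coord_ring n fs)"
    unfolding cc coord_ring_def by (auto simp: FactRing_def A_RCOSETS_defs a_r_coset_def)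
  show "{f \<in> pcarr n. coord_class n fs f = \<zero>\<^bsub>coord_ring n fs\<^esub>} = genideal (poly_ring n) (set fs)"
  proof (intro equalityI subsetI)
    fix f assume f: "f \<in> {f \<in> pcarr n. coord_class n fs f = \<zero>\<^bsub>coord_ring n fs\<^esub>}"
    then have "genideal (poly_ring n) (set fs) +>\<^bsub>poly_ring n\<^esub> f = genideal (poly_ring n) (set fs)"
      by (simp add: cc coord_ring_def FactRing_def)
    then show "f \<in> genideal (poly_ring n) (set fs)" using I.rcos_const_imp_mem f by blast
  next
    fix f assume f: "f \<in> genideal (poly_ring n) (set fs)"
    then have "f \<in> pcarr n" by (rule I.Icarr)
    then show "f \<in> {f \<in> pcarr n. coord_class n fs f = \<zero>\<^bsub>coord_ring n fs\<^esub>}"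
      using I.a_rcos_const[OF f] by (simp add: cc coord_ring_def FactRing_def)
  qed
qed

lemma germ_presentation:
  fixes fs :: "'k::field_char_0 mpol list"
  assumes fs: "set fs \<subseteq> pcarr n" and z: "primeideal z (coord_ring n fs)"
  defines "h \<equiv> \<lambda>f. fraction (coord_ring n fs) (carrier (coord_ring n fs) - z) (coord_class n fs f) \<one>\<^bsub>coord_ring n fs\<^esub>"
  shows "local_presentation (poly_ring n) (germ_ring n fs z) h (genideal (poly_ring n) (set fs))"
    and "{f \<in> pcarr n. h f \<notin> Units (germ_ring n fs z)} = {f \<in> pcarr n. coord_class n fs f \<in> z}"
proof -
  interpret c: ring_hom_cring "poly_ring n" "coord_ring n fs" "coord_class n fs" by (rule coord_class_hom[OF fs])
  note l = local_presentation_localization[OF c.S.is_cring z, folded germ_ring_def]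
  have "local_presentation (poly_ring n) (germ_ring n fs z) h {f \<in> pcarr n. coord_class n fs f \<in> {\<zero>\<^bsub>coord_ring n fs\<^esub>}}"
    unfolding h_def by (rule local_presentation_compose[OF l(1) c.R.is_cring c.homh coord_class_hom(2)[OF fs]])
  then show "local_presentation (poly_ring n) (germ_ring n fs z) h (genideal (poly_ring n) (set fs))"
    using coord_class_hom(3)[OF fs] by simp
  show "{f \<in> pcarr n. h f \<notin> Units (germ_ring n fs z)} = {f \<in> pcarr n. coord_class n fs f \<in> z}"
    using l(2) c.hom_closed unfolding h_def by blast
qed

lemma genideal_empty: "genideal (poly_ring n) {} = {0 :: 'k::field_char_0 mpol}"
proof -
  interpret P: cring "poly_ring n :: 'k mpol ring" by (rule cring_poly_ring)
  have "genideal (poly_ring n) {} \<subseteq> {0 :: 'k mpol}"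
    using P.genideal_minimal[OF P.zeroideal, of "{}"] by simp
  moreover have "\<zero>\<^bsub>poly_ring n\<^esub> \<in> genideal (poly_ring n) ({} :: 'k mpol set)"
    using P.genideal_ideal[of "{}"] by (simp add: ideal_def additive_subgroup.zero_closed del: poly_ring_simps)
  ultimately show ?thesis by auto
qed

text \<open>For the empty list of equations the Jacobian condition is vacuous, so each prime of the
  polynomial ring, closed point or not, is a smooth point and gives a local ring without
  relations.\<close>

lemma affine_space_germ:
  fixes P :: "'k::field_char_0 mpol set"
  assumes P: "primeideal P (poly_ring n)"
  obtains z h where "smooth_point n [] z" "poly_presentation n (germ_ring n [] z) h {0}"
    "{f \<in> pcarr n. h f \<notin> Units (germ_ring n [] z)} = P" "\<And>c. germ_const n [] z c = h (mconst c)"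
proof -
  define z where "z = coord_class n [] ` P"
  have fs: "set [] \<subseteq> pcarr n" by simp
  interpret c: ring_hom_cring "poly_ring n" "coord_ring n ([] :: 'k mpol list)" "coord_class n []" by (rule coord_class_hom[OF fs])
  have ker: "{f \<in> pcarr n. coord_class n [] f = \<zero>\<^bsub>coord_ring n []\<^esub>} \<subseteq> P"
    unfolding coord_class_hom(3)[OF fs] set_simps(1) genideal_empty
    using additive_subgroup.zero_closed[OF ideal.axioms(1)[OF primeideal.axioms(1)[OF P]]] by simp
  note im = primeideal_image[OF c.ring_hom_cring_axioms coord_class_hom(2)[OF fs] P ker, folded z_def]
  define h where "h f = fraction (coord_ring n []) (carrier (coord_ring n []) - z) (coord_class n [] f) \<one>\<^bsub>coord_ring n []\<^esub>"
    for f :: "'k mpol"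
  note g = germ_presentation[OF fs im(1), folded h_def]
  show thesis
  proof (rule that[of z h])
    show "smooth_point n [] z" unfolding smooth_point_def using im(1) by simp
    show "poly_presentation n (germ_ring n [] z) h {0}"
      unfolding poly_presentation_def using g(1) by (simp add: genideal_empty)
    have "P \<subseteq> pcarr n" using P by (meson ideal.Icarr primeideal.axioms(1) subsetI)
    then show "{f \<in> pcarr n. h f \<notin> Units (germ_ring n [] z)} = P" using g(2) im(2) by auto
    show "germ_const n [] z c = h (mconst c)" for c by (simp add: germ_const_def h_def)
  qed
qed

text \<open>The embedding space is affine space. The functions \<open>y\<^sub>j\<close> are part of a regular system of
  coordinates by the Jacobian criterion, since the matrix \<open>D\<^sub>i y\<^sub>j\<close> is diagonal and invertible.\<close>

lemma snc_pair_criterion: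
  fixes X :: "('p, 's, 'k::field_char_0) kspace" and P :: "nat \<Rightarrow> 'k mpol set" and m k :: nat
  assumes X: "locally_ringed_kspace X" and ac: "affine_coords n J X U \<phi>" and p: "p \<in> U"
    and pp: "pp = {f \<in> pcarr n. \<phi> f p \<notin> Units (stalk X p)}"
    and P: "\<And>i. i < k \<Longrightarrow> primeideal (P i) (poly_ring n)" and J: "J = {f \<in> pcarr n. \<forall>i<k. f \<in> P i}"
    and y: "\<And>i. i < m \<Longrightarrow> y i \<in> pp" and D: "\<And>i. i < m \<Longrightarrow> derivation n (D i)"
    and Dy: "\<And>i j. i < m \<Longrightarrow> j < m \<Longrightarrow> i \<noteq> j \<Longrightarrow> D i (y j) \<in> pp" and Dyy: "\<And>i. i < m \<Longrightarrow> D i (y i) \<notin> pp"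
    and T: "\<And>i. i < k \<Longrightarrow> P i \<subseteq> pp \<Longrightarrow> \<exists>T\<subseteq>{..<m}. Q \<inter> T = {} \<and> (\<forall>j\<in>T. y j \<in> P i) \<and>
      (\<forall>f\<in>P i. \<exists>g\<in>pcarr n. g \<notin> pp \<and> (\<exists>a. (\<forall>j\<in>T. a j \<in> pcarr n) \<and> g * f = (\<Sum>j\<in>T. a j * y j)))"
    and Q: "Q \<subseteq> {..<m}" and W: "openin (sp X) W" "p \<in> W" "W \<subseteq> U"
    and E: "\<And>\<xi>. \<xi> \<in> W \<Longrightarrow> prime_divisor X \<xi> \<Longrightarrow> E \<xi> = (\<Sum>j\<in>Q. \<alpha> j * div_of X (\<phi> (y j)) \<xi>)"
  shows "snc_pair_at X E p"
proof -
  interpret B: poly_presentation n "stalk X p" "\<lambda>f. \<phi> f p" J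
    unfolding poly_presentation_def by (rule affine_coords_presentation[OF X ac p])
  have pp_B: "pp = B.pp" by (simp add: B.pp_def pp)
  have pr: "primeideal pp (poly_ring n)" using B.prime_pp pp_B by simp
  obtain z h where z: "smooth_point n [] z" and hp: "poly_presentation n (germ_ring n [] z) h {0}"
    and hu: "{f \<in> pcarr n. h f \<notin> Units (germ_ring n [] z)} = pp" and hc: "\<And>c. germ_const n [] z c = h (mconst c)"
    by (rule affine_space_germ[OF pr]) blast
  define R where "R = germ_ring n [] z"
  interpret A: poly_presentation n R h "{0}" unfolding R_def by (rule hp)
  have pp_A: "pp = A.pp" unfolding A.pp_def by (rule hu[folded R_def, symmetric])
  have U_iff: "h g \<in> Units R \<longleftrightarrow> \<phi> g p \<in> Units (stalk X p)" if "g \<in> pcarr n" for g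
    using A.unit_iff[OF that] B.unit_iff[OF that] pp_A pp_B by simp
  have J0: "{0} \<subseteq> J"
    using additive_subgroup.zero_closed[OF ideal.axioms(1)[OF B.ideal_J]] by simp
  obtain \<theta> where th: "\<theta> \<in> ring_hom R (stalk X p)" "\<And>f. f \<in> pcarr n \<Longrightarrow> \<theta> (h f) = \<phi> f p"
    "\<theta> ` carrier R = carrier (stalk X p)"
    by (rule local_presentation_hom[OF A.local_presentation_axioms B.local_presentation_axioms J0 U_iff]) blast+
  have "\<theta> (germ_const n [] z c) = scalar X p c" for c
    using th(2)[of "mconst c"] ac p by (simp add: hc affine_coords_def)
  then have emb: "smooth_embedding X p n [] z \<theta>" unfolding smooth_embedding_def using z th by (simp add: R_def)
  have ind: "indep_mod_sq R m (\<lambda>i. h (y i))"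
  proof (rule A.jacobian_independent[where D = D])
    fix i assume i: "i < m"
    have "D i (0 + 0) = D i 0 + D i 0" using D[OF i] unfolding derivation_def by blast
    then show "{0} \<subseteq> {f \<in> A.pp. D i f \<in> A.pp}" using A.pp_0 by simp
  qed (simp_all only: pp_A[symmetric] y D Dy Dyy not_False_eq_True)
  obtain k' g where g: "\<forall>i<(k'::nat). g i \<in> max_ideal R" "max_ideal R \<subseteq> genideal R (g ` {..<k'})"
    using A.max_ideal_generators by blast
  obtain r y' where r: "m \<le> r" "\<forall>i<m. y' i = h (y i)" "regular_coords R r y'"
    using extend_regular_coords[OF A.S.is_cring A.ideal_max ind _ g(2)] g(1) by blast
  have JP: "\<And>i. i < k \<Longrightarrow> J \<subseteq> P i" using J by blast
  \<comment> \<open>Preimages under \<open>\<theta>\<close> are compared through fractions: an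
    element with numerator \<open>f\<close> is sent into the component \<open>P'\<close> exactly if
    \<open>f\<close> lies in the ideal \<open>P i\<close> of the plane, and such fractions form the
    extension of \<open>P i\<close> to the ambient germ.\<close>
  have comp: "\<exists>T\<subseteq>{..<m}. Q \<inter> T = {} \<and> {u \<in> carrier R. \<theta> u \<in> P'} = genideal R (y' ` T)"
    if P': "P' \<in> minimal_primes (stalk X p)" for P'
  proof -
    obtain i where i: "i < k" "P i \<subseteq> pp" "P' = B.ext (P i)"
      using B.minimal_primes_ext[of k P P', OF P JP _ P'] J pp_B by blast
    have Pi: "ideal (P i) (poly_ring n)" using P[OF i(1)] by (rule primeideal.axioms(1))
    obtain T where T': "T \<subseteq> {..<m}" "Q \<inter> T = {}" "\<forall>j\<in>T. y j \<in> P i"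
      "\<forall>f\<in>P i. \<exists>g\<in>pcarr n. g \<notin> pp \<and> (\<exists>a. (\<forall>j\<in>T. a j \<in> pcarr n) \<and> g * f = (\<Sum>j\<in>T. a j * y j))"
      using T[OF i(1,2)] by blast
    have Tf: "finite T" using T'(1) finite_subset by blast
    have "A.ext (P i) = genideal R ((\<lambda>j. h (y j)) ` T)"
      by (rule A.ext_eq_genideal[OF Pi Tf]) (use T'(3,4) pp_A in blast)+
    also have "(\<lambda>j. h (y j)) ` T = y' ` T" using r(2) T'(1) by (intro image_cong) auto
    finally have e: "A.ext (P i) = genideal R (y' ` T)" .
    have con: "\<phi> f p \<in> P' \<longleftrightarrow> f \<in> P i" if "f \<in> pcarr n" for f
      using B.ext_contract[OF Pi JP[OF i(1)] B.saturated_prime[OF P[OF i(1)]] that] i pp_B by simp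
    have P'id: "ideal P' (stalk X p)" using P' by (simp add: minimal_primes_def primeideal.axioms(1))
    have "\<theta> u \<in> P' \<longleftrightarrow> u \<in> A.ext (P i)" if u: "u \<in> carrier R" for u
    proof
      obtain f q where fq: "f \<in> pcarr n" "q \<in> pcarr n" "h q \<in> Units R" "u \<otimes>\<^bsub>R\<^esub> h q = h f"
        using A.frac[OF u] by blast
      have "\<theta> u \<otimes>\<^bsub>stalk X p\<^esub> \<phi> q p = \<phi> f p"
        using ring_hom_mult[OF th(1) u, of "h q"] fq th(2) by simp
      moreover assume "\<theta> u \<in> P'"
      ultimately have "\<phi> f p \<in> P'"
        using B.frac_mem_ideal[OF P'id _ fq(2), of "\<theta> u" f] th(3) u fq U_iff by blast
      then have "f \<in> P i" using con fq(1) by blast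
      then show "u \<in> A.ext (P i)" using A.ext_mem[OF u _ fq(2,3,4)] by blast
    next
      assume "u \<in> A.ext (P i)"
      then obtain f q where fq: "f \<in> P i" "q \<in> pcarr n" "h q \<in> Units R" "u \<otimes>\<^bsub>R\<^esub> h q = h f"
        unfolding A.ext_def by blast
      have fc: "f \<in> pcarr n" using fq(1) ideal.Icarr[OF Pi] by blast
      have "\<theta> u \<otimes>\<^bsub>stalk X p\<^esub> \<phi> q p = \<phi> f p"
        using ring_hom_mult[OF th(1) u, of "h q"] fq th(2) fc by simp
      moreover have "\<phi> f p \<in> P'" using con[OF fc] fq(1) by blast
      ultimately show "\<theta> u \<in> P'"
        using B.frac_mem_ideal[OF P'id _ fq(2), of "\<theta> u" f] th(3) u fq U_iff by blast
    qed
    then have "{u \<in> carrier R. \<theta> u \<in> P'} = A.ext (P i)" unfolding A.ext_def by blast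
    then show ?thesis using T'(1,2) e by blast
  qed
  define S where "S P' = (SOME T. T \<subseteq> {..<m} \<and> Q \<inter> T = {} \<and> {u \<in> carrier R. \<theta> u \<in> P'} = genideal R (y' ` T))" for P'
  have S: "S P' \<subseteq> {..<m} \<and> Q \<inter> S P' = {} \<and> {u \<in> carrier R. \<theta> u \<in> P'} = genideal R (y' ` S P')"
    if "P' \<in> minimal_primes (stalk X p)" for P'
    unfolding S_def by (rule someI_ex) (use comp[OF that] in blast)
  have "snc_coords X p n [] z \<theta> r y' S"
    unfolding snc_coords_def R_def[symmetric]
  proof (intro conjI ballI emb r(3))
    fix P' assume P': "P' \<in> minimal_primes (stalk X p)"
    show "S P' \<subseteq> {..<r}" using S[OF P'] r(1) by (meson lessThan_subset_iff order_trans)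
    show "{u \<in> carrier R. \<theta> u \<in> P'} = genideal R (y' ` S P')" using S[OF P'] by blast
  qed
  moreover have "Q \<subseteq> {..<r}" using Q r(1) by (meson lessThan_subset_iff order_trans)
  moreover have "restrict (\<phi> (y j)) W \<in> sec X W \<and> restrict (\<phi> (y j)) W p = \<theta> (y' j)" if "j \<in> Q" for j
  proof -
    have j: "j < m" using Q that by blast
    then have yc: "y j \<in> pcarr n" using y pp by blast
    show ?thesis using sec_restrict[OF X affine_coords_open[OF ac] W(1,3) affine_coords_sec[OF ac yc]]
      W(2) r(2) j th(2)[OF yc] by simp
  qed
  moreover have "E \<xi> = (\<Sum>j\<in>Q. \<alpha> j * div_of X (restrict (\<phi> (y j)) W) \<xi>)" if "\<xi> \<in> W" "prime_divisor X \<xi>" for \<xi>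
    using E[OF that] that by (simp add: div_of_def)
  ultimately show ?thesis
    unfolding snc_pair_at_def
    using S W(1,2)
    by (intro exI[of _ n] exI[of _ "[]"] exI[of _ z] exI[of _ \<theta>] exI[of _ r] exI[of _ y'] exI[of _ S] conjI
        exI[of _ Q] exI[of _ \<alpha>] exI[of _ W] exI[of _ "\<lambda>j. restrict (\<phi> (y j)) W"]) blast+
qed

section \<open>The three planes and their transforms in the charts of the blowing-up\<close>

definition coords :: "'a \<Rightarrow> 'a \<Rightarrow> 'a \<Rightarrow> 'a \<Rightarrow> nat \<Rightarrow> 'a" where
  "coords a b c d i = (if i = 0 then a else if i = 1 then b else if i = 2 then c else d)"

lemma coords_simps [simp]: "coords a b c d 0 = a" "coords a b c d (Suc 0) = b" "coords a b c d 2 = c"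
  "coords a b c d 3 = d"
  by (simp_all add: coords_def)

lemma less_4_cases: "i < (4::nat) \<Longrightarrow> i = 0 \<or> i = 1 \<or> i = 2 \<or> i = 3" by auto

lemma sum_lessThan_4: "(\<Sum>i<4. f i) = f 0 + f (Suc 0) + f 2 + (f 3 :: 'a::comm_monoid_add)"
  by (simp add: eval_nat_numeral lessThan_Suc ac_simps)

text \<open>The ideal of the image of the parametrization \<open>s\<close>. It is prime because the
  polynomials, where \<open>sub s\<close> takes its values, form a domain.\<close>

definition sub_ker :: "nat \<Rightarrow> (nat \<Rightarrow> 'k::field_char_0 mpol) \<Rightarrow> 'k mpol set" where
  "sub_ker n s = {f \<in> pcarr n. sub s f = 0}"

lemma primeideal_sub_ker: "primeideal (sub_ker n s) (poly_ring n :: 'k::field_char_0 mpol ring)"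
proof -
  interpret cring "poly_ring n :: 'k mpol ring" by (rule cring_poly_ring)
  show ?thesis
  proof (rule primeidealI[OF idealI_closed is_cring])
    have "(1 :: 'k mpol) \<notin> sub_ker n s" by (simp add: sub_ker_def)
    then show "pcarr n \<noteq> sub_ker n s" using pcarr_1 by metis
  qed (auto simp: sub_ker_def)
qed

lemma mvar_neq_0 [simp]: "mvar i \<noteq> 0"
proof
  assume "mvar i = (0 :: 'k::field_char_0 mpol)"
  then have "Poly_Mapping.lookup (mvar i :: 'k mpol) (Poly_Mapping.single i 1) = 0" by simp
  then show False by (simp add: mvar_def)
qed

text \<open>\<open>plane k i\<close> parametrizes the \<open>i\<close>-th component of the transform of the three planes in the
  chart of \<open>T\<^sub>k\<close>; only \<open>comps k\<close> of the planes meet that chart.\<close>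

definition plane :: "nat \<Rightarrow> nat \<Rightarrow> nat \<Rightarrow> 'k::field_char_0 mpol" where
  "plane k i = (if k = 0 then
       (if i = 0 then coords (mvar 0) 0 (mvar 2) 0
        else if i = 1 then coords (mvar 0) (mvar 1) 0 0
        else coords (mvar 0) (mvar 1) (- mvar 1) (- (mvar 1 * mvar 0)))
     else if k = 1 then
       (if i = 0 then coords (mvar 0) (mvar 1) 0 0
        else coords (mvar 0) (mvar 1) (- 1) (- (mvar 1 * mvar 0)))
     else
       (if i = 0 then coords (mvar 0) 0 (mvar 2) 0
        else coords (mvar 0) (- 1) (mvar 2) (mvar 2 * mvar 0)))"

definition comps :: "nat \<Rightarrow> nat" where "comps k = (if k = 0 then 3 else 2)"

definition planes :: "nat \<Rightarrow> 'k::field_char_0 mpol set" where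
  "planes k = {f \<in> pcarr 4. \<forall>i<comps k. f \<in> sub_ker 4 (plane k i)}"

lemma plane_pcarr: "plane k i j \<in> pcarr 4"
  by (auto simp: plane_def coords_def intro!: pcarr_mult pcarr_mvar pcarr_uminus)

lemma sub_ker_combination:
  assumes "f \<in> sub_ker 4 s" "\<And>i. i < 4 \<Longrightarrow> s i \<in> pcarr 4"
  obtains a where "\<And>i::nat. i < 4 \<Longrightarrow> a i \<in> pcarr 4"
    "f = a 0 * (mvar 0 - s 0) + a 1 * (mvar 1 - s 1) + a 2 * (mvar 2 - s 2) + a 3 * (mvar 3 - s 3)"
proof -
  have f: "f \<in> pcarr 4" "sub s f = 0" using assms(1) by (simp_all add: sub_ker_def)
  obtain a where a: "\<forall>i<4. a i \<in> pcarr 4" "f - sub s f = (\<Sum>i<4. a i * (mvar i - s i))"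
    using sub_diff_combination[OF f(1), of s] assms(2) by blast
  show thesis
  proof (rule that[of a])
    show "a i \<in> pcarr 4" if "i < 4" for i using a(1) that by blast
    show "f = a 0 * (mvar 0 - s 0) + a 1 * (mvar 1 - s 1) + a 2 * (mvar 2 - s 2) + a 3 * (mvar 3 - s 3)"
      using a(2) unfolding f(2) sum_lessThan_4 diff_0_right One_nat_def .
  qed
qed

text \<open>The two equations of a plane and the equation \<open>mvar k\<close> of the exceptional
  divisor have dual derivations, so their Jacobian matrix is the identity at every point. Thus each
  single plane is transversal to the divisor throughout the chart.\<close>

lemma plane_generators:
  assumes k: "k < 3" and i: "i < comps k"
  shows "\<exists>u v D0 D1 D2. u \<in> sub_ker 4 (plane k i) \<and> v \<in> sub_ker 4 (plane k i) \<and>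
    (\<forall>f\<in>sub_ker 4 (plane k i). \<exists>a\<in>pcarr 4. \<exists>b\<in>pcarr 4. f = a * u + b * v) \<and>
    derivation 4 D0 \<and> derivation 4 D1 \<and> derivation 4 D2 \<and>
    D0 u = 1 \<and> D0 v = 0 \<and> D0 (mvar k) = (0 :: 'k::field_char_0 mpol) \<and>
    D1 u = 0 \<and> D1 v = 1 \<and> D1 (mvar k) = 0 \<and>
    D2 u = 0 \<and> D2 v = 0 \<and> D2 (mvar k) = 1"
    (is "\<exists>u v D0 D1 D2. ?P u v D0 D1 D2")
proof -
  have com: thesis if f: "f \<in> sub_ker 4 (plane k i)"
    and "\<And>a :: nat \<Rightarrow> 'k mpol. (\<And>i. i < 4 \<Longrightarrow> a i \<in> pcarr 4) \<Longrightarrow> f = a 0 * (mvar 0 - plane k i 0) + a 1 * (mvar 1 - plane k i 1) +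
      a 2 * (mvar 2 - plane k i 2) + a 3 * (mvar 3 - plane k i 3) \<Longrightarrow> thesis" for f :: "'k mpol" and thesis
    by (rule sub_ker_combination[OF f plane_pcarr]) (rule that(2))
  note d = derivation_mderiv derivation_diff derivation_add derivation_smult
  consider "k = 0" "i = 0" | "k = 0" "i = 1" | "k = 0" "i = 2" | "k = 1" "i = 0" | "k = 1" "i = 1"
    | "k = 2" "i = 0" | "k = 2" "i = 1"
    using assms by (auto simp: comps_def split: if_splits) linarith+
  then show ?thesis
  proof cases
    case 1
    have "?P (mvar 1) (mvar 3) (mderiv 1) (mderiv 3) (mderiv 0)"
    proof (intro conjI ballI d)
      fix f :: "'k mpol" assume "f \<in> sub_ker 4 (plane k i)"
      then show "\<exists>a\<in>pcarr 4. \<exists>b\<in>pcarr 4. f = a * mvar 1 + b * mvar 3"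
        by (rule com, rename_tac a, rule_tac x = "a 1" in bexI, rule_tac x = "a 3" in bexI)
          (use 1 in \<open>simp_all add: plane_def\<close>)
    qed (use 1 in \<open>simp_all add: mderiv_mvar sub_ker_def plane_def\<close>)
    then show ?thesis by blast
  next
    case 2
    have "?P (mvar 2) (mvar 3) (mderiv 2) (mderiv 3) (mderiv 0)"
    proof (intro conjI ballI d)
      fix f :: "'k mpol" assume "f \<in> sub_ker 4 (plane k i)"
      then show "\<exists>a\<in>pcarr 4. \<exists>b\<in>pcarr 4. f = a * mvar 2 + b * mvar 3"
        by (rule com, rename_tac a, rule_tac x = "a 2" in bexI, rule_tac x = "a 3" in bexI)
          (use 2 in \<open>simp_all add: plane_def\<close>)
    qed (use 2 in \<open>simp_all add: mderiv_mvar sub_ker_def plane_def\<close>)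
    then show ?thesis by blast
  next
    case 3
    \<comment> \<open>The derivative along \<open>w\<close> sends \<open>z + xw\<close> to
      \<open>x\<close>; subtracting \<open>x\<close> times the derivative along \<open>z\<close>
      makes the third derivation tangent to the plane. The other planes with a curved equation are
      treated alike.\<close>
    have "?P (mvar 2 + mvar 1) (mvar 3 + mvar 1 * mvar 0) (mderiv 2) (mderiv 3)
        (\<lambda>p. mderiv 0 p - mvar 1 * mderiv 3 p)"
    proof (intro conjI ballI d)
      fix f :: "'k mpol" assume "f \<in> sub_ker 4 (plane k i)"
      then show "\<exists>a\<in>pcarr 4. \<exists>b\<in>pcarr 4. f = a * (mvar 2 + mvar 1) + b * (mvar 3 + mvar 1 * mvar 0)"
        by (rule com, rename_tac a, rule_tac x = "a 2" in bexI, rule_tac x = "a 3" in bexI)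
          (use 3 in \<open>simp_all add: plane_def\<close>)
    qed (use 3 in \<open>simp_all add: mderiv_simps sub_ker_def plane_def\<close>)
    then show ?thesis by blast
  next
    case 4
    have "?P (mvar 2) (mvar 3) (mderiv 2) (mderiv 3) (mderiv 1)"
    proof (intro conjI ballI d)
      fix f :: "'k mpol" assume "f \<in> sub_ker 4 (plane k i)"
      then show "\<exists>a\<in>pcarr 4. \<exists>b\<in>pcarr 4. f = a * mvar 2 + b * mvar 3"
        by (rule com, rename_tac a, rule_tac x = "a 2" in bexI, rule_tac x = "a 3" in bexI)
          (use 4 in \<open>simp_all add: plane_def\<close>)
    qed (use 4 in \<open>simp_all add: mderiv_mvar sub_ker_def plane_def\<close>)
    then show ?thesis by blast
  next
    case 5
    have "?P (mvar 2 + 1) (mvar 3 + mvar 1 * mvar 0) (mderiv 2) (mderiv 3)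
        (\<lambda>p. mderiv 1 p - mvar 0 * mderiv 3 p)"
    proof (intro conjI ballI d)
      fix f :: "'k mpol" assume "f \<in> sub_ker 4 (plane k i)"
      then show "\<exists>a\<in>pcarr 4. \<exists>b\<in>pcarr 4. f = a * (mvar 2 + 1) + b * (mvar 3 + mvar 1 * mvar 0)"
        by (rule com, rename_tac a, rule_tac x = "a 2" in bexI, rule_tac x = "a 3" in bexI)
          (use 5 in \<open>simp_all add: plane_def\<close>)
    qed (use 5 in \<open>simp_all add: mderiv_simps sub_ker_def plane_def\<close>)
    then show ?thesis by blast
  next
    case 6
    have "?P (mvar 1) (mvar 3) (mderiv 1) (mderiv 3) (mderiv 2)"
    proof (intro conjI ballI d)
      fix f :: "'k mpol" assume "f \<in> sub_ker 4 (plane k i)"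
      then show "\<exists>a\<in>pcarr 4. \<exists>b\<in>pcarr 4. f = a * mvar 1 + b * mvar 3"
        by (rule com, rename_tac a, rule_tac x = "a 1" in bexI, rule_tac x = "a 3" in bexI)
          (use 6 in \<open>simp_all add: plane_def\<close>)
    qed (use 6 in \<open>simp_all add: mderiv_mvar sub_ker_def plane_def\<close>)
    then show ?thesis by blast
  next
    case 7
    have "?P (mvar 1 + 1) (mvar 3 - mvar 2 * mvar 0) (mderiv 1) (mderiv 3)
        (\<lambda>p. mderiv 2 p + mvar 0 * mderiv 3 p)"
    proof (intro conjI ballI d)
      fix f :: "'k mpol" assume "f \<in> sub_ker 4 (plane k i)"
      then show "\<exists>a\<in>pcarr 4. \<exists>b\<in>pcarr 4. f = a * (mvar 1 + 1) + b * (mvar 3 - mvar 2 * mvar 0)"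
        by (rule com, rename_tac a, rule_tac x = "a 1" in bexI, rule_tac x = "a 3" in bexI)
          (use 7 in \<open>simp_all add: plane_def\<close>)
    qed (use 7 in \<open>simp_all add: mderiv_simps sub_ker_def plane_def\<close>)
    then show ?thesis by blast
  qed
qed

lemma genideal_pair_eq:
  assumes u: "u \<in> sub_ker 4 s" "v \<in> sub_ker 4 s"
    and gen: "\<And>f. f \<in> sub_ker 4 s \<Longrightarrow> \<exists>a\<in>pcarr 4. \<exists>b\<in>pcarr 4. f = a * u + b * v"
  shows "genideal (poly_ring 4) {u, v} = (sub_ker 4 s :: 'k::field_char_0 mpol set)"
proof -
  interpret P: cring "poly_ring 4 :: 'k mpol ring" by (rule cring_poly_ring)
  have uc: "{u, v} \<subseteq> pcarr 4" using u by (simp add: sub_ker_def)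
  have G: "ideal (genideal (poly_ring 4) {u, v}) (poly_ring 4)" by (rule P.genideal_ideal[OF uc])
  show ?thesis
  proof (intro equalityI subsetI)
    fix f assume "f \<in> genideal (poly_ring 4) {u, v}"
    then show "f \<in> sub_ker 4 s"
      using P.genideal_minimal[OF primeideal.axioms(1)[OF primeideal_sub_ker], of "{u, v}" s] u by blast
  next
    fix f assume "f \<in> sub_ker 4 s"
    then obtain a b where ab: "a \<in> pcarr 4" "b \<in> pcarr 4" "f = a * u + b * v" using gen by blast
    have "u \<in> genideal (poly_ring 4) {u, v}" "v \<in> genideal (poly_ring 4) {u, v}"
      using P.genideal_self[OF uc] by auto
    then show "f \<in> genideal (poly_ring 4) {u, v}"
      using ideal.add_mem[OF G ideal.I_l_closed[OF G _ ab(1)] ideal.I_l_closed[OF G _ ab(2)]] ab(3) by simp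
  qed
qed

lemma three_planes_eq: "three_planes = (planes 0 :: 'k::field_char_0 mpol set)"
proof -
  have com: thesis if f: "f \<in> sub_ker 4 (plane k i)"
    and "\<And>a :: nat \<Rightarrow> 'k mpol. (\<And>i. i < 4 \<Longrightarrow> a i \<in> pcarr 4) \<Longrightarrow> f = a 0 * (mvar 0 - plane k i 0) + a 1 * (mvar 1 - plane k i 1) +
      a 2 * (mvar 2 - plane k i 2) + a 3 * (mvar 3 - plane k i 3) \<Longrightarrow> thesis" for f :: "'k mpol" and thesis k i
    by (rule sub_ker_combination[OF f plane_pcarr]) (rule that(2))
  have 0: "genideal (poly_ring 4) {mvar 3, mvar 1} = (sub_ker 4 (plane 0 0) :: 'k mpol set)"
  proof (rule genideal_pair_eq)
    fix f :: "'k mpol" assume "f \<in> sub_ker 4 (plane 0 0)"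
    then show "\<exists>a\<in>pcarr 4. \<exists>b\<in>pcarr 4. f = a * mvar 3 + b * mvar 1"
      by (rule com, rename_tac a, rule_tac x = "a 3" in bexI, rule_tac x = "a 1" in bexI)
        (simp_all add: plane_def add.commute)
  qed (simp_all add: sub_ker_def plane_def)
  have 1: "genideal (poly_ring 4) {mvar 3, mvar 2} = (sub_ker 4 (plane 0 1) :: 'k mpol set)"
  proof (rule genideal_pair_eq)
    fix f :: "'k mpol" assume "f \<in> sub_ker 4 (plane 0 1)"
    then show "\<exists>a\<in>pcarr 4. \<exists>b\<in>pcarr 4. f = a * mvar 3 + b * mvar 2"
      by (rule com, rename_tac a, rule_tac x = "a 3" in bexI, rule_tac x = "a 2" in bexI)
        (simp_all add: plane_def add.commute)
  qed (simp_all add: sub_ker_def plane_def)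
  have 2: "genideal (poly_ring 4) {mvar 3 + mvar 1 * mvar 0, mvar 1 + mvar 2} = (sub_ker 4 (plane 0 2) :: 'k mpol set)"
  proof (rule genideal_pair_eq)
    fix f :: "'k mpol" assume "f \<in> sub_ker 4 (plane 0 2)"
    then show "\<exists>a\<in>pcarr 4. \<exists>b\<in>pcarr 4. f = a * (mvar 3 + mvar 1 * mvar 0) + b * (mvar 1 + mvar 2)"
      by (rule com, rename_tac a, rule_tac x = "a 3" in bexI, rule_tac x = "a 2" in bexI)
        (simp_all add: plane_def add.commute)
  qed (simp_all add: sub_ker_def plane_def)
  have "(\<forall>i<3. P i) \<longleftrightarrow> P 0 \<and> P 1 \<and> P (2::nat)" for P
    by (auto simp: eval_nat_numeral less_Suc_eq)
  then show ?thesis unfolding three_planes_def 0 1 2 planes_def by (auto simp: comps_def sub_ker_def)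
qed

lemma poly_prime_0_1:
  assumes "primeideal P (poly_ring n)" shows "0 \<in> P" "1 \<notin> P"
proof -
  interpret P: primeideal P "poly_ring n" by (rule assms)
  show "0 \<in> P" using additive_subgroup.zero_closed[OF P.additive_subgroup_axioms] by simp
  show "1 \<notin> P" using P.I_notcarr P.one_imp_carrier by auto
qed

section \<open>The origin\<close>

definition origin_ideal :: "nat \<Rightarrow> 'k::field_char_0 mpol set" where
  "origin_ideal n = sub_ker n (\<lambda>_. 0)"

lemma sub_0_const: "f \<in> pcarr n \<Longrightarrow> \<exists>c. sub (\<lambda>_. 0) f = mconst c"
proof (induction f rule: mpol_induct)
  case (var i)
  then show ?case by (intro exI[of _ 0]) simp
next
  case (add f g)
  then obtain a b where "sub (\<lambda>_. 0) f = mconst a" "sub (\<lambda>_. 0) g = mconst b" by blast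
  then show ?case by (intro exI[of _ "a + b"]) simp
next
  case (mult f g)
  then obtain a b where "sub (\<lambda>_. 0) f = mconst a" "sub (\<lambda>_. 0) g = mconst b" by blast
  then show ?case by (intro exI[of _ "a * b"]) simp
qed auto

text \<open>Modulo the variables every polynomial is a constant, and a nonzero constant in a prime
  would be an invertible element. So a prime containing the variables leaves no choice.\<close>

lemma origin_ideal_eq:
  fixes P :: "'k::field_char_0 mpol set"
  assumes P: "primeideal P (poly_ring n)" shows "(\<forall>i<n. mvar i \<in> P) \<longleftrightarrow> P = origin_ideal n"
proof
  interpret P: primeideal P "poly_ring n" by (rule P)
  assume v: "\<forall>i<n. mvar i \<in> P"
  note P1 = poly_prime_0_1(2)[OF P]
  have dec: "f - sub (\<lambda>_. 0) f \<in> P" if f: "f \<in> pcarr n" for f :: "'k mpol"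
  proof -
    obtain a where a: "\<forall>i<n. a i \<in> pcarr n" "f - sub (\<lambda>_. 0) f = (\<Sum>i<n. a i * mvar i)"
      using sub_diff_combination[OF f, of "\<lambda>_. 0"] by auto
    have "(\<Sum>i<m. a i * mvar i) \<in> P" if "m \<le> n" for m
      using that
    proof (induction m)
      case 0
      then show ?case using poly_prime_0_1(1)[OF P] by simp
    next
      case (Suc m)
      then have "a m * mvar m \<in> P" using P.I_l_closed[of "mvar m" "a m"] a(1) v by simp
      then show ?case using Suc P.add_mem[of "\<Sum>i<m. a i * mvar i" "a m * mvar m"] by simp
    qed
    then show ?thesis using a(2) by simp
  qed
  show "P = origin_ideal n"
  proof (intro equalityI subsetI)
    fix f assume f: "f \<in> P"
    have fc: "f \<in> pcarr n" by (rule P.Icarr[OF f])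
    obtain c where c: "sub (\<lambda>_. 0) f = mconst c" using sub_0_const[OF fc] by blast
    have "f \<ominus>\<^bsub>poly_ring n\<^esub> (f - mconst c) \<in> P" using P.minus_mem[OF f dec[OF fc]] c by simp
    then have m: "mconst c \<in> P" using fc by simp
    have "c = 0"
    proof (rule ccontr)
      assume "c \<noteq> 0"
      then have "mconst (inverse c) * mconst c = (1 :: 'k mpol)" by (metis left_inverse mconst_simps(2,4))
      then show False using P.I_l_closed[OF m, of "mconst (inverse c)"] P1 by simp
    qed
    then show "f \<in> origin_ideal n" using fc c by (simp add: origin_ideal_def sub_ker_def)
  next
    fix f :: "'k mpol" assume "f \<in> origin_ideal n"
    then show "f \<in> P" using dec[of f] by (simp add: origin_ideal_def sub_ker_def)
  qed
qed (simp add: origin_ideal_def sub_ker_def)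

lemma planes_0_origin: "planes 0 \<subseteq> (origin_ideal 4 :: 'k::field_char_0 mpol set)"
proof
  fix f :: "'k mpol" assume "f \<in> planes 0"
  then have f: "f \<in> pcarr 4" "sub (plane 0 0) f = 0" by (auto simp: planes_def comps_def sub_ker_def)
  have "sub (\<lambda>_. 0) (sub (plane 0 0) f) = sub (\<lambda>_. 0) f"
    by (rule sub_sub[OF f(1)]) (auto simp: plane_def coords_def)
  then show "f \<in> origin_ideal 4" using f by (simp add: origin_ideal_def sub_ker_def)
qed

lemma point_prime:
  assumes X: "locally_ringed_kspace X" and ac: "affine_coords n J X U \<phi>" and p: "p \<in> U"
  shows "primeideal {f \<in> pcarr n. \<phi> f p \<notin> Units (stalk X p)} (poly_ring n)"
    "J \<subseteq> {f \<in> pcarr n. \<phi> f p \<notin> Units (stalk X p)}"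
    "{f \<in> pcarr n. \<phi> f p \<in> max_ideal (stalk X p)} = {f \<in> pcarr n. \<phi> f p \<notin> Units (stalk X p)}"
proof -
  interpret B: local_presentation "poly_ring n" "stalk X p" "\<lambda>f. \<phi> f p" J
    by (rule affine_coords_presentation[OF X ac p])
  show "primeideal {f \<in> pcarr n. \<phi> f p \<notin> Units (stalk X p)} (poly_ring n)" by (rule B.prime)
  show "J \<subseteq> {f \<in> pcarr n. \<phi> f p \<notin> Units (stalk X p)}" using B.J_pp unfolding B.pp_def .
  show "{f \<in> pcarr n. \<phi> f p \<in> max_ideal (stalk X p)} = {f \<in> pcarr n. \<phi> f p \<notin> Units (stalk X p)}"
    using B.h_max unfolding B.pp_def by blast
qed

text \<open>Replaces the description of \<open>origin\<close> by an equation between primes of the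
  polynomial ring, the form in which points are compared from here on.\<close>

lemma origin_point:
  assumes X: "locally_ringed_kspace X" and ac: "affine_coords n J X U \<phi>" and J: "J \<subseteq> origin_ideal n"
  shows "origin n X U \<phi> \<in> U"
    and "p \<in> U \<Longrightarrow> p = origin n X U \<phi> \<longleftrightarrow> {f \<in> pcarr n. \<phi> f p \<notin> Units (stalk X p)} = origin_ideal n"
proof -
  have "\<exists>!p. p \<in> U \<and> {f \<in> pcarr n. \<phi> f p \<in> max_ideal (stalk X p)} = origin_ideal n"
    by (rule affine_coords_points[OF X ac _ J]) (simp only: origin_ideal_def primeideal_sub_ker)
  then obtain q where q: "q \<in> U" "{f \<in> pcarr n. \<phi> f q \<in> max_ideal (stalk X q)} = origin_ideal n"
    and uq: "\<And>p. p \<in> U \<Longrightarrow> {f \<in> pcarr n. \<phi> f p \<in> max_ideal (stalk X p)} = origin_ideal n \<Longrightarrow> p = q"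
    by (elim ex1E conjE) blast
  have iff: "(\<forall>i<n. \<phi> (mvar i) p \<in> max_ideal (stalk X p)) \<longleftrightarrow>
      {f \<in> pcarr n. \<phi> f p \<in> max_ideal (stalk X p)} = origin_ideal n" if p: "p \<in> U" for p
  proof -
    have pr: "primeideal {f \<in> pcarr n. \<phi> f p \<in> max_ideal (stalk X p)} (poly_ring n)"
      unfolding point_prime(3)[OF X ac p] by (rule point_prime(1)[OF X ac p])
    show ?thesis using origin_ideal_eq[OF pr] by simp
  qed
  have o: "origin n X U \<phi> = q"
    unfolding origin_def
  proof (rule the_equality)
    show "q \<in> U \<and> (\<forall>i<n. \<phi> (mvar i) q \<in> max_ideal (stalk X q))" using q iff[OF q(1)] by blast
    show "p = q" if "p \<in> U \<and> (\<forall>i<n. \<phi> (mvar i) p \<in> max_ideal (stalk X p))" for p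
      using uq[of p] iff[of p] that by blast
  qed
  show "origin n X U \<phi> \<in> U" using o q(1) by simp
  show "p = origin n X U \<phi> \<longleftrightarrow> {f \<in> pcarr n. \<phi> f p \<notin> Units (stalk X p)} = origin_ideal n" if p: "p \<in> U"
    unfolding o point_prime(3)[OF X ac p, symmetric] using q uq[OF p] by blast
qed

section \<open>Simple normal crossings away from the origin\<close>

lemma genideal_unit:
  assumes R: "cring R" and u: "u \<in> Units R" shows "genideal R {u} = carrier R"
proof -
  interpret cring R by fact
  have uc: "{u} \<subseteq> carrier R" using u by auto
  have I: "ideal (genideal R {u}) R" by (rule genideal_ideal[OF uc])
  have "u \<in> genideal R {u}" using genideal_self[OF uc] by blast
  then have "inv\<^bsub>R\<^esub> u \<otimes>\<^bsub>R\<^esub> u \<in> genideal R {u}" using ideal.I_l_closed[OF I] u by blast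
  then show ?thesis using ideal.one_imp_carrier[OF I] u by simp
qed

lemma colength_carrier: "cring R \<Longrightarrow> colength R (carrier R) = 0"
  unfolding colength_def
proof (rule Greatest_equality)
  assume R: "cring R"
  interpret cring R by fact
  show "\<exists>J. J 0 = carrier R \<and> J 0 = carrier R \<and> (\<forall>i\<le>0. ideal (J i) R) \<and> (\<forall>i<0. J i \<subset> J (Suc i))"
    by (intro exI[of _ "\<lambda>_. carrier R"]) (simp add: oneideal)
  fix n assume "\<exists>J. J 0 = carrier R \<and> J n = carrier R \<and> (\<forall>i\<le>n. ideal (J i) R) \<and> (\<forall>i<n. J i \<subset> J (Suc i))"
  then obtain J where J: "J 0 = carrier R" "\<forall>i\<le>n. ideal (J i) R" "\<forall>i<n. J i \<subset> J (Suc i)" by blast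
  show "n \<le> 0"
  proof (rule ccontr)
    assume "\<not> n \<le> 0"
    then have "carrier R \<subset> J 1" "ideal (J 1) R" using J by auto
    then show False using additive_subgroup.a_subset[OF ideal.axioms(1)] by blast
  qed
qed

lemma div_of_unit:
  assumes "cring (stalk X \<xi>)" "s \<xi> \<in> Units (stalk X \<xi>)" shows "div_of X s \<xi> = 0"
  by (simp add: div_of_def genideal_unit[OF assms] colength_carrier[OF assms(1)])

text \<open>If only one plane passes through \<open>p\<close>, the dual system of
  \<open>plane_generators\<close> consists of coordinates wherever \<open>p\<close> lies, whether on
  the exceptional divisor or off it.\<close>

lemma snc_single_plane:
  fixes X :: "('p, 's, 'k::field_char_0) kspace"
  assumes X: "locally_ringed_kspace X" and ac: "affine_coords 4 (planes k) X U \<phi>" and p: "p \<in> U"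
    and k: "k < 3" and E: "\<And>\<xi>. \<xi> \<in> U \<Longrightarrow> E \<xi> = c * div_of X (\<phi> (mvar k)) \<xi>"
    and pp: "pp = {f \<in> pcarr 4. \<phi> f p \<notin> Units (stalk X p)}"
    and i: "i < comps k" and uniq: "\<And>j. j < comps k \<Longrightarrow> sub_ker 4 (plane k j) \<subseteq> pp \<Longrightarrow> j = i"
    and sub: "sub_ker 4 (plane k i) \<subseteq> pp"
  shows "snc_pair_at X E p"
proof -
  have pr: "primeideal pp (poly_ring 4)" unfolding pp by (rule point_prime(1)[OF X ac p])
  interpret pr: primeideal pp "poly_ring 4" by (rule pr)
  note P0 = poly_prime_0_1(1)[OF pr] and P1 = poly_prime_0_1(2)[OF pr]
  obtain u v D0 D1 D2 where uv: "u \<in> sub_ker 4 (plane k i)" "v \<in> sub_ker 4 (plane k i)"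
    "\<forall>f\<in>sub_ker 4 (plane k i). \<exists>a\<in>pcarr 4. \<exists>b\<in>pcarr 4. f = a * u + b * v"
    and der: "derivation 4 D0" "derivation 4 D1" "derivation 4 D2"
    and D: "D0 u = 1" "D0 v = 0" "D0 (mvar k) = 0" "D1 u = 0" "D1 v = 1" "D1 (mvar k) = 0"
      "D2 u = 0" "D2 v = 0" "D2 (mvar k) = (1 :: 'k mpol)"
    using plane_generators[OF k i, where 'k = 'k] by (elim exE conjE)
  define y where "y = coords u v (mvar k) (0 :: 'k mpol)"
  define DD where "DD = coords D0 D1 D2 (\<lambda>_. 0 :: 'k mpol)"
  \<comment> \<open>The third function, the equation of the divisor, is a coordinate only if it
    vanishes at \<open>p\<close>. Otherwise the neighbourhood is shrunk to the set where it is a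
    unit, and there the divisor is zero.\<close>
  define m :: nat where "m = (if mvar k \<in> pp then 3 else 2)"
  define Q :: "nat set" where "Q = (if mvar k \<in> pp then {2} else {})"
  define W where "W = (if mvar k \<in> pp then U else {q \<in> U. \<phi> (mvar k) q \<in> Units (stalk X q)})"
  have kc: "mvar k \<in> pcarr 4" using k by simp
  have op: "openin (sp X) U" by (rule affine_coords_open[OF ac])
  have lt3: "j < m \<Longrightarrow> j = 0 \<or> j = 1 \<or> j = 2" for j by (auto simp: m_def split: if_splits)
  have lt2: "j < m \<Longrightarrow> mvar k \<in> pp \<or> j = 0 \<or> j = 1" for j by (auto simp: m_def)
  show ?thesis
  proof (rule snc_pair_criterion[OF X ac p pp, where k = "comps k" and P = "\<lambda>j. sub_ker 4 (plane k j)"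
        and m = m and y = y and D = DD and Q = Q and W = W and \<alpha> = "\<lambda>_. c"])
    show "primeideal (sub_ker 4 (plane k j)) (poly_ring 4)" for j by (rule primeideal_sub_ker)
    show "planes k = {f \<in> pcarr 4. \<forall>j<comps k. f \<in> sub_ker 4 (plane k j)}" by (rule planes_def)
    show "y j \<in> pp" if "j < m" for j
      using lt3[OF that] lt2[OF that] uv(1,2) sub by (auto simp: y_def)
    show "derivation 4 (DD j)" if "j < m" for j using lt3[OF that] der by (auto simp: DD_def)
    show "DD j (y l) \<in> pp" if "j < m" "l < m" "j \<noteq> l" for j l
      using lt3[OF that(1)] lt3[OF that(2)] that(3) D P0 by (auto simp: DD_def y_def)
    show "DD j (y j) \<notin> pp" if "j < m" for j
      using lt3[OF that] D P1 by (auto simp: DD_def y_def)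
    show "Q \<subseteq> {..<m}" by (simp add: Q_def m_def)
    show "W \<subseteq> U" by (auto simp: W_def)
    show "p \<in> W" using p kc unfolding W_def pp by auto
    have "openin (sp X) {q \<in> U. \<phi> (mvar k) q \<in> Units (stalk X q)}"
      by (rule affine_openD(3)[OF _ affine_coords_sec[OF ac kc]]) (use ac in \<open>simp add: affine_coords_def\<close>)
    then show "openin (sp X) W" using op by (simp add: W_def)
    show "E \<xi> = (\<Sum>j\<in>Q. c * div_of X (\<phi> (y j)) \<xi>)" if "\<xi> \<in> W" for \<xi>
    proof (cases "mvar k \<in> pp")
      case True
      then show ?thesis using that E by (simp add: Q_def W_def y_def)
    next
      case False
      then have xi: "\<xi> \<in> U" "\<phi> (mvar k) \<xi> \<in> Units (stalk X \<xi>)" using that by (auto simp: W_def)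
      have "cring (stalk X \<xi>)" using stalk_cring[OF X] xi(1) openin_subset[OF op] by blast
      then have "div_of X (\<phi> (mvar k)) \<xi> = 0" using xi(2) by (rule div_of_unit)
      then show ?thesis using E[OF xi(1)] False by (simp add: Q_def)
    qed
    fix j assume "j < comps k" "sub_ker 4 (plane k j) \<subseteq> pp"
    then have j: "j = i" by (rule uniq)
    show "\<exists>T\<subseteq>{..<m}. Q \<inter> T = {} \<and> (\<forall>l\<in>T. y l \<in> sub_ker 4 (plane k j)) \<and>
      (\<forall>f\<in>sub_ker 4 (plane k j). \<exists>g\<in>pcarr 4. g \<notin> pp \<and> (\<exists>a. (\<forall>l\<in>T. a l \<in> pcarr 4) \<and> g * f = (\<Sum>l\<in>T. a l * y l)))"
    proof (intro exI[of _ "{0, 1}"] conjI ballI)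
      show "{0, 1} \<subseteq> {..<m}" "Q \<inter> {0, 1} = {}" by (auto simp: m_def Q_def)
      show "y l \<in> sub_ker 4 (plane k j)" if "l \<in> {0, 1}" for l using that uv(1,2) j by (auto simp: y_def)
      fix f :: "'k mpol" assume "f \<in> sub_ker 4 (plane k j)"
      then obtain a b where ab: "a \<in> pcarr 4" "b \<in> pcarr 4" "f = a * u + b * v" using uv(3) j by blast
      have "1 * f = (\<Sum>l\<in>{0, 1}. coords a b 0 0 l * y l)" using ab(3) by (simp add: y_def)
      then show "\<exists>g\<in>pcarr 4. g \<notin> pp \<and> (\<exists>a. (\<forall>l\<in>{0, 1}. a l \<in> pcarr 4) \<and> g * f = (\<Sum>l\<in>{0, 1}. a l * y l))"
        using ab(1,2) P1 by (intro bexI[of _ 1] conjI exI[of _ "coords a b 0 0"]) auto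
    qed
  qed
qed

text \<open>Where \<open>w\<close> is a unit, the three planes span the directions of three independent lines, and
  \<open>z\<close>, \<open>wx + z\<close>, \<open>wy - z\<close> are coordinates in which they are coordinate subspaces.\<close>

lemma snc_triple_point:
  fixes X :: "('p, 's, 'k::field_char_0) kspace"
  assumes X: "locally_ringed_kspace X" and ac: "affine_coords 4 (planes 0) X U \<phi>" and p: "p \<in> U"
    and E: "\<And>\<xi>. \<xi> \<in> U \<Longrightarrow> E \<xi> = c * div_of X (\<phi> (mvar 0)) \<xi>"
    and pp: "pp = {f \<in> pcarr 4. \<phi> f p \<notin> Units (stalk X p)}"
    and m: "mvar 1 \<in> pp" "mvar 2 \<in> pp" "mvar 3 \<in> pp" "mvar 0 \<notin> pp"
  shows "snc_pair_at X E p"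
proof -
  have pr: "primeideal pp (poly_ring 4)" unfolding pp by (rule point_prime(1)[OF X ac p])
  interpret pr: primeideal pp "poly_ring 4" by (rule pr)
  note P0 = poly_prime_0_1(1)[OF pr]
  define u0 u1 u2 :: "'k mpol" where "u0 = mvar 3" and "u1 = mvar 0 * mvar 1 + mvar 3"
    and "u2 = mvar 0 * mvar 2 - mvar 3"
  \<comment> \<open>This field kills \<open>wx + z\<close> and \<open>wy - z\<close> and sends
    \<open>z\<close> to \<open>w\<close>. With the derivatives along \<open>x\<close> and
    \<open>y\<close> the Jacobian matrix becomes diagonal with all entries \<open>w\<close>, which
    is a unit at \<open>p\<close>.\<close>
  define D0 :: "'k mpol \<Rightarrow> 'k mpol" where "D0 q = mvar 0 * mderiv 3 q - mderiv 1 q + mderiv 2 q" for q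
  define y where "y = coords u0 u1 u2 0"
  define DD where "DD = coords D0 (mderiv 1) (mderiv 2) (\<lambda>_. 0)"
  \<comment> \<open>On \<open>W\<close> the function \<open>w\<close> is invertible, so the divisor
    vanishes there and no coordinate has to be reserved for it.\<close>
  define W where "W = {q \<in> U. \<phi> (mvar 0) q \<in> Units (stalk X q)}"
  have op: "openin (sp X) U" by (rule affine_coords_open[OF ac])
  have lt3: "j < 3 \<Longrightarrow> j = 0 \<or> j = 1 \<or> j = (2::nat)" for j by auto
  have lp: "a * b \<in> pp" if "a \<in> pcarr 4" "b \<in> pp" for a b using pr.I_l_closed[OF that(2,1)] by simp
  have upp: "u0 \<in> pp" "u1 \<in> pp" "u2 \<in> pp"
    using m(1-3) lp[of "mvar 0" "mvar 1"] lp[of "mvar 0" "mvar 2"]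
      pr.add_mem[of "mvar 0 * mvar 1" "mvar 3"] pr.minus_mem[of "mvar 0 * mvar 2" "mvar 3"]
    by (auto simp: u0_def u1_def u2_def)
  have com: thesis if f: "f \<in> sub_ker 4 (plane k i)"
    and "\<And>a :: nat \<Rightarrow> 'k mpol. (\<And>i. i < 4 \<Longrightarrow> a i \<in> pcarr 4) \<Longrightarrow> f = a 0 * (mvar 0 - plane k i 0) + a 1 * (mvar 1 - plane k i 1) +
      a 2 * (mvar 2 - plane k i 2) + a 3 * (mvar 3 - plane k i 3) \<Longrightarrow> thesis" for f :: "'k mpol" and thesis k i
    by (rule sub_ker_combination[OF f plane_pcarr]) (rule that(2))
  show ?thesis
  proof (rule snc_pair_criterion[OF X ac p pp, where k = 3 and P = "\<lambda>j. sub_ker 4 (plane 0 j)"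
        and m = 3 and y = y and D = DD and Q = "{}" and W = W and \<alpha> = "\<lambda>_. 0"])
    show "primeideal (sub_ker 4 (plane 0 j)) (poly_ring 4)" for j by (rule primeideal_sub_ker)
    show "planes 0 = {f \<in> pcarr 4. \<forall>j<3. f \<in> sub_ker 4 (plane 0 j)}" by (simp add: planes_def comps_def)
    show "y j \<in> pp" if "j < 3" for j using lt3[OF that] upp by (auto simp: y_def)
    have "derivation 4 D0" unfolding D0_def
      by (intro derivation_add derivation_diff derivation_smult derivation_mderiv) simp
    then show "derivation 4 (DD j)" if "j < 3" for j using lt3[OF that] derivation_mderiv by (auto simp: DD_def)
    show "DD j (y l) \<in> pp" if "j < 3" "l < 3" "j \<noteq> l" for j l
      using lt3[OF that(1)] lt3[OF that(2)] that(3) P0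
      by (auto simp: DD_def y_def D0_def u0_def u1_def u2_def mderiv_simps)
    show "DD j (y j) \<notin> pp" if "j < 3" for j
      using lt3[OF that] m(4) by (auto simp: DD_def y_def D0_def u0_def u1_def u2_def mderiv_simps)
    show "W \<subseteq> U" by (auto simp: W_def)
    show "p \<in> W" using p m(4) unfolding W_def pp by auto
    show "openin (sp X) W" unfolding W_def
      by (rule affine_openD(3)[OF _ affine_coords_sec[OF ac]]) (use ac in \<open>simp_all add: affine_coords_def\<close>)
    show "E \<xi> = (\<Sum>j\<in>{}. 0 * div_of X (\<phi> (y j)) \<xi>)" if "\<xi> \<in> W" for \<xi>
    proof -
      have xi: "\<xi> \<in> U" "\<phi> (mvar 0) \<xi> \<in> Units (stalk X \<xi>)" using that by (auto simp: W_def)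
      have "cring (stalk X \<xi>)" using stalk_cring[OF X] xi(1) openin_subset[OF op] by blast
      then have "div_of X (\<phi> (mvar 0)) \<xi> = 0" using xi(2) by (rule div_of_unit)
      then show ?thesis using E[OF xi(1)] by simp
    qed
    fix j assume "j < (3::nat)"
    then consider "j = 0" | "j = 1" | "j = 2" using lt3 by blast
    then show "\<exists>T\<subseteq>{..<3}. {} \<inter> T = {} \<and> (\<forall>l\<in>T. y l \<in> sub_ker 4 (plane 0 j)) \<and>
      (\<forall>f\<in>sub_ker 4 (plane 0 j). \<exists>g\<in>pcarr 4. g \<notin> pp \<and> (\<exists>a. (\<forall>l\<in>T. a l \<in> pcarr 4) \<and> g * f = (\<Sum>l\<in>T. a l * y l)))"
    proof cases
      case 1
      show ?thesis
      proof (intro exI[of _ "{0, 1}"] conjI ballI)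
        show "y l \<in> sub_ker 4 (plane 0 j)" if "l \<in> {0, 1}" for l
          using that 1 by (auto simp: y_def u0_def u1_def sub_ker_def plane_def)
        fix f :: "'k mpol" assume "f \<in> sub_ker 4 (plane 0 j)"
        then show "\<exists>g\<in>pcarr 4. g \<notin> pp \<and> (\<exists>a. (\<forall>l\<in>{0, 1}. a l \<in> pcarr 4) \<and> g * f = (\<Sum>l\<in>{0, 1}. a l * y l))"
        proof (rule com)
          fix a :: "nat \<Rightarrow> 'k mpol" assume a: "\<And>i. i < 4 \<Longrightarrow> a i \<in> pcarr 4" "f = a 0 * (mvar 0 - plane 0 j 0) + a 1 * (mvar 1 - plane 0 j 1) +
            a 2 * (mvar 2 - plane 0 j 2) + a 3 * (mvar 3 - plane 0 j 3)"
          \<comment> \<open>From \<open>wx = u1 - u0\<close> and \<open>wy = u2 + u0\<close> the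
            equations of the planes are combinations of two coordinates after multiplication by
            \<open>w\<close>; for the third plane one has \<open>w(x + y) = u1 + u2\<close>.\<close>
          have "mvar 0 * f = (\<Sum>l\<in>{0, 1}. coords (mvar 0 * a 3 - a 1) (a 1) 0 0 l * y l)"
            using a(2) 1 by (simp add: plane_def y_def u0_def u1_def algebra_simps)
          then show ?thesis using a(1) m(4)
            by (intro bexI[of _ "mvar 0"] conjI exI[of _ "coords (mvar 0 * a 3 - a 1) (a 1) 0 0"]) auto
        qed
      qed auto
    next
      case 2
      show ?thesis
      proof (intro exI[of _ "{0, 2}"] conjI ballI)
        show "y l \<in> sub_ker 4 (plane 0 j)" if "l \<in> {0, 2}" for l
          using that 2 by (auto simp: y_def u0_def u2_def sub_ker_def plane_def)
        fix f :: "'k mpol" assume "f \<in> sub_ker 4 (plane 0 j)"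
        then show "\<exists>g\<in>pcarr 4. g \<notin> pp \<and> (\<exists>a. (\<forall>l\<in>{0, 2}. a l \<in> pcarr 4) \<and> g * f = (\<Sum>l\<in>{0, 2}. a l * y l))"
        proof (rule com)
          fix a :: "nat \<Rightarrow> 'k mpol" assume a: "\<And>i. i < 4 \<Longrightarrow> a i \<in> pcarr 4" "f = a 0 * (mvar 0 - plane 0 j 0) + a 1 * (mvar 1 - plane 0 j 1) +
            a 2 * (mvar 2 - plane 0 j 2) + a 3 * (mvar 3 - plane 0 j 3)"
          have "mvar 0 * f = (\<Sum>l\<in>{0, 2}. coords (mvar 0 * a 3 + a 2) 0 (a 2) 0 l * y l)"
            using a(2) 2 by (simp add: plane_def y_def u0_def u2_def algebra_simps)
          then show ?thesis using a(1) m(4)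
            by (intro bexI[of _ "mvar 0"] conjI exI[of _ "coords (mvar 0 * a 3 + a 2) 0 (a 2) 0"]) auto
        qed
      qed auto
    next
      case 3
      show ?thesis
      proof (intro exI[of _ "{1, 2}"] conjI ballI)
        show "y l \<in> sub_ker 4 (plane 0 j)" if "l \<in> {1, 2}" for l
          using that 3 by (auto simp: y_def u1_def u2_def sub_ker_def plane_def algebra_simps)
        fix f :: "'k mpol" assume "f \<in> sub_ker 4 (plane 0 j)"
        then show "\<exists>g\<in>pcarr 4. g \<notin> pp \<and> (\<exists>a. (\<forall>l\<in>{1, 2}. a l \<in> pcarr 4) \<and> g * f = (\<Sum>l\<in>{1, 2}. a l * y l))"
        proof (rule com)
          fix a :: "nat \<Rightarrow> 'k mpol" assume a: "\<And>i. i < 4 \<Longrightarrow> a i \<in> pcarr 4" "f = a 0 * (mvar 0 - plane 0 j 0) + a 1 * (mvar 1 - plane 0 j 1) +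
            a 2 * (mvar 2 - plane 0 j 2) + a 3 * (mvar 3 - plane 0 j 3)"
          have "mvar 0 * f = (\<Sum>l\<in>{1, 2}. coords 0 (a 2 + mvar 0 * a 3) (a 2) 0 l * y l)"
            using a(2) 3 by (simp add: plane_def y_def u1_def u2_def algebra_simps)
          then show ?thesis using a(1) m(4)
            by (intro bexI[of _ "mvar 0"] conjI exI[of _ "coords 0 (a 2 + mvar 0 * a 3) (a 2) 0"]) auto
        qed
      qed auto
    qed
  qed auto
qed

text \<open>In the charts of \<open>x\<close> and \<open>y\<close> the two planes are disjoint: one
  lies in \<open>T = 0\<close>, the other in \<open>T + 1 = 0\<close>. In the chart of
  \<open>w\<close> any two planes meet only along \<open>x = y = z = 0\<close>, where the third
  passes as well, and off the origin \<open>w\<close> is a unit there. The factor \<open>c\<close>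
  allows for the zero divisor and for the exceptional one.\<close>

lemma snc_pair_off_origin:
  fixes X :: "('p, 's, 'k::field_char_0) kspace"
  assumes X: "locally_ringed_kspace X" and ac: "affine_coords 4 (planes k) X U \<phi>" and p: "p \<in> U"
    and k: "k < 3" and E: "\<And>\<xi>. \<xi> \<in> U \<Longrightarrow> E \<xi> = c * div_of X (\<phi> (mvar k)) \<xi>"
    and o: "k = 0 \<Longrightarrow> p \<noteq> origin 4 X U \<phi>"
  shows "snc_pair_at X E p"
proof -
  define pp where "pp = {f \<in> pcarr 4. \<phi> f p \<notin> Units (stalk X p)}"
  have pr: "primeideal pp (poly_ring 4)" unfolding pp_def by (rule point_prime(1)[OF X ac p])
  interpret pr: primeideal pp "poly_ring 4" by (rule pr)
  note P1 = poly_prime_0_1(2)[OF pr]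
  have diff: "a - b \<in> pp" if "a \<in> pp" "b \<in> pp" for a b using pr.minus_mem[OF that] pr.Icarr[OF that(2)] by simp
  have "planes k \<subseteq> pp" unfolding pp_def by (rule point_prime(2)[OF X ac p])
  then obtain i where i: "i < comps k" "sub_ker 4 (plane k i) \<subseteq> pp"
    using pr.prime_contains_factor[of "comps k" "\<lambda>i. sub_ker 4 (plane k i)"]
      primeideal.axioms(1)[OF primeideal_sub_ker] unfolding planes_def by blast
  show ?thesis
  proof (cases "\<forall>j<comps k. sub_ker 4 (plane k j) \<subseteq> pp \<longrightarrow> j = i")
    case True
    show ?thesis
    proof (rule snc_single_plane[OF X ac p k _ pp_def i(1) _ i(2)])
      show "E \<xi> = c * div_of X (\<phi> (mvar k)) \<xi>" if "\<xi> \<in> U" for \<xi> by (rule E[OF that])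
      show "j = i" if "j < comps k" "sub_ker 4 (plane k j) \<subseteq> pp" for j using True that by blast
    qed
  next
    case False
    then obtain j where j: "j < comps k" "sub_ker 4 (plane k j) \<subseteq> pp" "j \<noteq> i" by blast
    have ex: "\<exists>i j. i < j \<and> j < comps k \<and> sub_ker 4 (plane k i) \<subseteq> pp \<and> sub_ker 4 (plane k j) \<subseteq> pp"
      using i j by (metis linorder_neqE_nat)
    then obtain i j where ij: "i < j" "j < comps k" "sub_ker 4 (plane k i) \<subseteq> pp" "sub_ker 4 (plane k j) \<subseteq> pp" by blast
    have mi: "f \<in> pp" if "f \<in> pcarr 4" "sub (plane k i) f = 0" for f using ij(3) that by (auto simp: sub_ker_def)
    have mj: "f \<in> pp" if "f \<in> pcarr 4" "sub (plane k j) f = 0" for f using ij(4) that by (auto simp: sub_ker_def)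
    consider "k = 0" "i = 0" "j = 1" | "k = 0" "i = 0" "j = 2" | "k = 0" "i = 1" "j = 2" | "k = 1" "i = 0" "j = 1" | "k = 2" "i = 0" "j = 1"
      using ij(1,2) k by (auto simp: comps_def less_Suc_eq eval_nat_numeral split: if_splits)
    then show ?thesis
    proof cases
      case 4
      have "mvar 2 \<in> pp" by (rule mi) (simp_all add: 4 plane_def)
      moreover have "mvar 2 + 1 \<in> pp" by (rule mj) (simp_all add: 4 plane_def)
      ultimately show ?thesis using diff[of "mvar 2 + 1" "mvar 2"] P1 by simp
    next
      case 5
      have "mvar 1 \<in> pp" by (rule mi) (simp_all add: 5 plane_def)
      moreover have "mvar 1 + 1 \<in> pp" by (rule mj) (simp_all add: 5 plane_def)
      ultimately show ?thesis using diff[of "mvar 1 + 1" "mvar 1"] P1 by simp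
    next
      case 1
      have m: "mvar 1 \<in> pp" "mvar 3 \<in> pp" by (rule mi, simp_all add: 1 plane_def)+
      have m2: "mvar 2 \<in> pp" by (rule mj, simp_all add: 1 plane_def)
      note mm = m(1) m2 m(2)
      show ?thesis
      proof (cases "mvar 0 \<in> pp")
        case True
        then have "\<forall>i<4. mvar i \<in> pp" using mm less_4_cases by blast
        then show ?thesis using o[OF 1(1)] origin_point(2)[OF X ac _ p] origin_ideal_eq[OF pr] planes_0_origin 1(1)
          unfolding pp_def by blast
      next
        case False
        show ?thesis
          by (rule snc_triple_point[where c = c, OF X ac[unfolded 1(1)] p _ pp_def mm False]) (rule E[unfolded 1(1)])
      qed
    next
      case 2
      have m: "mvar 1 \<in> pp" "mvar 3 \<in> pp" by (rule mi, simp_all add: 2 plane_def)+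
      have "mvar 2 + mvar 1 \<in> pp" by (rule mj, simp_all add: 2 plane_def)
      then have m2: "mvar 2 \<in> pp" using diff[OF _ m(1)] by fastforce
      note mm = m(1) m2 m(2)
      show ?thesis
      proof (cases "mvar 0 \<in> pp")
        case True
        then have "\<forall>i<4. mvar i \<in> pp" using mm less_4_cases by blast
        then show ?thesis using o[OF 2(1)] origin_point(2)[OF X ac _ p] origin_ideal_eq[OF pr] planes_0_origin 2(1)
          unfolding pp_def by blast
      next
        case False
        show ?thesis
          by (rule snc_triple_point[where c = c, OF X ac[unfolded 2(1)] p _ pp_def mm False]) (rule E[unfolded 2(1)])
      qed
    next
      case 3
      have m: "mvar 2 \<in> pp" "mvar 3 \<in> pp" by (rule mi, simp_all add: 3 plane_def)+
      have "mvar 1 + mvar 2 \<in> pp" by (rule mj, simp_all add: 3 plane_def)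
      then have m2: "mvar 1 \<in> pp" using diff[OF _ m(1)] by fastforce
      note mm = m2 m(1) m(2)
      show ?thesis
      proof (cases "mvar 0 \<in> pp")
        case True
        then have "\<forall>i<4. mvar i \<in> pp" using mm less_4_cases by blast
        then show ?thesis using o[OF 3(1)] origin_point(2)[OF X ac _ p] origin_ideal_eq[OF pr] planes_0_origin 3(1)
          unfolding pp_def by blast
      next
        case False
        show ?thesis
          by (rule snc_triple_point[where c = c, OF X ac[unfolded 3(1)] p _ pp_def mm False]) (rule E[unfolded 3(1)])
      qed
    qed
  qed
qed

section \<open>The origin is not a simple normal crossings point\<close>

text \<open>An element of an ideal generated by some of the coordinates has a linear part involving
  only these coordinates. This is what the definition of snc contributes at the origin.\<close>

lemma genideal_combination_mod_sq:
  fixes R :: "'a ring" (structure)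
  assumes R: "cring R" and M: "ideal (max_ideal R) R" and y: "\<And>i. i < r \<Longrightarrow> y i \<in> carrier R"
    and T: "T \<subseteq> {..<(r::nat)}" and u: "u \<in> genideal R (y ` T)"
  obtains c where "\<And>j. j < r \<Longrightarrow> c j \<in> carrier R" "\<And>j. j < r \<Longrightarrow> j \<notin> T \<Longrightarrow> c j = \<zero>" "u \<in> carrier R"
    "u \<ominus> (\<Oplus>i\<in>{..<r}. c i \<otimes> y i) \<in> ideal_prod R (max_ideal R) (max_ideal R)"
proof -
  interpret cring R by fact
  \<comment> \<open>Zeros in place of the unwanted coordinates keep the index range
    \<open>{..<r}\<close>, so the span of \<open>yT\<close> is already known to be an ideal and can
    be compared with \<open>genideal\<close>.\<close>
  define yT where "yT j = (if j \<in> T then y j else \<zero>)" for j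
  have yT: "\<And>j. j < r \<Longrightarrow> yT j \<in> carrier R" using y by (simp add: yT_def)
  have "y ` T \<subseteq> span_mod_sq R r yT"
  proof
    fix a assume "a \<in> y ` T"
    then obtain j where j: "j \<in> T" "a = y j" by blast
    then have "a = yT j" "j < r" using T by (auto simp: yT_def)
    moreover from this have "yT j \<in> span_mod_sq R r yT" by (intro span_mod_sq_gen[OF R M] yT) simp_all
    ultimately show "a \<in> span_mod_sq R r yT" by simp
  qed
  moreover have "ideal (span_mod_sq R r yT) R" by (rule ideal_span_mod_sq[OF R M]) (rule yT)
  ultimately have "genideal R (y ` T) \<subseteq> span_mod_sq R r yT" by (intro genideal_minimal)
  then have "u \<in> span_mod_sq R r yT" using u by blast
  then obtain c where c: "u \<in> carrier R" "c \<in> {..<r} \<rightarrow> carrier R"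
    "u \<ominus> (\<Oplus>i\<in>{..<r}. c i \<otimes> yT i) \<in> ideal_prod R (max_ideal R) (max_ideal R)"
    unfolding span_mod_sq_def by blast
  have cc: "c j \<in> carrier R" if "j < r" for j using c(2) that by auto
  show thesis
  proof (rule that[of "\<lambda>j. if j \<in> T then c j else \<zero>"])
    have "(\<Oplus>i\<in>{..<r}. (if i \<in> T then c i else \<zero>) \<otimes> y i) = (\<Oplus>i\<in>{..<r}. c i \<otimes> yT i)"
      by (rule add.finprod_cong') (use y cc in \<open>auto simp: yT_def\<close>)
    then show "u \<ominus> (\<Oplus>i\<in>{..<r}. (if i \<in> T then c i else \<zero>) \<otimes> y i) \<in> ideal_prod R (max_ideal R) (max_ideal R)"
      using c(3) by simp
  qed (use cc c(1) in simp_all)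
qed

text \<open>A non-unit with invertible image would differ from a unit by an element of the kernel
  after multiplication, and the kernel lies in the maximal ideal. So the surjection of an embedding
  is a local homomorphism.\<close>

lemma max_ideal_image:
  assumes R: "cring R" and M: "ideal (max_ideal R) R" and S: "cring S" and th: "\<theta> \<in> ring_hom R S"
    and surj: "\<theta> ` carrier R = carrier S" and ker: "{u \<in> carrier R. \<theta> u = \<zero>\<^bsub>S\<^esub>} \<subseteq> max_ideal R"
    and u: "u \<in> max_ideal R"
  shows "\<theta> u \<in> max_ideal S"
proof -
  interpret ring_hom_cring R S \<theta> using R S th by (simp add: ring_hom_cring_def ring_hom_cring_axioms_def)
  interpret M: ideal "max_ideal R" R by (rule M)
  have uc: "u \<in> carrier R" by (rule M.Icarr[OF u])
  have "\<theta> u \<notin> Units S"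
  proof
    assume un: "\<theta> u \<in> Units S"
    then have "inv\<^bsub>S\<^esub> \<theta> u \<in> \<theta> ` carrier R" unfolding surj by simp
    then obtain v where v: "v \<in> carrier R" "\<theta> v = inv\<^bsub>S\<^esub> \<theta> u" by (metis imageE)
    have "\<theta> (u \<otimes>\<^bsub>R\<^esub> v \<ominus>\<^bsub>R\<^esub> \<one>\<^bsub>R\<^esub>) = \<zero>\<^bsub>S\<^esub>"
      using uc v un by (simp add: a_minus_def S.r_neg)
    then have "u \<otimes>\<^bsub>R\<^esub> v \<ominus>\<^bsub>R\<^esub> \<one>\<^bsub>R\<^esub> \<in> max_ideal R" using ker uc v(1) by auto
    from M.minus_mem[OF M.I_r_closed[OF u v(1)] this]
    have "u \<otimes>\<^bsub>R\<^esub> v \<ominus>\<^bsub>R\<^esub> (u \<otimes>\<^bsub>R\<^esub> v \<ominus>\<^bsub>R\<^esub> \<one>\<^bsub>R\<^esub>) \<in> max_ideal R" .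
    moreover have "u \<otimes>\<^bsub>R\<^esub> v \<ominus>\<^bsub>R\<^esub> (u \<otimes>\<^bsub>R\<^esub> v \<ominus>\<^bsub>R\<^esub> \<one>\<^bsub>R\<^esub>) = \<one>\<^bsub>R\<^esub>"
      using uc v(1) by (simp add: a_minus_def R.minus_add R.a_assoc[symmetric] R.r_neg)
    ultimately show False by (simp add: max_ideal_def)
  qed
  then show ?thesis using uc by (simp add: max_ideal_def)
qed

text \<open>If the germ were snc, the linear parts of the ideals of the components would be spanned by
  coordinates, hence \<open>(P\<^sub>0 + P\<^sub>2) \<inter> (P\<^sub>1 + P\<^sub>2)\<close> would be contained in \<open>P\<^sub>0 \<inter> P\<^sub>1 + P\<^sub>2 + m\<^sup>2\<close>. The
  element \<open>x\<close> lies in the former, but the tangent vector \<open>\<partial>/\<partial>x - \<partial>/\<partial>y\<close> kills the latter.\<close>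

lemma not_snc_origin:
  fixes X :: "('p, 's, 'k::field_char_0) kspace"
  assumes X: "locally_ringed_kspace X" and ac: "affine_coords 4 (planes 0) X U \<phi>"
  shows "\<not> snc_at X (origin 4 X U \<phi>)"
proof
  define p where "p = origin 4 X U \<phi>"
  assume "snc_at X (origin 4 X U \<phi>)"
  then obtain n fs z \<theta> r y S where snc: "snc_coords X p n fs z \<theta> r y S"
    unfolding snc_at_def p_def by blast
  have pU: "p \<in> U" and porig: "{f \<in> pcarr 4. \<phi> f p \<notin> Units (stalk X p)} = origin_ideal 4"
    using origin_point[OF X ac planes_0_origin] unfolding p_def by auto
  interpret B: poly_presentation 4 "stalk X p" "\<lambda>f. \<phi> f p" "planes 0"
    unfolding poly_presentation_def by (rule affine_coords_presentation[OF X ac pU])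
  have Bpp: "B.pp = origin_ideal 4" unfolding B.pp_def by (rule porig)
  have mv: "mvar i \<in> B.pp" if "i < 4" for i using that by (simp add: Bpp origin_ideal_def sub_ker_def)
  define P :: "nat \<Rightarrow> 'k mpol set" where "P i = sub_ker 4 (plane 0 i)" for i
  have Ppr: "primeideal (P i) (poly_ring 4)" for i unfolding P_def by (rule primeideal_sub_ker)
  have JP: "planes 0 \<subseteq> P i" if "i < 3" for i using that unfolding planes_def P_def by (auto simp: comps_def)
  have PJ: "{f \<in> pcarr 4. \<forall>i<3. f \<in> P i} \<subseteq> planes 0" unfolding planes_def P_def by (auto simp: comps_def)
  have Ppp: "P i \<subseteq> B.pp" if "i < 3" for i
  proof
    fix f assume "f \<in> P i"
    then have f: "f \<in> pcarr 4" "sub (plane 0 i) f = 0" by (simp_all add: P_def sub_ker_def)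
    have "sub (\<lambda>_. 0) (sub (plane 0 i) f) = sub (\<lambda>_. 0) f"
      by (rule sub_sub[OF f(1)]) (auto simp: plane_def coords_def)
    then show "f \<in> B.pp" using f by (simp add: Bpp origin_ideal_def sub_ker_def)
  qed
  \<comment> \<open>The functions \<open>x\<close>, \<open>y\<close> and \<open>x + y\<close> each
    vanish on exactly one of the planes, which excludes every proper inclusion.\<close>
  have inc: "P i = P j" if "i < 3" "j < 3" "P i \<subseteq> P j" for i j
  proof (rule ccontr)
    assume "P i \<noteq> P j"
    have x0: "mvar 1 \<in> P 0" "mvar 1 \<notin> P 1" "mvar 1 \<notin> P 2" by (simp_all add: P_def sub_ker_def plane_def)
    have y1: "mvar 2 \<in> P 1" "mvar 2 \<notin> P 0" "mvar 2 \<notin> P 2" by (simp_all add: P_def sub_ker_def plane_def)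
    have s2: "mvar 1 + mvar 2 \<in> P 2" "mvar 1 + mvar 2 \<notin> P 0" "mvar 1 + mvar 2 \<notin> P 1"
      by (simp_all add: P_def sub_ker_def plane_def)
    have "i = 0 \<or> i = 1 \<or> i = 2" "j = 0 \<or> j = 1 \<or> j = 2" using that(1,2) by auto
    then show False using \<open>P i \<noteq> P j\<close> that(3) x0 y1 s2 by (elim disjE) auto
  qed
  define Q where "Q i = B.ext (P i)" for i
  have Qmin: "Q i \<in> minimal_primes (stalk X p)" if "i < 3" for i
    unfolding Q_def by (rule B.ext_minimal_prime[of 3 P i, OF Ppr JP PJ that Ppp[OF that] inc[OF _ that]])
  define D where "D q = mderiv 1 q - mderiv 2 q" for q :: "'k mpol"
  have der: "derivation 4 D" unfolding D_def by (intro derivation_diff derivation_mderiv)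
  define M0 where "M0 = {f \<in> B.pp. D f \<in> B.pp}"
  note dm = B.derivation_ideal[OF der, folded M0_def]
  have com: thesis if f: "f \<in> P i"
    and "\<And>a :: nat \<Rightarrow> 'k mpol. (\<And>i. i < 4 \<Longrightarrow> a i \<in> pcarr 4) \<Longrightarrow> f = a 0 * (mvar 0 - plane 0 i 0) + a 1 * (mvar 1 - plane 0 i 1) +
      a 2 * (mvar 2 - plane 0 i 2) + a 3 * (mvar 3 - plane 0 i 3) \<Longrightarrow> thesis" for f :: "'k mpol" and thesis i
    by (rule sub_ker_combination[OF f[unfolded P_def] plane_pcarr]) (rule that(2))
  have P2M: "P 2 \<subseteq> M0"
  proof
    fix f assume "f \<in> P 2"
    then show "f \<in> M0"
    proof (rule com)
      fix a :: "nat \<Rightarrow> 'k mpol"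
      assume a: "\<And>i. i < 4 \<Longrightarrow> a i \<in> pcarr 4" and f: "f = a 0 * (mvar 0 - plane 0 2 0) + a 1 * (mvar 1 - plane 0 2 1) +
        a 2 * (mvar 2 - plane 0 2 2) + a 3 * (mvar 3 - plane 0 2 3)"
      have f': "f = a 2 * (mvar 2 + mvar 1) + a 3 * (mvar 3 + mvar 1 * mvar 0)" using f by (simp add: plane_def)
      have "mvar 2 + mvar 1 \<in> M0" using mv B.pp_0 by (simp add: M0_def D_def mderiv_simps B.pp_add)
      then have 1: "a 2 * (mvar 2 + mvar 1) \<in> M0" using ideal.I_l_closed[OF dm(1) _ a[of 2]] by simp
      \<comment> \<open>\<open>D\<close> sends \<open>z + xw\<close> to \<open>w\<close>, so this
        step uses that \<open>w\<close> vanishes at the point. It fails at the remaining points of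
        the \<open>w\<close>-axis, in accordance with \<open>snc_triple_point\<close>.\<close>
      have "mvar 3 + mvar 1 * mvar 0 \<in> M0" using mv by (simp add: M0_def D_def mderiv_simps B.pp_add B.pp_mult)
      then have 2: "a 3 * (mvar 3 + mvar 1 * mvar 0) \<in> M0" using ideal.I_l_closed[OF dm(1) _ a[of 3]] by simp
      show "f \<in> M0" using ideal.add_mem[OF dm(1) 1 2] f' by simp
    qed
  qed
  \<comment> \<open>Differentiation along \<open>y\<close> preserves the ideal of
    \<open>x = z = 0\<close>, and differentiation along \<open>x\<close> that of
    \<open>y = z = 0\<close>. So both partial derivatives of \<open>f\<close>, and with them
    \<open>D f\<close>, vanish at the origin.\<close>
  have P01M: "f \<in> M0" if f: "f \<in> P 0" "f \<in> P 1" for f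
  proof -
    have "mderiv 2 f \<in> B.pp" using f(1)
    proof (rule com)
      fix a :: "nat \<Rightarrow> 'k mpol"
      assume a: "\<And>i. i < 4 \<Longrightarrow> a i \<in> pcarr 4" and f: "f = a 0 * (mvar 0 - plane 0 0 0) + a 1 * (mvar 1 - plane 0 0 1) +
        a 2 * (mvar 2 - plane 0 0 2) + a 3 * (mvar 3 - plane 0 0 3)"
      have "mderiv 2 f = mderiv 2 (a 1) * mvar 1 + mderiv 2 (a 3) * mvar 3"
        using f by (simp add: plane_def mderiv_simps)
      then show "mderiv 2 f \<in> B.pp" using a mv by (simp add: B.pp_add B.pp_mult)
    qed
    moreover have "mderiv 1 f \<in> B.pp" using f(2)
    proof (rule com)
      fix a :: "nat \<Rightarrow> 'k mpol"
      assume a: "\<And>i. i < 4 \<Longrightarrow> a i \<in> pcarr 4" and f: "f = a 0 * (mvar 0 - plane 0 1 0) + a 1 * (mvar 1 - plane 0 1 1) +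
        a 2 * (mvar 2 - plane 0 1 2) + a 3 * (mvar 3 - plane 0 1 3)"
      have "mderiv 1 f = mderiv 1 (a 2) * mvar 2 + mderiv 1 (a 3) * mvar 3"
        using f by (simp add: plane_def mderiv_simps)
      then show "mderiv 1 f \<in> B.pp" using a mv by (simp add: B.pp_add B.pp_mult)
    qed
    moreover have "f \<in> B.pp" using f(1) Ppp[of 0] by auto
    ultimately show ?thesis unfolding M0_def D_def by (simp add: B.pp_diff)
  qed
  define E where "E = B.ext M0"
  have Eid: "ideal E (stalk X p)" unfolding E_def by (rule B.ideal_ext[OF dm(1)])
  have JM: "planes 0 \<subseteq> M0" using JP[of 2] P2M by auto
  have sqE: "ideal_prod (stalk X p) (max_ideal (stalk X p)) (max_ideal (stalk X p)) \<subseteq> E"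
    unfolding E_def by (rule dm(3)[OF JM])
  have Q2E: "Q 2 \<subseteq> E" unfolding Q_def E_def by (rule B.ext_mono[OF P2M])
  have Q01E: "a \<in> E" if a: "a \<in> Q 0" "a \<in> Q 1" for a
  proof -
    obtain f g where fg: "a \<in> carrier (stalk X p)" "f \<in> P 0" "g \<in> pcarr 4" "\<phi> g p \<in> Units (stalk X p)"
      "a \<otimes>\<^bsub>stalk X p\<^esub> \<phi> g p = \<phi> f p" using a(1) unfolding Q_def B.ext_def by blast
    have fc: "f \<in> pcarr 4" using fg(2) by (simp add: P_def sub_ker_def)
    note P1id = primeideal.axioms(1)[OF Ppr[of 1]]
    have "\<phi> f p \<in> B.ext (P 1)"
      using B.frac_mem_ideal[OF B.ideal_ext[OF P1id] fg(1,3,4,5)] a(2) unfolding Q_def by blast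
    then have "f \<in> P 1"
      using B.ext_contract[OF P1id JP[of 1] B.saturated_prime[OF Ppr[of 1] Ppp[of 1]] fc] by simp
    then have "f \<in> M0" using P01M fg(2) by blast
    then show "a \<in> E" unfolding E_def by (rule B.ext_mem[OF fg(1) _ fg(3,4,5)])
  qed
  have xE: "\<phi> (mvar 1) p \<notin> E"
  proof
    assume "\<phi> (mvar 1) p \<in> E"
    then have "mvar 1 \<in> M0" using B.ext_contract[OF dm(1) JM dm(2), of "mvar 1"] unfolding E_def by simp
    then have "1 \<in> B.pp" unfolding M0_def D_def by (simp add: mderiv_mvar)
    then show False using B.pp_1 by blast
  qed
  have emb: "smooth_embedding X p n fs z \<theta>" and reg: "regular_coords (germ_ring n fs z) r y"
    and comp: "\<And>P. P \<in> minimal_primes (stalk X p) \<Longrightarrow> S P \<subseteq> {..<r} \<and>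
      {u \<in> carrier (germ_ring n fs z). \<theta> u \<in> P} = genideal (germ_ring n fs z) (y ` S P)"
    using snc unfolding snc_coords_def by auto
  define R where "R = germ_ring n fs z"
  have fsz: "set fs \<subseteq> pcarr n" "primeideal z (coord_ring n fs)"
    and th: "\<theta> \<in> ring_hom R (stalk X p)" "\<theta> ` carrier R = carrier (stalk X p)"
    using emb unfolding smooth_embedding_def smooth_point_def R_def by auto
  obtain h where A0: "local_presentation (poly_ring n) R h (genideal (poly_ring n) (set fs))"
    using germ_presentation(1)[OF fsz] unfolding R_def by blast
  interpret A: local_presentation "poly_ring n" R h "genideal (poly_ring n) (set fs)" by (rule A0)
  have R: "cring R" by (rule A.S.is_cring)
  have M: "ideal (max_ideal R) R" by (rule A.ideal_max)
  interpret th: ring_hom_cring R "stalk X p" \<theta>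
    using R B.S.is_cring th(1) by (simp add: ring_hom_cring_def ring_hom_cring_axioms_def)
  interpret Eid: ideal E "stalk X p" by (rule Eid)
  interpret M: ideal "max_ideal R" R by (rule M)
  interpret MM: ideal "ideal_prod R (max_ideal R) (max_ideal R)" R by (rule A.S.ideal_prod_is_ideal[OF M M])
  have ymax: "y j \<in> max_ideal R" if "j < r" for j using reg that unfolding regular_coords_def R_def by blast
  have yc: "y j \<in> carrier R" if "j < r" for j by (rule M.Icarr[OF ymax[OF that]])
  define T where "T i = S (Q i)" for i
  have T: "T i \<subseteq> {..<r}" if "i < 3" for i using comp[OF Qmin[OF that]] unfolding T_def by blast
  have K: "{u \<in> carrier R. \<theta> u \<in> Q i} = genideal R (y ` T i)" if "i < 3" for i
    using comp[OF Qmin[OF that]] unfolding T_def R_def by blast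
  have Qid: "ideal (Q i) (stalk X p)" if "i < 3" for i
    using Qmin[OF that] unfolding minimal_primes_def by (simp add: primeideal.axioms(1))
  have yT: "\<theta> (y j) \<in> Q i" if "i < 3" "j \<in> T i" for i j
  proof -
    have "y ` T i \<subseteq> carrier R" using T[OF that(1)] yc by auto
    then have "y j \<in> genideal R (y ` T i)" using A.S.genideal_self that(2) by blast
    then show ?thesis using K[OF that(1)] by blast
  qed
  have "genideal R (y ` T 0) \<subseteq> max_ideal R"
    by (rule A.S.genideal_minimal[OF M]) (use T[of 0] ymax in auto)
  then have kerm: "{u \<in> carrier R. \<theta> u = \<zero>\<^bsub>stalk X p\<^esub>} \<subseteq> max_ideal R"
    using K[of 0] additive_subgroup.zero_closed[OF ideal.axioms(1)[OF Qid[of 0]]] by auto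
  note thmax = max_ideal_image[OF R M B.S.is_cring th kerm]
  \<comment> \<open>The ideal \<open>E\<close> is pulled back to the ambient germ, where the
    coordinates live. \<open>N\<close> contains the square of the maximal ideal because
    \<open>\<theta>\<close> is local and \<open>E\<close> contains the square of the maximal ideal
    of the stalk.\<close>
  define N where "N = {u \<in> carrier R. \<theta> u \<in> E}"
  have Nid: "ideal N R"
  proof (rule A.S.idealI_closed)
    show "\<zero>\<^bsub>R\<^esub> \<in> N" using additive_subgroup.zero_closed[OF Eid.additive_subgroup_axioms] by (simp add: N_def)
    show "a \<oplus>\<^bsub>R\<^esub> b \<in> N" if "a \<in> N" "b \<in> N" for a b using that Eid.add_mem by (simp add: N_def)
    show "x \<otimes>\<^bsub>R\<^esub> a \<in> N" if "a \<in> N" "x \<in> carrier R" for a x using that Eid.I_l_closed by (simp add: N_def)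
  qed (auto simp: N_def)
  have NI: "u \<in> N" if "u \<in> carrier R" "\<theta> u \<in> E" for u using that by (simp add: N_def)
  have ND: "\<theta> u \<in> E" if "u \<in> N" for u using that by (simp add: N_def)
  interpret Nid: ideal N R by (rule Nid)
  have sqN: "ideal_prod R (max_ideal R) (max_ideal R) \<subseteq> N"
  proof
    fix u assume "u \<in> ideal_prod R (max_ideal R) (max_ideal R)"
    then show "u \<in> N"
    proof (induction rule: ideal_prod.induct)
      case (prod a b)
      then have "\<theta> a \<otimes>\<^bsub>stalk X p\<^esub> \<theta> b \<in> E" using ideal_prod.prod[OF thmax thmax] sqE by blast
      then show ?case using M.Icarr[OF prod(1)] M.Icarr[OF prod(2)] by (intro NI) simp_all
    next
      case (sum a b)
      then show ?case by (rule_tac Nid.add_mem)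
    qed
  qed
  have lift: "\<exists>u. u \<in> carrier R \<and> \<theta> u = \<phi> f p" if "f \<in> pcarr 4" for f
    using th(2) B.hom_closed[OF that] by (metis imageE)
  \<comment> \<open>Lifts of \<open>x\<close> and \<open>y\<close>. They and their sum lie in the
    preimages of the first, second and third plane, and each preimage is generated by a set of
    coordinates.\<close>
  obtain u0 where u0: "u0 \<in> carrier R" "\<theta> u0 = \<phi> (mvar 1) p" using lift[of "mvar 1"] by auto
  obtain u1 where u1: "u1 \<in> carrier R" "\<theta> u1 = \<phi> (mvar 2) p" using lift[of "mvar 2"] by auto
  have in_Q: "\<phi> f p \<in> Q i" if "f \<in> P i" for f i
    unfolding Q_def by (rule B.ext_h[OF that]) (use that in \<open>simp add: P_def sub_ker_def\<close>)
  have "mvar 1 \<in> P 0" "mvar 2 \<in> P 1" "mvar 1 + mvar 2 \<in> P 2" by (simp_all add: P_def sub_ker_def plane_def)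
  then have inQ: "\<theta> u0 \<in> Q 0" "\<theta> u1 \<in> Q 1" "\<theta> (u0 \<oplus>\<^bsub>R\<^esub> u1) \<in> Q 2"
    using in_Q[of "mvar 1" 0] in_Q[of "mvar 2" 1] in_Q[of "mvar 1 + mvar 2" 2] u0 u1
    by (simp_all add: B.hom_simps)
  have lt: "0 < (3::nat)" "1 < (3::nat)" "2 < (3::nat)" by simp_all
  have g0: "u0 \<in> genideal R (y ` T 0)" unfolding K[OF lt(1), symmetric] using inQ(1) u0(1) by simp
  have g1: "u1 \<in> genideal R (y ` T 1)" unfolding K[OF lt(2), symmetric] using inQ(2) u1(1) by simp
  have g2: "u0 \<oplus>\<^bsub>R\<^esub> u1 \<in> genideal R (y ` T 2)"
    unfolding K[OF lt(3), symmetric] using inQ(3) u0(1) u1(1) A.S.a_closed by simp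
  let ?s = "\<lambda>c. \<Oplus>\<^bsub>R\<^esub>i\<in>{..<r}. c i \<otimes>\<^bsub>R\<^esub> y i"
  let ?sq = "ideal_prod R (max_ideal R) (max_ideal R)"
  obtain c where c: "\<And>j. j < r \<Longrightarrow> c j \<in> carrier R" "\<And>j. j < r \<Longrightarrow> j \<notin> T 0 \<Longrightarrow> c j = \<zero>\<^bsub>R\<^esub>"
    "u0 \<ominus>\<^bsub>R\<^esub> ?s c \<in> ?sq"
    by (rule genideal_combination_mod_sq[OF R M yc T[OF lt(1)] g0]) blast+
  obtain d where d: "\<And>j. j < r \<Longrightarrow> d j \<in> carrier R" "\<And>j. j < r \<Longrightarrow> j \<notin> T 1 \<Longrightarrow> d j = \<zero>\<^bsub>R\<^esub>"
    "u1 \<ominus>\<^bsub>R\<^esub> ?s d \<in> ?sq"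
    by (rule genideal_combination_mod_sq[OF R M yc T[OF lt(2)] g1]) blast+
  obtain e where e: "\<And>j. j < r \<Longrightarrow> e j \<in> carrier R" "\<And>j. j < r \<Longrightarrow> j \<notin> T 2 \<Longrightarrow> e j = \<zero>\<^bsub>R\<^esub>"
    "(u0 \<oplus>\<^bsub>R\<^esub> u1) \<ominus>\<^bsub>R\<^esub> ?s e \<in> ?sq"
    by (rule genideal_combination_mod_sq[OF R M yc T[OF lt(3)] g2]) blast+
  have sc: "?s a \<in> carrier R" if "\<And>j. j < r \<Longrightarrow> a j \<in> carrier R" for a
    by (rule A.S.finsum_closed) (use that yc in auto)
  note scd = sc[of c, OF c(1)] sc[of d, OF d(1)] sc[of e, OF e(1)]
  \<comment> \<open>Modulo \<open>m^2\<close> the linear parts \<open>c\<close>, \<open>d\<close>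
    and \<open>e\<close> represent \<open>u0\<close>, \<open>u1\<close> and \<open>u0 + u1\<close>.
    So \<open>b\<close> is a relation between coordinates, and regularity forces its entries into
    the maximal ideal.\<close>
  define b where "b j = c j \<oplus>\<^bsub>R\<^esub> d j \<ominus>\<^bsub>R\<^esub> e j" for j
  have sb: "?s b = ?s c \<oplus>\<^bsub>R\<^esub> ?s d \<ominus>\<^bsub>R\<^esub> ?s e"
  proof -
    have "?s b = (\<Oplus>\<^bsub>R\<^esub>i\<in>{..<r}. (c i \<otimes>\<^bsub>R\<^esub> y i \<oplus>\<^bsub>R\<^esub> d i \<otimes>\<^bsub>R\<^esub> y i) \<oplus>\<^bsub>R\<^esub> (\<ominus>\<^bsub>R\<^esub> \<one>\<^bsub>R\<^esub> \<otimes>\<^bsub>R\<^esub> e i) \<otimes>\<^bsub>R\<^esub> y i)"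
      by (rule A.S.add.finprod_cong')
        (use c(1) d(1) e(1) yc in \<open>auto simp: b_def a_minus_def A.S.l_distr A.S.l_minus\<close>)
    also have "\<dots> = (\<Oplus>\<^bsub>R\<^esub>i\<in>{..<r}. c i \<otimes>\<^bsub>R\<^esub> y i \<oplus>\<^bsub>R\<^esub> d i \<otimes>\<^bsub>R\<^esub> y i) \<oplus>\<^bsub>R\<^esub> ?s (\<lambda>i. \<ominus>\<^bsub>R\<^esub> \<one>\<^bsub>R\<^esub> \<otimes>\<^bsub>R\<^esub> e i)"
      by (rule A.S.finsum_addf) (use c(1) d(1) e(1) yc in auto)
    also have "(\<Oplus>\<^bsub>R\<^esub>i\<in>{..<r}. c i \<otimes>\<^bsub>R\<^esub> y i \<oplus>\<^bsub>R\<^esub> d i \<otimes>\<^bsub>R\<^esub> y i) = ?s c \<oplus>\<^bsub>R\<^esub> ?s d"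
      by (rule A.S.finsum_addf) (use c(1) d(1) yc in auto)
    also have "?s (\<lambda>i. \<ominus>\<^bsub>R\<^esub> \<one>\<^bsub>R\<^esub> \<otimes>\<^bsub>R\<^esub> e i) = \<ominus>\<^bsub>R\<^esub> \<one>\<^bsub>R\<^esub> \<otimes>\<^bsub>R\<^esub> ?s e"
      by (rule finsum_scale[OF R M, symmetric]) (use e(1) yc in auto)
    also have "\<ominus>\<^bsub>R\<^esub> \<one>\<^bsub>R\<^esub> \<otimes>\<^bsub>R\<^esub> ?s e = \<ominus>\<^bsub>R\<^esub> ?s e" using scd(3) by (simp add: A.S.l_minus)
    finally show ?thesis by (simp add: a_minus_def)
  qed
  have "((u0 \<oplus>\<^bsub>R\<^esub> u1) \<ominus>\<^bsub>R\<^esub> ?s e) \<ominus>\<^bsub>R\<^esub> (u0 \<ominus>\<^bsub>R\<^esub> ?s c) \<ominus>\<^bsub>R\<^esub> (u1 \<ominus>\<^bsub>R\<^esub> ?s d) \<in> ?sq"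
    by (intro MM.minus_mem c(3) d(3) e(3))
  moreover have "((u0 \<oplus>\<^bsub>R\<^esub> u1) \<ominus>\<^bsub>R\<^esub> s2) \<ominus>\<^bsub>R\<^esub> (u0 \<ominus>\<^bsub>R\<^esub> s0) \<ominus>\<^bsub>R\<^esub> (u1 \<ominus>\<^bsub>R\<^esub> s1) = s0 \<oplus>\<^bsub>R\<^esub> s1 \<ominus>\<^bsub>R\<^esub> s2"
    if "s0 \<in> carrier R" "s1 \<in> carrier R" "s2 \<in> carrier R" for s0 s1 s2
  proof -
    have "((u0 \<oplus>\<^bsub>R\<^esub> u1) \<ominus>\<^bsub>R\<^esub> s2) \<ominus>\<^bsub>R\<^esub> (u0 \<ominus>\<^bsub>R\<^esub> s0) \<ominus>\<^bsub>R\<^esub> (u1 \<ominus>\<^bsub>R\<^esub> s1) =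
      (u0 \<oplus>\<^bsub>R\<^esub> \<ominus>\<^bsub>R\<^esub> u0) \<oplus>\<^bsub>R\<^esub> ((u1 \<oplus>\<^bsub>R\<^esub> \<ominus>\<^bsub>R\<^esub> u1) \<oplus>\<^bsub>R\<^esub> (s0 \<oplus>\<^bsub>R\<^esub> s1 \<ominus>\<^bsub>R\<^esub> s2))"
      using that u0(1) u1(1) by (simp add: a_minus_def A.S.minus_add A.S.a_ac del: A.S.r_neg A.S.l_neg)
    then show ?thesis using that u0(1) u1(1) by (simp add: A.S.r_neg)
  qed
  ultimately have "?s b \<in> ?sq" unfolding sb using scd by simp
  moreover have bc: "b j \<in> carrier R" if "j < r" for j using c(1) d(1) e(1) that by (simp add: b_def)
  moreover have "b \<in> {..<r} \<rightarrow> carrier R" using bc by auto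
  ultimately have bm: "b j \<in> max_ideal R" if "j < r" for j
    using reg that unfolding regular_coords_def R_def by blast
  have summand: "c j \<otimes>\<^bsub>R\<^esub> y j \<in> N" if j: "j < r" for j
  proof -
    have yN: "y j \<in> N \<Longrightarrow> c j \<otimes>\<^bsub>R\<^esub> y j \<in> N" using Nid.I_l_closed c(1)[OF j] by blast
    \<comment> \<open>A term of the linear part of \<open>u0\<close> is zero outside
      \<open>T 0\<close>; it lies in \<open>N\<close> if \<open>y j\<close> vanishes on the third
      plane or on the first two. In the last case \<open>d j\<close> and \<open>e j\<close> are
      zero, so \<open>c j = b j\<close> lies in \<open>m\<close> and the term in
      \<open>m^2\<close>.\<close>
    consider "j \<notin> T 0" | "j \<in> T 2" | "j \<in> T 0" "j \<in> T 1" | "j \<notin> T 1" "j \<notin> T 2" by blast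
    then show ?thesis
    proof cases
      case 1
      then show ?thesis
        using c(2)[OF j] yc[OF j] additive_subgroup.zero_closed[OF Nid.additive_subgroup_axioms] by simp
    next
      case 2
      then have "y j \<in> N" using yT[of 2 j] Q2E yc[OF j] by (intro NI) auto
      then show ?thesis by (rule yN)
    next
      case 3
      then have "y j \<in> N" using yT[of 0 j] yT[of 1 j] Q01E yc[OF j] by (intro NI) simp_all
      then show ?thesis by (rule yN)
    next
      case 4
      then have "b j = c j" using c(1)[OF j] d(2)[OF j] e(2)[OF j] by (simp add: b_def a_minus_def)
      then have "c j \<in> max_ideal R" using bm[OF j] by simp
      then show ?thesis using ideal_prod.prod[OF _ ymax[OF j]] sqN by blast
    qed
  qed
  have "?s c \<in> N" if "\<And>j. j < r \<Longrightarrow> c j \<otimes>\<^bsub>R\<^esub> y j \<in> N"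
  proof -
    have "(\<Oplus>\<^bsub>R\<^esub>i\<in>{..<r'}. c i \<otimes>\<^bsub>R\<^esub> y i) \<in> N" if "r' \<le> r" for r'
      using that
    proof (induction r')
      case 0
      then show ?case using additive_subgroup.zero_closed[OF Nid.additive_subgroup_axioms] by simp
    next
      case (Suc r')
      have "(\<Oplus>\<^bsub>R\<^esub>i\<in>{..<Suc r'}. c i \<otimes>\<^bsub>R\<^esub> y i) = c r' \<otimes>\<^bsub>R\<^esub> y r' \<oplus>\<^bsub>R\<^esub> (\<Oplus>\<^bsub>R\<^esub>i\<in>{..<r'}. c i \<otimes>\<^bsub>R\<^esub> y i)"
        by (rule finsum_lessThan_Suc[OF R M]) (use c(1) yc Suc.prems in auto)
      then show ?case using Suc summand[of r'] Nid.add_mem by simp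
    qed
    then show ?thesis by blast
  qed
  then have scN: "?s c \<in> N" using summand by blast
  \<comment> \<open>Modulo \<open>m^2\<close> the lift \<open>u0\<close> is its linear part, so it
    lies in \<open>N\<close>. But its image \<open>x\<close> is not in \<open>E\<close>, as
    \<open>D\<close> takes the value 1 on \<open>x\<close>.\<close>
  have "u0 \<ominus>\<^bsub>R\<^esub> ?s c \<oplus>\<^bsub>R\<^esub> ?s c \<in> N" using Nid.add_mem[OF _ scN] c(3) sqN by blast
  then have "u0 \<in> N" using u0(1) scd(1) by (simp add: a_minus_def A.S.a_assoc A.S.l_neg)
  then show False using ND[of u0] u0(2) xE by simp
qed

section \<open>The charts of the blowing-up of the origin\<close>

text \<open>The ideal of the strict transform in the chart of \<open>T_k\<close>, in terms of
  numerators: \<open>p\<close> is the fraction with numerator \<open>q\<close> and denominator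
  \<open>T_k^N\<close>, and it vanishes on the chart when some power of \<open>T_k\<close>
  multiplies \<open>q\<close> into \<open>J\<close>.\<close>

definition chart_transform :: "nat \<Rightarrow> nat \<Rightarrow> 'k::field_char_0 mpol set \<Rightarrow> 'k mpol set" where
  "chart_transform n k J = {p \<in> pcarr n. \<exists>N q m. q \<in> pcarr n \<and>
     mvar k ^ N * p = chart_sub k q \<and> mvar k ^ m * q \<in> J}"

lemma chart_sub_simps [simp]:
  "chart_sub k (p + q) = chart_sub k p + chart_sub k q"
  "chart_sub k (p - q) = chart_sub k p - chart_sub k q"
  "chart_sub k (- p) = - chart_sub k p"
  "chart_sub k (p * q) = chart_sub k p * chart_sub k q"
  "chart_sub k (p ^ d) = chart_sub k p ^ d"
  "chart_sub k (mconst c) = mconst c" "chart_sub k 1 = 1" "chart_sub k 0 = 0"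
  "chart_sub k (mvar i) = (if i = k then mvar k else mvar i * mvar k)"
  by (simp_all add: chart_sub_def)

lemma chart_sub_eq_iff: "chart_sub k p = chart_sub k q \<longleftrightarrow> p = q"
  using chart_sub_inj[of k "p - q"] by auto

lemma chart_sub_denominator:
  assumes "p \<in> pcarr n" "k < n"
  shows "\<exists>N q. q \<in> pcarr n \<and> mvar k ^ N * p = chart_sub k q"
  using assms(1)
proof (induction p rule: mpol_induct)
  case (const c)
  show ?case by (rule exI[of _ 0], rule exI[of _ "mconst c"]) simp
next
  case (var i)
  show ?case
  proof (cases "i = k")
    case True
    then show ?thesis using var by (intro exI[of _ 0] exI[of _ "mvar i"]) simp
  next
    case False
    then show ?thesis using var by (intro exI[of _ 1] exI[of _ "mvar i"]) (simp add: mult.commute)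
  qed
next
  case (add f g)
  then obtain N q N' q' where *: "q \<in> pcarr n" "mvar k ^ N * f = chart_sub k q"
    "q' \<in> pcarr n" "mvar k ^ N' * g = chart_sub k q'" by blast
  have "mvar k ^ (N + N') * (f + g) = mvar k ^ N' * (mvar k ^ N * f) + mvar k ^ N * (mvar k ^ N' * g)"
    by (simp add: power_add algebra_simps)
  also have "\<dots> = chart_sub k (mvar k ^ N' * q + mvar k ^ N * q')" by (simp add: *)
  finally show ?case using * assms(2) by (intro exI[of _ "N + N'"] exI[of _ "mvar k ^ N' * q + mvar k ^ N * q'"]) auto
next
  case (mult f g)
  then obtain N q N' q' where *: "q \<in> pcarr n" "mvar k ^ N * f = chart_sub k q"
    "q' \<in> pcarr n" "mvar k ^ N' * g = chart_sub k q'" by blast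
  have "mvar k ^ (N + N') * (f * g) = (mvar k ^ N * f) * (mvar k ^ N' * g)"
    by (simp add: power_add algebra_simps)
  also have "\<dots> = chart_sub k (q * q')" by (simp add: *)
  finally show ?case using * by (intro exI[of _ "N + N'"] exI[of _ "q * q'"]) auto
qed

text \<open>Here \<open>s'\<close> parametrizes the transform of the plane given by
  \<open>s\<close>: the hypotheses say that substituting commutes with passing to the chart. As
  \<open>chart_sub k\<close> is injective and powers of \<open>T_k\<close> are nonzero in a domain,
  the kernels correspond. \<open>T_k\<close> must be a parameter of \<open>s'\<close>.\<close>

lemma chart_kernel_iff:
  assumes s: "\<And>i. i < n \<Longrightarrow> chart_sub k (s i) = (if i = k then mvar k else s' i * mvar k)"
    and s'k: "s' k = mvar k" and q: "q \<in> pcarr n" and p: "mvar k ^ N * p = chart_sub k q"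
  shows "sub s' p = 0 \<longleftrightarrow> sub s q = 0"
proof -
  have "sub s' (chart_sub k q) = chart_sub k (sub s q)"
  proof -
    have 1: "sub s' (chart_sub k q) = sub (\<lambda>i. if i = k then mvar k else s' i * mvar k) q"
      unfolding chart_sub_def by (rule sub_sub[OF q]) (simp add: s'k)
    have 2: "chart_sub k (sub s q) = sub (\<lambda>i. if i = k then mvar k else s' i * mvar k) q"
      unfolding chart_sub_def by (rule sub_sub[OF q]) (simp add: s[unfolded chart_sub_def])
    show ?thesis using 1 2 by simp
  qed
  then have "mvar k ^ N * sub s' p = chart_sub k (sub s q)" using arg_cong[OF p, of "sub s'"] s'k by simp
  moreover have "chart_sub k (sub s q) = 0 \<longleftrightarrow> sub s q = 0" using chart_sub_eq_iff[of k _ 0] by simp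
  ultimately show ?thesis by (metis mult_eq_0_iff mvar_neq_0 power_not_zero)
qed

text \<open>The chart of \<open>y\<close> requires \<open>y\<close> as a parameter, whereas
  \<open>plane 0 2\<close> uses \<open>x\<close>. The same plane is therefore parametrized a second
  time.\<close>

lemma third_plane_alt:
  assumes "q \<in> pcarr 4"
  shows "sub (plane 0 2) q = 0 \<longleftrightarrow> sub (coords (mvar 0) (- mvar 2) (mvar 2) (mvar 2 * mvar 0)) q = 0"
    (is "_ \<longleftrightarrow> sub ?s q = 0")
proof -
  have 1: "sub ?s (sub (plane 0 2) q) = sub ?s q"
    by (rule sub_sub[OF assms]) (auto simp: plane_def dest!: less_4_cases)
  have 2: "sub (plane 0 2) (sub ?s q) = sub (plane 0 2) q"
    by (rule sub_sub[OF assms]) (auto simp: plane_def dest!: less_4_cases)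
  show ?thesis using 1 2 by (metis sub_0)
qed

text \<open>Each plane on which \<open>T_k\<close> is a nonzero function is carried to its transform
  by \<open>chart_kernel_iff\<close>; a plane inside \<open>T_k = 0\<close> is removed by the
  saturation. For \<open>k = 0\<close> all three planes survive with unchanged equations, which is
  the self-reproduction of the example.\<close>

lemma chart_transform_planes:
  assumes k: "k < 3" shows "chart_transform 4 k (planes 0) = (planes k :: 'k::field_char_0 mpol set)"
proof -
  have all3: "(\<forall>i<comps 0. Z i) \<longleftrightarrow> Z 0 \<and> Z 1 \<and> Z (2::nat)" for Z
    by (auto simp: comps_def eval_nat_numeral less_Suc_eq)
  have all2: "k \<noteq> 0 \<Longrightarrow> (\<forall>i<comps k. Z i) \<longleftrightarrow> Z 0 \<and> Z (1::nat)" for Z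
    by (auto simp: comps_def eval_nat_numeral less_Suc_eq)
  have key: "p \<in> planes k \<longleftrightarrow> (\<exists>m. mvar k ^ m * q \<in> planes 0)"
    if p: "p \<in> pcarr 4" and q: "q \<in> pcarr 4" and pq: "mvar k ^ N * p = chart_sub k q"
    for p q :: "'k mpol" and N
  proof -
    have sk: "mvar k ^ m * q \<in> planes 0 \<longleftrightarrow>
       (\<forall>i<comps 0. plane 0 i k ^ m = (0 :: 'k mpol) \<or> sub (plane 0 i) q = 0)" for m
      using q k by (simp add: planes_def sub_ker_def)
    have kk: "k = 0 \<or> k = 1 \<or> k = 2" using k by auto
    show ?thesis
    proof (cases "k = 0")
      case True
      have it: "sub (plane 0 i) p = 0 \<longleftrightarrow> sub (plane 0 i) q = 0" if "i = 0 \<or> i = 1 \<or> i = 2" for i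
        by (rule chart_kernel_iff[OF _ _ q pq]) (use True that in \<open>auto simp: plane_def dest!: less_4_cases\<close>)
      have nz: "plane 0 i 0 ^ m \<noteq> (0 :: 'k mpol)" if "i = 0 \<or> i = 1 \<or> i = 2" for i m
        using that by (auto simp: plane_def)
      have "p \<in> planes 0 \<longleftrightarrow> (\<forall>i<comps 0. sub (plane 0 i) q = 0)"
        unfolding planes_def all3 using it p by (simp add: sub_ker_def)
      then show ?thesis unfolding sk using nz True unfolding all3 by auto
    next
      case False
      then consider "k = 1" | "k = 2" using kk by blast
      then show ?thesis
      proof cases
        case 1
        have i0: "sub (plane 1 0) p = 0 \<longleftrightarrow> sub (plane 0 1) q = 0"
          by (rule chart_kernel_iff[OF _ _ q pq[unfolded 1]]) (auto simp: plane_def dest!: less_4_cases)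
        have i1: "sub (plane 1 1) p = 0 \<longleftrightarrow> sub (plane 0 2) q = 0"
          by (rule chart_kernel_iff[OF _ _ q pq[unfolded 1]]) (auto simp: plane_def dest!: less_4_cases)
        have "p \<in> planes 1 \<longleftrightarrow> sub (plane 0 1) q = 0 \<and> sub (plane 0 2) q = 0"
          using i0 i1 p all2[unfolded 1] by (simp add: planes_def sub_ker_def)
        \<comment> \<open>\<open>x\<close> vanishes on the plane \<open>x = z = 0\<close>, so the
          condition of this plane remains only for \<open>m = 0\<close>, and \<open>m = 1\<close>
          already removes it. In the chart of \<open>y\<close> the same happens to
          \<open>y = z = 0\<close>.\<close>
        moreover have "mvar k ^ m * q \<in> planes 0 \<longleftrightarrow> (m = 0 \<longrightarrow> sub (plane 0 0) q = 0) \<and>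
           sub (plane 0 1) q = 0 \<and> sub (plane 0 2) q = 0" for m
          unfolding sk all3 unfolding 1 by (auto simp: plane_def power_0_left)
        ultimately show ?thesis unfolding 1 by (metis zero_neq_one)
      next
        case 2
        have i0: "sub (plane 2 0) p = 0 \<longleftrightarrow> sub (plane 0 0) q = 0"
          by (rule chart_kernel_iff[OF _ _ q pq[unfolded 2]]) (auto simp: plane_def dest!: less_4_cases)
        have i1: "sub (plane 2 1) p = 0 \<longleftrightarrow> sub (plane 0 2) q = 0"
          unfolding third_plane_alt[OF q]
          by (rule chart_kernel_iff[OF _ _ q pq[unfolded 2]]) (auto simp: plane_def dest!: less_4_cases)
        have "p \<in> planes 2 \<longleftrightarrow> sub (plane 0 0) q = 0 \<and> sub (plane 0 2) q = 0"
          using i0 i1 p all2[unfolded 2] by (simp add: planes_def sub_ker_def)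
        moreover have "mvar k ^ m * q \<in> planes 0 \<longleftrightarrow> (m = 0 \<longrightarrow> sub (plane 0 1) q = 0) \<and>
           sub (plane 0 0) q = 0 \<and> sub (plane 0 2) q = 0" for m
          unfolding sk all3 unfolding 2 by (auto simp: plane_def power_0_left)
        ultimately show ?thesis unfolding 2 by (metis zero_neq_one)
      qed
    qed
  qed
  show ?thesis
  proof (intro equalityI subsetI)
    fix p :: "'k mpol" assume "p \<in> chart_transform 4 k (planes 0)"
    then obtain N q m where *: "p \<in> pcarr 4" "q \<in> pcarr 4" "mvar k ^ N * p = chart_sub k q" "mvar k ^ m * q \<in> planes 0"
      unfolding chart_transform_def by blast
    then show "p \<in> planes k" using key[OF *(1,2,3)] by blast
  next
    fix p :: "'k mpol" assume p: "p \<in> planes k"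
    then have pc: "p \<in> pcarr 4" by (simp add: planes_def)
    obtain N q where q: "q \<in> pcarr 4" "mvar k ^ N * p = chart_sub k q"
      using chart_sub_denominator[OF pc, of k] k by auto
    obtain m where "mvar k ^ m * q \<in> planes 0" using key[OF pc q] p by blast
    then show "p \<in> chart_transform 4 k (planes 0)" unfolding chart_transform_def using pc q by blast
  qed
qed

text \<open>The ring of the chart consists of the fractions \<open>H q / H T\<^sub>k\<^sup>N\<close>; such a fraction is the value of
  the polynomial \<open>p\<close> with \<open>T\<^sub>k\<^sup>N p(T) = q(T\<^sub>0 T\<^sub>k, \<dots>, T\<^sub>k, \<dots>)\<close> at the coordinates of the chart.\<close>

lemma chart_coordinates:
  fixes B :: "'b ring" (structure) and H :: "'k::field_char_0 mpol \<Rightarrow> 'b"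
  assumes H: "ring_hom_cring (poly_ring n) B H" and k: "k < n"
    and reg: "\<And>g. g \<in> carrier B \<Longrightarrow> H (mvar k) \<otimes> g = \<zero> \<Longrightarrow> g = \<zero>"
    and ex: "\<And>i. i < n \<Longrightarrow> \<exists>g\<in>carrier B. H (mvar k) \<otimes> g = H (mvar i)"
    and surj: "\<And>g. g \<in> carrier B \<Longrightarrow> \<exists>N q p. q \<in> pcarr n \<and> p \<in> pcarr n \<and>
      mvar k ^ N * p = chart_sub k q \<and> H (mvar k ^ N) \<otimes> g = H q"
    and ker: "\<And>q. q \<in> pcarr n \<Longrightarrow> H q = \<zero> \<longleftrightarrow> (\<exists>m. mvar k ^ m * q \<in> J)"
  shows "\<exists>\<psi>. \<psi> \<in> ring_hom (poly_ring n) B \<and> \<psi> ` pcarr n = carrier B \<and>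
    {p \<in> pcarr n. \<psi> p = \<zero>} = chart_transform n k J \<and> \<psi> (mvar k) = H (mvar k) \<and>
    (\<forall>i<n. i \<noteq> k \<longrightarrow> H (mvar i) = H (mvar k) \<otimes> \<psi> (mvar i)) \<and> (\<forall>c. \<psi> (mconst c) = H (mconst c))"
proof -
  interpret H: ring_hom_cring "poly_ring n" B H by (rule H)
  have Hs: "H (f * g) = H f \<otimes> H g" "H (f + g) = H f \<oplus> H g" if "f \<in> pcarr n" "g \<in> pcarr n" for f g
    using H.hom_mult[of f g] H.hom_add[of f g] that by simp_all
  have H1: "H 1 = \<one>" and H0: "H 0 = \<zero>" using H.hom_one H.hom_zero by simp_all
  have Hc: "H f \<in> carrier B" if "f \<in> pcarr n" for f using H.hom_closed that by blast
  have tc: "mvar k ^ N \<in> pcarr n" for N using k by simp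
  have regN: "g = \<zero>" if "g \<in> carrier B" "H (mvar k ^ N) \<otimes> g = \<zero>" for g N
    using that(2)
  proof (induction N)
    case (Suc N)
    have "H (mvar k) \<otimes> (H (mvar k ^ N) \<otimes> g) = \<zero>"
      using Suc.prems Hs(1)[of "mvar k" "mvar k ^ N"] Hc tc k that(1) by (simp add: H.S.m_assoc)
    then have "H (mvar k ^ N) \<otimes> g = \<zero>" by (rule reg[OF H.S.m_closed[OF Hc[OF tc] that(1)]])
    then show ?case by (rule Suc.IH)
  qed (use that(1) H1 in simp)
  have cancel: "g = g'" if "g \<in> carrier B" "g' \<in> carrier B" "H (mvar k ^ N) \<otimes> g = H (mvar k ^ N) \<otimes> g'" for g g' N
  proof -
    have "H (mvar k ^ N) \<otimes> (g \<ominus> g') = H (mvar k ^ N) \<otimes> g \<ominus> H (mvar k ^ N) \<otimes> g'"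
      using that(1,2) Hc[OF tc] by (simp add: a_minus_def H.S.r_distr H.S.r_minus)
    also have "\<dots> = \<zero>" unfolding that(3) using that(2) Hc[OF tc] by (simp add: a_minus_def H.S.r_neg)
    finally have "g \<ominus> g' = \<zero>" using regN[of "g \<ominus> g'"] that(1,2) by simp
    then show ?thesis using that(1,2) H.S.minus_equality[of g "\<ominus> g'"] by (simp add: a_minus_def)
  qed
  \<comment> \<open>The graph of \<open>\<psi>\<close>. It is single-valued because
    \<open>chart_sub k\<close> is injective and \<open>H (mvar k)\<close> is not a zero-divisor, and
    it is total because it contains constants and variables and is closed under sums and
    products.\<close>
  define G where "G p g \<longleftrightarrow> g \<in> carrier B \<and> (\<exists>N q. q \<in> pcarr n \<and> mvar k ^ N * p = chart_sub k q \<and>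
     H (mvar k ^ N) \<otimes> g = H q)" for p g
  have Gc: "G p g \<Longrightarrow> g \<in> carrier B" for p g by (simp add: G_def)
  have uniq: "g = g'" if GG: "G p g" "G p g'" for p g g'
  proof -
    obtain N q where q: "q \<in> pcarr n" "mvar k ^ N * p = chart_sub k q" "H (mvar k ^ N) \<otimes> g = H q"
      using GG(1) unfolding G_def by blast
    obtain N' q' where q': "q' \<in> pcarr n" "mvar k ^ N' * p = chart_sub k q'" "H (mvar k ^ N') \<otimes> g' = H q'"
      using GG(2) unfolding G_def by blast
    have "chart_sub k (mvar k ^ N' * q) = mvar k ^ N' * (mvar k ^ N * p)" using q(2) by simp
    also have "\<dots> = mvar k ^ N * (mvar k ^ N' * p)" by (simp add: mult.left_commute)
    also have "\<dots> = chart_sub k (mvar k ^ N * q')" using q'(2) by simp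
    finally have e: "mvar k ^ N' * q = mvar k ^ N * q'" unfolding chart_sub_eq_iff .
    have "H (mvar k ^ (N' + N)) \<otimes> g = H (mvar k ^ N') \<otimes> (H (mvar k ^ N) \<otimes> g)"
      unfolding power_add Hs(1)[OF tc tc] using Gc[OF GG(1)] Hc[OF tc] by (simp add: H.S.m_assoc)
    also have "\<dots> = H (mvar k ^ N' * q)" unfolding q(3) Hs(1)[OF tc q(1)] ..
    also have "\<dots> = H (mvar k ^ N) \<otimes> (H (mvar k ^ N') \<otimes> g')" unfolding e q'(3) Hs(1)[OF tc q'(1)] ..
    also have "\<dots> = H (mvar k ^ (N' + N)) \<otimes> g'"
      unfolding power_add Hs(1)[OF tc tc] using Gc[OF GG(2)] Hc[OF tc] by (simp add: H.S.m_ac)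
    finally show ?thesis by (rule cancel[OF Gc[OF GG(1)] Gc[OF GG(2)]])
  qed
  have Gconst: "G (mconst c) (H (mconst c))" for c
    unfolding G_def using Hc H1 by (intro conjI exI[of _ 0] exI[of _ "mconst c"]) simp_all
  have Gk: "G (mvar k) (H (mvar k))"
    unfolding G_def using Hc H1 k by (intro conjI exI[of _ 0] exI[of _ "mvar k"]) simp_all
  have Gi: "G (mvar i) g" if "i < n" "i \<noteq> k" "g \<in> carrier B" "H (mvar k) \<otimes> g = H (mvar i)" for i g
    unfolding G_def using that by (intro conjI exI[of _ 1] exI[of _ "mvar i"]) (simp_all add: mult.commute)
  have Gadd: "G (p + p') (g \<oplus> g')" if GG: "G p g" "G p' g'" for p p' g g'
  proof -
    obtain N q where q: "q \<in> pcarr n" "mvar k ^ N * p = chart_sub k q" "H (mvar k ^ N) \<otimes> g = H q"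
      using GG(1) unfolding G_def by blast
    obtain N' q' where q': "q' \<in> pcarr n" "mvar k ^ N' * p' = chart_sub k q'" "H (mvar k ^ N') \<otimes> g' = H q'"
      using GG(2) unfolding G_def by blast
    have "mvar k ^ (N' + N) * (p + p') = mvar k ^ N' * (mvar k ^ N * p) + mvar k ^ N * (mvar k ^ N' * p')"
      by (simp add: power_add algebra_simps)
    then have 1: "mvar k ^ (N' + N) * (p + p') = chart_sub k (mvar k ^ N' * q + mvar k ^ N * q')"
      using q(2) q'(2) by simp
    have "H (mvar k ^ (N' + N)) \<otimes> (g \<oplus> g') =
      H (mvar k ^ N') \<otimes> (H (mvar k ^ N) \<otimes> g) \<oplus> H (mvar k ^ N) \<otimes> (H (mvar k ^ N') \<otimes> g')"
      unfolding power_add Hs(1)[OF tc tc] using Gc[OF GG(1)] Gc[OF GG(2)] Hc[OF tc]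
      by (simp add: H.S.r_distr[of g g' "_ \<otimes> _"]) (simp add: H.S.m_ac)
    also have "\<dots> = H (mvar k ^ N' * q + mvar k ^ N * q')"
      unfolding q(3) q'(3) by (simp add: Hs q(1) q'(1) k)
    finally have 2: "H (mvar k ^ (N' + N)) \<otimes> (g \<oplus> g') = H (mvar k ^ N' * q + mvar k ^ N * q')" .
    show ?thesis unfolding G_def using 1 2 Gc[OF GG(1)] Gc[OF GG(2)] q(1) q'(1) tc
      by (intro conjI exI[of _ "N' + N"] exI[of _ "mvar k ^ N' * q + mvar k ^ N * q'"]) auto
  qed
  have Gmult: "G (p * p') (g \<otimes> g')" if GG: "G p g" "G p' g'" for p p' g g'
  proof -
    obtain N q where q: "q \<in> pcarr n" "mvar k ^ N * p = chart_sub k q" "H (mvar k ^ N) \<otimes> g = H q"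
      using GG(1) unfolding G_def by blast
    obtain N' q' where q': "q' \<in> pcarr n" "mvar k ^ N' * p' = chart_sub k q'" "H (mvar k ^ N') \<otimes> g' = H q'"
      using GG(2) unfolding G_def by blast
    have "mvar k ^ (N + N') * (p * p') = (mvar k ^ N * p) * (mvar k ^ N' * p')"
      by (simp add: power_add algebra_simps)
    then have 1: "mvar k ^ (N + N') * (p * p') = chart_sub k (q * q')" using q(2) q'(2) by simp
    have "H (mvar k ^ (N + N')) \<otimes> (g \<otimes> g') = (H (mvar k ^ N) \<otimes> g) \<otimes> (H (mvar k ^ N') \<otimes> g')"
      unfolding power_add Hs(1)[OF tc tc]
      by (rule H.S.mult_fracs[OF Hc[OF tc] Hc[OF tc] Gc[OF GG(1)] Gc[OF GG(2)]])
    also have "\<dots> = H (q * q')" unfolding q(3) q'(3) Hs(1)[OF q(1) q'(1)] ..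
    finally have 2: "H (mvar k ^ (N + N')) \<otimes> (g \<otimes> g') = H (q * q')" .
    show ?thesis unfolding G_def using 1 2 Gc[OF GG(1)] Gc[OF GG(2)] q(1) q'(1)
      by (intro conjI exI[of _ "N + N'"] exI[of _ "q * q'"]) auto
  qed
  have total: "\<exists>g. G p g" if "p \<in> pcarr n" for p
    using that
  proof (induction p rule: mpol_induct)
    case (const c) show ?case using Gconst by blast
  next
    case (var i)
    show ?case
    proof (cases "i = k")
      case True then show ?thesis using Gk by blast
    next
      case False then show ?thesis using ex[OF var] Gi[OF var] by blast
    qed
  next
    case (add f g) then show ?case using Gadd by blast
  next
    case (mult f g) then show ?case using Gmult by blast
  qed
  define \<psi> where "\<psi> p = (SOME g. G p g)" for p
  have G\<psi>: "G p (\<psi> p)" if "p \<in> pcarr n" for p unfolding \<psi>_def using total[OF that] by (rule someI_ex)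
  have \<psi>I: "\<psi> p = g" if "p \<in> pcarr n" "G p g" for p g by (rule uniq[OF G\<psi>[OF that(1)] that(2)])
  have hom: "\<psi> \<in> ring_hom (poly_ring n) B"
  proof (rule ring_hom_memI)
    show "\<psi> p \<in> carrier B" if "p \<in> pcarr n" for p using Gc[OF G\<psi>[OF that]] .
    show "\<psi> (p \<otimes>\<^bsub>poly_ring n\<^esub> p') = \<psi> p \<otimes> \<psi> p'" if "p \<in> pcarr n" "p' \<in> pcarr n" for p p'
      using \<psi>I[OF pcarr_mult[OF that] Gmult[OF G\<psi>[OF that(1)] G\<psi>[OF that(2)]]] by simp
    show "\<psi> (p \<oplus>\<^bsub>poly_ring n\<^esub> p') = \<psi> p \<oplus> \<psi> p'" if "p \<in> pcarr n" "p' \<in> pcarr n" for p p'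
      using \<psi>I[OF pcarr_add[OF that] Gadd[OF G\<psi>[OF that(1)] G\<psi>[OF that(2)]]] by simp
    show "\<psi> \<one>\<^bsub>poly_ring n\<^esub> = \<one>" using \<psi>I[OF pcarr_mconst Gconst[of 1]] H1 by simp
  qed
  have im: "\<psi> ` pcarr n = carrier B"
  proof (intro equalityI subsetI)
    fix g assume g: "g \<in> carrier B"
    obtain N q p where *: "q \<in> pcarr n" "p \<in> pcarr n" "mvar k ^ N * p = chart_sub k q" "H (mvar k ^ N) \<otimes> g = H q"
      using surj[OF g] by blast
    have "G p g" unfolding G_def using g * by blast
    then show "g \<in> \<psi> ` pcarr n" using \<psi>I[OF *(2)] *(2) by blast
  qed (use ring_hom_closed[OF hom] in blast)
  have kern: "\<psi> p = \<zero> \<longleftrightarrow> p \<in> chart_transform n k J" if p: "p \<in> pcarr n" for p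
  proof
    assume z: "\<psi> p = \<zero>"
    obtain N q where q: "q \<in> pcarr n" "mvar k ^ N * p = chart_sub k q" "H (mvar k ^ N) \<otimes> \<psi> p = H q"
      using G\<psi>[OF p] unfolding G_def by blast
    then have "H q = \<zero>" using z Hc[OF tc] by simp
    then show "p \<in> chart_transform n k J" unfolding chart_transform_def using ker[OF q(1)] p q(1,2) by blast
  next
    assume "p \<in> chart_transform n k J"
    then obtain N q m where q: "q \<in> pcarr n" "mvar k ^ N * p = chart_sub k q" "mvar k ^ m * q \<in> J"
      unfolding chart_transform_def by blast
    then have "H q = \<zero>" using ker[OF q(1)] by blast
    then have "G p \<zero>" unfolding G_def using q(1,2) Hc[OF tc] by (intro conjI exI[of _ N] exI[of _ q]) simp_all
    then show "\<psi> p = \<zero>" by (rule \<psi>I[OF p])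
  qed
  show ?thesis
  proof (intro exI[of _ \<psi>] conjI allI impI hom im)
    show "{p \<in> pcarr n. \<psi> p = \<zero>} = chart_transform n k J"
      using kern unfolding chart_transform_def by blast
    show "\<psi> (mvar k) = H (mvar k)" by (rule \<psi>I[OF pcarr_mvar[OF k] Gk])
    show "\<psi> (mconst c) = H (mconst c)" for c by (rule \<psi>I[OF pcarr_mconst Gconst])
    fix i assume i: "i < n" "i \<noteq> k"
    obtain g where g: "g \<in> carrier B" "H (mvar k) \<otimes> g = H (mvar i)" using ex[OF i(1)] by blast
    have "\<psi> (mvar i) = g" by (rule \<psi>I[OF pcarr_mvar[OF i(1)] Gi[OF i g]])
    then show "H (mvar i) = H (mvar k) \<otimes> \<psi> (mvar i)" using g(2) by simp
  qed
qed

subsection \<open>The charts as schemes\<close>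

lemma kmorphismD:
  assumes "kmorphism X' X \<sigma>"
  shows "continuous_map (sp X') (sp X) (on_pts \<sigma>)"
    and "q \<in> pts X' \<Longrightarrow> on_stalks \<sigma> q \<in> ring_hom (stalk X (on_pts \<sigma> q)) (stalk X' q)"
    and "q \<in> pts X' \<Longrightarrow> a \<in> max_ideal (stalk X (on_pts \<sigma> q)) \<Longrightarrow> on_stalks \<sigma> q a \<in> max_ideal (stalk X' q)"
    and "q \<in> pts X' \<Longrightarrow> on_stalks \<sigma> q (scalar X (on_pts \<sigma> q) c) = scalar X' q c"
    and "openin (sp X) U \<Longrightarrow> s \<in> sec X U \<Longrightarrow> pullback X' \<sigma> U s \<in> sec X' {q \<in> pts X'. on_pts \<sigma> q \<in> U}"
proof -
  note * = assms[unfolded kmorphism_def]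
  show "continuous_map (sp X') (sp X) (on_pts \<sigma>)" by (rule *[THEN conjunct1])
  note * = *[THEN conjunct2]
  show "q \<in> pts X' \<Longrightarrow> on_stalks \<sigma> q \<in> ring_hom (stalk X (on_pts \<sigma> q)) (stalk X' q)"
    by (rule *[THEN conjunct1, THEN bspec, THEN conjunct1])
  show "q \<in> pts X' \<Longrightarrow> a \<in> max_ideal (stalk X (on_pts \<sigma> q)) \<Longrightarrow> on_stalks \<sigma> q a \<in> max_ideal (stalk X' q)"
    using *[THEN conjunct1, THEN bspec, THEN conjunct2, THEN conjunct1] by blast
  show "q \<in> pts X' \<Longrightarrow> on_stalks \<sigma> q (scalar X (on_pts \<sigma> q) c) = scalar X' q c"
    by (rule *[THEN conjunct1, THEN bspec, THEN conjunct2, THEN conjunct2, THEN spec])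
  show "openin (sp X) U \<Longrightarrow> s \<in> sec X U \<Longrightarrow> pullback X' \<sigma> U s \<in> sec X' {q \<in> pts X'. on_pts \<sigma> q \<in> U}"
    using *[THEN conjunct2, THEN spec[of _ U]] by blast
qed

abbreviation pull_to :: "('q, 'r, 'k) kspace \<Rightarrow> ('q, 'p, 'r, 's) kmap \<Rightarrow> 'p set \<Rightarrow> 'q set \<Rightarrow> ('p \<Rightarrow> 's) \<Rightarrow> 'q \<Rightarrow> 'r" where
  "pull_to X' \<sigma> U V s \<equiv> restrict (pullback X' \<sigma> U s) V"

lemma blowing_upD:
  assumes bl: "blowing_up X C X' \<sigma>"
  shows "kscheme X'" "kmorphism X' X \<sigma>"
    and "affine_open X U \<Longrightarrow>
      {q \<in> pts X'. on_pts \<sigma> q \<in> U} = (\<Union>f\<in>ideal_sections X C U. blowup_chart X C X' \<sigma> U f)"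
proof -
  note * = bl[unfolded blowing_up_def Let_def]
  show "kscheme X'" by (rule *[THEN conjunct1])
  show "kmorphism X' X \<sigma>" by (rule *[THEN conjunct2, THEN conjunct1])
  show "affine_open X U \<Longrightarrow>
      {q \<in> pts X'. on_pts \<sigma> q \<in> U} = (\<Union>f\<in>ideal_sections X C U. blowup_chart X C X' \<sigma> U f)"
    by (rule *[THEN conjunct2, THEN conjunct2, THEN spec, THEN mp, THEN conjunct1])
qed

lemma blowing_up_chartD:
  fixes X :: "('p, 's, 'k::field_char_0) kspace" and X' :: "('q, 'r, 'k) kspace"
  assumes bl: "blowing_up X C X' \<sigma>" and U: "affine_open X U" and f: "f \<in> ideal_sections X C U"
  defines "V \<equiv> blowup_chart X C X' \<sigma> U f" and "I \<equiv> ideal_sections X C U"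
  shows "affine_open X' V"
    and "b \<in> ideal_pow (sec_ring X U) I n \<Longrightarrow>
      \<exists>g\<in>sec X' V. (pull_to X' \<sigma> U V f [^]\<^bsub>sec_ring X' V\<^esub> n) \<otimes>\<^bsub>sec_ring X' V\<^esub> g = pull_to X' \<sigma> U V b"
    and "g \<in> sec X' V \<Longrightarrow> \<exists>n. \<exists>b\<in>ideal_pow (sec_ring X U) I n.
      (pull_to X' \<sigma> U V f [^]\<^bsub>sec_ring X' V\<^esub> n) \<otimes>\<^bsub>sec_ring X' V\<^esub> g = pull_to X' \<sigma> U V b"
    and "g \<in> sec X' V \<Longrightarrow> pull_to X' \<sigma> U V f \<otimes>\<^bsub>sec_ring X' V\<^esub> g = \<zero>\<^bsub>sec_ring X' V\<^esub> \<Longrightarrow> g = \<zero>\<^bsub>sec_ring X' V\<^esub>"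
    and "b \<in> sec X U \<Longrightarrow> pull_to X' \<sigma> U V b = \<zero>\<^bsub>sec_ring X' V\<^esub> \<Longrightarrow>
      \<exists>n::nat. (f [^]\<^bsub>sec_ring X U\<^esub> n) \<otimes>\<^bsub>sec_ring X U\<^esub> b = \<zero>\<^bsub>sec_ring X U\<^esub>"
proof -
  note * = bl[unfolded blowing_up_def Let_def, THEN conjunct2, THEN conjunct2, THEN spec, THEN mp, OF U,
      THEN conjunct2, THEN bspec, OF f, folded V_def I_def, unfolded sec_ring_simps(1)]
  show "affine_open X' V" by (rule *[THEN conjunct1])
  note * = *[THEN conjunct2]
  show "b \<in> ideal_pow (sec_ring X U) I n \<Longrightarrow>
      \<exists>g\<in>sec X' V. (pull_to X' \<sigma> U V f [^]\<^bsub>sec_ring X' V\<^esub> n) \<otimes>\<^bsub>sec_ring X' V\<^esub> g = pull_to X' \<sigma> U V b"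
    by (rule *[THEN conjunct1, THEN spec, THEN bspec])
  note * = *[THEN conjunct2]
  show "g \<in> sec X' V \<Longrightarrow> \<exists>n. \<exists>b\<in>ideal_pow (sec_ring X U) I n.
      (pull_to X' \<sigma> U V f [^]\<^bsub>sec_ring X' V\<^esub> n) \<otimes>\<^bsub>sec_ring X' V\<^esub> g = pull_to X' \<sigma> U V b"
    by (rule *[THEN conjunct1, THEN bspec])
  note * = *[THEN conjunct2]
  show "g \<in> sec X' V \<Longrightarrow> pull_to X' \<sigma> U V f \<otimes>\<^bsub>sec_ring X' V\<^esub> g = \<zero>\<^bsub>sec_ring X' V\<^esub> \<Longrightarrow> g = \<zero>\<^bsub>sec_ring X' V\<^esub>"
    by (rule *[THEN conjunct1, THEN bspec, THEN mp])
  note * = *[THEN conjunct2]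
  show "b \<in> sec X U \<Longrightarrow> pull_to X' \<sigma> U V b = \<zero>\<^bsub>sec_ring X' V\<^esub> \<Longrightarrow>
      \<exists>n::nat. (f [^]\<^bsub>sec_ring X U\<^esub> n) \<otimes>\<^bsub>sec_ring X U\<^esub> b = \<zero>\<^bsub>sec_ring X U\<^esub>"
    by (rule *[THEN bspec, THEN mp])
qed

lemma kscheme_lrs: "kscheme X \<Longrightarrow> locally_ringed_kspace X"
  by (simp add: kscheme_def)

lemma blowup_chartD:
  assumes "q \<in> blowup_chart X C X' \<sigma> U f"
  shows "q \<in> pts X'" "on_pts \<sigma> q \<in> U"
    "inverse_ideal X C X' \<sigma> q = genideal (stalk X' q) {on_stalks \<sigma> q (f (on_pts \<sigma> q))}"
  using assms by (simp_all add: blowup_chart_def)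

lemma pull_to_value:
  assumes "V \<subseteq> {q \<in> pts X'. on_pts \<sigma> q \<in> U}" "q \<in> V"
  shows "pull_to X' \<sigma> U V s q = on_stalks \<sigma> q (s (on_pts \<sigma> q))"
  using assms by (auto simp: pullback_def)

lemma pull_to_hom:
  fixes X :: "('p, 's, 'k::field_char_0) kspace" and X' :: "('q, 'r, 'k) kspace"
  assumes X: "locally_ringed_kspace X" and X': "locally_ringed_kspace X'" and m: "kmorphism X' X \<sigma>"
    and U: "openin (sp X) U" and V: "openin (sp X') V" "V \<subseteq> {q \<in> pts X'. on_pts \<sigma> q \<in> U}"
  shows "pull_to X' \<sigma> U V \<in> ring_hom (sec_ring X U) (sec_ring X' V)"
proof (rule ring_hom_memI)
  have hom: "on_stalks \<sigma> q \<in> ring_hom (stalk X (on_pts \<sigma> q)) (stalk X' q)" if "q \<in> V" for q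
    using kmorphismD(2)[OF m] V(2) that by blast
  have sU: "on_pts \<sigma> q \<in> U" if "q \<in> V" for q using V(2) that by blast
  have pre: "openin (sp X') {q \<in> pts X'. on_pts \<sigma> q \<in> U}"
    by (rule openin_continuous_map_preimage[OF kmorphismD(1)[OF m] U])
  show "pull_to X' \<sigma> U V s \<in> carrier (sec_ring X' V)" if "s \<in> carrier (sec_ring X U)" for s
    using sec_restrict[OF X' pre V kmorphismD(5)[OF m U]] that by simp
  fix s t assume st: "s \<in> carrier (sec_ring X U)" "t \<in> carrier (sec_ring X U)"
  show "pull_to X' \<sigma> U V (s \<otimes>\<^bsub>sec_ring X U\<^esub> t) = pull_to X' \<sigma> U V s \<otimes>\<^bsub>sec_ring X' V\<^esub> pull_to X' \<sigma> U V t"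
  proof
    fix q show "pull_to X' \<sigma> U V (s \<otimes>\<^bsub>sec_ring X U\<^esub> t) q = (pull_to X' \<sigma> U V s \<otimes>\<^bsub>sec_ring X' V\<^esub> pull_to X' \<sigma> U V t) q"
    proof (cases "q \<in> V")
      case True
      then show ?thesis
        using sU[OF True] V(2) st ring_hom_mult[OF hom[OF True], of "s (on_pts \<sigma> q)" "t (on_pts \<sigma> q)"]
          sec_value[OF X U _ sU[OF True], of s] sec_value[OF X U _ sU[OF True], of t]
        by (simp add: pullback_def subset_iff)
    next
      case False
      then show ?thesis by simp
    qed
  qed
  show "pull_to X' \<sigma> U V (s \<oplus>\<^bsub>sec_ring X U\<^esub> t) = pull_to X' \<sigma> U V s \<oplus>\<^bsub>sec_ring X' V\<^esub> pull_to X' \<sigma> U V t"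
  proof
    fix q show "pull_to X' \<sigma> U V (s \<oplus>\<^bsub>sec_ring X U\<^esub> t) q = (pull_to X' \<sigma> U V s \<oplus>\<^bsub>sec_ring X' V\<^esub> pull_to X' \<sigma> U V t) q"
    proof (cases "q \<in> V")
      case True
      then show ?thesis
        using sU[OF True] V(2) st ring_hom_add[OF hom[OF True], of "s (on_pts \<sigma> q)" "t (on_pts \<sigma> q)"]
          sec_value[OF X U _ sU[OF True], of s] sec_value[OF X U _ sU[OF True], of t]
        by (simp add: pullback_def subset_iff)
    next
      case False
      then show ?thesis by simp
    qed
  qed
next
  show "pull_to X' \<sigma> U V \<one>\<^bsub>sec_ring X U\<^esub> = \<one>\<^bsub>sec_ring X' V\<^esub>"
  proof
    fix q show "pull_to X' \<sigma> U V \<one>\<^bsub>sec_ring X U\<^esub> q = \<one>\<^bsub>sec_ring X' V\<^esub> q"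
    proof (cases "q \<in> V")
      case True
      then have "on_pts \<sigma> q \<in> U" "q \<in> pts X'" using V(2) by auto
      then show ?thesis
        using True ring_hom_one[OF kmorphismD(2)[OF m]] by (simp add: pullback_def)
    next
      case False
      then show ?thesis by simp
    qed
  qed
qed

lemma ideal_sections_origin:
  assumes X: "locally_ringed_kspace X" and ac: "affine_coords n J X U \<phi>" and J: "J \<subseteq> origin_ideal n"
    and C: "C \<inter> U = {origin n X U \<phi>}"
  shows "ideal_sections X C U = \<phi> ` origin_ideal n"
proof -
  note o = origin_point[OF X ac J]
  have oi: "{f \<in> pcarr n. \<phi> f (origin n X U \<phi>) \<in> max_ideal (stalk X (origin n X U \<phi>))} = origin_ideal n"
    using o(2)[OF o(1)] point_prime(3)[OF X ac o(1)] by simp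
  have surj: "\<phi> ` pcarr n = sec X U" using ac by (simp add: affine_coords_def)
  have "ideal_sections X C U = {s \<in> sec X U. s (origin n X U \<phi>) \<in> max_ideal (stalk X (origin n X U \<phi>))}"
    unfolding ideal_sections_def using C by (simp add: Int_commute)
  also have "\<dots> = \<phi> ` {f \<in> pcarr n. \<phi> f (origin n X U \<phi>) \<in> max_ideal (stalk X (origin n X U \<phi>))}"
    unfolding surj[symmetric] by blast
  finally show ?thesis unfolding oi .
qed

lemma origin_ideal_combination:
  assumes "q \<in> origin_ideal n"
  obtains a where "\<And>i::nat. i < n \<Longrightarrow> a i \<in> pcarr n" "q = (\<Sum>i<n. a i * mvar i)"
proof -
  have q: "q \<in> pcarr n" "sub (\<lambda>_. 0) q = 0" using assms by (simp_all add: origin_ideal_def sub_ker_def)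
  obtain a where a: "\<forall>i<n. a i \<in> pcarr n" "q - sub (\<lambda>_. 0) q = (\<Sum>i<n. a i * (mvar i - 0))"
    using sub_diff_combination[OF q(1), of "\<lambda>_. 0"] pcarr_0 by blast
  show thesis
  proof (rule that[of a])
    show "a i \<in> pcarr n" if "i < n" for i using a(1) that by blast
    show "q = (\<Sum>i<n. a i * mvar i)" using a(2) unfolding q(2) diff_0_right .
  qed
qed

lemma chart_sub_origin_ideal:
  assumes q: "q \<in> origin_ideal n" and k: "k < n"
  shows "\<exists>p\<in>pcarr n. mvar k * p = chart_sub k q"
proof -
  obtain a where a: "\<And>i::nat. i < n \<Longrightarrow> a i \<in> pcarr n" "q = (\<Sum>i<n. a i * mvar i)"
    by (rule origin_ideal_combination[OF q]) blast
  have "\<exists>p\<in>pcarr n. mvar k * p = chart_sub k (\<Sum>i<m. a i * mvar i)" if "m \<le> n" for m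
    using that
  proof (induction m)
    case (Suc m)
    then obtain p where p: "p \<in> pcarr n" "mvar k * p = chart_sub k (\<Sum>i<m. a i * mvar i)" by auto
    let ?p = "p + chart_sub k (a m) * (if m = k then 1 else mvar m)"
    have "?p \<in> pcarr n" using p(1) chart_sub_pcarr[OF a(1) k] Suc.prems by auto
    moreover have "mvar k * ?p = chart_sub k (\<Sum>i<Suc m. a i * mvar i)"
      using p(2) by (simp add: algebra_simps)
    ultimately show ?case by blast
  qed (auto intro: bexI[of _ 0])
  then show ?thesis unfolding a(2) by blast
qed

text \<open>A product of \<open>m\<close> elements vanishing at the origin acquires the factor
  \<open>T_k^m\<close> in the chart. Hence a fraction \<open>b / T_k^m\<close> with \<open>b\<close>
  in the \<open>m\<close>-th power is a polynomial in the chart coordinates, which yields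
  surjectivity of \<open>\<psi>\<close>.\<close>

lemma ideal_pow_origin:
  assumes X: "locally_ringed_kspace X" and ac: "affine_coords n J X U \<phi>" and k: "k < n"
    and b: "b \<in> ideal_pow (sec_ring X U) (\<phi> ` origin_ideal n) m"
  shows "\<exists>q p. q \<in> pcarr n \<and> p \<in> pcarr n \<and> b = \<phi> q \<and> mvar k ^ m * p = chart_sub k q"
  using b
proof (induction m arbitrary: b)
  case 0
  then have "b \<in> \<phi> ` pcarr n" using ac by (simp add: affine_coords_def)
  then obtain q where "q \<in> pcarr n" "b = \<phi> q" by blast
  then show ?case using chart_sub_pcarr[OF _ k] by (intro exI[of _ q] exI[of _ "chart_sub k q"]) simp
next
  case (Suc m)
  interpret \<phi>: ring_hom_cring "poly_ring n" "sec_ring X U" \<phi> by (rule affine_coords_cring_hom[OF X ac])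
  have "b \<in> ideal_prod (sec_ring X U) (ideal_pow (sec_ring X U) (\<phi> ` origin_ideal n) m) (\<phi> ` origin_ideal n)"
    using Suc.prems by simp
  then show ?case
  proof (induction rule: ideal_prod.induct)
    case (prod i j)
    obtain q p where q: "q \<in> pcarr n" "p \<in> pcarr n" "i = \<phi> q" "mvar k ^ m * p = chart_sub k q"
      using Suc.IH[OF prod(1)] by blast
    obtain q' where q': "q' \<in> origin_ideal n" "j = \<phi> q'" using prod(2) by blast
    obtain p' where p': "p' \<in> pcarr n" "mvar k * p' = chart_sub k q'" using chart_sub_origin_ideal[OF q'(1) k] by blast
    have q'c: "q' \<in> pcarr n" using q'(1) by (simp add: origin_ideal_def sub_ker_def)
    have "i \<otimes>\<^bsub>sec_ring X U\<^esub> j = \<phi> (q * q')"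
      unfolding q(3) q'(2) using \<phi>.hom_mult[of q q'] q(1) q'c by (simp only: poly_ring_simps)
    moreover have "mvar k ^ Suc m * (p * p') = chart_sub k (q * q')"
      using q(4)[symmetric] p'(2)[symmetric] by (simp add: algebra_simps)
    ultimately show ?case using q(1,2) q'c p'(1) by (intro exI[of _ "q * q'"] exI[of _ "p * p'"]) simp
  next
    case (sum s1 s2)
    then obtain q p q' p' where *: "q \<in> pcarr n" "p \<in> pcarr n" "s1 = \<phi> q" "mvar k ^ Suc m * p = chart_sub k q"
      "q' \<in> pcarr n" "p' \<in> pcarr n" "s2 = \<phi> q'" "mvar k ^ Suc m * p' = chart_sub k q'" by blast
    have "s1 \<oplus>\<^bsub>sec_ring X U\<^esub> s2 = \<phi> (q + q')"
      unfolding *(3,7) using \<phi>.hom_add[of q q'] *(1,5) by (simp only: poly_ring_simps)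
    moreover have "mvar k ^ Suc m * (p + p') = chart_sub k (q + q')"
      unfolding distrib_left *(4,8) by simp
    ultimately show ?case using *(1,2,5,6) by (intro exI[of _ "q + q'"] exI[of _ "p + p'"]) simp
  qed
qed

text \<open>Near \<open>U\<close> the centre is the origin, so its ideal is the image of
  \<open>origin_ideal n\<close>. The fractions by which \<open>blowing_up\<close> describes the
  chart of \<open>T_k\<close> are then exactly the input of
  \<open>chart_coordinates\<close>.\<close>

lemma blowup_chart_coords:
  fixes X :: "('p, 's, 'k::field_char_0) kspace" and X' :: "('q, 'r, 'k) kspace"
  assumes X: "locally_ringed_kspace X" and ac: "affine_coords n J X U \<phi>" and J: "J \<subseteq> origin_ideal n"
    and C: "C \<inter> U = {origin n X U \<phi>}" and bl: "blowing_up X C X' \<sigma>" and k: "k < n"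
  defines "V \<equiv> blowup_chart X C X' \<sigma> U (\<phi> (mvar k))"
  shows "\<exists>\<phi>'. affine_coords n (chart_transform n k J) X' V \<phi>' \<and>
    pull_to X' \<sigma> U V (\<phi> (mvar k)) = \<phi>' (mvar k) \<and>
    (\<forall>i<n. i \<noteq> k \<longrightarrow> pull_to X' \<sigma> U V (\<phi> (mvar i)) = \<phi>' (mvar k) \<otimes>\<^bsub>sec_ring X' V\<^esub> \<phi>' (mvar i))"
proof -
  have aU: "affine_open X U" using ac by (simp add: affine_coords_def)
  have oU: "openin (sp X) U" by (rule affine_coords_open[OF ac])
  have X': "locally_ringed_kspace X'" by (rule kscheme_lrs[OF blowing_upD(1)[OF bl]])
  have m: "kmorphism X' X \<sigma>" by (rule blowing_upD(2)[OF bl])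
  have I: "ideal_sections X C U = \<phi> ` origin_ideal n" by (rule ideal_sections_origin[OF X ac J C])
  have mvI: "mvar i \<in> origin_ideal n" if "i < n" for i using that by (simp add: origin_ideal_def sub_ker_def)
  have fI: "\<phi> (mvar k) \<in> ideal_sections X C U" unfolding I using mvI[OF k] by blast
  note ch = blowing_up_chartD[OF bl aU fI, folded V_def, unfolded I]
  have oV: "openin (sp X') V" by (rule affine_openD(1)[OF ch(1)])
  have Vsub: "V \<subseteq> {q \<in> pts X'. on_pts \<sigma> q \<in> U}" unfolding V_def blowup_chart_def by blast
  interpret \<phi>: ring_hom_cring "poly_ring n" "sec_ring X U" \<phi> by (rule affine_coords_cring_hom[OF X ac])
  have hhom: "pull_to X' \<sigma> U V \<in> ring_hom (sec_ring X U) (sec_ring X' V)"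
    by (rule pull_to_hom[OF X X' m oU oV Vsub])
  define B where "B = sec_ring X' V"
  define H where "H p = pull_to X' \<sigma> U V (\<phi> p)" for p
  have B: "cring B" unfolding B_def by (rule sec_cring[OF X' oV])
  have "(\<lambda>p. pull_to X' \<sigma> U V (\<phi> p)) \<in> ring_hom (poly_ring n) B"
  proof (rule ring_hom_memI)
    fix p :: "'k mpol" assume p: "p \<in> pcarr n"
    show "pull_to X' \<sigma> U V (\<phi> p) \<in> carrier B"
      unfolding B_def by (rule ring_hom_closed[OF hhom \<phi>.hom_closed[OF p]])
    fix p' :: "'k mpol" assume p': "p' \<in> pcarr n"
    show "pull_to X' \<sigma> U V (\<phi> (p \<otimes>\<^bsub>poly_ring n\<^esub> p')) = pull_to X' \<sigma> U V (\<phi> p) \<otimes>\<^bsub>B\<^esub> pull_to X' \<sigma> U V (\<phi> p')"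
      unfolding B_def \<phi>.hom_mult[OF p p'] by (rule ring_hom_mult[OF hhom \<phi>.hom_closed[OF p] \<phi>.hom_closed[OF p']])
    show "pull_to X' \<sigma> U V (\<phi> (p \<oplus>\<^bsub>poly_ring n\<^esub> p')) = pull_to X' \<sigma> U V (\<phi> p) \<oplus>\<^bsub>B\<^esub> pull_to X' \<sigma> U V (\<phi> p')"
      unfolding B_def \<phi>.hom_add[OF p p'] by (rule ring_hom_add[OF hhom \<phi>.hom_closed[OF p] \<phi>.hom_closed[OF p']])
  next
    show "pull_to X' \<sigma> U V (\<phi> \<one>\<^bsub>poly_ring n\<^esub>) = \<one>\<^bsub>B\<^esub>"
      unfolding B_def \<phi>.hom_one by (rule ring_hom_one[OF hhom])
  qed
  then have Hhom: "H \<in> ring_hom (poly_ring n) B" unfolding H_def[abs_def] .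
  then have Hc: "ring_hom_cring (poly_ring n) B H"
    using B cring_poly_ring by (simp add: ring_hom_cring_def ring_hom_cring_axioms_def)
  interpret H: ring_hom_cring "poly_ring n" B H by (rule Hc)
  have Hmult: "H (p * q) = H p \<otimes>\<^bsub>B\<^esub> H q" if "p \<in> pcarr n" "q \<in> pcarr n" for p q
    using H.hom_mult[of p q] that by simp
  have Hpow: "H (mvar k ^ N) = H (mvar k) [^]\<^bsub>B\<^esub> N" for N
  proof (induction N)
    case 0
    then show ?case using H.hom_one by simp
  next
    case (Suc N)
    have "H (mvar k ^ Suc N) = H (mvar k ^ N * mvar k)" by (simp add: mult.commute)
    also have "\<dots> = H (mvar k ^ N) \<otimes>\<^bsub>B\<^esub> H (mvar k)" by (rule Hmult) (use k in auto)
    finally show ?case using Suc by simp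
  qed
  have ppow: "\<phi> (mvar k ^ N) = \<phi> (mvar k) [^]\<^bsub>sec_ring X U\<^esub> N" for N
  proof (induction N)
    case 0
    then show ?case using \<phi>.hom_one by (simp only: power_0 poly_ring_simps \<phi>.S.nat_pow_0)
  next
    case (Suc N)
    have "\<phi> (mvar k ^ Suc N) = \<phi> (mvar k ^ N \<otimes>\<^bsub>poly_ring n\<^esub> mvar k)" by (simp add: mult.commute)
    also have "\<dots> = \<phi> (mvar k ^ N) \<otimes>\<^bsub>sec_ring X U\<^esub> \<phi> (mvar k)" by (rule \<phi>.hom_mult) (use k in auto)
    finally show ?case unfolding Suc by (simp only: \<phi>.S.nat_pow_Suc)
  qed
  have reg: "g = \<zero>\<^bsub>B\<^esub>" if "g \<in> carrier B" "H (mvar k) \<otimes>\<^bsub>B\<^esub> g = \<zero>\<^bsub>B\<^esub>" for g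
    using ch(4)[of g] that unfolding B_def H_def by (simp only: sec_ring_simps(1))
  have "\<exists>\<psi>. \<psi> \<in> ring_hom (poly_ring n) B \<and> \<psi> ` pcarr n = carrier B \<and>
    {p \<in> pcarr n. \<psi> p = \<zero>\<^bsub>B\<^esub>} = chart_transform n k J \<and> \<psi> (mvar k) = H (mvar k) \<and>
    (\<forall>i<n. i \<noteq> k \<longrightarrow> H (mvar i) = H (mvar k) \<otimes>\<^bsub>B\<^esub> \<psi> (mvar i)) \<and> (\<forall>c. \<psi> (mconst c) = H (mconst c))"
  proof (rule chart_coordinates[OF Hc k reg])
    fix i assume i: "i < n"
    have iI: "\<phi> (mvar i) \<in> \<phi> ` origin_ideal n" using mvI[OF i] by blast
    have ic: "\<phi> (mvar i) \<in> carrier (sec_ring X U)" using \<phi>.hom_closed[of "mvar i"] i by blast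
    have "\<one>\<^bsub>sec_ring X U\<^esub> \<otimes>\<^bsub>sec_ring X U\<^esub> \<phi> (mvar i) \<in> ideal_pow (sec_ring X U) (\<phi> ` origin_ideal n) (Suc 0)"
      unfolding ideal_pow.simps by (rule ideal_prod.prod[OF \<phi>.S.one_closed iI])
    then have "\<phi> (mvar i) \<in> ideal_pow (sec_ring X U) (\<phi> ` origin_ideal n) (Suc 0)"
      unfolding \<phi>.S.l_one[OF ic] .
    then obtain g where g: "g \<in> sec X' V"
      "(H (mvar k) [^]\<^bsub>B\<^esub> Suc 0) \<otimes>\<^bsub>B\<^esub> g = H (mvar i)" using ch(2)[of "\<phi> (mvar i)" "Suc 0"] unfolding B_def H_def by blast
    have "H (mvar k) [^]\<^bsub>B\<^esub> Suc 0 = H (mvar k)" using Hpow[of "Suc 0"] by simp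
    then show "\<exists>g\<in>carrier B. H (mvar k) \<otimes>\<^bsub>B\<^esub> g = H (mvar i)" using g by (auto simp: B_def)
  next
    fix g assume "g \<in> carrier B"
    then have "g \<in> sec X' V" by (simp add: B_def)
    then obtain N b where b: "b \<in> ideal_pow (sec_ring X U) (\<phi> ` origin_ideal n) N"
      "(H (mvar k) [^]\<^bsub>B\<^esub> N) \<otimes>\<^bsub>B\<^esub> g = pull_to X' \<sigma> U V b" using ch(3)[of g] unfolding B_def H_def by blast
    obtain q p where q: "q \<in> pcarr n" "p \<in> pcarr n" "b = \<phi> q" "mvar k ^ N * p = chart_sub k q"
      using ideal_pow_origin[OF X ac k b(1)] by blast
    have "H (mvar k ^ N) \<otimes>\<^bsub>B\<^esub> g = pull_to X' \<sigma> U V b" unfolding Hpow by (rule b(2))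
    then have "H (mvar k ^ N) \<otimes>\<^bsub>B\<^esub> g = H q" unfolding q(3) H_def[of q] .
    then show "\<exists>N q p. q \<in> pcarr n \<and> p \<in> pcarr n \<and> mvar k ^ N * p = chart_sub k q \<and> H (mvar k ^ N) \<otimes>\<^bsub>B\<^esub> g = H q"
      using q by blast
  next
    fix q :: "'k mpol" assume q: "q \<in> pcarr n"
    have qs: "\<phi> q \<in> sec X U" by (rule affine_coords_sec[OF ac q])
    have mem: "mvar k ^ m * q \<in> J \<longleftrightarrow> (\<phi> (mvar k) [^]\<^bsub>sec_ring X U\<^esub> m) \<otimes>\<^bsub>sec_ring X U\<^esub> \<phi> q = \<zero>\<^bsub>sec_ring X U\<^esub>" for m
    proof -
      have "\<phi> (mvar k ^ m \<otimes>\<^bsub>poly_ring n\<^esub> q) = (\<phi> (mvar k) [^]\<^bsub>sec_ring X U\<^esub> m) \<otimes>\<^bsub>sec_ring X U\<^esub> \<phi> q"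
        unfolding ppow[symmetric] by (rule \<phi>.hom_mult) (use k q in auto)
      moreover have "mvar k ^ m * q \<in> pcarr n" using k q by simp
      ultimately show ?thesis unfolding affine_coords_ker[OF ac] poly_ring_simps by (simp only: mem_Collect_eq simp_thms)
    qed
    show "H q = \<zero>\<^bsub>B\<^esub> \<longleftrightarrow> (\<exists>m. mvar k ^ m * q \<in> J)"
    proof
      assume "H q = \<zero>\<^bsub>B\<^esub>"
      then obtain m where "(\<phi> (mvar k) [^]\<^bsub>sec_ring X U\<^esub> (m::nat)) \<otimes>\<^bsub>sec_ring X U\<^esub> \<phi> q = \<zero>\<^bsub>sec_ring X U\<^esub>"
        using ch(5)[OF qs] unfolding H_def B_def by blast
      then show "\<exists>m. mvar k ^ m * q \<in> J" unfolding mem by blast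
    next
      assume "\<exists>m. mvar k ^ m * q \<in> J"
      then obtain m where m: "mvar k ^ m * q \<in> J" by blast
      then have "\<phi> (mvar k ^ m * q) = \<zero>\<^bsub>sec_ring X U\<^esub>" using affine_coords_ker[OF ac] by blast
      then have "H (mvar k ^ m * q) = pull_to X' \<sigma> U V (\<phi> \<zero>\<^bsub>poly_ring n\<^esub>)" unfolding H_def \<phi>.hom_zero by simp
      also have "\<dots> = \<zero>\<^bsub>B\<^esub>" using H.hom_zero unfolding H_def .
      finally have z: "H (mvar k ^ m) \<otimes>\<^bsub>B\<^esub> H q = \<zero>\<^bsub>B\<^esub>" using Hmult[of "mvar k ^ m" q] k q by simp
      have "H (mvar k ^ m) \<otimes>\<^bsub>B\<^esub> g = \<zero>\<^bsub>B\<^esub> \<Longrightarrow> g \<in> carrier B \<Longrightarrow> g = \<zero>\<^bsub>B\<^esub>" for g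
      proof (induction m)
        case 0
        then show ?case using H.hom_one by simp
      next
        case (Suc m)
        have "H (mvar k) \<otimes>\<^bsub>B\<^esub> (H (mvar k ^ m) \<otimes>\<^bsub>B\<^esub> g) = \<zero>\<^bsub>B\<^esub>"
          using Suc.prems Hmult[of "mvar k" "mvar k ^ m"] k H.hom_closed[of "mvar k"] H.hom_closed[of "mvar k ^ m"]
          by (simp add: H.S.m_assoc)
        then have "H (mvar k ^ m) \<otimes>\<^bsub>B\<^esub> g = \<zero>\<^bsub>B\<^esub>"
          by (rule reg[rotated]) (use Suc.prems(2) k H.hom_closed[of "mvar k ^ m"] in auto)
        then show ?case using Suc.IH Suc.prems(2) by blast
      qed
      then show "H q = \<zero>\<^bsub>B\<^esub>" using z H.hom_closed[OF q] by blast
    qed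
  qed
  then obtain \<psi> where \<psi>: "\<psi> \<in> ring_hom (poly_ring n) B" "\<psi> ` pcarr n = carrier B"
    "{p \<in> pcarr n. \<psi> p = \<zero>\<^bsub>B\<^esub>} = chart_transform n k J" "\<psi> (mvar k) = H (mvar k)"
    "\<forall>i<n. i \<noteq> k \<longrightarrow> H (mvar i) = H (mvar k) \<otimes>\<^bsub>B\<^esub> \<psi> (mvar i)" "\<forall>c. \<psi> (mconst c) = H (mconst c)"
    by (elim exE conjE)
  have "\<psi> (mconst c) = (\<lambda>q\<in>V. scalar X' q c)" for c
  proof
    fix q
    have pc: "\<phi> (mconst c) = (\<lambda>p\<in>U. scalar X p c)" using ac by (simp add: affine_coords_def)
    show "\<psi> (mconst c) q = (\<lambda>q\<in>V. scalar X' q c) q"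
    proof (cases "q \<in> V")
      case True
      then have q: "q \<in> pts X'" "on_pts \<sigma> q \<in> U" using Vsub by auto
      have "\<psi> (mconst c) q = on_stalks \<sigma> q (scalar X (on_pts \<sigma> q) c)"
        using pull_to_value[OF Vsub True, of "\<phi> (mconst c)"] \<psi>(6) q(2) by (simp add: H_def pc)
      then show ?thesis using kmorphismD(4)[OF m q(1)] True by simp
    next
      case False
      then show ?thesis using \<psi>(6) unfolding H_def by simp
    qed
  qed
  then have "affine_coords n (chart_transform n k J) X' V \<psi>"
    unfolding affine_coords_def a_kernel_def' using ch(1) \<psi>(1,2,3) unfolding B_def by simp
  then show ?thesis using \<psi>(4,5) unfolding H_def B_def by (intro exI[of _ \<psi>]) simp
qed

section \<open>The exceptional divisor and the covering by charts\<close>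

lemma (in cring) unit_of_mult_unit:
  assumes "a \<in> carrier R" "b \<in> carrier R" "a \<otimes> b \<in> Units R" shows "a \<in> Units R"
proof -
  have "a \<otimes> (b \<otimes> inv (a \<otimes> b)) = \<one>" using assms by (simp add: m_assoc[symmetric])
  moreover have "(b \<otimes> inv (a \<otimes> b)) \<otimes> a = \<one>"
    using calculation assms by (simp add: m_comm[of a])
  moreover have "b \<otimes> inv (a \<otimes> b) \<in> carrier R" using assms by simp
  ultimately show ?thesis unfolding Units_def using assms(1) by blast
qed

lemma ring_hom_unit:
  assumes R: "cring R" and S: "cring S" and h: "h \<in> ring_hom R S" and u: "u \<in> Units R"
  shows "h u \<in> Units S"
proof -
  interpret ring_hom_cring R S h using R S h by (simp add: ring_hom_cring_def ring_hom_cring_axioms_def)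
  have "h u \<otimes>\<^bsub>S\<^esub> h (inv\<^bsub>R\<^esub> u) = \<one>\<^bsub>S\<^esub>" 
    using hom_mult[OF R.Units_closed[OF u] R.Units_inv_closed[OF u]] R.Units_r_inv[OF u] hom_one by simp
  then have "h u \<otimes>\<^bsub>S\<^esub> h (inv\<^bsub>R\<^esub> u) \<in> Units S" by simp
  then show ?thesis by (rule S.unit_of_mult_unit[rotated 2]) (use u in auto)
qed

lemma ideal_sections_stalk:
  assumes "openin (sp X) U" "p \<in> U" "s \<in> ideal_sections X C U" shows "s p \<in> ideal_stalk X C p"
  unfolding ideal_stalk_def using assms by blast

text \<open>Over a point other than the origin some \<open>T_i\<close> is a unit, and its pullback
  is \<open>T_k\<close> or a multiple of \<open>T_k\<close>; so \<open>T_k\<close> is a unit there.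
  On the chart the divisor of \<open>T_k\<close> therefore has no part outside the preimage of the
  centre.\<close>

lemma chart_divisor:
  fixes X :: "('p, 's, 'k::field_char_0) kspace" and X' :: "('q, 'r, 'k) kspace"
  assumes X: "locally_ringed_kspace X" and ac: "affine_coords n J X U \<phi>" and J: "J \<subseteq> origin_ideal n"
    and C: "C \<inter> U = {origin n X U \<phi>}" and bl: "blowing_up X C X' \<sigma>" and k: "k < n"
    and ac': "affine_coords n J' X' V \<phi>'" and V: "V = blowup_chart X C X' \<sigma> U (\<phi> (mvar k))"
    and pk: "pull_to X' \<sigma> U V (\<phi> (mvar k)) = \<phi>' (mvar k)"
    and pi: "\<And>i. i < n \<Longrightarrow> i \<noteq> k \<Longrightarrow> pull_to X' \<sigma> U V (\<phi> (mvar i)) = \<phi>' (mvar k) \<otimes>\<^bsub>sec_ring X' V\<^esub> \<phi>' (mvar i)"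
    and xi: "\<xi> \<in> V"
  shows "inverse_ideal X C X' \<sigma> \<xi> = genideal (stalk X' \<xi>) {\<phi>' (mvar k) \<xi>}"
    and "on_pts \<sigma> \<xi> \<notin> C \<Longrightarrow> \<phi>' (mvar k) \<xi> \<in> Units (stalk X' \<xi>)"
    and "on_pts \<sigma> \<xi> \<notin> C \<Longrightarrow> \<phi> (mvar k) (on_pts \<sigma> \<xi>) \<in> Units (stalk X (on_pts \<sigma> \<xi>))"
    and "exceptional_divisor X C X' \<sigma> \<xi> = div_of X' (\<phi>' (mvar k)) \<xi>"
proof -
  have X': "locally_ringed_kspace X'" by (rule kscheme_lrs[OF blowing_upD(1)[OF bl]])
  have m: "kmorphism X' X \<sigma>" by (rule blowing_upD(2)[OF bl])
  have Vsub: "V \<subseteq> {q \<in> pts X'. on_pts \<sigma> q \<in> U}" unfolding V blowup_chart_def by blast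
  have q: "\<xi> \<in> pts X'" "on_pts \<sigma> \<xi> \<in> U" using Vsub xi by auto
  have oU: "openin (sp X) U" by (rule affine_coords_open[OF ac])
  have oV: "openin (sp X') V" by (rule affine_coords_open[OF ac'])
  have pX: "on_pts \<sigma> \<xi> \<in> pts X" using openin_subset[OF oU] q(2) by blast
  have R: "cring (stalk X (on_pts \<sigma> \<xi>))" by (rule stalk_cring[OF X pX])
  have S: "cring (stalk X' \<xi>)" by (rule stalk_cring[OF X' q(1)])
  have hom: "on_stalks \<sigma> \<xi> \<in> ring_hom (stalk X (on_pts \<sigma> \<xi>)) (stalk X' \<xi>)" by (rule kmorphismD(2)[OF m q(1)])
  have t: "on_stalks \<sigma> \<xi> (\<phi> (mvar k) (on_pts \<sigma> \<xi>)) = \<phi>' (mvar k) \<xi>"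
    using pull_to_value[OF Vsub xi, of "\<phi> (mvar k)"] pk by simp
  have val: "\<phi>' f \<xi> \<in> carrier (stalk X' \<xi>)" if "f \<in> pcarr n" for f
    by (rule sec_value[OF X' oV affine_coords_sec[OF ac' that] xi])
  show inv: "inverse_ideal X C X' \<sigma> \<xi> = genideal (stalk X' \<xi>) {\<phi>' (mvar k) \<xi>}"
    using blowup_chartD(3)[of \<xi> X C X' \<sigma> U "\<phi> (mvar k)"] xi unfolding V t by blast
  show unit: "\<phi>' (mvar k) \<xi> \<in> Units (stalk X' \<xi>)" if nC: "on_pts \<sigma> \<xi> \<notin> C"
  proof -
    define P where "P = {f \<in> pcarr n. \<phi> f (on_pts \<sigma> \<xi>) \<notin> Units (stalk X (on_pts \<sigma> \<xi>))}"
    have pr: "primeideal P (poly_ring n)" unfolding P_def by (rule point_prime(1)[OF X ac q(2)])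
    have "origin n X U \<phi> \<in> C" using C by blast
    then have "on_pts \<sigma> \<xi> \<noteq> origin n X U \<phi>" using nC by metis
    then have "P \<noteq> origin_ideal n" using origin_point(2)[OF X ac J q(2)] unfolding P_def by blast
    then obtain i where i: "i < n" "mvar i \<notin> P" using origin_ideal_eq[OF pr] by blast
    then have "\<phi> (mvar i) (on_pts \<sigma> \<xi>) \<in> Units (stalk X (on_pts \<sigma> \<xi>))" unfolding P_def by simp
    then have u: "on_stalks \<sigma> \<xi> (\<phi> (mvar i) (on_pts \<sigma> \<xi>)) \<in> Units (stalk X' \<xi>)"
      by (rule ring_hom_unit[OF R S hom])
    show ?thesis
    proof (cases "i = k")
      case True
      then show ?thesis using u t by simp
    next
      case False
      have "on_stalks \<sigma> \<xi> (\<phi> (mvar i) (on_pts \<sigma> \<xi>)) = \<phi>' (mvar k) \<xi> \<otimes>\<^bsub>stalk X' \<xi>\<^esub> \<phi>' (mvar i) \<xi>"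
        using pull_to_value[OF Vsub xi, of "\<phi> (mvar i)"] pi[OF i(1) False] xi by simp
      then show ?thesis using cring.unit_of_mult_unit[OF S val[of "mvar k"] val[of "mvar i"]] u k i(1) by simp
    qed
  qed
  show "\<phi> (mvar k) (on_pts \<sigma> \<xi>) \<in> Units (stalk X (on_pts \<sigma> \<xi>))" if nC: "on_pts \<sigma> \<xi> \<notin> C"
  proof (rule ccontr)
    assume "\<phi> (mvar k) (on_pts \<sigma> \<xi>) \<notin> Units (stalk X (on_pts \<sigma> \<xi>))"
    moreover have "\<phi> (mvar k) (on_pts \<sigma> \<xi>) \<in> carrier (stalk X (on_pts \<sigma> \<xi>))"
      by (rule sec_value[OF X oU affine_coords_sec[OF ac] q(2)]) (use k in simp)
    ultimately have "\<phi> (mvar k) (on_pts \<sigma> \<xi>) \<in> max_ideal (stalk X (on_pts \<sigma> \<xi>))" by (simp add: max_ideal_def)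
    then have "\<phi>' (mvar k) \<xi> \<in> max_ideal (stalk X' \<xi>)" using kmorphismD(3)[OF m q(1)] t by metis
    then show False using unit[OF nC] by (simp add: max_ideal_def)
  qed
  show "exceptional_divisor X C X' \<sigma> \<xi> = div_of X' (\<phi>' (mvar k)) \<xi>"
  proof (cases "on_pts \<sigma> \<xi> \<in> C")
    case True
    then show ?thesis by (simp add: exceptional_divisor_def div_of_def inv)
  next
    case False
    then show ?thesis using div_of_unit[where X=X' and s="\<phi>' (mvar k)", OF S unit[OF False]] by (simp add: exceptional_divisor_def)
  qed
qed

lemma genideal_unit_multiple:
  assumes R: "cring R" and u: "u \<in> Units R" and a: "a \<in> carrier R"
  shows "genideal R {u \<otimes>\<^bsub>R\<^esub> a} = genideal R {a}"
proof -
  interpret cring R by fact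
  have uc: "u \<in> carrier R" using u by blast
  have I: "ideal (genideal R {a}) R" "ideal (genideal R {u \<otimes>\<^bsub>R\<^esub> a}) R"
    using a uc by (auto intro!: genideal_ideal)
  have "u \<otimes>\<^bsub>R\<^esub> a \<in> genideal R {a}" using ideal.I_l_closed[OF I(1) genideal_self'[OF a] uc] .
  then have "genideal R {u \<otimes>\<^bsub>R\<^esub> a} \<subseteq> genideal R {a}" by (intro genideal_minimal[OF I(1)]) simp
  moreover have "inv\<^bsub>R\<^esub> u \<otimes>\<^bsub>R\<^esub> (u \<otimes>\<^bsub>R\<^esub> a) \<in> genideal R {u \<otimes>\<^bsub>R\<^esub> a}"
    using ideal.I_l_closed[OF I(2) genideal_self'[of "u \<otimes>\<^bsub>R\<^esub> a"], of "inv\<^bsub>R\<^esub> u"] u uc a by simp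
  then have "a \<in> genideal R {u \<otimes>\<^bsub>R\<^esub> a}" using u uc a by (simp add: m_assoc[symmetric])
  then have "genideal R {a} \<subseteq> genideal R {u \<otimes>\<^bsub>R\<^esub> a}" by (intro genideal_minimal[OF I(2)]) simp
  ultimately show ?thesis by blast
qed

text \<open>The chart of \<open>z\<close> is not needed: where \<open>z\<close> generates the inverse image of the maximal ideal,
  the relation \<open>z (z + xw) = 0\<close> shows that \<open>x\<close> generates it as well.\<close>

lemma blowup_covered_by_charts:
  fixes X :: "('p, 's, 'k::field_char_0) kspace" and X' :: "('q, 'r, 'k) kspace"
  assumes X: "locally_ringed_kspace X" and ac: "affine_coords 4 (planes 0) X U \<phi>"
    and C: "C \<inter> U = {origin 4 X U \<phi>}" and bl: "blowing_up X C X' \<sigma>"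
    and q: "q \<in> pts X'" "on_pts \<sigma> q \<in> U"
  shows "\<exists>k<3. q \<in> blowup_chart X C X' \<sigma> U (\<phi> (mvar k))"
proof -
  have aU: "affine_open X U" using ac by (simp add: affine_coords_def)
  have oU: "openin (sp X) U" by (rule affine_coords_open[OF ac])
  have X': "locally_ringed_kspace X'" by (rule kscheme_lrs[OF blowing_upD(1)[OF bl]])
  have m: "kmorphism X' X \<sigma>" by (rule blowing_upD(2)[OF bl])
  have I: "ideal_sections X C U = \<phi> ` origin_ideal 4" by (rule ideal_sections_origin[OF X ac planes_0_origin C])
  define p where "p = on_pts \<sigma> q"
  have pU: "p \<in> U" using q(2) by (simp add: p_def)
  have "q \<in> (\<Union>f\<in>ideal_sections X C U. blowup_chart X C X' \<sigma> U f)"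
    using blowing_upD(3)[OF bl aU] q by blast
  then obtain F where F: "F \<in> origin_ideal 4" "q \<in> blowup_chart X C X' \<sigma> U (\<phi> F)" unfolding I by blast
  define V where "V = blowup_chart X C X' \<sigma> U (\<phi> F)"
  have qV: "q \<in> V" using F(2) by (simp add: V_def)
  have FI: "\<phi> F \<in> ideal_sections X C U" unfolding I using F(1) by blast
  note ch = blowing_up_chartD[OF bl aU FI, folded V_def]
  have oV: "openin (sp X') V" by (rule affine_openD(1)[OF ch(1)])
  have Vsub: "V \<subseteq> {q \<in> pts X'. on_pts \<sigma> q \<in> U}" unfolding V_def blowup_chart_def by blast
  define S where "S = stalk X' q"
  interpret L: local_presentation "sec_ring X' V" S "\<lambda>s. s q" "{\<zero>\<^bsub>sec_ring X' V\<^esub>}"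
    unfolding S_def by (rule local_presentation_stalk[OF X' ch(1) qV])
  interpret A: local_presentation "poly_ring 4" "stalk X p" "\<lambda>f. \<phi> f p" "planes 0"
    by (rule affine_coords_presentation[OF X ac pU])
  define e where "e f = on_stalks \<sigma> q (\<phi> f p)" for f
  have shom: "on_stalks \<sigma> q \<in> ring_hom (stalk X p) S" unfolding S_def p_def by (rule kmorphismD(2)[OF m q(1)])
  have ec: "e f \<in> carrier S" if "f \<in> pcarr 4" for f
    unfolding e_def by (rule ring_hom_closed[OF shom A.hom_closed[OF that]])
  have emult: "e (f * g) = e f \<otimes>\<^bsub>S\<^esub> e g" if "f \<in> pcarr 4" "g \<in> pcarr 4" for f g
    using A.hom_mult[OF that] ring_hom_mult[OF shom A.hom_closed[OF that(1)] A.hom_closed[OF that(2)]]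
    unfolding e_def poly_ring_simps by simp
  have eadd: "e (f + g) = e f \<oplus>\<^bsub>S\<^esub> e g" if "f \<in> pcarr 4" "g \<in> pcarr 4" for f g
    using A.hom_add[OF that] ring_hom_add[OF shom A.hom_closed[OF that(1)] A.hom_closed[OF that(2)]]
    unfolding e_def poly_ring_simps by simp
  have Fc: "F \<in> pcarr 4" using F(1) by (simp add: origin_ideal_def sub_ker_def)
  have inv: "inverse_ideal X C X' \<sigma> q = genideal S {e F}"
    using blowup_chartD(3)[OF F(2)] unfolding S_def e_def p_def .
  have hF: "pull_to X' \<sigma> U V (\<phi> F) q = e F" unfolding e_def p_def by (rule pull_to_value[OF Vsub qV])
  have hFs: "pull_to X' \<sigma> U V (\<phi> F) \<in> carrier (sec_ring X' V)"
    using ring_hom_closed[OF pull_to_hom[OF X X' m oU oV Vsub]] affine_coords_sec[OF ac Fc] by (simp only: sec_ring_simps(1))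
  \<comment> \<open>\<open>e F\<close> is not a zero-divisor in the stalk. For sections over the
    chart this is part of \<open>blowing_up\<close>, and it is transferred by clearing
    denominators.\<close>
  have reg: "a = \<zero>\<^bsub>S\<^esub>" if a: "a \<in> carrier S" "e F \<otimes>\<^bsub>S\<^esub> a = \<zero>\<^bsub>S\<^esub>" for a
  proof -
    obtain s t where st: "s \<in> carrier (sec_ring X' V)" "t \<in> carrier (sec_ring X' V)" "t q \<in> Units S" "a \<otimes>\<^bsub>S\<^esub> t q = s q"
      using L.frac[OF a(1)] by blast
    have "(pull_to X' \<sigma> U V (\<phi> F) \<otimes>\<^bsub>sec_ring X' V\<^esub> s) q = e F \<otimes>\<^bsub>S\<^esub> (a \<otimes>\<^bsub>S\<^esub> t q)"
      using L.hom_mult[OF hFs st(1)] unfolding hF st(4) .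
    also have "\<dots> = (e F \<otimes>\<^bsub>S\<^esub> a) \<otimes>\<^bsub>S\<^esub> t q" using a(1) ec[OF Fc] L.hom_closed[OF st(2)] by (simp add: L.S.m_assoc)
    also have "\<dots> = \<zero>\<^bsub>S\<^esub>" unfolding a(2) using L.hom_closed[OF st(2)] by simp
    finally have "(pull_to X' \<sigma> U V (\<phi> F) \<otimes>\<^bsub>sec_ring X' V\<^esub> s) q = \<zero>\<^bsub>S\<^esub>" .
    then obtain g where g: "g \<in> carrier (sec_ring X' V)" "g q \<in> Units S"
      "g \<otimes>\<^bsub>sec_ring X' V\<^esub> (pull_to X' \<sigma> U V (\<phi> F) \<otimes>\<^bsub>sec_ring X' V\<^esub> s) = \<zero>\<^bsub>sec_ring X' V\<^esub>"
      using L.ker[OF L.R.m_closed[OF hFs st(1)]] by blast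
    have gs: "g \<otimes>\<^bsub>sec_ring X' V\<^esub> s \<in> sec X' V" using L.R.m_closed[OF g(1) st(1)] by (simp only: sec_ring_simps(1))
    have "pull_to X' \<sigma> U V (\<phi> F) \<otimes>\<^bsub>sec_ring X' V\<^esub> (g \<otimes>\<^bsub>sec_ring X' V\<^esub> s) = \<zero>\<^bsub>sec_ring X' V\<^esub>"
      using g(3) L.R.m_lcomm[OF hFs g(1) st(1)] by (simp only:)
    then have "g \<otimes>\<^bsub>sec_ring X' V\<^esub> s = \<zero>\<^bsub>sec_ring X' V\<^esub>" by (rule ch(4)[OF gs])
    then have "s q = \<zero>\<^bsub>S\<^esub>" using L.ker[OF st(1)] g(1,2) by blast
    then have "a \<otimes>\<^bsub>S\<^esub> t q = \<zero>\<^bsub>S\<^esub> \<otimes>\<^bsub>S\<^esub> t q" using st(4) L.hom_closed[OF st(2)] by simp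
    then show ?thesis using L.unit_cancel[OF st(3) a(1) L.S.zero_closed] by blast
  qed
  have "\<exists>g. \<forall>i<4. g i \<in> carrier S \<and> e (mvar i) = g i \<otimes>\<^bsub>S\<^esub> e F"
  proof -
    have "\<exists>g. g \<in> carrier S \<and> e (mvar i) = g \<otimes>\<^bsub>S\<^esub> e F" if i: "i < 4" for i
    proof -
      have "mvar i \<in> origin_ideal 4" using i by (simp add: origin_ideal_def sub_ker_def)
      then have "\<phi> (mvar i) p \<in> ideal_stalk X C p" by (intro ideal_sections_stalk[OF oU pU]) (unfold I, rule imageI)
      moreover have "on_stalks \<sigma> q ` ideal_stalk X C p \<subseteq> carrier S"
      proof
        fix b assume "b \<in> on_stalks \<sigma> q ` ideal_stalk X C p"
        then obtain s W where sW: "b = on_stalks \<sigma> q (s p)" "openin (sp X) W" "p \<in> W" "s \<in> ideal_sections X C W"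
          unfolding ideal_stalk_def by blast
        have "s p \<in> carrier (stalk X p)"
          by (rule sec_value[OF X sW(2) _ sW(3)]) (use sW(4) in \<open>simp add: ideal_sections_def\<close>)
        then show "b \<in> carrier S" unfolding sW(1) by (rule ring_hom_closed[OF shom])
      qed
      ultimately have "e (mvar i) \<in> inverse_ideal X C X' \<sigma> q"
        unfolding inverse_ideal_def e_def S_def[symmetric] p_def[symmetric] using L.S.genideal_self by blast
      then have "e (mvar i) \<in> cgenideal S (e F)" unfolding inv L.S.cgenideal_eq_genideal[OF ec[OF Fc]] .
      then show ?thesis unfolding cgenideal_def by blast
    qed
    then show ?thesis by metis
  qed
  then obtain g where g: "\<And>i. i < 4 \<Longrightarrow> g i \<in> carrier S" "\<And>i. i < 4 \<Longrightarrow> e (mvar i) = g i \<otimes>\<^bsub>S\<^esub> e F" by blast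
  obtain a where a: "\<And>i::nat. i < 4 \<Longrightarrow> a i \<in> pcarr 4" "F = (\<Sum>i<4. a i * mvar i)"
    by (rule origin_ideal_combination[OF F(1)]) blast
  interpret M: ideal "max_ideal S" S by (rule L.ideal_max)
  \<comment> \<open>\<open>F\<close> is a combination of the variables, so if no \<open>g i\<close>
    were a unit, \<open>e F = b e F\<close> with \<open>b\<close> in the maximal ideal, and
    cancelling \<open>e F\<close> would give \<open>b = 1\<close>.\<close>
  have "\<exists>i<4. g i \<in> Units S"
  proof (rule ccontr)
    assume "\<not> (\<exists>i<4. g i \<in> Units S)"
    then have gm: "g i \<in> max_ideal S" if "i < 4" for i using that g(1) by (simp add: max_ideal_def)
    have "\<exists>b\<in>max_ideal S. e (\<Sum>i<n. a i * mvar i) = b \<otimes>\<^bsub>S\<^esub> e F" if "n \<le> 4" for n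
      using that
    proof (induction n)
      case 0
      have "e 0 = \<zero>\<^bsub>S\<^esub>" unfolding e_def using A.hom_zero ring_hom_zero[OF shom A.S.ring_axioms L.S.ring_axioms] by simp
      then show ?case using additive_subgroup.zero_closed[OF M.additive_subgroup_axioms] ec[OF Fc]
        by (intro bexI[of _ "\<zero>\<^bsub>S\<^esub>"]) simp_all
    next
      case (Suc n)
      then obtain b where b: "b \<in> max_ideal S" "e (\<Sum>i<n. a i * mvar i) = b \<otimes>\<^bsub>S\<^esub> e F" by auto
      have n4: "n < 4" using Suc.prems by simp
      have sumc: "(\<Sum>i<n. a i * mvar i) \<in> pcarr 4" by (rule pcarr_sum) (use a(1) n4 in auto)
      have "e (\<Sum>i<Suc n. a i * mvar i) = b \<otimes>\<^bsub>S\<^esub> e F \<oplus>\<^bsub>S\<^esub> e (a n) \<otimes>\<^bsub>S\<^esub> (g n \<otimes>\<^bsub>S\<^esub> e F)"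
        using eadd[OF sumc, of "a n * mvar n"] emult[of "a n" "mvar n"] a(1)[OF n4] n4 b(2) g(2)[OF n4] by simp
      also have "\<dots> = (b \<oplus>\<^bsub>S\<^esub> e (a n) \<otimes>\<^bsub>S\<^esub> g n) \<otimes>\<^bsub>S\<^esub> e F"
        using M.Icarr[OF b(1)] ec[OF a(1)[OF n4]] g(1)[OF n4] ec[OF Fc] by (simp add: L.S.l_distr L.S.m_assoc)
      finally show ?case
        using M.add_mem[OF b(1) M.I_l_closed[OF gm[OF n4] ec[OF a(1)[OF n4]]]] by blast
    qed
    then obtain b where b: "b \<in> max_ideal S" "e F = b \<otimes>\<^bsub>S\<^esub> e F" using a(2) by blast
    have bc: "b \<in> carrier S" by (rule M.Icarr[OF b(1)])
    have "e F \<otimes>\<^bsub>S\<^esub> (\<one>\<^bsub>S\<^esub> \<ominus>\<^bsub>S\<^esub> b) = e F \<ominus>\<^bsub>S\<^esub> b \<otimes>\<^bsub>S\<^esub> e F"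
      using bc ec[OF Fc] by (simp add: a_minus_def L.S.r_distr L.S.r_minus L.S.m_comm)
    also have "\<dots> = \<zero>\<^bsub>S\<^esub>" unfolding b(2)[symmetric] using ec[OF Fc] by (simp add: a_minus_def L.S.r_neg)
    finally have z: "\<one>\<^bsub>S\<^esub> \<ominus>\<^bsub>S\<^esub> b = \<zero>\<^bsub>S\<^esub>" using reg bc by simp
    have "\<one>\<^bsub>S\<^esub> = (\<one>\<^bsub>S\<^esub> \<ominus>\<^bsub>S\<^esub> b) \<oplus>\<^bsub>S\<^esub> b" using bc by (simp add: a_minus_def L.S.a_assoc L.S.l_neg)
    then have "b = \<one>\<^bsub>S\<^esub>" unfolding z using bc by simp
    then have "b \<in> Units S" using L.S.Units_one_closed by (simp only:)
    then show False using b(1) by (simp add: max_ideal_def)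
  qed
  then obtain i where i: "i < 4" "g i \<in> Units S" by blast
  have chart: "q \<in> blowup_chart X C X' \<sigma> U (\<phi> (mvar j))" if j: "j < 4" "g j \<in> Units S" for j
  proof -
    have "genideal S {e (mvar j)} = genideal S {e F}"
      unfolding g(2)[OF j(1)] by (rule genideal_unit_multiple[OF L.S.is_cring j(2) ec[OF Fc]])
    then show ?thesis unfolding blowup_chart_def using q inv unfolding S_def e_def p_def by simp
  qed
  show ?thesis
  proof (cases "i = 3")
    case False
    then show ?thesis using chart[OF i] i(1) by (intro exI[of _ i]) simp
  next
    case True
    then have g3: "g 3 \<in> Units S" using i(2) by simp
    have rel: "mvar 3 * (mvar 3 + mvar 1 * mvar 0) \<in> planes 0"
      by (auto simp: planes_def comps_def sub_ker_def plane_def)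
    have gc: "g 0 \<in> carrier S" "g 1 \<in> carrier S" "g 3 \<in> carrier S" using g(1) by auto
    \<comment> \<open>After division by \<open>e F\<close> the second factor of
      \<open>z (z + xw) = 0\<close> becomes \<open>d\<close>. The relation reads
      \<open>(e F)^2 (g 3) d = 0\<close>, so \<open>d = 0\<close>; as \<open>g 3\<close> is a unit,
      the remaining product in \<open>d\<close> cannot lie in the maximal ideal, and
      \<open>g 1\<close> is a unit.\<close>
    define d where "d = g 3 \<oplus>\<^bsub>S\<^esub> g 1 \<otimes>\<^bsub>S\<^esub> (g 0 \<otimes>\<^bsub>S\<^esub> e F)"
    have dc: "d \<in> carrier S" using gc ec[OF Fc] by (simp add: d_def)
    have "\<phi> (mvar 3 * (mvar 3 + mvar 1 * mvar 0)) = \<zero>\<^bsub>sec_ring X U\<^esub>"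
      using rel affine_coords_ker[OF ac] by blast
    then have "\<phi> (mvar 3 * (mvar 3 + mvar 1 * mvar 0)) p = \<zero>\<^bsub>stalk X p\<^esub>" using pU by simp
    then have "e (mvar 3 * (mvar 3 + mvar 1 * mvar 0)) = \<zero>\<^bsub>S\<^esub>"
      unfolding e_def using ring_hom_zero[OF shom] A.S.ring_axioms L.S.ring_axioms by simp
    moreover have "e (mvar 3 * (mvar 3 + mvar 1 * mvar 0)) = e (mvar 3) \<otimes>\<^bsub>S\<^esub> (e (mvar 3) \<oplus>\<^bsub>S\<^esub> e (mvar 1) \<otimes>\<^bsub>S\<^esub> e (mvar 0))"
      using emult[of "mvar 3" "mvar 3 + mvar 1 * mvar 0"] eadd[of "mvar 3" "mvar 1 * mvar 0"] emult[of "mvar 1" "mvar 0"]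
      by simp
    moreover have "\<dots> = e F \<otimes>\<^bsub>S\<^esub> (e F \<otimes>\<^bsub>S\<^esub> (g 3 \<otimes>\<^bsub>S\<^esub> d))"
    proof -
      have 1: "e (mvar 3) \<oplus>\<^bsub>S\<^esub> e (mvar 1) \<otimes>\<^bsub>S\<^esub> e (mvar 0) = e F \<otimes>\<^bsub>S\<^esub> d"
        unfolding d_def using g(2)[of 0] g(2)[of 1] g(2)[of 3] gc ec[OF Fc]
        by (simp add: L.S.r_distr) (simp add: L.S.m_ac)
      show ?thesis unfolding 1 using g(2)[of 3] gc(3) dc ec[OF Fc] by (simp add: L.S.m_ac)
    qed
    ultimately have "e F \<otimes>\<^bsub>S\<^esub> (e F \<otimes>\<^bsub>S\<^esub> (g 3 \<otimes>\<^bsub>S\<^esub> d)) = \<zero>\<^bsub>S\<^esub>" by simp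
    then have "e F \<otimes>\<^bsub>S\<^esub> (g 3 \<otimes>\<^bsub>S\<^esub> d) = \<zero>\<^bsub>S\<^esub>" by (rule reg[rotated]) (use gc dc ec[OF Fc] in simp)
    then have "g 3 \<otimes>\<^bsub>S\<^esub> d = \<zero>\<^bsub>S\<^esub>" by (rule reg[rotated]) (use gc dc in simp)
    then have "d = \<zero>\<^bsub>S\<^esub>" using L.S.Units_l_cancel[OF g3 dc L.S.zero_closed] gc by simp
    have "g 1 \<in> Units S"
    proof (rule ccontr)
      assume "g 1 \<notin> Units S"
      then have "g 1 \<in> max_ideal S" using gc by (simp add: max_ideal_def)
      then have m1: "g 1 \<otimes>\<^bsub>S\<^esub> (g 0 \<otimes>\<^bsub>S\<^esub> e F) \<in> max_ideal S" using gc ec[OF Fc] by (intro M.I_r_closed) simp_all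
      have "d \<in> max_ideal S" unfolding \<open>d = \<zero>\<^bsub>S\<^esub>\<close> using additive_subgroup.zero_closed[OF M.additive_subgroup_axioms] .
      from M.minus_mem[OF this m1] have "g 3 \<in> max_ideal S"
        unfolding d_def using gc ec[OF Fc] by (simp add: a_minus_def L.S.a_assoc L.S.r_neg)
      then show False using g3 by (simp add: max_ideal_def)
    qed
    then show ?thesis using chart[of 1] by (intro exI[of _ 1]) simp
  qed
qed

subsection \<open>Blowing up the empty set\<close>

text \<open>Chains of primes and of ideals are carried along the isomorphism. Applied to the inverse
  as well, this fixes the Krull dimension and the colength, the two invariants from which prime
  divisors and their multiplicities are read off.\<close>

lemma ring_iso_invariants_le:
  assumes R: "cring R" and S: "cring S" and h: "h \<in> ring_hom R S" and bij: "bij_betw h (carrier R) (carrier S)"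
  shows "(\<exists>P. (\<forall>i\<le>n. primeideal (P i) R) \<and> (\<forall>i<n. P i \<subset> P (Suc i))) \<Longrightarrow>
      \<exists>P. (\<forall>i\<le>n. primeideal (P i) S) \<and> (\<forall>i<(n::nat). P i \<subset> P (Suc i))"
    and "\<exists>J. J 0 = I \<and> J n = carrier R \<and> (\<forall>i\<le>n. ideal (J i) R) \<and> (\<forall>i<n. J i \<subset> J (Suc i)) \<Longrightarrow>
      \<exists>J. J 0 = h ` I \<and> J n = carrier S \<and> (\<forall>i\<le>n. ideal (J i) S) \<and> (\<forall>i<n. J i \<subset> J (Suc i))"
proof -
  interpret h: ring_hom_cring R S h using R S h by (simp add: ring_hom_cring_def ring_hom_cring_axioms_def)
  have surj: "h ` carrier R = carrier S" and inj: "inj_on h (carrier R)" using bij by (auto simp: bij_betw_def)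
  have ker: "{f \<in> carrier R. h f = \<zero>\<^bsub>S\<^esub>} \<subseteq> {\<zero>\<^bsub>R\<^esub>}" using inj_onD[OF inj, of _ "\<zero>\<^bsub>R\<^esub>"] by auto
  have strict: "h ` A \<subset> h ` B" if "A \<subset> B" "B \<subseteq> carrier R" for A B
    using that inj inj_on_image_eq_iff[OF inj, of A B] by blast
  have im: "ideal (h ` A) S" if A: "ideal A R" for A
  proof (rule h.S.idealI_closed)
    interpret A: ideal A R by fact
    show "h ` A \<subseteq> carrier S" using A.Icarr by auto
    show "\<zero>\<^bsub>S\<^esub> \<in> h ` A" using additive_subgroup.zero_closed[OF A.additive_subgroup_axioms] h.hom_zero by (metis imageI)
    show "a \<oplus>\<^bsub>S\<^esub> b \<in> h ` A" if ab: "a \<in> h ` A" "b \<in> h ` A" for a b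
    proof -
      obtain x y where xy: "x \<in> A" "a = h x" "y \<in> A" "b = h y" using ab by blast
      have "a \<oplus>\<^bsub>S\<^esub> b = h (x \<oplus>\<^bsub>R\<^esub> y)" unfolding xy(2,4) using A.Icarr xy(1,3) by simp
      then show ?thesis using A.add_mem[OF xy(1,3)] by blast
    qed
    show "x \<otimes>\<^bsub>S\<^esub> a \<in> h ` A" if ax: "a \<in> h ` A" "x \<in> carrier S" for a x
    proof -
      obtain b y where bx: "b \<in> A" "a = h b" "y \<in> carrier R" "x = h y" using ax unfolding surj[symmetric] by blast
      have "x \<otimes>\<^bsub>S\<^esub> a = h (y \<otimes>\<^bsub>R\<^esub> b)" unfolding bx(2,4) using A.Icarr bx(1,3) by simp
      then show ?thesis using A.I_l_closed[OF bx(1,3)] by blast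
    qed
  qed
  have sub: "A \<subseteq> carrier R" if "ideal A R" for A
    by (rule additive_subgroup.a_subset[OF ideal.axioms(1)[OF that]])
  show "\<exists>P. (\<forall>i\<le>n. primeideal (P i) S) \<and> (\<forall>i<(n::nat). P i \<subset> P (Suc i))"
    if ex: "\<exists>P. (\<forall>i\<le>n. primeideal (P i) R) \<and> (\<forall>i<n. P i \<subset> P (Suc i))"
  proof -
    obtain P where P: "\<forall>i\<le>n. primeideal (P i) R" "\<forall>i<n. P i \<subset> P (Suc i)" using ex by blast
    have "primeideal (h ` P i) S" if "i \<le> n" for i
    proof -
      have Pi: "primeideal (P i) R" using P(1) that by blast
      have "{f \<in> carrier R. h f = \<zero>\<^bsub>S\<^esub>} \<subseteq> P i"
        using ker additive_subgroup.zero_closed[OF ideal.axioms(1)[OF primeideal.axioms(1)[OF Pi]]] by blast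
      then show ?thesis by (rule primeideal_image(1)[OF h.ring_hom_cring_axioms surj Pi])
    qed
    moreover have "h ` P i \<subset> h ` P (Suc i)" if "i < n" for i
      using strict sub[OF primeideal.axioms(1)] P that by (meson Suc_leI)
    ultimately show ?thesis by (intro exI[of _ "\<lambda>i. h ` P i"]) simp
  qed
  show "\<exists>J. J 0 = h ` I \<and> J n = carrier S \<and> (\<forall>i\<le>n. ideal (J i) S) \<and> (\<forall>i<n. J i \<subset> J (Suc i))"
    if ex: "\<exists>J. J 0 = I \<and> J n = carrier R \<and> (\<forall>i\<le>n. ideal (J i) R) \<and> (\<forall>i<n. J i \<subset> J (Suc i))"
  proof -
    obtain J where J: "J 0 = I" "J n = carrier R" "\<forall>i\<le>n. ideal (J i) R" "\<forall>i<n. J i \<subset> J (Suc i)" using ex by blast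
    have "h ` J i \<subset> h ` J (Suc i)" if "i < n" for i
      using strict sub J(3,4) that by (meson Suc_leI)
    then show ?thesis using J im surj by (intro exI[of _ "\<lambda>i. h ` J i"]) simp
  qed
qed

lemma ring_iso_invariants:
  assumes R: "cring R" and S: "cring S" and h: "h \<in> ring_hom R S" and bij: "bij_betw h (carrier R) (carrier S)"
  shows "krull_dim R = krull_dim S"
    and "a \<in> carrier R \<Longrightarrow> colength R (genideal R {a}) = colength S (genideal S {h a})"
proof -
  interpret h: ring_hom_cring R S h using R S h by (simp add: ring_hom_cring_def ring_hom_cring_axioms_def)
  define k where "k = inv_into (carrier R) h"
  have k: "k \<in> ring_hom S R" "bij_betw k (carrier S) (carrier R)"
    using ring_iso_set_sym[OF h.R.ring_axioms, of h S] h bij unfolding k_def ring_iso_def by auto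
  have kh: "k ` h ` A = A" if "A \<subseteq> carrier R" for A
    using that bij unfolding k_def bij_betw_def by (simp add: inv_into_image_cancel)
  have "(\<exists>P. (\<forall>i\<le>n. primeideal (P i) R) \<and> (\<forall>i<n. P i \<subset> P (Suc i))) \<longleftrightarrow>
    (\<exists>P. (\<forall>i\<le>n. primeideal (P i) S) \<and> (\<forall>i<(n::nat). P i \<subset> P (Suc i)))" for n
    using ring_iso_invariants_le(1)[OF R S h bij] ring_iso_invariants_le(1)[OF S R k] by (rule iffI)
  then show "krull_dim R = krull_dim S" unfolding krull_dim_def by simp
  assume a: "a \<in> carrier R"
  have gR: "genideal R {a} = cgenideal R a" using h.R.cgenideal_eq_genideal[OF a] by simp
  have gS: "genideal S {h a} = cgenideal S (h a)" using h.S.cgenideal_eq_genideal[of "h a"] a by simp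
  have im: "h ` genideal R {a} = genideal S {h a}"
  proof -
    have "h ` cgenideal R a = {h x \<otimes>\<^bsub>S\<^esub> h a | x. x \<in> carrier R}" using a unfolding cgenideal_def by force
    also have "\<dots> = {y \<otimes>\<^bsub>S\<^esub> h a | y. y \<in> h ` carrier R}" by blast
    also have "h ` carrier R = carrier S" using bij by (simp add: bij_betw_def)
    finally show ?thesis unfolding gR gS cgenideal_def .
  qed
  have sub: "genideal R {a} \<subseteq> carrier R"
    using additive_subgroup.a_subset[OF ideal.axioms(1)[OF h.R.genideal_ideal[of "{a}"]]] a by simp
  have "(\<exists>J. J 0 = genideal R {a} \<and> J n = carrier R \<and> (\<forall>i\<le>n. ideal (J i) R) \<and> (\<forall>i<n. J i \<subset> J (Suc i))) \<longleftrightarrow>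
    (\<exists>J. J 0 = genideal S {h a} \<and> J n = carrier S \<and> (\<forall>i\<le>n. ideal (J i) S) \<and> (\<forall>i<n. J i \<subset> J (Suc i)))" for n
    using ring_iso_invariants_le(2)[OF R S h bij, of "genideal R {a}" n, unfolded im]
      ring_iso_invariants_le(2)[OF S R k, of "h ` genideal R {a}" n, unfolded kh[OF sub], unfolded im] by (rule iffI)
  then show "colength R (genideal R {a}) = colength S (genideal S {h a})" unfolding colength_def by simp
qed

lemma ideal_pow_carrier:
  assumes R: "cring R" and I: "I \<subseteq> carrier R" and b: "b \<in> ideal_pow R I n" shows "b \<in> carrier R"
  using b
proof (induction n arbitrary: b)
  case (Suc n)
  interpret cring R by fact
  have "b \<in> ideal_prod R (ideal_pow R I n) I" using Suc.prems by simp
  then show ?case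
  proof (induction rule: ideal_prod.induct)
    case (prod i j)
    then show ?case using Suc.IH I by blast
  qed auto
qed simp

text \<open>Over a chart that the centre avoids, the ideal of the centre is the unit ideal. In the
  chart of the section 1 the denominators are powers of 1, so pulling back is an isomorphism of
  section rings and the coordinates persist.\<close>

lemma blowup_empty_coords:
  fixes X :: "('p, 's, 'k::field_char_0) kspace" and X' :: "('q, 'r, 'k) kspace"
  assumes X: "locally_ringed_kspace X" and ac: "affine_coords n J X U \<phi>"
    and C: "C \<inter> U = {}" and bl: "blowing_up X C X' \<sigma>"
  obtains V \<phi>' where "affine_coords n J X' V \<phi>'" "V \<subseteq> {q \<in> pts X'. on_pts \<sigma> q \<in> U}"
    "\<And>\<xi>. \<xi> \<in> V \<Longrightarrow> prime_divisor X' \<xi> \<longleftrightarrow> prime_divisor X (on_pts \<sigma> \<xi>)"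
    "\<And>f \<xi>. f \<in> pcarr n \<Longrightarrow> \<xi> \<in> V \<Longrightarrow> div_of X' (\<phi>' f) \<xi> = div_of X (\<phi> f) (on_pts \<sigma> \<xi>)"
proof -
  have aU: "affine_open X U" using ac by (simp add: affine_coords_def)
  have oU: "openin (sp X) U" by (rule affine_coords_open[OF ac])
  have X': "locally_ringed_kspace X'" by (rule kscheme_lrs[OF blowing_upD(1)[OF bl]])
  have m: "kmorphism X' X \<sigma>" by (rule blowing_upD(2)[OF bl])
  have I: "ideal_sections X C U = sec X U" unfolding ideal_sections_def using C by blast
  interpret \<phi>: ring_hom_cring "poly_ring n" "sec_ring X U" \<phi> by (rule affine_coords_cring_hom[OF X ac])
  define u where "u = \<one>\<^bsub>sec_ring X U\<^esub>"
  have us: "u \<in> sec X U" unfolding u_def using \<phi>.S.one_closed by (simp only: sec_ring_simps(1))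
  have uI: "u \<in> ideal_sections X C U" unfolding I by (rule us)
  define V where "V = blowup_chart X C X' \<sigma> U u"
  note ch = blowing_up_chartD[OF bl aU uI, folded V_def, unfolded I]
  have oV: "openin (sp X') V" by (rule affine_openD(1)[OF ch(1)])
  have Vsub: "V \<subseteq> {q \<in> pts X'. on_pts \<sigma> q \<in> U}" unfolding V_def blowup_chart_def by blast
  have hhom: "pull_to X' \<sigma> U V \<in> ring_hom (sec_ring X U) (sec_ring X' V)"
    by (rule pull_to_hom[OF X X' m oU oV Vsub])
  have B: "cring (sec_ring X' V)" by (rule sec_cring[OF X' oV])
  interpret h: ring_hom_cring "sec_ring X U" "sec_ring X' V" "pull_to X' \<sigma> U V"
    using \<phi>.S.is_cring B hhom by (simp add: ring_hom_cring_def ring_hom_cring_axioms_def del: sec_ring_simps)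
  have hu: "pull_to X' \<sigma> U V u = \<one>\<^bsub>sec_ring X' V\<^esub>" unfolding u_def by (rule h.hom_one)
  have surj: "\<exists>b\<in>sec X U. g = pull_to X' \<sigma> U V b" if g: "g \<in> sec X' V" for g
  proof -
    obtain N b where b: "b \<in> ideal_pow (sec_ring X U) (sec X U) N"
      "(\<one>\<^bsub>sec_ring X' V\<^esub> [^]\<^bsub>sec_ring X' V\<^esub> (N::nat)) \<otimes>\<^bsub>sec_ring X' V\<^esub> g = pull_to X' \<sigma> U V b"
      using ch(3)[OF g] unfolding hu by blast
    have gc: "g \<in> carrier (sec_ring X' V)" using g by (simp only: sec_ring_simps(1))
    have bc: "b \<in> carrier (sec_ring X U)"
      by (rule ideal_pow_carrier[OF \<phi>.S.is_cring _ b(1)]) (simp only: sec_ring_simps(1) subset_refl)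
    have "g = pull_to X' \<sigma> U V b"
      using b(2) unfolding h.S.nat_pow_one h.S.l_one[OF gc] .
    then show ?thesis using bc by (intro bexI[of _ b]) (simp_all only: sec_ring_simps(1))
  qed
  have inj: "b = \<zero>\<^bsub>sec_ring X U\<^esub>" if b: "b \<in> sec X U" "pull_to X' \<sigma> U V b = \<zero>\<^bsub>sec_ring X' V\<^esub>" for b
  proof -
    obtain N where N: "(\<one>\<^bsub>sec_ring X U\<^esub> [^]\<^bsub>sec_ring X U\<^esub> (N::nat)) \<otimes>\<^bsub>sec_ring X U\<^esub> b = \<zero>\<^bsub>sec_ring X U\<^esub>"
      using ch(5)[OF b] unfolding u_def by blast
    have bc: "b \<in> carrier (sec_ring X U)" using b(1) by (simp only: sec_ring_simps(1))
    show ?thesis using N unfolding \<phi>.S.nat_pow_one \<phi>.S.l_one[OF bc] .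
  qed
  define \<phi>' where "\<phi>' f = pull_to X' \<sigma> U V (\<phi> f)" for f
  have surj\<phi>: "\<phi> ` pcarr n = sec X U" using ac by (simp add: affine_coords_def)
  have ac': "affine_coords n J X' V \<phi>'"
    unfolding affine_coords_def
  proof (intro conjI allI ch(1))
    show "\<phi>' \<in> ring_hom (poly_ring n) (sec_ring X' V)"
    proof (rule ring_hom_memI)
      fix p :: "'k mpol" assume p: "p \<in> pcarr n"
      show "\<phi>' p \<in> carrier (sec_ring X' V)" unfolding \<phi>'_def by (rule h.hom_closed[OF \<phi>.hom_closed[OF p]])
      fix p' :: "'k mpol" assume p': "p' \<in> pcarr n"
      show "\<phi>' (p \<otimes>\<^bsub>poly_ring n\<^esub> p') = \<phi>' p \<otimes>\<^bsub>sec_ring X' V\<^esub> \<phi>' p'"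
        unfolding \<phi>'_def \<phi>.hom_mult[OF p p'] by (rule h.hom_mult[OF \<phi>.hom_closed[OF p] \<phi>.hom_closed[OF p']])
      show "\<phi>' (p \<oplus>\<^bsub>poly_ring n\<^esub> p') = \<phi>' p \<oplus>\<^bsub>sec_ring X' V\<^esub> \<phi>' p'"
        unfolding \<phi>'_def \<phi>.hom_add[OF p p'] by (rule h.hom_add[OF \<phi>.hom_closed[OF p] \<phi>.hom_closed[OF p']])
    next
      show "\<phi>' \<one>\<^bsub>poly_ring n\<^esub> = \<one>\<^bsub>sec_ring X' V\<^esub>" unfolding \<phi>'_def \<phi>.hom_one by (rule h.hom_one)
    qed
    show "\<phi>' ` pcarr n = sec X' V"
    proof (intro equalityI subsetI)
      fix g assume "g \<in> sec X' V"
      then obtain b where "b \<in> sec X U" "g = pull_to X' \<sigma> U V b" using surj by blast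
      then show "g \<in> \<phi>' ` pcarr n" unfolding surj\<phi>[symmetric] \<phi>'_def by blast
    next
      fix g assume "g \<in> \<phi>' ` pcarr n"
      then obtain p where p: "p \<in> pcarr n" "g = pull_to X' \<sigma> U V (\<phi> p)" unfolding \<phi>'_def by blast
      show "g \<in> sec X' V" using h.hom_closed[OF \<phi>.hom_closed[OF p(1)]] unfolding p(2) sec_ring_simps(1) .
    qed
    have "\<phi>' p = \<zero>\<^bsub>sec_ring X' V\<^esub> \<longleftrightarrow> \<phi> p = \<zero>\<^bsub>sec_ring X U\<^esub>" if p: "p \<in> pcarr n" for p
      unfolding \<phi>'_def using inj[OF affine_coords_sec[OF ac p]] h.hom_zero by metis
    then show "a_kernel (poly_ring n) (sec_ring X' V) \<phi>' = J"
      unfolding a_kernel_def' affine_coords_ker[OF ac] by blast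
    fix c
    have pc: "\<phi> (mconst c) = (\<lambda>p\<in>U. scalar X p c)" using ac by (simp add: affine_coords_def)
    show "\<phi>' (mconst c) = (\<lambda>q\<in>V. scalar X' q c)"
    proof
      fix q show "\<phi>' (mconst c) q = (\<lambda>q\<in>V. scalar X' q c) q"
      proof (cases "q \<in> V")
        case True
        then have q: "q \<in> pts X'" "on_pts \<sigma> q \<in> U" using Vsub by auto
        have "\<phi>' (mconst c) q = on_stalks \<sigma> q (scalar X (on_pts \<sigma> q) c)"
          using pull_to_value[OF Vsub True, of "\<phi> (mconst c)"] q(2) unfolding \<phi>'_def pc by simp
        then show ?thesis using kmorphismD(4)[OF m q(1)] True by simp
      next
        case False
        then show ?thesis unfolding \<phi>'_def by simp
      qed
    qed
  qed
  have iso: "cring (stalk X (on_pts \<sigma> \<xi>)) \<and> cring (stalk X' \<xi>) \<and>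
      on_stalks \<sigma> \<xi> \<in> ring_hom (stalk X (on_pts \<sigma> \<xi>)) (stalk X' \<xi>) \<and>
      bij_betw (on_stalks \<sigma> \<xi>) (carrier (stalk X (on_pts \<sigma> \<xi>))) (carrier (stalk X' \<xi>))"
    if xi: "\<xi> \<in> V" for \<xi>
  proof -
    define p where "p = on_pts \<sigma> \<xi>"
    have q: "\<xi> \<in> pts X'" "p \<in> U" using Vsub xi by (auto simp: p_def)
    interpret A: local_presentation "poly_ring n" "stalk X p" "\<lambda>f. \<phi> f p" J
      by (rule affine_coords_presentation[OF X ac q(2)])
    interpret B: local_presentation "poly_ring n" "stalk X' \<xi>" "\<lambda>f. \<phi>' f \<xi>" J
      by (rule affine_coords_presentation[OF X' ac' xi])
    have hom: "on_stalks \<sigma> \<xi> \<in> ring_hom (stalk X p) (stalk X' \<xi>)" unfolding p_def by (rule kmorphismD(2)[OF m q(1)])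
    interpret s: ring_hom_cring "stalk X p" "stalk X' \<xi>" "on_stalks \<sigma> \<xi>"
      using A.S.is_cring B.S.is_cring hom by (simp add: ring_hom_cring_def ring_hom_cring_axioms_def)
    have val: "on_stalks \<sigma> \<xi> (\<phi> f p) = \<phi>' f \<xi>" for f
      using pull_to_value[OF Vsub xi, of "\<phi> f"] unfolding \<phi>'_def p_def by simp
    \<comment> \<open>A morphism maps non-units of stalks to non-units, hence reflects units. So
      denominators over \<open>\<xi>\<close> are already denominators over its image, which makes
      the map of stalks bijective.\<close>
    have unit: "\<phi> f p \<in> Units (stalk X p)" if f: "f \<in> pcarr n" "\<phi>' f \<xi> \<in> Units (stalk X' \<xi>)" for f
    proof (rule ccontr)
      assume "\<phi> f p \<notin> Units (stalk X p)"
      then have "\<phi> f p \<in> max_ideal (stalk X p)" using A.hom_closed[OF f(1)] by (simp add: max_ideal_def)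
      then have "\<phi>' f \<xi> \<in> max_ideal (stalk X' \<xi>)" using kmorphismD(3)[OF m q(1)] val unfolding p_def by metis
      then show False using f(2) by (simp add: max_ideal_def)
    qed
    have "bij_betw (on_stalks \<sigma> \<xi>) (carrier (stalk X p)) (carrier (stalk X' \<xi>))"
      unfolding bij_betw_def
    proof
      have kz: "a = \<zero>\<^bsub>stalk X p\<^esub>" if a: "a \<in> carrier (stalk X p)" "on_stalks \<sigma> \<xi> a = \<zero>\<^bsub>stalk X' \<xi>\<^esub>" for a
      proof -
        obtain f g where fg: "f \<in> pcarr n" "g \<in> pcarr n" "\<phi> g p \<in> Units (stalk X p)" "a \<otimes>\<^bsub>stalk X p\<^esub> \<phi> g p = \<phi> f p"
          using A.frac[OF a(1)] by blast
        have "\<phi>' f \<xi> = on_stalks \<sigma> \<xi> a \<otimes>\<^bsub>stalk X' \<xi>\<^esub> \<phi>' g \<xi>"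
          unfolding val[symmetric] fg(4)[symmetric] by (rule s.hom_mult[OF a(1) A.hom_closed[OF fg(2)]])
        then have "\<phi>' f \<xi> = \<zero>\<^bsub>stalk X' \<xi>\<^esub>" unfolding a(2) using B.hom_closed[OF fg(2)] by simp
        then obtain k where k: "k \<in> pcarr n" "\<phi>' k \<xi> \<in> Units (stalk X' \<xi>)" "k \<otimes>\<^bsub>poly_ring n\<^esub> f \<in> J"
          using B.ker[OF fg(1)] by blast
        then have "\<phi> f p = \<zero>\<^bsub>stalk X p\<^esub>" using A.ker[OF fg(1)] unit[OF k(1,2)] by blast
        then have "a \<otimes>\<^bsub>stalk X p\<^esub> \<phi> g p = \<zero>\<^bsub>stalk X p\<^esub> \<otimes>\<^bsub>stalk X p\<^esub> \<phi> g p"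
          using fg(4) A.hom_closed[OF fg(2)] by simp
        then show ?thesis using A.unit_cancel[OF fg(3) a(1) A.S.zero_closed] by blast
      qed
      show "inj_on (on_stalks \<sigma> \<xi>) (carrier (stalk X p))"
      proof (rule inj_onI)
        fix a b assume ab: "a \<in> carrier (stalk X p)" "b \<in> carrier (stalk X p)" "on_stalks \<sigma> \<xi> a = on_stalks \<sigma> \<xi> b"
        have "on_stalks \<sigma> \<xi> (a \<ominus>\<^bsub>stalk X p\<^esub> b) = \<zero>\<^bsub>stalk X' \<xi>\<^esub>"
          using ab by (simp add: a_minus_def B.S.r_neg)
        then have "a \<ominus>\<^bsub>stalk X p\<^esub> b = \<zero>\<^bsub>stalk X p\<^esub>" using kz[of "a \<ominus>\<^bsub>stalk X p\<^esub> b"] ab(1,2) by simp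
        then show "a = b" using ab(1,2) A.S.minus_equality[of a "\<ominus>\<^bsub>stalk X p\<^esub> b"] by (simp add: a_minus_def)
      qed
      show "on_stalks \<sigma> \<xi> ` carrier (stalk X p) = carrier (stalk X' \<xi>)"
      proof (intro equalityI subsetI)
        fix b assume b: "b \<in> carrier (stalk X' \<xi>)"
        obtain f g where fg: "f \<in> pcarr n" "g \<in> pcarr n" "\<phi>' g \<xi> \<in> Units (stalk X' \<xi>)" "b \<otimes>\<^bsub>stalk X' \<xi>\<^esub> \<phi>' g \<xi> = \<phi>' f \<xi>"
          using B.frac[OF b] by blast
        have u: "\<phi> g p \<in> Units (stalk X p)" by (rule unit[OF fg(2,3)])
        define a where "a = \<phi> f p \<otimes>\<^bsub>stalk X p\<^esub> inv\<^bsub>stalk X p\<^esub> \<phi> g p"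
        have ac: "a \<in> carrier (stalk X p)" unfolding a_def using A.hom_closed[OF fg(1)] u by simp
        have "a \<otimes>\<^bsub>stalk X p\<^esub> \<phi> g p = \<phi> f p"
          unfolding a_def using A.hom_closed[OF fg(1)] A.hom_closed[OF fg(2)] u by (simp add: A.S.m_assoc)
        then have "on_stalks \<sigma> \<xi> a \<otimes>\<^bsub>stalk X' \<xi>\<^esub> \<phi>' g \<xi> = \<phi>' f \<xi>"
          using s.hom_mult[OF ac A.hom_closed[OF fg(2)]] by (simp add: val)
        then have "on_stalks \<sigma> \<xi> a = b" using B.unit_cancel[OF fg(3) s.hom_closed[OF ac] b] fg(4) by simp
        then show "b \<in> on_stalks \<sigma> \<xi> ` carrier (stalk X p)" using ac by blast
      qed auto
    qed
    then show ?thesis using A.S.is_cring B.S.is_cring hom unfolding p_def by blast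
  qed
  have pd: "prime_divisor X' \<xi> \<longleftrightarrow> prime_divisor X (on_pts \<sigma> \<xi>)" if xi: "\<xi> \<in> V" for \<xi>
  proof -
    have "\<xi> \<in> pts X'" "on_pts \<sigma> \<xi> \<in> pts X" using Vsub xi openin_subset[OF oU] by auto
    moreover have "krull_dim (stalk X (on_pts \<sigma> \<xi>)) = krull_dim (stalk X' \<xi>)"
      using iso[OF xi] by (elim conjE) (rule ring_iso_invariants(1))
    ultimately show ?thesis by (simp add: prime_divisor_def)
  qed
  have dv: "div_of X' (\<phi>' f) \<xi> = div_of X (\<phi> f) (on_pts \<sigma> \<xi>)" if f: "f \<in> pcarr n" and xi: "\<xi> \<in> V" for f \<xi>
  proof -
    have pU: "on_pts \<sigma> \<xi> \<in> U" using Vsub xi by auto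
    have fc: "\<phi> f (on_pts \<sigma> \<xi>) \<in> carrier (stalk X (on_pts \<sigma> \<xi>))"
      by (rule sec_value[OF X oU affine_coords_sec[OF ac f] pU])
    have "\<phi>' f \<xi> = on_stalks \<sigma> \<xi> (\<phi> f (on_pts \<sigma> \<xi>))" unfolding \<phi>'_def by (rule pull_to_value[OF Vsub xi])
    moreover have "colength (stalk X (on_pts \<sigma> \<xi>)) (genideal (stalk X (on_pts \<sigma> \<xi>)) {\<phi> f (on_pts \<sigma> \<xi>)}) =
      colength (stalk X' \<xi>) (genideal (stalk X' \<xi>) {on_stalks \<sigma> \<xi> (\<phi> f (on_pts \<sigma> \<xi>))})"
      using iso[OF xi] by (elim conjE) (rule ring_iso_invariants(2)[OF _ _ _ _ fc])
    ultimately show ?thesis unfolding div_of_def pd[OF xi] by simp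
  qed
  show thesis by (rule that[OF ac' Vsub]) (use pd dv in blast)+
qed

section \<open>The theorem\<close>

text \<open>Read contrapositively: the obstruction at the origin is one of the variety alone and
  therefore excludes snc for every divisor carried along the sequence.\<close>

lemma snc_pair_imp_snc: "snc_pair_at X D p \<Longrightarrow> snc_at X p"
  unfolding snc_pair_at_def snc_at_def by blast

text \<open>The invariant of the sequence of blowings-up: an open copy of the three planes, on which the
  divisor is a multiple of \<open>(w = 0)\<close>.\<close>

lemma persistent_chart:
  fixes X :: "('p, 's, 'k::field_char_0) kspace"
  assumes X: "locally_ringed_kspace X" and ac: "affine_coords 4 (planes 0) X U \<phi>"
    and D: "\<And>\<xi>. \<xi> \<in> U \<Longrightarrow> D \<xi> = c * div_of X (\<phi> (mvar 0)) \<xi>"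
    and C: "\<And>p. p \<in> C \<Longrightarrow> \<not> snc_pair_at X D p" and bl: "blowing_up X C X' \<sigma>"
  shows "\<exists>V \<phi>' c'. affine_coords 4 (planes 0) X' V \<phi>' \<and>
    (\<forall>\<xi>\<in>V. transform_divisor X C X' \<sigma> D \<xi> = c' * div_of X' (\<phi>' (mvar 0)) \<xi>)"
proof -
  have "C \<inter> U \<subseteq> {origin 4 X U \<phi>}"
  proof
    fix p assume p: "p \<in> C \<inter> U"
    have "snc_pair_at X D p" if "p \<noteq> origin 4 X U \<phi>"
      by (rule snc_pair_off_origin[OF X ac _ _ D]) (use p that in auto)
    then show "p \<in> {origin 4 X U \<phi>}" using C p by blast
  qed
  then consider "C \<inter> U = {}" | "C \<inter> U = {origin 4 X U \<phi>}" by blast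
  then show ?thesis
  proof cases
    case 1
    obtain V \<phi>' where V: "affine_coords 4 (planes 0) X' V \<phi>'" "V \<subseteq> {q \<in> pts X'. on_pts \<sigma> q \<in> U}"
      "\<And>\<xi>. \<xi> \<in> V \<Longrightarrow> prime_divisor X' \<xi> \<longleftrightarrow> prime_divisor X (on_pts \<sigma> \<xi>)"
      "\<And>f \<xi>. f \<in> pcarr 4 \<Longrightarrow> \<xi> \<in> V \<Longrightarrow> div_of X' (\<phi>' f) \<xi> = div_of X (\<phi> f) (on_pts \<sigma> \<xi>)"
      by (rule blowup_empty_coords[OF X ac 1 bl]) blast
    have "transform_divisor X C X' \<sigma> D \<xi> = c * div_of X' (\<phi>' (mvar 0)) \<xi>" if xi: "\<xi> \<in> V" for \<xi>
    proof -
      have pU: "on_pts \<sigma> \<xi> \<in> U" using V(2) xi by auto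
      then have "on_pts \<sigma> \<xi> \<notin> C" using 1 by blast
      then have "transform_divisor X C X' \<sigma> D \<xi> = (if prime_divisor X' \<xi> then D (on_pts \<sigma> \<xi>) else 0)"
        by (simp add: transform_divisor_def strict_transform_def exceptional_divisor_def)
      also have "\<dots> = c * div_of X (\<phi> (mvar 0)) (on_pts \<sigma> \<xi>)"
        using V(3)[OF xi] D[OF pU] by (simp add: div_of_def)
      finally show ?thesis using V(4)[OF _ xi, of "mvar 0"] by simp
    qed
    then show ?thesis using V(1) by blast
  next
    case 2
    define V where "V = blowup_chart X C X' \<sigma> U (\<phi> (mvar 0))"
    obtain \<phi>' where ac': "affine_coords 4 (chart_transform 4 0 (planes 0)) X' V \<phi>'"
      and pk: "pull_to X' \<sigma> U V (\<phi> (mvar 0)) = \<phi>' (mvar 0)"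
      and pi: "\<forall>i<4. i \<noteq> 0 \<longrightarrow> pull_to X' \<sigma> U V (\<phi> (mvar i)) = \<phi>' (mvar 0) \<otimes>\<^bsub>sec_ring X' V\<^esub> \<phi>' (mvar i)"
      using blowup_chart_coords[OF X ac planes_0_origin 2 bl, of 0] unfolding V_def by auto
    have ac0: "affine_coords 4 (planes 0) X' V \<phi>'" using ac' unfolding chart_transform_planes[OF zero_less_numeral] .
    have "transform_divisor X C X' \<sigma> D \<xi> = 1 * div_of X' (\<phi>' (mvar 0)) \<xi>" if xi: "\<xi> \<in> V" for \<xi>
    proof -
      have pU: "on_pts \<sigma> \<xi> \<in> U" using xi unfolding V_def by (rule blowup_chartD(2))
      have k4: "0 < (4::nat)" by simp
      note cd = chart_divisor[OF X ac planes_0_origin 2 bl k4 ac0 V_def pk pi[rule_format] xi]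
      \<comment> \<open>The old divisor \<open>w = 0\<close> leaves the chart of \<open>w\<close>:
        at points of this chart lying off the centre \<open>w\<close> is a unit. So only the new
        exceptional divisor remains, and the multiplicity becomes 1 for every
        \<open>c\<close>.\<close>
      have "strict_transform C X' \<sigma> D \<xi> = 0"
      proof (cases "on_pts \<sigma> \<xi> \<in> C")
        case False
        have "cring (stalk X (on_pts \<sigma> \<xi>))"
          using stalk_cring[OF X] pU openin_subset[OF affine_coords_open[OF ac]] by blast
        moreover have "\<phi> (mvar 0) (on_pts \<sigma> \<xi>) \<in> Units (stalk X (on_pts \<sigma> \<xi>))"
          by (rule cd(3)) (use False in simp_all)
        ultimately have "div_of X (\<phi> (mvar 0)) (on_pts \<sigma> \<xi>) = 0" by (rule div_of_unit)
        then show ?thesis using D[OF pU] by (simp add: strict_transform_def)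
      qed (simp add: strict_transform_def)
      moreover have "exceptional_divisor X C X' \<sigma> \<xi> = div_of X' (\<phi>' (mvar 0)) \<xi>" by (rule cd(4)) simp_all
      ultimately show ?thesis by (simp add: transform_divisor_def)
    qed
    then show ?thesis using ac0 by blast
  qed
qed

lemma no_snc_avoiding_sequence:
  fixes X :: "('p, 's, 'k::field_char_0) kspace"
  assumes X: "locally_ringed_kspace X" and ac: "affine_coords 4 (planes 0) X U \<phi>"
    and seq: "snc_avoiding_sequence X t Xs C \<sigma> D"
  shows "\<exists>p\<in>pts (Xs t). \<not> snc_pair_at (Xs t) (D t) p"
proof -
  have X0: "Xs 0 = X" "D 0 = (\<lambda>_. 0)"
    and step: "\<And>j. j < t \<Longrightarrow> (\<forall>p\<in>C j. \<not> snc_pair_at (Xs j) (D j) p) \<and>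
        blowing_up (Xs j) (C j) (Xs (Suc j)) (\<sigma> j) \<and>
        D (Suc j) = transform_divisor (Xs j) (C j) (Xs (Suc j)) (\<sigma> j) (D j)"
    using seq unfolding snc_avoiding_sequence_def by blast+
  have "locally_ringed_kspace (Xs j) \<and> (\<exists>V \<phi>' c. affine_coords 4 (planes 0) (Xs j) V \<phi>' \<and>
    (\<forall>\<xi>\<in>V. D j \<xi> = c * div_of (Xs j) (\<phi>' (mvar 0)) \<xi>))" if "j \<le> t" for j
    using that
  proof (induction j)
    case 0
    \<comment> \<open>The initial divisor is zero, which is the multiple of \<open>w = 0\<close>
      with \<open>c = 0\<close>.\<close>
    show ?case unfolding X0 using X ac by (intro conjI exI[of _ U] exI[of _ \<phi>] exI[of _ 0]) simp_all
  next
    case (Suc j)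
    then obtain V \<phi>' c where IH: "locally_ringed_kspace (Xs j)" "affine_coords 4 (planes 0) (Xs j) V \<phi>'"
      "\<forall>\<xi>\<in>V. D j \<xi> = c * div_of (Xs j) (\<phi>' (mvar 0)) \<xi>" by auto
    have j: "j < t" using Suc.prems by simp
    note st = step[OF j]
    have bl: "blowing_up (Xs j) (C j) (Xs (Suc j)) (\<sigma> j)" using st by blast
    have Cj: "\<not> snc_pair_at (Xs j) (D j) p" if "p \<in> C j" for p using st that by blast
    have Ds: "D (Suc j) = transform_divisor (Xs j) (C j) (Xs (Suc j)) (\<sigma> j) (D j)" using st by blast
    show ?case
      using kscheme_lrs[OF blowing_upD(1)[OF bl]]
        persistent_chart[OF IH(1,2) IH(3)[rule_format] Cj bl] unfolding Ds by blast
  qed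
  then obtain V \<phi>' where V: "locally_ringed_kspace (Xs t)" "affine_coords 4 (planes 0) (Xs t) V \<phi>'" by blast
  have "origin 4 (Xs t) V \<phi>' \<in> pts (Xs t)"
    using origin_point(1)[OF V planes_0_origin] openin_subset[OF affine_coords_open[OF V(2)]] by blast
  moreover have "\<not> snc_pair_at (Xs t) (D t) (origin 4 (Xs t) V \<phi>')"
    by (rule contrapos_nn[OF not_snc_origin[OF V] snc_pair_imp_snc])
  ultimately show ?thesis by blast
qed

theorem mainTheorem3:
  fixes X :: "('p, 's, 'k::field_char_0) kspace"
    and \<phi> :: "'k mpol \<Rightarrow> 'p \<Rightarrow> 's"
  assumes "kscheme X"
    and "affine_coords 4 three_planes X (pts X) \<phi>"
  shows "origin 4 X (pts X) \<phi> \<in> pts X \<and>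
    (\<forall>p\<in>pts X. snc_at X p \<longleftrightarrow> p \<noteq> origin 4 X (pts X) \<phi>) \<and>
    (\<forall>(X' :: ('q, 'r, 'k) kspace) \<sigma>.
       blowing_up X {origin 4 X (pts X) \<phi>} X' \<sigma> \<longrightarrow>
       (let C = {origin 4 X (pts X) \<phi>};
            D' = exceptional_divisor X C X' \<sigma>;
            V = blowup_chart X C X' \<sigma> (pts X) (\<phi> (mvar 0));
            pull = (\<lambda>s. restrict (pullback X' \<sigma> (pts X) s) V)
        in \<exists>\<phi>'. affine_coords 4 three_planes X' V \<phi>' \<and>
             pull (\<phi> (mvar 0)) = \<phi>' (mvar 0) \<and>
             (\<forall>i\<in>{1, 2, 3}. pull (\<phi> (mvar i)) = \<phi>' (mvar 0) \<otimes>\<^bsub>sec_ring X' V\<^esub> \<phi>' (mvar i)) \<and>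
             (\<forall>q\<in>V. inverse_ideal X C X' \<sigma> q = genideal (stalk X' q) {\<phi>' (mvar 0) q}) \<and>
             (\<forall>\<xi>\<in>V. D' \<xi> = div_of X' (\<phi>' (mvar 0)) \<xi>) \<and>
             origin 4 X' V \<phi>' \<in> V \<and>
             (\<forall>q\<in>pts X'. snc_pair_at X' D' q \<longleftrightarrow> q \<noteq> origin 4 X' V \<phi>'))) \<and>
    (\<nexists>t Xs C \<sigma> D. snc_avoiding_sequence X t Xs C \<sigma> D \<and>
       (\<forall>p\<in>pts (Xs t). snc_pair_at (Xs t) (D t) p))"
proof -
  define o' where "o' = origin 4 X (pts X) \<phi>"
  have X: "locally_ringed_kspace X" by (rule kscheme_lrs[OF assms(1)])
  have ac: "affine_coords 4 (planes 0) X (pts X) \<phi>" using assms(2) by (simp add: three_planes_eq)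
  have o_pts: "o' \<in> pts X" unfolding o'_def by (rule origin_point(1)[OF X ac planes_0_origin])
  have snc: "snc_at X p \<longleftrightarrow> p \<noteq> o'" if p: "p \<in> pts X" for p
  proof
    assume "p \<noteq> o'"
    \<comment> \<open>The variety alone is treated as the pair with the zero divisor,
      \<open>c = 0\<close>, so that one lemma covers both the original planes and the
      blowing-up.\<close>
    then have "snc_pair_at X (\<lambda>_. 0) p" unfolding o'_def
      by (intro snc_pair_off_origin[OF X ac p, where c = 0]) simp_all
    then show "snc_at X p" by (rule snc_pair_imp_snc)
  qed (use not_snc_origin[OF X ac] o'_def in blast)
  have blowup: "\<exists>\<phi>'. affine_coords 4 three_planes X' V \<phi>' \<and>
             pull_to X' \<sigma> (pts X) V (\<phi> (mvar 0)) = \<phi>' (mvar 0) \<and>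
             (\<forall>i\<in>{1, 2, 3}. pull_to X' \<sigma> (pts X) V (\<phi> (mvar i)) = \<phi>' (mvar 0) \<otimes>\<^bsub>sec_ring X' V\<^esub> \<phi>' (mvar i)) \<and>
             (\<forall>q\<in>V. inverse_ideal X {o'} X' \<sigma> q = genideal (stalk X' q) {\<phi>' (mvar 0) q}) \<and>
             (\<forall>\<xi>\<in>V. exceptional_divisor X {o'} X' \<sigma> \<xi> = div_of X' (\<phi>' (mvar 0)) \<xi>) \<and>
             origin 4 X' V \<phi>' \<in> V \<and>
             (\<forall>q\<in>pts X'. snc_pair_at X' (exceptional_divisor X {o'} X' \<sigma>) q \<longleftrightarrow> q \<noteq> origin 4 X' V \<phi>')"
    if bl: "blowing_up X {o'} X' \<sigma>" and V: "V = blowup_chart X {o'} X' \<sigma> (pts X) (\<phi> (mvar 0))"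
    for X' :: "('q, 'r, 'k) kspace" and \<sigma> V
  proof -
    have C: "{o'} \<inter> pts X = {origin 4 X (pts X) \<phi>}" using o_pts by (simp add: o'_def)
    have X': "locally_ringed_kspace X'" by (rule kscheme_lrs[OF blowing_upD(1)[OF bl]])
    have m: "kmorphism X' X \<sigma>" by (rule blowing_upD(2)[OF bl])
    have chart: "\<exists>\<phi>'. affine_coords 4 (planes k) X' (W k) \<phi>' \<and>
        pull_to X' \<sigma> (pts X) (W k) (\<phi> (mvar k)) = \<phi>' (mvar k) \<and>
        (\<forall>i<4. i \<noteq> k \<longrightarrow> pull_to X' \<sigma> (pts X) (W k) (\<phi> (mvar i)) = \<phi>' (mvar k) \<otimes>\<^bsub>sec_ring X' (W k)\<^esub> \<phi>' (mvar i)) \<and>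
        (\<forall>q\<in>W k. inverse_ideal X {o'} X' \<sigma> q = genideal (stalk X' q) {\<phi>' (mvar k) q}) \<and>
        (\<forall>\<xi>\<in>W k. exceptional_divisor X {o'} X' \<sigma> \<xi> = div_of X' (\<phi>' (mvar k)) \<xi>)"
      if k: "k < 3" and W: "W = (\<lambda>k. blowup_chart X {o'} X' \<sigma> (pts X) (\<phi> (mvar k)))" for k W
    proof -
      have k4: "k < 4" using k by simp
      obtain \<phi>' where ac': "affine_coords 4 (planes k) X' (W k) \<phi>'"
        and pk: "pull_to X' \<sigma> (pts X) (W k) (\<phi> (mvar k)) = \<phi>' (mvar k)"
        and pi: "\<forall>i<4. i \<noteq> k \<longrightarrow> pull_to X' \<sigma> (pts X) (W k) (\<phi> (mvar i)) = \<phi>' (mvar k) \<otimes>\<^bsub>sec_ring X' (W k)\<^esub> \<phi>' (mvar i)"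
        using blowup_chart_coords[OF X ac planes_0_origin C bl k4] unfolding W chart_transform_planes[OF k]
        by (elim exE conjE)
      have Wk: "W k = blowup_chart X {o'} X' \<sigma> (pts X) (\<phi> (mvar k))" by (simp add: W)
      note cd = chart_divisor[OF X ac planes_0_origin C bl k4 ac' Wk pk pi[rule_format]]
      show ?thesis
      proof (intro exI[of _ \<phi>'] conjI ballI ac' pk pi)
        show "inverse_ideal X {o'} X' \<sigma> q = genideal (stalk X' q) {\<phi>' (mvar k) q}" if "q \<in> W k" for q
          by (rule cd(1)) (use that in simp_all)
        show "exceptional_divisor X {o'} X' \<sigma> q = div_of X' (\<phi>' (mvar k)) q" if "q \<in> W k" for q
          by (rule cd(4)) (use that in simp_all)
      qed
    qed
    define W where "W = (\<lambda>k. blowup_chart X {o'} X' \<sigma> (pts X) (\<phi> (mvar k)))"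
    have VW: "V = W 0" by (simp add: V W_def)
    obtain \<phi>' where ac': "affine_coords 4 (planes 0) X' V \<phi>'"
      and pk: "pull_to X' \<sigma> (pts X) V (\<phi> (mvar 0)) = \<phi>' (mvar 0)"
      and pi: "\<forall>i<4. i \<noteq> 0 \<longrightarrow> pull_to X' \<sigma> (pts X) V (\<phi> (mvar i)) = \<phi>' (mvar 0) \<otimes>\<^bsub>sec_ring X' V\<^esub> \<phi>' (mvar i)"
      and inv: "\<forall>q\<in>V. inverse_ideal X {o'} X' \<sigma> q = genideal (stalk X' q) {\<phi>' (mvar 0) q}"
      and ex: "\<forall>\<xi>\<in>V. exceptional_divisor X {o'} X' \<sigma> \<xi> = div_of X' (\<phi>' (mvar 0)) \<xi>"
      using chart[OF zero_less_numeral W_def] unfolding VW by (elim exE conjE)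
    have "snc_pair_at X' (exceptional_divisor X {o'} X' \<sigma>) q" if q: "q \<in> pts X'" "q \<noteq> origin 4 X' V \<phi>'" for q
    proof (cases "q \<in> V")
      case True
      show ?thesis by (rule snc_pair_off_origin[OF X' ac' True, where c = 1]) (use ex q(2) in simp_all)
    next
      case False
      have "on_pts \<sigma> q \<in> pts X" using continuous_map_image_subset_topspace[OF kmorphismD(1)[OF m]] q(1) by blast
      then obtain k where k: "k < 3" "q \<in> W k"
        using blowup_covered_by_charts[OF X ac C bl q(1)] unfolding W_def by blast
      obtain \<psi> where \<psi>: "affine_coords 4 (planes k) X' (W k) \<psi>"
        "\<forall>\<xi>\<in>W k. exceptional_divisor X {o'} X' \<sigma> \<xi> = div_of X' (\<psi> (mvar k)) \<xi>"
        using chart[OF k(1) W_def] by blast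
      \<comment> \<open>A point outside the chart of \<open>w\<close> lies in the chart of
        \<open>x\<close> or of \<open>y\<close>, where \<open>snc_pair_off_origin\<close> excludes
        no point.\<close>
      have "k \<noteq> 0" using False k(2) VW by metis
      then show ?thesis
        by (intro snc_pair_off_origin[OF X' \<psi>(1) k(2) k(1), where c = 1]) (use \<psi>(2) in simp_all)
    qed
    moreover have "\<not> snc_pair_at X' (exceptional_divisor X {o'} X' \<sigma>) (origin 4 X' V \<phi>')"
      by (rule contrapos_nn[OF not_snc_origin[OF X' ac'] snc_pair_imp_snc])
    ultimately have iff: "\<forall>q\<in>pts X'. snc_pair_at X' (exceptional_divisor X {o'} X' \<sigma>) q \<longleftrightarrow> q \<noteq> origin 4 X' V \<phi>'"
      by blast
    have pi': "\<forall>i\<in>{1, 2, 3}. pull_to X' \<sigma> (pts X) V (\<phi> (mvar i)) = \<phi>' (mvar 0) \<otimes>\<^bsub>sec_ring X' V\<^esub> \<phi>' (mvar i)"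
      using pi by simp
    show ?thesis unfolding three_planes_eq
      by (intro exI[of _ \<phi>'] conjI ac' pk pi' inv ex iff origin_point(1)[OF X' ac' planes_0_origin])
  qed
  show ?thesis
    unfolding Let_def o'_def[symmetric]
  proof (intro conjI o_pts ballI allI impI)
    show "snc_at X p \<longleftrightarrow> p \<noteq> o'" if "p \<in> pts X" for p by (rule snc[OF that])
    show "\<nexists>t Xs C \<sigma> D. snc_avoiding_sequence X t Xs C \<sigma> D \<and> (\<forall>p\<in>pts (Xs t). snc_pair_at (Xs t) (D t) p)"
      using no_snc_avoiding_sequence[OF X ac] by blast
  qed (rule blowup[OF _ refl])
qed

end
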